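(* Let $T>0$ and let $\{X_s,\ s\ge 0\}$ be a real-valued stochastic process with independent increments. Let $C_X$ be the set of all $\theta\in\mathbb R$ for which conditions (A), (B), (C) below hold. (A) There exists a constant $K(\theta)$ such that for all $0\le s<t\le T$ and all $\varepsilon>0$, $$\varepsilon^2\int_{\frac{2s}{\varepsilon^2}}^{\frac{2t}{\varepsilon^2}}\int_{\frac{2s}{\varepsilon^2}}^{y}\|\phi_{X_y-X_x}(\theta)\|\,dx\,dy\le K(\theta)(t-s).$$ (B) There exists a constant $c(\theta)$ such that for all $0\le s<t\le T$, $$\lim_{\varepsilon\to0}\varepsilon^2c(\theta)^2\int_{\frac{2s}{\varepsilon^2}}^{\frac{2t}{\varepsilon^2}}\int_{\frac{2s}{\varepsilon^2}}^{x}\big[\phi_{X_x-X_y}(\theta)+\phi_{X_x-X_y}(-\theta)\big]\,dy\,dx=2(t-s).$$ (C) For all $0\le s<t\le T$, $$\lim_{\varepsilon\to0}\varepsilon^2\int_{\frac{2s}{\varepsilon^2}}^{\frac{2t}{\varepsilon^2}}\int_{\frac{2s}{\varepsilon^2}}^{y}\|\phi_{X_y-X_x}(\theta)\|\,\big\|\phi_{X_x-X_{2s/\varepsilon^2}}(2\theta)\big\|\,dx\,dy=0.$$ For $\theta\in C_X$ and $\varepsilon>0$ define $$x_\varepsilon^\theta(t)=\varepsilon\,c(\theta)\int_0^{\frac{2t}{\varepsilon^2}}e^{i\theta X_s}\,ds,\qquad t\in[0,T],$$ where $c(\theta)$ is the constant given by condition (B), and let $P_\varepsilon^\theta$ be the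 image law of $x_\varepsilon^\theta$ in the Banach space $\mathcal C([0,T],\mathbb C)$ of continuous functions on $[0,T]$. Then, for every $\theta\in C_X$, $P_\varepsilon^\theta$ converges weakly, as $\varepsilon$ tends to zero, towards the law on $\mathcal C([0,T],\mathbb C)$ of a complex Brownian motion.
   Context: For a real random variable $Z$, $\phi_Z(u)=E(e^{iuZ})$, $u\in\mathbb R$, is its characteristic function; $\|z\|$ is the modulus of a complex number $z$. The constant $c(\theta)$ is real. A process $X$ has independent increments if for all $0\le s<t$ the increment $X_t-X_s$ is independent of $\sigma(X_u,\ 0\le u\le s)$; $X$ is assumed jointly measurable in $(s,\omega)$ so that the integrals defining $x_\varepsilon^\theta$ make sense. A complex Brownian motion $\{B_t,\ t\in[0,T]\}$ is a $\mathbb C$-valued process whose real and imaginary parts are two independent standard Brownian motions (started at $0$). *)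

theory Defs
  imports "HOL-Probability.Probability"
begin

definition char_fun :: "'a measure \<Rightarrow> ('a \<Rightarrow> real) \<Rightarrow> real \<Rightarrow> complex" where
  "char_fun M Z u = char (distr M borel Z) u"

(* The map into the product space generates the sigma-algebra sigma(X_u, u in I, u <= s). *)
definition indep_increments :: "'a measure \<Rightarrow> real set \<Rightarrow> (real \<Rightarrow> 'a \<Rightarrow> real) \<Rightarrow> bool" where
  "indep_increments M I X \<longleftrightarrow>
     (\<forall>s\<in>I. \<forall>t\<in>I. s < t \<longrightarrow>
        prob_space.indep_set M
          (sets (vimage_algebra (space M) (\<lambda>\<omega>. X t \<omega> - X s \<omega>) borel))
          (sets (vimage_algebra (space M) (\<lambda>\<omega>. \<lambda>u\<in>I \<inter> {..s}. X u \<omega>)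
            (Pi\<^sub>M (I \<inter> {..s}) (\<lambda>_. borel)))))"

definition jointly_measurable :: "'a measure \<Rightarrow> (real \<Rightarrow> 'a \<Rightarrow> real) \<Rightarrow> bool" where
  "jointly_measurable M X \<longleftrightarrow>
     (\<lambda>(s, \<omega>). X s \<omega>) \<in> borel_measurable (restrict_space borel {0..} \<Otimes>\<^sub>M M)"

definition cond_A :: "'a measure \<Rightarrow> (real \<Rightarrow> 'a \<Rightarrow> real) \<Rightarrow> real \<Rightarrow> real \<Rightarrow> bool" where
  "cond_A M X T \<theta> \<longleftrightarrow>
     (\<exists>K::real. \<forall>s t \<epsilon>. 0 \<le> s \<and> s < t \<and> t \<le> T \<and> 0 < \<epsilon> \<longrightarrow>
        \<epsilon>\<^sup>2 * (LBINT y:{2 * s / \<epsilon>\<^sup>2..2 * t / \<epsilon>\<^sup>2}. LBINT x:{2 * s / \<epsilon>\<^sup>2..y}.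
                cmod (char_fun M (\<lambda>\<omega>. X y \<omega> - X x \<omega>) \<theta>))
          \<le> K * (t - s))"

definition cond_B :: "'a measure \<Rightarrow> (real \<Rightarrow> 'a \<Rightarrow> real) \<Rightarrow> real \<Rightarrow> real \<Rightarrow> real \<Rightarrow> bool" where
  "cond_B M X T \<theta> c \<longleftrightarrow>
     (\<forall>s t. 0 \<le> s \<and> s < t \<and> t \<le> T \<longrightarrow>
        ((\<lambda>\<epsilon>. of_real (\<epsilon>\<^sup>2 * c\<^sup>2) *
            (LBINT x:{2 * s / \<epsilon>\<^sup>2..2 * t / \<epsilon>\<^sup>2}. LBINT y:{2 * s / \<epsilon>\<^sup>2..x}.
               char_fun M (\<lambda>\<omega>. X x \<omega> - X y \<omega>) \<theta> + char_fun M (\<lambda>\<omega>. X x \<omega> - X y \<omega>) (- \<theta>)))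
          \<longlongrightarrow> complex_of_real (2 * (t - s))) (at_right 0))"

definition cond_C :: "'a measure \<Rightarrow> (real \<Rightarrow> 'a \<Rightarrow> real) \<Rightarrow> real \<Rightarrow> real \<Rightarrow> bool" where
  "cond_C M X T \<theta> \<longleftrightarrow>
     (\<forall>s t. 0 \<le> s \<and> s < t \<and> t \<le> T \<longrightarrow>
        ((\<lambda>\<epsilon>. \<epsilon>\<^sup>2 *
            (LBINT y:{2 * s / \<epsilon>\<^sup>2..2 * t / \<epsilon>\<^sup>2}. LBINT x:{2 * s / \<epsilon>\<^sup>2..y}.
               cmod (char_fun M (\<lambda>\<omega>. X y \<omega> - X x \<omega>) \<theta>) *
               cmod (char_fun M (\<lambda>\<omega>. X x \<omega> - X (2 * s / \<epsilon>\<^sup>2) \<omega>) (2 * \<theta>))))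
          \<longlongrightarrow> 0) (at_right 0))"

definition C_set :: "'a measure \<Rightarrow> (real \<Rightarrow> 'a \<Rightarrow> real) \<Rightarrow> real \<Rightarrow> real set" where
  "C_set M X T = {\<theta>. cond_A M X T \<theta> \<and> (\<exists>c. cond_B M X T \<theta> c) \<and> cond_C M X T \<theta>}"

definition x_process ::
    "(real \<Rightarrow> 'a \<Rightarrow> real) \<Rightarrow> real \<Rightarrow> real \<Rightarrow> real \<Rightarrow> real \<Rightarrow> 'a \<Rightarrow> complex" where
  "x_process X \<theta> c \<epsilon> t \<omega> =
     of_real (\<epsilon> * c) * (LBINT s:{0..2 * t / \<epsilon>\<^sup>2}. iexp (\<theta> * X s \<omega>))"

(* The space C([0,T], complex) with the uniform metric; its points are extensional functions,
   i.e. undefined outside {0..T}. *)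
definition path_space :: "real \<Rightarrow> (real \<Rightarrow> complex) metric" where
  "path_space T = cfunspace (top_of_set {0..T}) euclidean_metric"

definition borel_of_metric :: "'b metric \<Rightarrow> 'b measure" where
  "borel_of_metric m = sigma (mspace m) {U. openin (mtopology_of m) U}"

definition path_law :: "real \<Rightarrow> 'a measure \<Rightarrow> (real \<Rightarrow> 'a \<Rightarrow> complex) \<Rightarrow> (real \<Rightarrow> complex) measure" where
  "path_law T M Y = distr M (borel_of_metric (path_space T)) (\<lambda>\<omega>. \<lambda>t\<in>{0..T}. Y t \<omega>)"

definition weakly_converges ::
    "'b metric \<Rightarrow> ('i \<Rightarrow> 'b measure) \<Rightarrow> 'b measure \<Rightarrow> 'i filter \<Rightarrow> bool" where
  "weakly_converges m P Q F \<longleftrightarrow>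
     (\<forall>f. continuous_map (mtopology_of m) euclideanreal f \<and> bounded (f ` mspace m) \<longrightarrow>
        ((\<lambda>i. \<integral>w. f w \<partial>P i) \<longlongrightarrow> (\<integral>w. f w \<partial>Q)) F)"

definition standard_brownian_motion :: "real \<Rightarrow> 'a measure \<Rightarrow> (real \<Rightarrow> 'a \<Rightarrow> real) \<Rightarrow> bool" where
  "standard_brownian_motion T N W \<longleftrightarrow>
     prob_space N \<and>
     (\<forall>t\<in>{0..T}. W t \<in> borel_measurable N) \<and>
     (AE \<omega> in N. W 0 \<omega> = 0) \<and>
     indep_increments N {0..T} W \<and>
     (\<forall>s t. 0 \<le> s \<and> s < t \<and> t \<le> T \<longrightarrow>
        distributed N lborel (\<lambda>\<omega>. W t \<omega> - W s \<omega>) (normal_density 0 (sqrt (t - s)))) \<and>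
     (\<forall>\<omega>\<in>space N. continuous_on {0..T} (\<lambda>t. W t \<omega>))"

(* Independence of the real and imaginary parts is independence as processes. *)
definition complex_brownian_motion :: "real \<Rightarrow> 'a measure \<Rightarrow> (real \<Rightarrow> 'a \<Rightarrow> complex) \<Rightarrow> bool" where
  "complex_brownian_motion T N B \<longleftrightarrow>
     standard_brownian_motion T N (\<lambda>t \<omega>. Re (B t \<omega>)) \<and>
     standard_brownian_motion T N (\<lambda>t \<omega>. Im (B t \<omega>)) \<and>
     prob_space.indep_var N
       (Pi\<^sub>M {0..T} (\<lambda>_. borel)) (\<lambda>\<omega>. \<lambda>t\<in>{0..T}. Re (B t \<omega>))
       (Pi\<^sub>M {0..T} (\<lambda>_. borel)) (\<lambda>\<omega>. \<lambda>t\<in>{0..T}. Im (B t \<omega>))"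

(* Taking the path type as sample type is no restriction: every law of a complex Brownian motion
   is realised by the coordinate process on the path space itself. *)
definition complex_brownian_law :: "real \<Rightarrow> (real \<Rightarrow> complex) measure \<Rightarrow> bool" where
  "complex_brownian_law T Q \<longleftrightarrow>
     (\<exists>(N :: (real \<Rightarrow> complex) measure) B. complex_brownian_motion T N B \<and> Q = path_law T N B)"

end

(* The increments of x_eps are handled through moments: writing the integral of exp(i theta X) over a
   time interval as Z, the product rule and the independence of the increments reduce conditional first
   and second moments of Z, and the fourth moment of |Z|, to integrals of the characteristic functions of the
   increments.  Condition (A) forces |phi| to decay quadratically, which makes the conditional first moments
   O(eps) and gives E|x_eps(t) - x_eps(s)|^4 <= C (t - s)^2; condition (C) kills the conditional second
   moment of Z^2 and condition (B) normalises that of |Z|^2.  Expanding characters to second order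
   along a dyadic grid and refining the grid, the characteristic functions of the grid increments converge to the
   Gaussian ones.  The fourth moment bound makes dyadic interpolation uniformly accurate on bounded Lipschitz
   functionals of paths, so these converge as well.  As the limit is constructed explicitly (Levy's midpoint
   refinement), no tightness argument is needed: a bounded continuous functional is an increasing limit of
   Lipschitz functionals, from below and, after a sign change, from above. *)

theory Submission
  imports Defs
begin


section \<open>Characteristic functions and Gaussian smoothing\<close>

text \<open>Condition (A) sees only the window [0,T], but it holds for every \<epsilon>, so
  rescaling turns it into a linear bound for the double integral of |phi| over every interval.
  Independence makes phi multiplicative, hence |phi| over an interval is at most its value over any
  subinterval; the integral over the triangle then gives decay of order 1/length, and cutting at the
  midpoint squares that rate. Two obstacles shape the rest. The process is only jointly measurable,
  so a time integral belongs to the history only up to null sets; the history is completed, and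
  membership is shown by comparing the integral with its conditional expectation. And on a grid of
  mesh h the one-step expansion carries an error bound of order h^(3/2) that does not shrink with
  \<epsilon>; summed over order 1/h steps it leaves sqrt h. Repeating each frequency on the subcells
  of a finer grid changes neither characteristic function, so this remainder can be made arbitrarily
  small. Characters are exchanged for Lipschitz functions by Gaussian smoothing, one coordinate at a
  time, with second moments controlling the truncation.\<close>

lemma prob_space_std_normal: "prob_space std_normal_distribution"
  using prob_space_normal_density by auto

text \<open>A non-integrable \<open>f\<close> has Bochner integral 0 and \<open>g\<close> is
  nonnegative on the space, so domination by an integrable function decides both cases.\<close>

lemma norm_integral_le_integral:
  fixes f :: "'a \<Rightarrow> 'b::{banach, second_countable_topology}"
  assumes "integrable M g" "\<And>x. x \<in> space M \<Longrightarrow> norm (f x) \<le> g x"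
  shows "norm (integral\<^sup>L M f) \<le> integral\<^sup>L M g"
  using assms by (intro order_trans[OF integral_norm_bound integral_mono']) (auto intro: order_trans[OF norm_ge_zero])

lemma (in prob_space) norm_integral_le_const:
  fixes f :: "'a \<Rightarrow> 'b::{banach, second_countable_topology}"
  assumes "\<And>x. x \<in> space M \<Longrightarrow> norm (f x) \<le> B"
  shows "norm (integral\<^sup>L M f) \<le> B"
  using norm_integral_le_integral[of M "\<lambda>_. B" f] assms prob_space by simp

lemma Fubini_bounded:
  fixes f :: "'a \<Rightarrow> 'b \<Rightarrow> 'c::{banach, second_countable_topology}"
  assumes "finite_measure M" "finite_measure N"
    and meas: "(\<lambda>(x,y). f x y) \<in> borel_measurable (M \<Otimes>\<^sub>M N)"
    and bnd: "\<And>x y. x \<in> space M \<Longrightarrow> y \<in> space N \<Longrightarrow> norm (f x y) \<le> C"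
  shows "(\<integral>x. \<integral>y. f x y \<partial>N \<partial>M) = (\<integral>y. \<integral>x. f x y \<partial>M \<partial>N)"
proof -
  interpret M: finite_measure M by fact
  interpret N: finite_measure N by fact
  interpret P: pair_sigma_finite M N ..
  interpret Q: finite_measure "M \<Otimes>\<^sub>M N"
    by (rule finite_measureI) (auto simp: space_pair_measure N.emeasure_pair_measure_Times ennreal_mult_eq_top_iff)
  have "integrable (M \<Otimes>\<^sub>M N) (\<lambda>(x,y). f x y)"
    using meas bnd by (intro Q.integrable_const_bound[where B=C]) (auto simp: space_pair_measure)
  then show ?thesis by (rule P.Fubini_integral[symmetric])
qed

text \<open>The characteristic function of the standard normal law is exp(-z^2/2), its own density
  up to a factor. Read backwards, this is Fourier inversion for the one function that requires
  it.\<close>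

lemma normal_density_eq_integral_iexp:
  "complex_of_real (std_normal_density z)
     = of_real (1 / sqrt (2 * pi)) * (CLINT x | std_normal_distribution. iexp (z * x))"
  using fun_cong[OF char_std_normal_distribution, of z]
  by (simp add: char_def std_normal_density_def)

text \<open>Writing the Gaussian kernel as a Fourier integral and exchanging the integrals exhibits
  the smoothed \<open>g\<close> as a superposition of characters. The amplitude
  \<open>\<tau>\<close> is a rescaled Fourier transform of \<open>g\<close>, bounded because
  \<open>g\<close> is bounded with compact support.\<close>

lemma gaussian_smoothing_Fourier:
  fixes g :: "real \<Rightarrow> real"
  assumes g[measurable]: "g \<in> borel_measurable borel"
    and bnd: "\<And>x. \<bar>g x\<bar> \<le> C" and supp: "\<And>x. R < \<bar>x\<bar> \<Longrightarrow> g x = 0" and "0 < \<sigma>"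
  obtains \<tau> :: "real \<Rightarrow> complex" and K where "\<tau> \<in> borel_measurable borel" "\<And>x. cmod (\<tau> x) \<le> K"
    "\<And>v. complex_of_real (\<integral>x. g (v + \<sigma> * x) \<partial>std_normal_distribution)
      = (CLINT x | std_normal_distribution. \<tau> x * iexp (x / \<sigma> * v))"
proof -
  interpret G: prob_space std_normal_distribution by (rule prob_space_std_normal)
  let ?G = "std_normal_distribution"
  \<comment> \<open>Lebesgue measure cut down to the support interval: a finite measure, so that
    \<open>Fubini_bounded\<close> applies to bounded integrands.\<close>
  let ?L = "density lborel (\<lambda>y. ennreal (indicator {-R..R} y))"
  define k where "k = complex_of_real (1 / (\<sigma> * sqrt (2 * pi)))"
  define \<tau> where "\<tau> x = k * (CLINT y | ?L. of_real (g y) * iexp (- (x / \<sigma> * y)))" for x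
  have C0: "0 \<le> C" using bnd[of 0] by linarith
  interpret L: finite_measure ?L
    by (rule finite_measureI) (simp add: emeasure_density ennreal_indicator emeasure_lborel_Icc_eq)
  have [measurable]: "\<tau> \<in> borel_measurable borel"
    unfolding \<tau>_def by (measurable)
  have bd: "cmod (\<tau> x) \<le> cmod k * (C * measure ?L (space ?L))" for x
  proof -
    have "cmod (CLINT y | ?L. of_real (g y) * iexp (- (x / \<sigma> * y))) \<le> (\<integral>y. C \<partial>?L)"
      using bnd C0 by (intro norm_integral_le_integral) (auto simp: norm_mult)
    then show ?thesis by (simp add: \<tau>_def norm_mult mult_left_mono mult.commute)
  qed
  have supp': "indicator {-R..R} y *\<^sub>R f y = f y" if "g y = 0 \<Longrightarrow> f y = 0" for f :: "real \<Rightarrow> complex" and y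
    using that supp[of y] by (auto simp: indicator_def abs_real_def split: if_splits)
  have main: "complex_of_real (\<integral>x. g (v + \<sigma> * x) \<partial>?G) = (CLINT x | ?G. \<tau> x * iexp (x / \<sigma> * v))" for v
  proof -
    have "(CLINT x | ?G. \<tau> x * iexp (x / \<sigma> * v))
        = k * (CLINT x | ?G. CLINT y | ?L. of_real (g y) * iexp (- (x / \<sigma> * y)) * iexp (x / \<sigma> * v))"
      by (simp only: \<tau>_def mult.assoc[of k] integral_mult_right_zero integral_mult_left_zero)
    also have "\<dots> = k * (CLINT y | ?L. CLINT x | ?G. of_real (g y) * iexp (- (x / \<sigma> * y)) * iexp (x / \<sigma> * v))"
      using bnd by (subst Fubini_bounded[where C=C]) (auto intro: G.finite_measure_axioms L.finite_measure_axioms simp: norm_mult)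
    also have "\<dots> = k * (CLINT y | ?L. of_real (g y) * (CLINT x | ?G. iexp ((v - y) / \<sigma> * x)))"
      by (simp add: mult.assoc mult_exp_exp diff_divide_distrib algebra_simps)
    also have "\<dots> = (CLINT y | ?L. of_real (g y * std_normal_density ((v - y) / \<sigma>) / \<sigma>))"
      by (simp add: normal_density_eq_integral_iexp k_def)
    also have "\<dots> = (CLINT y | lborel. of_real (g y * std_normal_density ((v - y) / \<sigma>) / \<sigma>))"
    proof -
      have "indicator {-R..R} y *\<^sub>R complex_of_real (g y * std_normal_density ((v - y) / \<sigma>) / \<sigma>)
          = of_real (g y * std_normal_density ((v - y) / \<sigma>) / \<sigma>)" for y
        by (rule supp') simp
      then show ?thesis by (subst integral_density) auto
    qed
    also have "\<dots> = of_real (\<integral>y. g y * std_normal_density ((v - y) / \<sigma>) / \<sigma> \<partial>lborel)"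
      by (rule integral_complex_of_real)
    \<comment> \<open>Substitution of v + \<sigma> x for y; the sign of the argument disappears
      because the density is even.\<close>
    also have "(\<integral>y. g y * std_normal_density ((v - y) / \<sigma>) / \<sigma> \<partial>lborel)
        = (\<integral>x. g (v + \<sigma> * x) * std_normal_density x \<partial>lborel)"
      using \<open>0 < \<sigma>\<close> by (subst lborel_integral_real_affine[of \<sigma> _ v]) (auto simp: std_normal_density_def)
    also have "\<dots> = (\<integral>x. g (v + \<sigma> * x) \<partial>?G)"
      by (subst integral_density) (auto simp: mult.commute normal_density_nonneg)
    finally show ?thesis by simp
  qed
  show ?thesis using that[OF _ bd main] by simp
qed

text \<open>Smoothing shifts the argument by \<sigma> |x|, and the mean of |x| under the standard
  normal law is sqrt (2/pi), which is at most 1.\<close>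

lemma gaussian_smoothing_error:
  fixes g :: "real \<Rightarrow> real"
  assumes bnd: "\<And>x. \<bar>g x\<bar> \<le> C" and lip: "\<And>x y. \<bar>g x - g y\<bar> \<le> L * \<bar>x - y\<bar>" and "0 < \<sigma>" "0 \<le> L"
    and [measurable]: "g \<in> borel_measurable borel"
  shows "\<bar>(\<integral>x. g (v + \<sigma> * x) \<partial>std_normal_distribution) - g v\<bar> \<le> L * \<sigma>"
proof -
  interpret G: prob_space std_normal_distribution by (rule prob_space_std_normal)
  let ?G = "std_normal_distribution"
  have i: "integrable ?G (\<lambda>x. g (v + \<sigma> * x))"
    using bnd by (intro G.integrable_const_bound[where B=C]) auto
  have i1: "integrable ?G (\<lambda>x. \<bar>x\<bar>)"
    using integrable_std_normal_distribution_moment[of 1] by simp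
  have "(\<integral>x. \<bar>x\<bar> \<partial>?G) = sqrt (2/pi)"
    using std_normal_distribution_odd_moments_abs[of 0] by simp
  also have "\<dots> \<le> 1" using pi_gt3 by (simp add: real_sqrt_le_1_iff)
  finally have m: "(\<integral>x. \<bar>x\<bar> \<partial>?G) \<le> 1" .
  have "(\<integral>x. g (v + \<sigma> * x) \<partial>?G) - g v = (\<integral>x. g (v + \<sigma> * x) - g v \<partial>?G)"
    using i G.prob_space by (subst Bochner_Integration.integral_diff) auto
  also have "\<bar>\<dots>\<bar> \<le> (\<integral>x. L * \<sigma> * \<bar>x\<bar> \<partial>?G)"
    using lip[of "v + \<sigma> * _" v] i i1 \<open>0 < \<sigma>\<close>
    by (intro integral_abs_bound_integral) (auto simp: abs_mult mult.assoc)
  also have "\<dots> \<le> L * \<sigma>" using m \<open>0 < \<sigma>\<close> \<open>0 \<le> L\<close> by (simp add: mult_left_le)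
  finally show ?thesis .
qed

text \<open>For the smoothed \<open>g\<close> the claim is dominated convergence over the
  frequencies; the smoothing is then removed with an error uniform in \<open>n\<close>. The bounded
  weight \<open>Q\<close> is the point of the formulation: it hides all other coordinates, which
  reduces several variables to one.\<close>

lemma Fourier_determining:
  fixes M :: "nat \<Rightarrow> 'a measure" and N :: "'b measure" and g :: "real \<Rightarrow> real"
    and Q :: "nat \<Rightarrow> 'a \<Rightarrow> complex" and Q' :: "'b \<Rightarrow> complex"
  assumes M: "\<And>n. prob_space (M n)" and N: "prob_space N"
    and [measurable]: "\<And>n. Q n \<in> borel_measurable (M n)" "\<And>n. V n \<in> borel_measurable (M n)"
      "Q' \<in> borel_measurable N" "V' \<in> borel_measurable N"
    and Q: "\<And>n \<omega>. cmod (Q n \<omega>) \<le> B" "\<And>\<omega>. cmod (Q' \<omega>) \<le> B"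
    and conv: "\<And>u. (\<lambda>n. CLINT \<omega> | M n. Q n \<omega> * iexp (u * V n \<omega>)) \<longlonglongrightarrow> (CLINT \<omega> | N. Q' \<omega> * iexp (u * V' \<omega>))"
    and bnd: "\<And>x. \<bar>g x\<bar> \<le> C" and lip: "\<And>x y. \<bar>g x - g y\<bar> \<le> L * \<bar>x - y\<bar>" "0 \<le> L"
    and supp: "\<And>x. R < \<bar>x\<bar> \<Longrightarrow> g x = 0"
  shows "(\<lambda>n. CLINT \<omega> | M n. Q n \<omega> * g (V n \<omega>)) \<longlonglongrightarrow> (CLINT \<omega> | N. Q' \<omega> * g (V' \<omega>))"
proof -
  have contg: "continuous_on UNIV g"
    using lip by (intro lipschitz_on_continuous_on[of L] lipschitz_onI) (auto simp: dist_real_def)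
  then have [measurable]: "g \<in> borel_measurable borel" by (rule borel_measurable_continuous_onI)
  interpret G: prob_space std_normal_distribution by (rule prob_space_std_normal)
  let ?G = "std_normal_distribution"
  have B0: "0 \<le> B" using Q(2) norm_ge_zero order_trans by blast
  have step: "(\<lambda>n. CLINT \<omega> | M n. Q n \<omega> * of_real (\<integral>x. g (V n \<omega> + \<sigma> * x) \<partial>?G))
     \<longlonglongrightarrow> (CLINT \<omega> | N. Q' \<omega> * of_real (\<integral>x. g (V' \<omega> + \<sigma> * x) \<partial>?G))" if "0 < \<sigma>" for \<sigma>
  proof -
    obtain \<tau> K where \<tau>[measurable]: "\<tau> \<in> borel_measurable borel" and K: "\<And>x. cmod (\<tau> x) \<le> K"
      and eq: "\<And>v. complex_of_real (\<integral>x. g (v + \<sigma> * x) \<partial>?G) = (CLINT x | ?G. \<tau> x * iexp (x / \<sigma> * v))"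
      by (rule gaussian_smoothing_Fourier[OF \<open>g \<in> borel_measurable borel\<close> bnd supp \<open>0 < \<sigma>\<close>]) blast+
    have K0: "0 \<le> K" using K norm_ge_zero order_trans by blast
    \<comment> \<open>By Fubini the smoothed expectation is an average over frequencies of the
      weighted Fourier transforms whose convergence is assumed.\<close>
    have swap: "(CLINT \<omega> | A. q \<omega> * of_real (\<integral>x. g (v \<omega> + \<sigma> * x) \<partial>?G))
        = (CLINT x | ?G. \<tau> x * (CLINT \<omega> | A. q \<omega> * iexp (x / \<sigma> * v \<omega>)))"
      if "prob_space A" and [measurable]: "q \<in> borel_measurable A" "v \<in> borel_measurable A"
        and q: "\<And>\<omega>. cmod (q \<omega>) \<le> B" for A :: "'c measure" and q v
    proof -
      interpret A: prob_space A by fact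
      have "(CLINT \<omega> | A. q \<omega> * of_real (\<integral>x. g (v \<omega> + \<sigma> * x) \<partial>?G))
          = (CLINT \<omega> | A. CLINT x | ?G. q \<omega> * (\<tau> x * iexp (x / \<sigma> * v \<omega>)))"
        unfolding eq by simp
      also have "\<dots> = (CLINT x | ?G. CLINT \<omega> | A. q \<omega> * (\<tau> x * iexp (x / \<sigma> * v \<omega>)))"
        using q K B0 by (intro Fubini_bounded[where C="B * K"])
          (auto intro: G.finite_measure_axioms A.finite_measure_axioms simp: norm_mult mult_mono)
      also have "\<dots> = (CLINT x | ?G. \<tau> x * (CLINT \<omega> | A. q \<omega> * iexp (x / \<sigma> * v \<omega>)))"
        by (simp add: mult.left_commute)
      finally show ?thesis .
    qed
    have qb: "cmod (CLINT \<omega> | M n. Q n \<omega> * iexp (u * V n \<omega>)) \<le> B" for n u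
    proof -
      interpret A: prob_space "M n" by (rule M)
      show ?thesis
        using Q by (intro A.norm_integral_le_const) (auto simp: norm_mult)
    qed
    have mM: "(\<lambda>x. CLINT \<omega> | M n. Q n \<omega> * iexp (x / \<sigma> * V n \<omega>)) \<in> borel_measurable borel" for n
    proof -
      interpret A: prob_space "M n" by (rule M)
      show ?thesis by measurable
    qed
    have mN: "(\<lambda>x. CLINT \<omega> | N. Q' \<omega> * iexp (x / \<sigma> * V' \<omega>)) \<in> borel_measurable borel"
    proof -
      interpret A: prob_space N by (rule N)
      show ?thesis by measurable
    qed
    have "(\<lambda>n. CLINT x | ?G. \<tau> x * (CLINT \<omega> | M n. Q n \<omega> * iexp (x / \<sigma> * V n \<omega>)))
       \<longlonglongrightarrow> (CLINT x | ?G. \<tau> x * (CLINT \<omega> | N. Q' \<omega> * iexp (x / \<sigma> * V' \<omega>)))"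
    proof (intro integral_dominated_convergence[where w="\<lambda>_. K * B"] AE_I2 tendsto_mult tendsto_const conv)
      show "cmod (\<tau> x * (CLINT \<omega> | M n. Q n \<omega> * iexp (x / \<sigma> * V n \<omega>))) \<le> K * B" for n x
        using mult_mono[OF K[of x] qb[of n "x/\<sigma>"]] K0 by (simp add: norm_mult)
    qed (use mM mN in auto)
    then show ?thesis using swap[OF M _ _ Q(1)] swap[OF N _ _ Q(2)] by simp
  qed
  have err: "cmod ((CLINT \<omega> | A. q \<omega> * of_real (\<integral>x. g (v \<omega> + \<sigma> * x) \<partial>?G)) - (CLINT \<omega> | A. q \<omega> * g (v \<omega>))) \<le> B * (L * \<sigma>)"
    if "0 < \<sigma>" "prob_space A" and [measurable]: "q \<in> borel_measurable A" "v \<in> borel_measurable A"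
      and q: "\<And>\<omega>. cmod (q \<omega>) \<le> B" for A :: "'c measure" and q v \<sigma>
  proof -
    interpret A: prob_space A by fact
    have gb: "\<bar>\<integral>x. g (y + \<sigma> * x) \<partial>?G\<bar> \<le> C + L * \<sigma>" for y
      using gaussian_smoothing_error[OF bnd lip(1) \<open>0 < \<sigma>\<close> lip(2), of y] bnd[of y] by simp
    have C0: "0 \<le> C" using bnd[of 0] by linarith
    have "(CLINT \<omega> | A. q \<omega> * of_real (\<integral>x. g (v \<omega> + \<sigma> * x) \<partial>?G)) - (CLINT \<omega> | A. q \<omega> * g (v \<omega>))
       = (CLINT \<omega> | A. q \<omega> * of_real (\<integral>x. g (v \<omega> + \<sigma> * x) \<partial>?G) - q \<omega> * g (v \<omega>))"
      using q gb bnd B0 \<open>0 < \<sigma>\<close> lip(2) C0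
      by (intro Bochner_Integration.integral_diff[symmetric]
          A.integrable_const_bound[where B="B * (C + L * \<sigma>)"] A.integrable_const_bound[where B="B * C"])
        (auto simp: norm_mult intro!: mult_mono)
    also have "cmod \<dots> \<le> B * (L * \<sigma>)"
    proof (rule A.norm_integral_le_const)
      show "cmod (q \<omega> * of_real (\<integral>x. g (v \<omega> + \<sigma> * x) \<partial>?G) - q \<omega> * g (v \<omega>)) \<le> B * (L * \<sigma>)" for \<omega>
        using gaussian_smoothing_error[OF bnd lip(1) \<open>0 < \<sigma>\<close> lip(2), of "v \<omega>"] q[of \<omega>] B0
        by (auto simp: norm_mult right_diff_distrib[symmetric] of_real_diff[symmetric] simp del: of_real_diff intro!: mult_mono)
    qed
    finally show ?thesis .
  qed
  show ?thesis
  proof (rule LIMSEQ_I)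
    fix r :: real assume "0 < r"
    \<comment> \<open>Chosen so that the smoothing error B L \<sigma> is at most r/4 on either side;
      the summand 1 covers B L = 0.\<close>
    define \<sigma> where "\<sigma> = r / (4 * (B * L + 1))"
    have BL: "0 \<le> B * L" using B0 lip(2) by simp
    have \<sigma>: "0 < \<sigma>" using \<open>0 < r\<close> BL by (simp add: \<sigma>_def)
    have "B * (L * \<sigma>) = (B * L) / (B * L + 1) * (r / 4)" by (simp add: \<sigma>_def algebra_simps)
    also have "\<dots> \<le> 1 * (r / 4)" using BL \<open>0 < r\<close> by (intro mult_right_mono) auto
    finally have small: "B * (L * \<sigma>) \<le> r / 4" by simp
    obtain n0 where n0: "\<And>n. n \<ge> n0 \<Longrightarrow> cmod ((CLINT \<omega> | M n. Q n \<omega> * of_real (\<integral>x. g (V n \<omega> + \<sigma> * x) \<partial>?G))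
        - (CLINT \<omega> | N. Q' \<omega> * of_real (\<integral>x. g (V' \<omega> + \<sigma> * x) \<partial>?G))) < r / 4"
      using LIMSEQ_D[OF step[OF \<sigma>], of "r/4"] \<open>0 < r\<close> by auto
    show "\<exists>n0. \<forall>n\<ge>n0. cmod ((CLINT \<omega> | M n. Q n \<omega> * g (V n \<omega>)) - (CLINT \<omega> | N. Q' \<omega> * g (V' \<omega>))) < r"
    proof (intro exI[of _ n0] allI impI)
      fix n assume "n0 \<le> n"
      have "cmod ((CLINT \<omega> | M n. Q n \<omega> * of_real (\<integral>x. g (V n \<omega> + \<sigma> * x) \<partial>?G)) - (CLINT \<omega> | M n. Q n \<omega> * g (V n \<omega>))) \<le> r / 4"
        by (rule order_trans[OF err small]) (use \<sigma> M Q in auto)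
      moreover have "cmod ((CLINT \<omega> | N. Q' \<omega> * of_real (\<integral>x. g (V' \<omega> + \<sigma> * x) \<partial>?G)) - (CLINT \<omega> | N. Q' \<omega> * g (V' \<omega>))) \<le> r / 4"
        by (rule order_trans[OF err small]) (use \<sigma> N Q in auto)
      ultimately show "cmod ((CLINT \<omega> | M n. Q n \<omega> * g (V n \<omega>)) - (CLINT \<omega> | N. Q' \<omega> * g (V' \<omega>))) < r"
        using n0[OF \<open>n0 \<le> n\<close>] \<open>0 < r\<close> by norm
    qed
  qed
qed


section \<open>Lipschitz test functions of finitely many coordinates\<close>

text \<open>The tent function. Its integer translates form a partition of unity, which serves twice:
  for lattice approximation of test functions and for piecewise linear interpolation of
  paths.\<close>

definition hat :: "real \<Rightarrow> real" where
  "hat x = max 0 (1 - \<bar>x\<bar>)"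

lemma hat_nonneg: "0 \<le> hat x" and hat_le_1: "hat x \<le> 1" and hat_eq_0: "1 \<le> \<bar>x\<bar> \<Longrightarrow> hat x = 0"
  and hat_0: "hat 0 = 1"
  by (auto simp: hat_def)

lemma hat_lipschitz: "\<bar>hat x - hat y\<bar> \<le> \<bar>x - y\<bar>"
  by (auto simp: hat_def)

lemma continuous_on_hat [continuous_intros]: "continuous_on S f \<Longrightarrow> continuous_on S (\<lambda>x. hat (f x))"
  unfolding hat_def by (intro continuous_intros)

lemma borel_measurable_hat [measurable]: "hat \<in> borel_measurable borel"
  by (intro borel_measurable_continuous_onI continuous_intros)

text \<open>At most the floor and the ceiling of \<open>x\<close> carry weight, namely one minus the
  distance to each of them.\<close>

lemma sum_hat_eq_1:
  assumes "finite A" "\<lfloor>x\<rfloor> \<in> A" "\<lceil>x\<rceil> \<in> A"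
  shows "(\<Sum>k\<in>A. hat (x - of_int k)) = 1"
proof -
  have "(\<Sum>k\<in>A. hat (x - of_int k)) = (\<Sum>k\<in>{\<lfloor>x\<rfloor>, \<lceil>x\<rceil>}. hat (x - of_int k))"
  proof (rule sum.mono_neutral_right[OF assms(1)])
    show "\<forall>i\<in>A - {\<lfloor>x\<rfloor>, \<lceil>x\<rceil>}. hat (x - of_int i) = 0"
    proof
      fix i assume "i \<in> A - {\<lfloor>x\<rfloor>, \<lceil>x\<rceil>}"
      then have "i < \<lfloor>x\<rfloor> \<or> \<lceil>x\<rceil> < i" by auto linarith+
      then show "hat (x - of_int i) = 0" by (intro hat_eq_0) linarith
    qed
  qed (use assms in auto)
  also have "\<dots> = 1"
  proof (cases "\<lfloor>x\<rfloor> = \<lceil>x\<rceil>")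
    case True
    then have "x = of_int \<lfloor>x\<rfloor>" by linarith
    then have "x - of_int \<lfloor>x\<rfloor> = 0" by linarith
    with True show ?thesis by (simp add: hat_0)
  next
    case False
    then have "\<lceil>x\<rceil> = \<lfloor>x\<rfloor> + 1" by linarith
    with False show ?thesis by (simp add: hat_def) linarith
  qed
  finally show ?thesis .
qed

lemma sum_hat_le_1:
  assumes "finite A"
  shows "(\<Sum>k\<in>A. hat (x - of_int k)) \<le> 1"
proof -
  have "(\<Sum>k\<in>A. hat (x - of_int k)) \<le> (\<Sum>k\<in>A \<union> {\<lfloor>x\<rfloor>, \<lceil>x\<rceil>}. hat (x - of_int k))"
    using assms by (intro sum_mono2) (auto simp: hat_nonneg)
  also have "\<dots> = 1" using assms by (intro sum_hat_eq_1) auto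
  finally show ?thesis .
qed

text \<open>Induction on \<open>J\<close> exchanges characters for test functions coordinate by
  coordinate. In the step for \<open>j\<close>, the factors already exchanged and the characters
  still present together form the bounded weight of \<open>Fourier_determining\<close>.\<close>

lemma tendsto_integral_product_functions:
  fixes M :: "nat \<Rightarrow> 'a measure" and N :: "'b measure" and g :: "'i \<Rightarrow> real \<Rightarrow> real"
  assumes M: "\<And>n. prob_space (M n)" and N: "prob_space N" and I: "finite I"
    and V: "\<And>n i. i \<in> I \<Longrightarrow> V n i \<in> borel_measurable (M n)" "\<And>i. i \<in> I \<Longrightarrow> W i \<in> borel_measurable N"
    and conv: "\<And>u. (\<lambda>n. CLINT \<omega> | M n. iexp (\<Sum>i\<in>I. u i * V n i \<omega>)) \<longlonglongrightarrow> (CLINT \<omega> | N. iexp (\<Sum>i\<in>I. u i * W i \<omega>))"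
    and g: "\<And>i x. \<bar>g i x\<bar> \<le> 1" "\<And>i x y. \<bar>g i x - g i y\<bar> \<le> L * \<bar>x - y\<bar>" "0 \<le> L" "\<And>i x. R i < \<bar>x\<bar> \<Longrightarrow> g i x = 0"
    and J: "J \<subseteq> I"
  shows "(\<lambda>n. CLINT \<omega> | M n. of_real (\<Prod>i\<in>J. g i (V n i \<omega>)) * iexp (\<Sum>i\<in>I-J. u i * V n i \<omega>))
     \<longlonglongrightarrow> (CLINT \<omega> | N. of_real (\<Prod>i\<in>J. g i (W i \<omega>)) * iexp (\<Sum>i\<in>I-J. u i * W i \<omega>))"
  using finite_subset[OF J I] J
proof (induction J arbitrary: u)
  case empty
  then show ?case using conv[of u] by simp
next
  case (insert j J)
  have gm: "g i \<in> borel_measurable borel" for i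
    by (intro borel_measurable_continuous_onI lipschitz_on_continuous_on[of L] lipschitz_onI)
       (use g in \<open>auto simp: dist_real_def\<close>)
  have bd: "\<bar>\<Prod>i\<in>J. g i (x i)\<bar> \<le> 1" for x
    unfolding abs_prod using g(1) by (intro prod_le_1) auto
  \<comment> \<open>Setting the frequency of coordinate \<open>j\<close> to \<open>t\<close> in the
    induction hypothesis produces the extra character in that coordinate.\<close>
  have split: "(\<Sum>i\<in>I-J. (u(j:=t)) i * x i) = t * x j + (\<Sum>i\<in>I-insert j J. u i * x i)" for t x
  proof -
    have IJ: "I - J = insert j (I - insert j J)" "j \<notin> I - insert j J" "finite (I - insert j J)"
      using insert.prems insert.hyps I by auto
    have "(\<Sum>i\<in>I - insert j J. (u(j:=t)) i * x i) = (\<Sum>i\<in>I-insert j J. u i * x i)"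
      by (intro sum.cong) auto
    then show ?thesis by (subst IJ(1), subst sum.insert[OF IJ(3,2)]) (simp only: fun_upd_same)
  qed
  have "(\<lambda>n. CLINT \<omega> | M n. (of_real (\<Prod>i\<in>J. g i (V n i \<omega>)) * iexp (\<Sum>i\<in>I-insert j J. u i * V n i \<omega>)) * of_real (g j (V n j \<omega>)))
     \<longlonglongrightarrow> (CLINT \<omega> | N. (of_real (\<Prod>i\<in>J. g i (W i \<omega>)) * iexp (\<Sum>i\<in>I-insert j J. u i * W i \<omega>)) * of_real (g j (W j \<omega>)))"
  proof (rule Fourier_determining[OF M N, where g="g j" and V="\<lambda>n. V n j" and V'="W j" and B=1 and C=1 and L=L and R="R j"])
    fix t
    have eq: "of_real (\<Prod>i\<in>J. g i (x i)) * iexp (\<Sum>i\<in>I-insert j J. u i * x i) * iexp (t * x j)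
       = of_real (\<Prod>i\<in>J. g i (x i)) * iexp (\<Sum>i\<in>I-J. (u(j:=t)) i * x i)" for x
      unfolding split by (simp add: exp_add[symmetric] algebra_simps)
    show "(\<lambda>n. CLINT \<omega> | M n. of_real (\<Prod>i\<in>J. g i (V n i \<omega>)) * iexp (\<Sum>i\<in>I-insert j J. u i * V n i \<omega>) * iexp (t * V n j \<omega>))
      \<longlonglongrightarrow> (CLINT \<omega> | N. of_real (\<Prod>i\<in>J. g i (W i \<omega>)) * iexp (\<Sum>i\<in>I-insert j J. u i * W i \<omega>) * iexp (t * W j \<omega>))"
    proof -
      have "(\<lambda>n. CLINT \<omega> | M n. of_real (\<Prod>i\<in>J. g i (V n i \<omega>)) * iexp (\<Sum>i\<in>I-J. (u(j:=t)) i * V n i \<omega>))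
        \<longlonglongrightarrow> (CLINT \<omega> | N. of_real (\<Prod>i\<in>J. g i (W i \<omega>)) * iexp (\<Sum>i\<in>I-J. (u(j:=t)) i * W i \<omega>))"
        by (rule insert.IH) (use insert.prems in auto)
      then show ?thesis
        by (simp only: eq[of "\<lambda>i. V n i \<omega>" for n \<omega>, symmetric] eq[of "\<lambda>i. W i \<omega>" for \<omega>, symmetric])
    qed
  next
    have [measurable]: "(\<lambda>\<omega>. \<Prod>i\<in>J. g i (V n i \<omega>)) \<in> borel_measurable (M n)"
       "(\<lambda>\<omega>. \<Sum>i\<in>I-insert j J. u i * V n i \<omega>) \<in> borel_measurable (M n)" for n
      using insert.prems V(1) gm
      by (auto intro!: borel_measurable_prod borel_measurable_sum borel_measurable_times measurable_compose[OF _ gm])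
    have [measurable]: "(\<lambda>\<omega>. \<Prod>i\<in>J. g i (W i \<omega>)) \<in> borel_measurable N"
       "(\<lambda>\<omega>. \<Sum>i\<in>I-insert j J. u i * W i \<omega>) \<in> borel_measurable N"
      using insert.prems V(2) gm
      by (auto intro!: borel_measurable_prod borel_measurable_sum borel_measurable_times measurable_compose[OF _ gm])
    show "(\<lambda>\<omega>. of_real (\<Prod>i\<in>J. g i (V n i \<omega>)) * iexp (\<Sum>i\<in>I-insert j J. u i * V n i \<omega>)) \<in> borel_measurable (M n)" for n
      by measurable
    show "(\<lambda>\<omega>. of_real (\<Prod>i\<in>J. g i (W i \<omega>)) * iexp (\<Sum>i\<in>I-insert j J. u i * W i \<omega>)) \<in> borel_measurable N"
      by measurable
  qed (use insert.prems V g(1,2,3) bd in \<open>auto simp: norm_mult simp del: of_real_prod\<close>, rule g(4))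
  then show ?case
    by (simp only: prod.insert[OF insert.hyps] of_real_mult mult_ac)
qed

text \<open>The sum interpolates \<open>f\<close> from the lattice of mesh \<eta> by tents, cut off
  at K meshes. Inside the cube the weights sum to 1 and only lattice points within one mesh of
  \<open>v\<close> count. Outside, the second error term alone exceeds the trivial bound 2 B; it is
  Chebyshev's inequality in pointwise form.\<close>

lemma lattice_approximation:
  fixes f :: "('i \<Rightarrow> real) \<Rightarrow> real"
  assumes I: "finite I" and B: "\<And>v. \<bar>f v\<bar> \<le> B" and L: "\<And>v w. \<bar>f v - f w\<bar> \<le> L * (\<Sum>i\<in>I. \<bar>v i - w i\<bar>)" "0 \<le> L"
    and "0 < \<eta>" "0 < (K::nat)"
  shows "\<bar>f v - (\<Sum>p\<in>PiE I (\<lambda>_. {- int K..int K}). f (\<lambda>i. \<eta> * of_int (p i)) * (\<Prod>i\<in>I. hat (v i / \<eta> - of_int (p i))))\<bar>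
    \<le> L * card I * \<eta> + 2 * B * (\<Sum>i\<in>I. (v i)\<^sup>2) / (\<eta> * K)\<^sup>2"
proof -
  let ?P = "PiE I (\<lambda>_. {- int K..int K})"
  define w where "w p = (\<Prod>i\<in>I. hat (v i / \<eta> - of_int (p i)))" for p
  have w0: "0 \<le> w p" for p unfolding w_def by (intro prod_nonneg) (auto simp: hat_nonneg)
  have fin: "finite ?P" using I by (intro finite_PiE) auto
  have sw: "sum w ?P = (\<Prod>i\<in>I. \<Sum>k\<in>{-int K..int K}. hat (v i / \<eta> - of_int k))"
    unfolding w_def using I by (subst prod_sum_PiE) auto
  have sw1: "sum w ?P \<le> 1"
    unfolding sw by (intro prod_le_1) (auto simp: sum_hat_le_1 intro!: sum_nonneg hat_nonneg)
  have B0: "0 \<le> B" using B[of undefined] by linarith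
  have nn: "0 \<le> L * card I * \<eta>" "0 \<le> 2 * B * (\<Sum>i\<in>I. (v i)\<^sup>2) / (\<eta> * K)\<^sup>2"
    using B0 L(2) \<open>0 < \<eta>\<close> by (auto intro!: divide_nonneg_nonneg mult_nonneg_nonneg sum_nonneg)
  show ?thesis
  proof (cases "\<forall>i\<in>I. \<bar>v i / \<eta>\<bar> \<le> K")
    case True
    have "sum w ?P = (\<Prod>i\<in>I. 1)"
      unfolding sw
    proof (intro prod.cong sum_hat_eq_1 refl)
      fix i assume "i \<in> I"
      with True have "\<bar>v i / \<eta>\<bar> \<le> K" by blast
      moreover define y where "y = v i / \<eta>"
      ultimately have "- K \<le> y" "y \<le> K" by (simp_all only: abs_le_iff) linarith+
      then show "\<lfloor>v i / \<eta>\<rfloor> \<in> {- int K..int K}" "\<lceil>v i / \<eta>\<rceil> \<in> {- int K..int K}"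
        unfolding atLeastAtMost_iff y_def[symmetric] by linarith+
    qed auto
    then have sw: "sum w ?P = 1" by simp
    have "f v - (\<Sum>p\<in>?P. f (\<lambda>i. \<eta> * of_int (p i)) * w p) = (\<Sum>p\<in>?P. (f v - f (\<lambda>i. \<eta> * of_int (p i))) * w p)"
      by (simp add: left_diff_distrib sum_subtractf sum_distrib_left[symmetric] sw)
    also have "\<bar>\<dots>\<bar> \<le> (\<Sum>p\<in>?P. (L * card I * \<eta>) * w p)"
    proof (rule order_trans[OF sum_abs sum_mono])
      fix p assume "p \<in> ?P"
      show "\<bar>(f v - f (\<lambda>i. \<eta> * of_int (p i))) * w p\<bar> \<le> L * card I * \<eta> * w p"
      proof (cases "w p = 0")
        case False
        \<comment> \<open>A nonzero product weight forces every tent to be nonzero, hence every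
          coordinate of the lattice point to lie within one mesh of \<open>v\<close>.\<close>
        have "\<bar>v i - \<eta> * of_int (p i)\<bar> \<le> \<eta>" if "i \<in> I" for i
        proof -
          have "hat (v i / \<eta> - of_int (p i)) \<noteq> 0"
            using False that I by (auto simp: w_def)
          then have "\<bar>v i / \<eta> - of_int (p i)\<bar> \<le> 1" using hat_eq_0[of "v i / \<eta> - of_int (p i)"] by linarith
          then have "\<eta> * \<bar>v i / \<eta> - of_int (p i)\<bar> \<le> \<eta>" using \<open>0 < \<eta>\<close> by simp
          moreover have "\<eta> * \<bar>v i / \<eta> - of_int (p i)\<bar> = \<bar>\<eta> * (v i / \<eta> - of_int (p i))\<bar>"
            using \<open>0 < \<eta>\<close> by (simp add: abs_mult)
          ultimately show ?thesis using \<open>0 < \<eta>\<close> by (simp add: right_diff_distrib)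
        qed
        then have "(\<Sum>i\<in>I. \<bar>v i - \<eta> * of_int (p i)\<bar>) \<le> card I * \<eta>"
          by (rule sum_bounded_above)
        then have "\<bar>f v - f (\<lambda>i. \<eta> * of_int (p i))\<bar> \<le> L * card I * \<eta>"
          using L(1)[of v "\<lambda>i. \<eta> * of_int (p i)"] mult_left_mono[OF _ L(2)] by (fastforce simp: mult.assoc)
        then show ?thesis using w0[of p] by (simp add: abs_mult mult_right_mono)
      qed simp
    qed
    also have "\<dots> = L * card I * \<eta>" by (simp add: sum_distrib_left[symmetric] sw)
    finally show ?thesis using nn by (simp add: w_def)
  next
    case False
    \<comment> \<open>One coordinate beyond the cutoff already makes the sum of squares larger than
      the square of \<eta> K.\<close>
    then obtain i where i: "i \<in> I" "K < \<bar>v i / \<eta>\<bar>" by auto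
    then have "\<eta> * K < \<bar>v i\<bar>" using \<open>0 < \<eta>\<close> by (simp add: field_simps)
    then have "(\<eta> * K)\<^sup>2 \<le> \<bar>v i\<bar>\<^sup>2" using \<open>0 < \<eta>\<close> by (intro power_mono) auto
    also have "\<dots> \<le> (\<Sum>i\<in>I. (v i)\<^sup>2)" using i I by (auto intro!: member_le_sum)
    finally have "1 \<le> (\<Sum>i\<in>I. (v i)\<^sup>2) / (\<eta> * K)\<^sup>2" using \<open>0 < \<eta>\<close> \<open>0 < K\<close> by simp
    then have *: "2 * B * 1 \<le> 2 * B * ((\<Sum>i\<in>I. (v i)\<^sup>2) / (\<eta> * K)\<^sup>2)" using B0 by (intro mult_left_mono) auto
    have "\<bar>\<Sum>p\<in>?P. f (\<lambda>i. \<eta> * of_int (p i)) * w p\<bar> \<le> (\<Sum>p\<in>?P. B * w p)"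
      using B w0 by (intro order_trans[OF sum_abs sum_mono]) (auto simp: abs_mult intro!: mult_right_mono)
    also have "\<dots> \<le> B" using sw1 B0 by (simp add: sum_distrib_left[symmetric] mult_left_le)
    finally have "\<bar>\<Sum>p\<in>?P. f (\<lambda>i. \<eta> * of_int (p i)) * w p\<bar> \<le> B" .
    with B[of v] * nn show ?thesis unfolding w_def by simp
  qed
qed

text \<open>After lattice approximation only finitely many products of tents remain, and those
  converge. The uniform second moments bound the truncation error for all laws at once, which is the
  role tightness would play.\<close>

lemma tendsto_integral_lipschitz:
  fixes M :: "nat \<Rightarrow> 'a measure" and N :: "'b measure" and f :: "('i \<Rightarrow> real) \<Rightarrow> real"
  assumes M: "\<And>n. prob_space (M n)" and N: "prob_space N" and I: "finite I"
    and V: "\<And>n i. i \<in> I \<Longrightarrow> V n i \<in> borel_measurable (M n)" "\<And>i. i \<in> I \<Longrightarrow> W i \<in> borel_measurable N"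
    and conv: "\<And>u. (\<lambda>n. CLINT \<omega> | M n. iexp (\<Sum>i\<in>I. u i * V n i \<omega>)) \<longlonglongrightarrow> (CLINT \<omega> | N. iexp (\<Sum>i\<in>I. u i * W i \<omega>))"
    and V2: "\<And>n i. i \<in> I \<Longrightarrow> integrable (M n) (\<lambda>\<omega>. (V n i \<omega>)\<^sup>2)" "\<And>n i. i \<in> I \<Longrightarrow> (\<integral>\<omega>. (V n i \<omega>)\<^sup>2 \<partial>M n) \<le> C"
    and W2: "\<And>i. i \<in> I \<Longrightarrow> integrable N (\<lambda>\<omega>. (W i \<omega>)\<^sup>2)" "\<And>i. i \<in> I \<Longrightarrow> (\<integral>\<omega>. (W i \<omega>)\<^sup>2 \<partial>N) \<le> C"
    and B: "\<And>v. \<bar>f v\<bar> \<le> B" and L: "\<And>v w. \<bar>f v - f w\<bar> \<le> L * (\<Sum>i\<in>I. \<bar>v i - w i\<bar>)" "0 \<le> L"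
    and fV: "\<And>n. (\<lambda>\<omega>. f (\<lambda>i. V n i \<omega>)) \<in> borel_measurable (M n)" "(\<lambda>\<omega>. f (\<lambda>i. W i \<omega>)) \<in> borel_measurable N"
  shows "(\<lambda>n. \<integral>\<omega>. f (\<lambda>i. V n i \<omega>) \<partial>M n) \<longlonglongrightarrow> (\<integral>\<omega>. f (\<lambda>i. W i \<omega>) \<partial>N)"
proof (rule LIMSEQ_I)
  fix r :: real assume "0 < r"
  have B0: "0 \<le> B" using B[of undefined] by linarith
  \<comment> \<open>Makes the Lipschitz part of the approximation error at most r/8.\<close>
  define \<eta> where "\<eta> = r / (8 * (L * card I + 1))"
  have Lc: "0 \<le> L * card I" using L(2) by simp
  then have \<eta>: "0 < \<eta>" using \<open>0 < r\<close> by (simp add: \<eta>_def)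
  have "L * card I * \<eta> = (L * card I) / (L * card I + 1) * (r / 8)" by (simp add: \<eta>_def algebra_simps)
  also have "\<dots> \<le> 1 * (r / 8)" using Lc \<open>0 < r\<close> by (intro mult_right_mono) auto
  finally have small1: "L * card I * \<eta> \<le> r / 8" by simp
  \<comment> \<open>The constant in front of 1/K^2 in the truncation error after taking
    expectations; \<open>K\<close> is then chosen so large that this part is also at most
    r/8.\<close>
  define C' where "C' = 2 * B * (card I * \<bar>C\<bar>) / \<eta>\<^sup>2"
  have C'0: "0 \<le> C'" using B0 by (simp add: C'_def)
  obtain K0 :: nat where K0: "C' * 8 / r < K0" using reals_Archimedean2 by blast
  define K where "K = Suc K0"
  have K: "0 < K" "C' * 8 / r < K" using K0 by (auto simp: K_def)
  have "C' / (real K)\<^sup>2 \<le> C' / K" using C'0 K by (intro divide_left_mono) (auto simp: power2_eq_square)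
  also have "\<dots> \<le> r / 8" using K \<open>0 < r\<close> by (simp add: field_simps)
  finally have small2: "2 * B * (card I * \<bar>C\<bar>) / (\<eta> * K)\<^sup>2 \<le> r / 8"
    by (simp add: C'_def power_mult_distrib)
  let ?P = "PiE I (\<lambda>_. {- int K..int K})"
  define h where "h v = (\<Sum>p\<in>?P. f (\<lambda>i. \<eta> * of_int (p i)) * (\<Prod>i\<in>I. hat (v i / \<eta> - of_int (p i))))" for v
  have hb: "\<bar>\<Prod>i\<in>I. hat (v i / \<eta> - of_int (p i))\<bar> \<le> 1" for v and p :: "'i \<Rightarrow> int"
    unfolding abs_prod by (intro prod_le_1) (auto simp: hat_nonneg hat_le_1)
  have err: "\<bar>(\<integral>\<omega>. f (\<lambda>i. v i \<omega>) \<partial>A) - (\<integral>\<omega>. h (\<lambda>i. v i \<omega>) \<partial>A)\<bar> \<le> r / 4"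
    and int_h: "(\<integral>\<omega>. h (\<lambda>i. v i \<omega>) \<partial>A) = (\<Sum>p\<in>?P. f (\<lambda>i. \<eta> * of_int (p i)) * (\<integral>\<omega>. (\<Prod>i\<in>I. hat (v i \<omega> / \<eta> - of_int (p i))) \<partial>A))"
    if "prob_space A" and v: "\<And>i. i \<in> I \<Longrightarrow> v i \<in> borel_measurable A" and fv: "(\<lambda>\<omega>. f (\<lambda>i. v i \<omega>)) \<in> borel_measurable A"
      and v2: "\<And>i. i \<in> I \<Longrightarrow> integrable A (\<lambda>\<omega>. (v i \<omega>)\<^sup>2)" "\<And>i. i \<in> I \<Longrightarrow> (\<integral>\<omega>. (v i \<omega>)\<^sup>2 \<partial>A) \<le> C"
    for A :: "'c measure" and v
  proof -
    interpret A: prob_space A by fact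
    have pi: "integrable A (\<lambda>\<omega>. \<Prod>i\<in>I. hat (v i \<omega> / \<eta> - of_int (p i)))" for p :: "'i \<Rightarrow> int"
      using hb v by (intro A.integrable_const_bound[where B=1]) (auto intro!: borel_measurable_prod)
    show "(\<integral>\<omega>. h (\<lambda>i. v i \<omega>) \<partial>A) = (\<Sum>p\<in>?P. f (\<lambda>i. \<eta> * of_int (p i)) * (\<integral>\<omega>. (\<Prod>i\<in>I. hat (v i \<omega> / \<eta> - of_int (p i))) \<partial>A))"
      unfolding h_def using pi by (subst Bochner_Integration.integral_sum) auto
    have ih: "integrable A (\<lambda>\<omega>. h (\<lambda>i. v i \<omega>))"
      unfolding h_def using pi by (intro Bochner_Integration.integrable_sum integrable_mult_right) auto
    have if': "integrable A (\<lambda>\<omega>. f (\<lambda>i. v i \<omega>))"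
      using B fv by (intro A.integrable_const_bound[where B=B]) auto
    have i2: "integrable A (\<lambda>\<omega>. \<Sum>i\<in>I. (v i \<omega>)\<^sup>2)"
      using v2(1) by (intro Bochner_Integration.integrable_sum) auto
    have "(\<integral>\<omega>. f (\<lambda>i. v i \<omega>) \<partial>A) - (\<integral>\<omega>. h (\<lambda>i. v i \<omega>) \<partial>A) = (\<integral>\<omega>. f (\<lambda>i. v i \<omega>) - h (\<lambda>i. v i \<omega>) \<partial>A)"
      using ih if' by simp
    also have "norm \<dots> \<le> (\<integral>\<omega>. L * card I * \<eta> + 2 * B / (\<eta> * K)\<^sup>2 * (\<Sum>i\<in>I. (v i \<omega>)\<^sup>2) \<partial>A)"
    proof (rule norm_integral_le_integral)
      show "norm (f (\<lambda>i. v i \<omega>) - h (\<lambda>i. v i \<omega>)) \<le> L * card I * \<eta> + 2 * B / (\<eta> * K)\<^sup>2 * (\<Sum>i\<in>I. (v i \<omega>)\<^sup>2)" for \<omega>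
        using lattice_approximation[OF I B L \<eta> K(1), of "\<lambda>i. v i \<omega>"] by (simp add: h_def)
    qed (use i2 in auto)
    also have "\<dots> = L * card I * \<eta> + 2 * B / (\<eta> * K)\<^sup>2 * (\<Sum>i\<in>I. \<integral>\<omega>. (v i \<omega>)\<^sup>2 \<partial>A)"
      using i2 v2(1) A.prob_space by (subst Bochner_Integration.integral_add) auto
    also have "\<dots> \<le> L * card I * \<eta> + 2 * B / (\<eta> * K)\<^sup>2 * (card I * \<bar>C\<bar>)"
      using v2(2) B0 by (intro add_left_mono mult_left_mono sum_bounded_above) (auto intro: order_trans[OF _ abs_ge_self])
    also have "\<dots> \<le> r / 4" using small1 small2 by simp
    finally show "\<bar>(\<integral>\<omega>. f (\<lambda>i. v i \<omega>) \<partial>A) - (\<integral>\<omega>. h (\<lambda>i. v i \<omega>) \<partial>A)\<bar> \<le> r / 4" by simp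
  qed
  have prodconv: "(\<lambda>n. \<integral>\<omega>. (\<Prod>i\<in>I. hat (V n i \<omega> / \<eta> - of_int (p i))) \<partial>M n) \<longlonglongrightarrow> (\<integral>\<omega>. (\<Prod>i\<in>I. hat (W i \<omega> / \<eta> - of_int (p i))) \<partial>N)" for p :: "'i \<Rightarrow> int"
  proof -
    \<comment> \<open>All coordinates are exchanged here, so the character factor is an empty
      sum.\<close>
    have "(\<lambda>n. CLINT \<omega> | M n. of_real (\<Prod>i\<in>I. hat (V n i \<omega> / \<eta> - of_int (p i))) * iexp (\<Sum>i\<in>I-I. 0 * V n i \<omega>))
       \<longlonglongrightarrow> (CLINT \<omega> | N. of_real (\<Prod>i\<in>I. hat (W i \<omega> / \<eta> - of_int (p i))) * iexp (\<Sum>i\<in>I-I. 0 * W i \<omega>))"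
    proof (rule tendsto_integral_product_functions[OF M N I V conv, where L="1/\<eta>" and R="\<lambda>i. \<eta> * (1 + \<bar>of_int (p i)\<bar>)"])
      show "\<bar>hat (x / \<eta> - of_int (p i)) - hat (y / \<eta> - of_int (p i))\<bar> \<le> 1 / \<eta> * \<bar>x - y\<bar>" for i x y
      proof -
        have "\<bar>x / \<eta> - of_int (p i) - (y / \<eta> - of_int (p i))\<bar> = 1 / \<eta> * \<bar>x - y\<bar>"
          using \<eta> by (simp add: diff_divide_distrib[symmetric])
        then show ?thesis using hat_lipschitz[of "x / \<eta> - of_int (p i)" "y / \<eta> - of_int (p i)"] by simp
      qed
      show "hat (x / \<eta> - of_int (p i)) = 0" if "\<eta> * (1 + \<bar>of_int (p i)\<bar>) < \<bar>x\<bar>" for i x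
      proof (rule hat_eq_0)
        have "1 + \<bar>of_int (p i)\<bar> < \<bar>x / \<eta>\<bar>" using that \<eta> by (simp add: field_simps)
        then show "1 \<le> \<bar>x / \<eta> - of_int (p i)\<bar>" by linarith
      qed
    qed (use \<eta> in \<open>auto simp: hat_nonneg hat_le_1\<close>)
    then have "(\<lambda>n. complex_of_real (\<integral>\<omega>. (\<Prod>i\<in>I. hat (V n i \<omega> / \<eta> - of_int (p i))) \<partial>M n)) \<longlonglongrightarrow> complex_of_real (\<integral>\<omega>. (\<Prod>i\<in>I. hat (W i \<omega> / \<eta> - of_int (p i))) \<partial>N)"
      by (simp add: integral_complex_of_real del: of_real_prod)
    then show ?thesis by (simp only: tendsto_of_real_iff)
  qed
  have "(\<lambda>n. \<integral>\<omega>. h (\<lambda>i. V n i \<omega>) \<partial>M n) \<longlonglongrightarrow> (\<integral>\<omega>. h (\<lambda>i. W i \<omega>) \<partial>N)"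
    using int_h[OF M V(1) fV(1) V2] int_h[OF N V(2) fV(2) W2] by (simp add: tendsto_intros prodconv)
  from LIMSEQ_D[OF this, of "r/4"] \<open>0 < r\<close> obtain n0 where
    n0: "\<And>n. n \<ge> n0 \<Longrightarrow> \<bar>(\<integral>\<omega>. h (\<lambda>i. V n i \<omega>) \<partial>M n) - (\<integral>\<omega>. h (\<lambda>i. W i \<omega>) \<partial>N)\<bar> < r / 4" by auto
  show "\<exists>n0. \<forall>n\<ge>n0. norm ((\<integral>\<omega>. f (\<lambda>i. V n i \<omega>) \<partial>M n) - (\<integral>\<omega>. f (\<lambda>i. W i \<omega>) \<partial>N)) < r"
  proof (intro exI[of _ n0] allI impI)
    fix n assume "n0 \<le> n"
    show "norm ((\<integral>\<omega>. f (\<lambda>i. V n i \<omega>) \<partial>M n) - (\<integral>\<omega>. f (\<lambda>i. W i \<omega>) \<partial>N)) < r"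
      using n0[OF \<open>n0 \<le> n\<close>] err[OF M V(1) fV(1) V2, of n] err[OF N V(2) fV(2) W2] \<open>0 < r\<close>
      unfolding real_norm_def by linarith
  qed
qed


section \<open>Independence from characteristic functions\<close>

text \<open>Uniqueness of Fourier transforms for the complex measure with density \<open>Q\<close>,
  transported by \<open>V\<close>. Trapezoidal functions reduce intervals to
  \<open>Fourier_determining\<close>, and the pi-lambda theorem extends from intervals to Borel
  sets.\<close>

lemma integral_indicator_eq_0_of_Fourier:
  fixes N :: "'a measure" and Q :: "'a \<Rightarrow> complex"
  assumes N: "prob_space N" and [measurable]: "Q \<in> borel_measurable N" "V \<in> borel_measurable N"
    and Q: "\<And>\<omega>. cmod (Q \<omega>) \<le> B"
    and 0: "\<And>u. (CLINT \<omega> | N. Q \<omega> * iexp (u * V \<omega>)) = 0"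
    and A: "A \<in> sets borel"
  shows "(CLINT \<omega> | N. Q \<omega> * indicator A (V \<omega>)) = 0"
proof -
  interpret N: prob_space N by fact
  have B0: "0 \<le> B" using Q norm_ge_zero order_trans by blast
  have int: "integrable N (\<lambda>\<omega>. Q \<omega> * indicator A (V \<omega>))" if [measurable]: "A \<in> sets borel" for A
    using Q B0 by (intro N.integrable_const_bound[where B=B]) (auto simp: norm_mult indicator_def)
  have box: "(CLINT \<omega> | N. Q \<omega> * indicator {a..b} (V \<omega>)) = 0" for a b
  proof -
    \<comment> \<open>For a \<le> b this is the distance to the interval, and for a > b it is
      positive everywhere, in agreement with the empty interval.\<close>
    define d where "d x = max 0 (max (a - x) (x - b))" for x :: real
    define g where "g n x = max 0 (1 - real n * d x)" for n :: nat and x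
    have dl: "\<bar>d x - d y\<bar> \<le> \<bar>x - y\<bar>" for x y by (auto simp: d_def)
    have d0: "0 \<le> d x" for x by (simp add: d_def)
    have g1: "\<bar>g n x\<bar> \<le> 1" for n x using d0[of x] by (auto simp: g_def)
    have gl: "\<bar>g n x - g n y\<bar> \<le> n * \<bar>x - y\<bar>" for n x y
    proof -
      have "\<bar>g n x - g n y\<bar> \<le> \<bar>n * d x - n * d y\<bar>" by (auto simp: g_def)
      also have "\<dots> = n * \<bar>d x - d y\<bar>" by (simp add: right_diff_distrib[symmetric] abs_mult)
      finally show ?thesis using mult_left_mono[OF dl[of x y], of "real n"] by simp
    qed
    have gc: "continuous_on UNIV (g n)" for n
      unfolding g_def d_def by (intro continuous_intros)
    then have gm: "g n \<in> borel_measurable borel" for n by (rule borel_measurable_continuous_onI)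
    \<comment> \<open>A constant sequence with limit weight 0: convergence then says that the
      constant is 0. The index \<open>Suc n\<close> is used because slope 0 would give a function
      without compact support.\<close>
    have "(\<lambda>_::nat. CLINT \<omega> | N. Q \<omega> * of_real (g (Suc n) (V \<omega>))) \<longlonglongrightarrow> (CLINT \<omega> | N. 0 * of_real (g (Suc n) (V \<omega>)))" for n
    proof (rule Fourier_determining[OF N N, where g="g (Suc n)" and V="\<lambda>_. V" and V'=V and Q'="\<lambda>_. 0" and B=B and C=1 and L="Suc n" and R="\<bar>a\<bar> + \<bar>b\<bar> + 1"])
      fix x assume "\<bar>a\<bar> + \<bar>b\<bar> + 1 < \<bar>x\<bar>"
      then have "1 \<le> d x" by (auto simp: d_def)
      then have "1 * 1 \<le> real (Suc n) * d x" by (intro mult_mono) auto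
      then show "g (Suc n) x = 0" by (simp add: g_def)
    next
      show "\<bar>g (Suc n) x - g (Suc n) y\<bar> \<le> real (Suc n) * \<bar>x - y\<bar>" for x y by (rule gl)
    qed (use Q B0 g1 0 in auto)
    then have "(CLINT \<omega> | N. Q \<omega> * of_real (g (Suc n) (V \<omega>))) = 0" for n
      by (simp add: LIMSEQ_const_iff)
    moreover have "(\<lambda>n. CLINT \<omega> | N. Q \<omega> * of_real (g (Suc n) (V \<omega>))) \<longlonglongrightarrow> (CLINT \<omega> | N. Q \<omega> * indicator {a..b} (V \<omega>))"
    proof (intro integral_dominated_convergence[where w="\<lambda>_. B"] AE_I2 tendsto_mult tendsto_const)
      show "(\<lambda>n. complex_of_real (g (Suc n) (V \<omega>))) \<longlonglongrightarrow> indicator {a..b} (V \<omega>)" for \<omega>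
      proof (cases "V \<omega> \<in> {a..b}")
        case True
        then show ?thesis by (auto simp: g_def d_def)
      next
        case False
        then have "0 < d (V \<omega>)" by (auto simp: d_def)
        then obtain n0 :: nat where n0: "1 / d (V \<omega>) < n0" using reals_Archimedean2 by blast
        have "g (Suc n) (V \<omega>) = 0" if "n0 \<le> n" for n
        proof -
          have "1 / d (V \<omega>) < real (Suc n)" using n0 that by linarith
          then show ?thesis using \<open>0 < d (V \<omega>)\<close> by (simp add: g_def field_simps)
        qed
        then have "\<forall>\<^sub>F n in sequentially. complex_of_real (g (Suc n) (V \<omega>)) = 0"
          unfolding eventually_sequentially by auto
        with False show ?thesis by (simp add: tendsto_eventually)
      qed
      show "cmod (Q \<omega> * complex_of_real (g (Suc n) (V \<omega>))) \<le> B" for n \<omega>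
        using mult_mono[OF Q[of \<omega>] g1[of "Suc n" "V \<omega>"]] B0 by (simp add: norm_mult)
    qed (use gm in \<open>auto intro!: borel_measurable_times measurable_compose[OF _ gm]\<close>)
    ultimately show ?thesis by (simp add: LIMSEQ_const_iff)
  qed
  have "Int_stable (range (\<lambda>(a,b). {a..b::real}))" "range (\<lambda>(a,b). {a..b::real}) \<subseteq> Pow UNIV"
    by (auto simp: Int_stable_def)
  moreover have "A \<in> sigma_sets UNIV (range (\<lambda>(a,b). {a..b}))"
    using A by (simp add: borel_eq_atLeastAtMost)
  ultimately show ?thesis
  proof (induction rule: sigma_sets_induct_disjoint)
    case (basic A) then show ?case using box by auto
  next
    case empty then show ?case by simp
  next
    case (compl A)
    then have [measurable]: "A \<in> sets borel" by (simp add: borel_eq_atLeastAtMost)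
    have "Q \<omega> * indicator (UNIV - A) (V \<omega>) = Q \<omega> - Q \<omega> * indicator A (V \<omega>)" for \<omega>
      by (auto simp: indicator_def)
    then show ?case
      using int[of A] int[of UNIV] compl.IH 0[of 0] by (simp add: Bochner_Integration.integral_diff)
  next
    case (union A)
    then have Am[measurable]: "A i \<in> sets borel" for i by (auto simp: borel_eq_atLeastAtMost)
    have [measurable]: "(\<Union>i. A i) \<in> sets borel" using Am by auto
    have "(\<lambda>n. CLINT \<omega> | N. Q \<omega> * (\<Sum>i<n. indicator (A i) (V \<omega>))) \<longlonglongrightarrow> (CLINT \<omega> | N. Q \<omega> * indicator (\<Union>i. A i) (V \<omega>))"
    proof (intro integral_dominated_convergence[where w="\<lambda>_. B"] AE_I2 tendsto_mult tendsto_const)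
      have "(\<lambda>i. complex_of_real (indicator (A i) x)) sums of_real (indicator (\<Union>i. A i) x)" for x
        using indicator_sums[of A x] union.hyps(1) by (intro sums_of_real) (auto simp: disjoint_family_on_def)
      then show "(\<lambda>n. \<Sum>i<n. indicator (A i) (V \<omega>) :: complex) \<longlonglongrightarrow> indicator (\<Union>i. A i) (V \<omega>)" for \<omega>
        by (simp add: sums_def of_real_indicator)
      show "cmod (Q \<omega> * (\<Sum>i<n. indicator (A i) (V \<omega>))) \<le> B" for n \<omega>
      proof -
        have "(\<Sum>i<n. indicator (A i) (V \<omega>) :: complex) = indicator (\<Union>i<n. A i) (V \<omega>)"
          using union.hyps(1) by (subst indicator_UN_disjoint) (auto simp: disjoint_family_on_def)
        then show ?thesis using Q[of \<omega>] B0 by (auto simp: norm_mult indicator_def)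
      qed
    qed auto
    moreover have "(CLINT \<omega> | N. Q \<omega> * (\<Sum>i<n. indicator (A i) (V \<omega>))) = 0" for n
    proof -
      have "(CLINT \<omega> | N. Q \<omega> * (\<Sum>i<n. indicator (A i) (V \<omega>))) = (CLINT \<omega> | N. \<Sum>i<n. Q \<omega> * indicator (A i) (V \<omega>))"
        by (simp only: sum_distrib_left)
      also have "\<dots> = (\<Sum>i<n. CLINT \<omega> | N. Q \<omega> * indicator (A i) (V \<omega>))"
        using int[OF Am] by (rule Bochner_Integration.integral_sum)
      finally show ?thesis using union.IH by simp
    qed
    ultimately show ?case by (simp add: LIMSEQ_const_iff)
  qed
qed

text \<open>Indicators are traded for characters one coordinate at a time; the indicator already
  obtained is absorbed into the weight \<open>Q\<close>, which keeps its bound.\<close>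

lemma integral_prod_indicator_eq_0_of_Fourier:
  fixes N :: "'a measure" and Q :: "'a \<Rightarrow> complex" and V :: "'i \<Rightarrow> 'a \<Rightarrow> real"
  assumes N: "prob_space N" and "finite J"
    and "Q \<in> borel_measurable N" "\<And>j. j \<in> J \<Longrightarrow> V j \<in> borel_measurable N"
    and "\<And>\<omega>. cmod (Q \<omega>) \<le> B"
    and "\<And>u. (CLINT \<omega> | N. Q \<omega> * iexp (\<Sum>j\<in>J. u j * V j \<omega>)) = 0"
    and "\<And>j. j \<in> J \<Longrightarrow> A j \<in> sets borel"
  shows "(CLINT \<omega> | N. Q \<omega> * (\<Prod>j\<in>J. indicator (A j) (V j \<omega>))) = 0"
  using assms(2-)
proof (induction J arbitrary: Q)
  case empty
  then show ?case by simp
next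
  case (insert j J)
  have B0: "0 \<le> B" using insert.prems(3) norm_ge_zero order_trans by blast
  have [measurable]: "V j \<in> borel_measurable N" "A j \<in> sets borel" "Q \<in> borel_measurable N"
    using insert.prems by auto
  have "(CLINT \<omega> | N. (Q \<omega> * indicator (A j) (V j \<omega>)) * (\<Prod>j\<in>J. indicator (A j) (V j \<omega>))) = 0"
  proof (rule insert.IH)
    show "cmod (Q \<omega> * indicator (A j) (V j \<omega>)) \<le> B" for \<omega>
      using insert.prems(3)[of \<omega>] B0 by (auto simp: norm_mult indicator_def)
    fix u
    have [measurable]: "(\<lambda>\<omega>. \<Sum>i\<in>J. u i * V i \<omega>) \<in> borel_measurable N"
      using insert.prems(2) by (intro borel_measurable_sum borel_measurable_times) auto
    have "(CLINT \<omega> | N. (Q \<omega> * iexp (\<Sum>j\<in>J. u j * V j \<omega>)) * indicator (A j) (V j \<omega>)) = 0"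
    proof (rule integral_indicator_eq_0_of_Fourier[OF N, where B=B])
      fix t
      have "(\<Sum>i\<in>J. (u(j:=t)) i * V i \<omega>) = (\<Sum>i\<in>J. u i * V i \<omega>)" for \<omega>
        using insert.hyps by (intro sum.cong) auto
      then have "(\<Sum>i\<in>insert j J. (u(j:=t)) i * V i \<omega>) = t * V j \<omega> + (\<Sum>i\<in>J. u i * V i \<omega>)" for \<omega>
        by (subst sum.insert[OF insert.hyps]) (simp only: fun_upd_same)
      then show "(CLINT \<omega> | N. (Q \<omega> * iexp (\<Sum>j\<in>J. u j * V j \<omega>)) * iexp (t * V j \<omega>)) = 0"
        using insert.prems(4)[of "u(j:=t)"] by (simp add: exp_add[symmetric] algebra_simps del: fun_upd_apply)
    qed (use insert.prems(3) in \<open>auto simp: norm_mult simp del: of_real_sum of_real_mult\<close>)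
    then show "(CLINT \<omega> | N. (Q \<omega> * indicator (A j) (V j \<omega>)) * iexp (\<Sum>j\<in>J. u j * V j \<omega>)) = 0"
      by (simp add: mult_ac)
  qed (use insert.prems in auto)
  then show ?case using insert.hyps by (simp add: mult.assoc)
qed

text \<open>Kac's criterion for two possibly infinite families. Cylinder sets over finitely many
  coordinates generate both sigma-algebras, and uniqueness of Fourier transforms is applied twice,
  each time to a centred weight: to a character of \<open>V\<close> minus its mean, then to the
  indicator of \<open>a\<close> minus its probability.\<close>

lemma prob_space_indep_set_vimage_PiM_of_char:
  fixes N :: "'a measure" and U :: "'i \<Rightarrow> 'a \<Rightarrow> real" and V :: "'j \<Rightarrow> 'a \<Rightarrow> real"
  assumes N: "prob_space N"
    and U: "\<And>i. i \<in> I \<Longrightarrow> U i \<in> borel_measurable N" and V: "\<And>j. j \<in> K \<Longrightarrow> V j \<in> borel_measurable N"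
    and char: "\<And>I' K' u v. finite I' \<Longrightarrow> I' \<subseteq> I \<Longrightarrow> finite K' \<Longrightarrow> K' \<subseteq> K \<Longrightarrow>
      (CLINT \<omega> | N. iexp (\<Sum>i\<in>I'. u i * U i \<omega>) * iexp (\<Sum>j\<in>K'. v j * V j \<omega>))
      = (CLINT \<omega> | N. iexp (\<Sum>i\<in>I'. u i * U i \<omega>)) * (CLINT \<omega> | N. iexp (\<Sum>j\<in>K'. v j * V j \<omega>))"
  shows "prob_space.indep_set N
      (sets (vimage_algebra (space N) (\<lambda>\<omega>. \<lambda>i\<in>I. U i \<omega>) (Pi\<^sub>M I (\<lambda>_. borel))))
      (sets (vimage_algebra (space N) (\<lambda>\<omega>. \<lambda>j\<in>K. V j \<omega>) (Pi\<^sub>M K (\<lambda>_. borel))))"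
proof -
  interpret N: prob_space N by fact
  note of_real_sum [simp del] of_real_mult [simp del]
  have gen: "sets (vimage_algebra (space N) (\<lambda>\<omega>. \<lambda>i\<in>I. U i \<omega>) (Pi\<^sub>M I (\<lambda>_. borel)))
      = sigma_sets (space N) {(\<lambda>\<omega>. \<lambda>i\<in>I. U i \<omega>) -` A \<inter> space N | A. A \<in> prod_algebra I (\<lambda>_. borel)}"
    for I and U :: "'k \<Rightarrow> 'a \<Rightarrow> real"
    by (subst sets_vimage_algebra2) (auto simp: space_PiM sets_PiM intro!: sigma_sets_vimage_commute)
  have stable: "Int_stable {(\<lambda>\<omega>. \<lambda>i\<in>I. U i \<omega>) -` A \<inter> space N | A. A \<in> prod_algebra I (\<lambda>_. borel)}"
    for I and U :: "'k \<Rightarrow> 'a \<Rightarrow> real"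
  proof (rule Int_stableI, clarify)
    fix A B assume "A \<in> prod_algebra I (\<lambda>_. borel :: real measure)" "B \<in> prod_algebra I (\<lambda>_. borel :: real measure)"
    then have "A \<inter> B \<in> prod_algebra I (\<lambda>_. borel)" using Int_stable_prod_algebra by (auto simp: Int_stable_def)
    then show "\<exists>C. (\<lambda>\<omega>. \<lambda>i\<in>I. U i \<omega>) -` A \<inter> space N \<inter> ((\<lambda>\<omega>. \<lambda>i\<in>I. U i \<omega>) -` B \<inter> space N) = (\<lambda>\<omega>. \<lambda>i\<in>I. U i \<omega>) -` C \<inter> space N
      \<and> C \<in> prod_algebra I (\<lambda>_. borel)" by (intro exI[of _ "A \<inter> B"]) auto
  qed
  \<comment> \<open>A generating cylinder constrains finitely many coordinates, so its indicator is
    a finite product of indicators of single coordinates.\<close>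
  have rep: "\<exists>J E. finite J \<and> J \<subseteq> I \<and> (\<forall>i\<in>J. E i \<in> sets borel) \<and> a \<in> sets N \<and> (\<forall>\<omega>\<in>space N. indicator a \<omega> = (\<Prod>i\<in>J. indicator (E i) (U i \<omega>) :: complex))"
    if a: "a \<in> {(\<lambda>\<omega>. \<lambda>i\<in>I. U i \<omega>) -` A \<inter> space N | A. A \<in> prod_algebra I (\<lambda>_. borel)}" and U: "\<And>i. i \<in> I \<Longrightarrow> U i \<in> borel_measurable N"
    for I a and U :: "'k \<Rightarrow> 'a \<Rightarrow> real"
  proof -
    from a obtain A where a: "a = (\<lambda>\<omega>. \<lambda>i\<in>I. U i \<omega>) -` A \<inter> space N" and A: "A \<in> prod_algebra I (\<lambda>_. borel)" by auto
    from prod_algebraE[OF A] obtain J E where AE: "A = prod_emb I (\<lambda>_. borel) J (Pi\<^sub>E J E)" "finite J" "J \<subseteq> I" "\<And>i. i \<in> J \<Longrightarrow> E i \<in> sets borel"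
      by metis
    have eq: "\<omega> \<in> a \<longleftrightarrow> (\<forall>i\<in>J. U i \<omega> \<in> E i)" if "\<omega> \<in> space N" for \<omega>
    proof -
      have "I \<inter> J = J" using AE(3) by auto
      then have "(\<lambda>i\<in>I. U i \<omega>) \<in> A \<longleftrightarrow> (\<lambda>i\<in>J. U i \<omega>) \<in> Pi\<^sub>E J E"
        by (simp add: AE(1) prod_emb_iff restrict_restrict)
      then show ?thesis using that by (simp add: a Pi_iff)
    qed
    have "a = {\<omega>\<in>space N. \<forall>i\<in>J. U i \<omega> \<in> E i}" using eq by (auto simp: a)
    also have "\<dots> \<in> sets N"
      using AE U by (intro sets.sets_Collect_finite_All) (auto simp: subset_eq intro!: measurable_sets_Collect[where P="\<lambda>x. x \<in> E _"])
    finally have "a \<in> sets N" .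
    moreover have "indicator a \<omega> = (\<Prod>i\<in>J. indicator (E i) (U i \<omega>) :: complex)" if "\<omega> \<in> space N" for \<omega>
    proof (cases "\<forall>i\<in>J. U i \<omega> \<in> E i")
      case True then show ?thesis using eq[OF that] by simp
    next
      case False
      then obtain i where "i \<in> J" "U i \<omega> \<notin> E i" by auto
      then have "(\<Prod>i\<in>J. indicator (E i) (U i \<omega>) :: complex) = 0"
        using AE(2) by (intro prod_zero) (auto intro: bexI[of _ i])
      with False show ?thesis using eq[OF that] by simp
    qed
    ultimately show ?thesis using AE by blast
  qed
  show ?thesis
    unfolding gen
  proof (rule N.indep_set_sigma_sets[OF _ stable stable], rule N.indep_setI)
    fix a b
    assume a: "a \<in> {(\<lambda>\<omega>. \<lambda>i\<in>I. U i \<omega>) -` A \<inter> space N | A. A \<in> prod_algebra I (\<lambda>_. borel)}"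
      and b: "b \<in> {(\<lambda>\<omega>. \<lambda>j\<in>K. V j \<omega>) -` A \<inter> space N | A. A \<in> prod_algebra K (\<lambda>_. borel)}"
    obtain I' E where I': "finite I'" "I' \<subseteq> I" "\<forall>i\<in>I'. E i \<in> sets borel" and [measurable]: "a \<in> sets N"
      and ia: "\<And>\<omega>. \<omega> \<in> space N \<Longrightarrow> indicator a \<omega> = (\<Prod>i\<in>I'. indicator (E i) (U i \<omega>) :: complex)"
      using rep[OF a U] by blast
    obtain K' F where K': "finite K'" "K' \<subseteq> K" "\<forall>i\<in>K'. F i \<in> sets borel" and [measurable]: "b \<in> sets N"
      and ib: "\<And>\<omega>. \<omega> \<in> space N \<Longrightarrow> indicator b \<omega> = (\<Prod>i\<in>K'. indicator (F i) (V i \<omega>) :: complex)"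
      using rep[OF b V] by blast
    have eU[measurable]: "(\<lambda>\<omega>. \<Sum>i\<in>I'. u i * U i \<omega>) \<in> borel_measurable N" for u
      using U I' by (intro borel_measurable_sum borel_measurable_times) auto
    have eV[measurable]: "(\<lambda>\<omega>. \<Sum>i\<in>K'. u i * V i \<omega>) \<in> borel_measurable N" for u
      using V K' by (intro borel_measurable_sum borel_measurable_times) auto
    have bnd: "integrable N f" if "f \<in> borel_measurable N" "\<And>\<omega>. cmod (f \<omega>) \<le> 2" for f
      using that by (intro N.integrable_const_bound[where B=2]) auto
    have c1: "cmod (CLINT \<omega> | N. iexp (\<Sum>j\<in>K'. v j * V j \<omega>)) \<le> 1" for v
      by (intro N.norm_integral_le_const) simp
    \<comment> \<open>Characters of \<open>V\<close> are uncorrelated with the event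
      \<open>a\<close>: the first application, in the variables \<open>U\<close>.\<close>
    have step1: "(CLINT \<omega> | N. (iexp (\<Sum>j\<in>K'. v j * V j \<omega>) - (CLINT \<omega> | N. iexp (\<Sum>j\<in>K'. v j * V j \<omega>))) * indicator a \<omega>) = 0" for v
    proof -
      let ?c = "CLINT \<omega> | N. iexp (\<Sum>j\<in>K'. v j * V j \<omega>)"
      have "(CLINT \<omega> | N. (iexp (\<Sum>j\<in>K'. v j * V j \<omega>) - ?c) * (\<Prod>i\<in>I'. indicator (E i) (U i \<omega>))) = 0"
      proof (rule integral_prod_indicator_eq_0_of_Fourier[OF N, where B=2])
        show "cmod (iexp (\<Sum>j\<in>K'. v j * V j \<omega>) - ?c) \<le> 2" for \<omega>
          using norm_triangle_ineq4[of "iexp (\<Sum>j\<in>K'. v j * V j \<omega>)" ?c] c1[of v] by simp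
        fix u
        have "(CLINT \<omega> | N. (iexp (\<Sum>j\<in>K'. v j * V j \<omega>) - ?c) * iexp (\<Sum>i\<in>I'. u i * U i \<omega>))
          = (CLINT \<omega> | N. iexp (\<Sum>i\<in>I'. u i * U i \<omega>) * iexp (\<Sum>j\<in>K'. v j * V j \<omega>) - ?c * iexp (\<Sum>i\<in>I'. u i * U i \<omega>))"
          by (simp add: algebra_simps)
        also have "\<dots> = (CLINT \<omega> | N. iexp (\<Sum>i\<in>I'. u i * U i \<omega>) * iexp (\<Sum>j\<in>K'. v j * V j \<omega>)) - ?c * (CLINT \<omega> | N. iexp (\<Sum>i\<in>I'. u i * U i \<omega>))"
          using c1[of v] by (subst Bochner_Integration.integral_diff) (auto intro!: bnd simp: norm_mult)
        also have "\<dots> = 0" using char[OF I'(1,2) K'(1,2)] by simp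
        finally show "(CLINT \<omega> | N. (iexp (\<Sum>j\<in>K'. v j * V j \<omega>) - ?c) * iexp (\<Sum>i\<in>I'. u i * U i \<omega>)) = 0" .
      qed (use U I' in auto)
      then show ?thesis by (simp cong: Bochner_Integration.integral_cong add: ia)
    qed
    \<comment> \<open>The second application, in the variables \<open>V\<close>; its Fourier
      hypothesis is \<open>step1\<close> read for the centred indicator of \<open>a\<close>.\<close>
    have "(CLINT \<omega> | N. (indicator a \<omega> - of_real (N.prob a)) * (\<Prod>j\<in>K'. indicator (F j) (V j \<omega>))) = 0"
    proof (rule integral_prod_indicator_eq_0_of_Fourier[OF N, where B=2])
      show "cmod (indicator a \<omega> - complex_of_real (N.prob a)) \<le> 2" for \<omega>
      proof -
        have "cmod (indicator a \<omega>) \<le> 1" by (simp add: indicator_def)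
        moreover have "cmod (complex_of_real (N.prob a)) \<le> 1" by simp
        ultimately show ?thesis
          using norm_triangle_ineq4[of "indicator a \<omega>" "complex_of_real (N.prob a)"] by linarith
      qed
      fix v
      let ?c = "CLINT \<omega> | N. iexp (\<Sum>j\<in>K'. v j * V j \<omega>)"
      have ind: "(CLINT \<omega> | N. indicator a \<omega>) = complex_of_real (N.prob a)"
        using integral_complex_of_real[of N "indicator a"] by (simp add: of_real_indicator)
      have p2: "N.prob a \<le> 2" using N.prob_le_1[of a] by linarith
      have "0 = (CLINT \<omega> | N. indicator a \<omega> * iexp (\<Sum>j\<in>K'. v j * V j \<omega>) - ?c * indicator a \<omega>)"
        using step1[of v] by (simp add: algebra_simps)
      also have "\<dots> = (CLINT \<omega> | N. indicator a \<omega> * iexp (\<Sum>j\<in>K'. v j * V j \<omega>)) - ?c * of_real (N.prob a)"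
      proof -
        have "(CLINT \<omega> | N. indicator a \<omega> * iexp (\<Sum>j\<in>K'. v j * V j \<omega>) - ?c * indicator a \<omega>)
          = (CLINT \<omega> | N. indicator a \<omega> * iexp (\<Sum>j\<in>K'. v j * V j \<omega>)) - (CLINT \<omega> | N. ?c * indicator a \<omega>)"
          using c1[of v] by (intro Bochner_Integration.integral_diff bnd) (auto simp: norm_mult indicator_def)
        then show ?thesis using ind by simp
      qed
      also have "\<dots> = (CLINT \<omega> | N. indicator a \<omega> * iexp (\<Sum>j\<in>K'. v j * V j \<omega>) - of_real (N.prob a) * iexp (\<Sum>j\<in>K'. v j * V j \<omega>))"
        using p2 by (subst Bochner_Integration.integral_diff) (auto intro!: bnd simp: norm_mult indicator_def)
      finally show "(CLINT \<omega> | N. (indicator a \<omega> - complex_of_real (N.prob a)) * iexp (\<Sum>j\<in>K'. v j * V j \<omega>)) = 0"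
        by (simp add: algebra_simps)
    qed (use V K' in auto)
    then have "(CLINT \<omega> | N. (indicator a \<omega> - of_real (N.prob a)) * indicator b \<omega>) = 0"
      by (simp cong: Bochner_Integration.integral_cong add: ib)
    moreover have "(indicator a \<omega> - of_real (N.prob a)) * indicator b \<omega> = complex_of_real ((indicator a \<omega> - N.prob a) * indicator b \<omega>)" for \<omega>
      by (simp add: of_real_mult of_real_indicator)
    ultimately have "(CLINT \<omega> | N. of_real ((indicator a \<omega> - N.prob a) * indicator b \<omega>)) = 0"
      by (simp only:)
    then have "(\<integral>\<omega>. (indicator a \<omega> - N.prob a) * indicator b \<omega> \<partial>N) = 0"
      by (simp only: integral_complex_of_real of_real_eq_0_iff)
    then have "(\<integral>\<omega>. indicator (a \<inter> b) \<omega> - N.prob a * indicator b \<omega> \<partial>N) = 0"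
      by (simp add: left_diff_distrib indicator_inter_arith)
    moreover have "(\<integral>\<omega>. indicator (a \<inter> b) \<omega> - N.prob a * indicator b \<omega> \<partial>N) = N.prob (a \<inter> b) - N.prob a * N.prob b"
    proof -
      have "integrable N (indicator c :: 'a \<Rightarrow> real)" if "c \<in> sets N" for c
        using that by (intro integrable_real_indicator) (auto simp: N.emeasure_eq_measure)
      then show ?thesis by (subst Bochner_Integration.integral_diff) auto
    qed
    ultimately show "N.prob (a \<inter> b) = N.prob a * N.prob b" by linarith
  next
    show "{(\<lambda>\<omega>. \<lambda>i\<in>I. U i \<omega>) -` A \<inter> space N | A. A \<in> prod_algebra I (\<lambda>_. borel)} \<subseteq> N.events"
    proof
      fix a assume a: "a \<in> {(\<lambda>\<omega>. \<lambda>i\<in>I. U i \<omega>) -` A \<inter> space N | A. A \<in> prod_algebra I (\<lambda>_. borel)}"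
      have "\<exists>J E. finite J \<and> J \<subseteq> I \<and> (\<forall>i\<in>J. E i \<in> sets borel) \<and> a \<in> sets N \<and> (\<forall>\<omega>\<in>space N. indicator a \<omega> = (\<Prod>i\<in>J. indicator (E i) (U i \<omega>) :: complex))"
        using a U by (rule rep)
      then show "a \<in> N.events" by (elim exE conjE)
    qed
    show "{(\<lambda>\<omega>. \<lambda>i\<in>K. V i \<omega>) -` A \<inter> space N | A. A \<in> prod_algebra K (\<lambda>_. borel)} \<subseteq> N.events"
    proof
      fix a assume a: "a \<in> {(\<lambda>\<omega>. \<lambda>i\<in>K. V i \<omega>) -` A \<inter> space N | A. A \<in> prod_algebra K (\<lambda>_. borel)}"
      have "\<exists>J E. finite J \<and> J \<subseteq> K \<and> (\<forall>i\<in>J. E i \<in> sets borel) \<and> a \<in> sets N \<and> (\<forall>\<omega>\<in>space N. indicator a \<omega> = (\<Prod>i\<in>J. indicator (E i) (V i \<omega>) :: complex))"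
        using a V by (rule rep)
      then show "a \<in> N.events" by (elim exE conjE)
    qed
  qed
qed


section \<open>The path space and dyadic interpolation\<close>

lemma lipschitz_imp_continuous_map_mtopology_of:
  fixes F :: "'b \<Rightarrow> real"
  assumes F: "\<And>x y. x \<in> mspace m \<Longrightarrow> y \<in> mspace m \<Longrightarrow> \<bar>F x - F y\<bar> \<le> L * mdist m x y" and "0 \<le> L"
  shows "continuous_map (mtopology_of m) euclideanreal F"
  unfolding mtopology_of_def
proof (subst Metric_space.continuous_map_from_metric[OF Metric_space_mspace_mdist], intro conjI ballI allI impI)
  fix a U assume a: "a \<in> mspace m" and U: "openin euclideanreal U \<and> F a \<in> U"
  then obtain e where e: "0 < e" "\<And>y. \<bar>y - F a\<bar> < e \<Longrightarrow> y \<in> U"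
    by (auto simp: open_dist dist_real_def)
  show "\<exists>r>0. \<forall>x. x \<in> mspace m \<and> mdist m a x < r \<longrightarrow> F x \<in> U"
  proof (intro exI[of _ "e / (L + 1)"] conjI allI impI)
    show "0 < e / (L + 1)" using e \<open>0 \<le> L\<close> by simp
    fix x assume x: "x \<in> mspace m \<and> mdist m a x < e / (L + 1)"
    have "\<bar>F x - F a\<bar> \<le> L * mdist m a x" using F[of a x] a x by (simp add: abs_minus_commute)
    also have "\<dots> \<le> (L + 1) * mdist m a x" by (simp add: algebra_simps)
    also have "\<dots> < e" using x \<open>0 \<le> L\<close> by (simp add: field_simps)
    finally show "F x \<in> U" using e by blast
  qed
qed auto

lemma space_borel_of_metric [simp]: "space (borel_of_metric m) = mspace m"
  unfolding borel_of_metric_def by (simp add: space_measure_of_conv)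

lemma continuous_map_imp_borel_measurable:
  assumes F: "continuous_map (mtopology_of m) euclideanreal F"
  shows "F \<in> borel_measurable (borel_of_metric m)"
proof (rule borel_measurableI)
  fix U :: "real set" assume "open U"
  then have "openin (mtopology_of m) {x \<in> mspace m. F x \<in> U}"
    using openin_continuous_map_preimage[OF F] by simp
  moreover have "{U. openin (mtopology_of m) U} \<subseteq> Pow (mspace m)"
    using openin_subset[of "mtopology_of m"] by auto
  ultimately have "{x \<in> mspace m. F x \<in> U} \<in> sets (borel_of_metric m)"
    by (simp add: borel_of_metric_def)
  moreover have "F -` U \<inter> space (borel_of_metric m) = {x \<in> mspace m. F x \<in> U}" by auto
  ultimately show "F -` U \<inter> space (borel_of_metric m) \<in> sets (borel_of_metric m)" by simp
qed

section \<open>Lipschitz envelopes and the reduction to Lipschitz functionals\<close>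

lemma mdist_self: "x \<in> mspace m \<Longrightarrow> mdist m x x = 0"
  by (simp add: Metric_space.mdist_zero[OF Metric_space_mspace_mdist])

text \<open>The Pasch-Hausdorff envelope. With \<open>S\<close> the whole space it is the largest
  k-Lipschitz function below a \<open>\<phi>\<close> bounded from below; with \<open>\<phi>\<close>
  = 0 and \<open>k\<close> = 1 it is the distance to \<open>S\<close>. Both uses occur.\<close>

definition inf_convolution :: "'b metric \<Rightarrow> 'b set \<Rightarrow> ('b \<Rightarrow> real) \<Rightarrow> real \<Rightarrow> 'b \<Rightarrow> real" where
  "inf_convolution m S \<phi> k x = (INF y\<in>S. \<phi> y + k * mdist m x y)"

context
  fixes m :: "'b metric" and S :: "'b set" and \<phi> :: "'b \<Rightarrow> real" and B k :: real
  assumes S: "S \<subseteq> mspace m" "S \<noteq> {}" and \<phi>: "\<And>y. y \<in> S \<Longrightarrow> - B \<le> \<phi> y" and k: "0 \<le> k"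
begin

lemma inf_convolution_bdd: "bdd_below ((\<lambda>y. \<phi> y + k * mdist m x y) ` S)"
  by (intro bdd_belowI[of _ "-B"]) (use \<phi> k in \<open>auto simp: add_increasing2\<close>)

lemma inf_convolution_le: "y \<in> S \<Longrightarrow> inf_convolution m S \<phi> k x \<le> \<phi> y + k * mdist m x y"
  unfolding inf_convolution_def by (rule cINF_lower[OF inf_convolution_bdd])

lemma inf_convolution_ge: "(\<And>y. y \<in> S \<Longrightarrow> z \<le> \<phi> y + k * mdist m x y) \<Longrightarrow> z \<le> inf_convolution m S \<phi> k x"
  unfolding inf_convolution_def by (rule cINF_greatest[OF S(2)])

lemma inf_convolution_lipschitz:
  assumes "x \<in> mspace m" "x' \<in> mspace m"
  shows "\<bar>inf_convolution m S \<phi> k x - inf_convolution m S \<phi> k x'\<bar> \<le> k * mdist m x x'"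
proof -
  have *: "inf_convolution m S \<phi> k x - k * mdist m x x' \<le> inf_convolution m S \<phi> k x'"
    if "x \<in> mspace m" "x' \<in> mspace m" for x x'
  proof (rule inf_convolution_ge)
    fix y assume "y \<in> S"
    have "mdist m x y \<le> mdist m x x' + mdist m x' y"
      using that \<open>y \<in> S\<close> S by (intro mdist_triangle) auto
    then have "k * mdist m x y \<le> k * mdist m x x' + k * mdist m x' y"
      using mult_left_mono[OF _ k] by (fastforce simp: distrib_left)
    then show "inf_convolution m S \<phi> k x - k * mdist m x x' \<le> \<phi> y + k * mdist m x' y"
      using inf_convolution_le[OF \<open>y \<in> S\<close>, of x] by simp
  qed
  have "mdist m x x' = mdist m x' x" by (rule mdist_commute)
  then show ?thesis using *[OF assms] *[OF assms(2,1)] by simp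
qed

end

text \<open>Near \<open>x\<close> the values of \<open>F\<close> are at least F x - e/2 by
  continuity, and far from \<open>x\<close> the penalty exceeds the oscillation of
  \<open>F\<close>.\<close>

lemma tendsto_inf_convolution:
  assumes F: "continuous_map (mtopology_of m) euclideanreal F" and B: "\<And>y. y \<in> mspace m \<Longrightarrow> \<bar>F y\<bar> \<le> B"
    and x: "x \<in> mspace m"
  shows "(\<lambda>k. inf_convolution m (mspace m) F (real k) x) \<longlonglongrightarrow> F x"
proof (rule LIMSEQ_I)
  fix e :: real assume "0 < e"
  have ne: "mspace m \<noteq> {}" using x by auto
  have lo: "- B \<le> F y" if "y \<in> mspace m" for y using B[OF that] by linarith
  have "\<forall>a\<in>mspace m. \<forall>U. openin euclideanreal U \<and> F a \<in> U \<longrightarrow> (\<exists>r>0. \<forall>x. x \<in> mspace m \<and> mdist m a x < r \<longrightarrow> F x \<in> U)"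
    using F unfolding mtopology_of_def
    by (subst (asm) Metric_space.continuous_map_from_metric[OF Metric_space_mspace_mdist]) auto
  then have "\<exists>r>0. \<forall>y. y \<in> mspace m \<and> mdist m x y < r \<longrightarrow> F y \<in> {F x - e / 2<..}"
    using x \<open>0 < e\<close> by (elim ballE[of _ _ x] allE[of _ "{F x - e / 2<..}"]) auto
  then obtain r where r: "0 < r" "\<And>y. y \<in> mspace m \<Longrightarrow> mdist m x y < r \<Longrightarrow> F x - e / 2 < F y" by auto
  \<comment> \<open>Beyond distance \<open>r\<close> the penalty k r is then larger than 2 B, the
    greatest possible gain from changing the value of \<open>F\<close>.\<close>
  obtain k0 :: nat where k0: "2 * B / r < k0" using reals_Archimedean2 by blast
  show "\<exists>k0. \<forall>k\<ge>k0. norm (inf_convolution m (mspace m) F (real k) x - F x) < e"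
  proof (intro exI[of _ k0] allI impI)
    fix k assume "k0 \<le> k"
    then have "2 * B / r < real k" using k0 by linarith
    then have k: "2 * B < real k * r" using r by (simp add: field_simps)
    have "inf_convolution m (mspace m) F (real k) x \<le> F x + real k * mdist m x x"
      by (rule inf_convolution_le[OF _ ne lo _ x]) auto
    then have "inf_convolution m (mspace m) F (real k) x \<le> F x" using x by (simp add: mdist_self)
    moreover have "F x - e / 2 \<le> inf_convolution m (mspace m) F (real k) x"
    proof (rule inf_convolution_ge[OF _ ne lo])
      fix y assume y: "y \<in> mspace m"
      show "F x - e / 2 \<le> F y + real k * mdist m x y"
      proof (cases "mdist m x y < r")
        case True
        then show ?thesis using r(2)[OF y] by (simp add: add_increasing2)
      next
        case False
        then have "real k * r \<le> real k * mdist m x y" by (intro mult_left_mono) auto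
        then show ?thesis using k B[OF x] B[OF y] \<open>0 < e\<close> by linarith
      qed
    qed auto
    ultimately show "norm (inf_convolution m (mspace m) F (real k) x - F x) < e" using \<open>0 < e\<close> by simp
  qed
qed

text \<open>An envelope lying below \<open>F\<close> with nearly the same limit integral yields the
  lower estimate; the same for \<open>- F\<close> yields the upper one. Measurability is eventual
  because the approximating paths are known to be continuous for positive parameters.\<close>

lemma tendsto_integral_continuous_of_lipschitz:
  fixes m :: "'b metric" and Y :: "'i \<Rightarrow> 'a \<Rightarrow> 'b" and Z :: "'c \<Rightarrow> 'b" and F :: "'b \<Rightarrow> real"
  assumes M: "prob_space M" and N: "prob_space N"
    and Y: "\<forall>\<^sub>F i in \<F>. Y i \<in> measurable M (borel_of_metric m)" and Z: "Z \<in> measurable N (borel_of_metric m)"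
    and lip: "\<And>F L B. (\<And>x y. x \<in> mspace m \<Longrightarrow> y \<in> mspace m \<Longrightarrow> \<bar>F x - F y\<bar> \<le> L * mdist m x y) \<Longrightarrow> 0 \<le> L
       \<Longrightarrow> (\<And>x. x \<in> mspace m \<Longrightarrow> \<bar>F x\<bar> \<le> B) \<Longrightarrow> ((\<lambda>i. \<integral>\<omega>. F (Y i \<omega>) \<partial>M) \<longlongrightarrow> (\<integral>\<omega>. F (Z \<omega>) \<partial>N)) \<F>"
    and F: "continuous_map (mtopology_of m) euclideanreal F" and B: "\<And>x. x \<in> mspace m \<Longrightarrow> \<bar>F x\<bar> \<le> B"
  shows "((\<lambda>i. \<integral>\<omega>. F (Y i \<omega>) \<partial>M) \<longlongrightarrow> (\<integral>\<omega>. F (Z \<omega>) \<partial>N)) \<F>"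
proof -
  interpret M: prob_space M by fact
  interpret N: prob_space N by fact
  have Zm: "Z \<omega> \<in> mspace m" if "\<omega> \<in> space N" for \<omega> using measurable_space[OF Z that] by simp
  have ne: "mspace m \<noteq> {}" using Zm N.not_empty by auto
  have B0: "0 \<le> B" using B Zm N.not_empty by force
  have lower: "\<forall>\<^sub>F i in \<F>. (\<integral>\<omega>. F (Z \<omega>) \<partial>N) - e < (\<integral>\<omega>. F (Y i \<omega>) \<partial>M)"
    if "0 < e" and F: "continuous_map (mtopology_of m) euclideanreal F" and B: "\<And>x. x \<in> mspace m \<Longrightarrow> \<bar>F x\<bar> \<le> B" for e F
  proof -
    define \<Phi> where "\<Phi> k = inf_convolution m (mspace m) F (real k)" for k :: nat
    have lo: "- B \<le> F y" if "y \<in> mspace m" for y using B[OF that] by linarith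
    have \<Phi>l: "\<bar>\<Phi> k x - \<Phi> k y\<bar> \<le> real k * mdist m x y" if "x \<in> mspace m" "y \<in> mspace m" for k x y
      unfolding \<Phi>_def by (rule inf_convolution_lipschitz[OF _ ne lo]) (use that in auto)
    have \<Phi>F: "\<Phi> k x \<le> F x" if "x \<in> mspace m" for k x
    proof -
      have "\<Phi> k x \<le> F x + real k * mdist m x x"
        unfolding \<Phi>_def by (rule inf_convolution_le[OF _ ne lo _ that]) auto
      then show ?thesis using that by (simp add: mdist_self)
    qed
    have \<Phi>B: "\<bar>\<Phi> k x\<bar> \<le> B" if "x \<in> mspace m" for k x
    proof -
      have "- B \<le> \<Phi> k x" unfolding \<Phi>_def
        by (rule inf_convolution_ge[OF _ ne lo]) (use lo in \<open>auto simp: add_increasing2\<close>)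
      then show ?thesis using \<Phi>F[OF that, of k] B[OF that] by linarith
    qed
    have \<Phi>m: "\<Phi> k \<in> borel_measurable (borel_of_metric m)" for k
      by (intro continuous_map_imp_borel_measurable lipschitz_imp_continuous_map_mtopology_of[OF \<Phi>l]) auto
    have Fm: "F \<in> borel_measurable (borel_of_metric m)" by (rule continuous_map_imp_borel_measurable[OF F])
    have "(\<lambda>k. \<integral>\<omega>. \<Phi> k (Z \<omega>) \<partial>N) \<longlonglongrightarrow> (\<integral>\<omega>. F (Z \<omega>) \<partial>N)"
    proof (rule integral_dominated_convergence[where w="\<lambda>_. B"])
      show "AE \<omega> in N. (\<lambda>k. \<Phi> k (Z \<omega>)) \<longlonglongrightarrow> F (Z \<omega>)"
        unfolding \<Phi>_def using Zm by (intro AE_I2 tendsto_inf_convolution[OF F B]) auto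
      show "AE \<omega> in N. norm (\<Phi> k (Z \<omega>)) \<le> B" for k using \<Phi>B Zm by (intro AE_I2) auto
    qed (use measurable_compose[OF Z \<Phi>m] measurable_compose[OF Z Fm] in auto)
    from order_tendstoD(1)[OF this, of "(\<integral>\<omega>. F (Z \<omega>) \<partial>N) - e"] \<open>0 < e\<close>
    obtain k where k: "(\<integral>\<omega>. F (Z \<omega>) \<partial>N) - e < (\<integral>\<omega>. \<Phi> k (Z \<omega>) \<partial>N)" by (auto simp: eventually_sequentially)
    have "((\<lambda>i. \<integral>\<omega>. \<Phi> k (Y i \<omega>) \<partial>M) \<longlongrightarrow> (\<integral>\<omega>. \<Phi> k (Z \<omega>) \<partial>N)) \<F>"
      by (rule lip[OF \<Phi>l]) (use \<Phi>B in auto)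
    from order_tendstoD(1)[OF this k] Y show ?thesis
    proof eventually_elim
      case (elim i)
      have sp: "Y i \<omega> \<in> mspace m" if "\<omega> \<in> space M" for \<omega> using measurable_space[OF elim(2) that] by simp
      have "(\<integral>\<omega>. \<Phi> k (Y i \<omega>) \<partial>M) \<le> (\<integral>\<omega>. F (Y i \<omega>) \<partial>M)"
        using measurable_compose[OF elim(2) \<Phi>m] measurable_compose[OF elim(2) Fm] \<Phi>B \<Phi>F sp B
        by (intro integral_mono M.integrable_const_bound[where B=B]) auto
      with elim(1) show ?case by simp
    qed
  qed
  have Fn: "continuous_map (mtopology_of m) euclideanreal (\<lambda>x. - F x)"
    using F by (rule continuous_map_minus)
  have Bn: "\<bar>- F x\<bar> \<le> B" if "x \<in> mspace m" for x using B[OF that] by simp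
  show ?thesis
  proof (rule tendstoI)
    fix e :: real assume "0 < e"
    show "\<forall>\<^sub>F i in \<F>. dist (\<integral>\<omega>. F (Y i \<omega>) \<partial>M) (\<integral>\<omega>. F (Z \<omega>) \<partial>N) < e"
    proof -
      have "\<forall>\<^sub>F i in \<F>. (\<integral>\<omega>. F (Z \<omega>) \<partial>N) - e < (\<integral>\<omega>. F (Y i \<omega>) \<partial>M)"
        using \<open>0 < e\<close> F by (rule lower) (rule B)
      moreover have "\<forall>\<^sub>F i in \<F>. (\<integral>\<omega>. - F (Z \<omega>) \<partial>N) - e < (\<integral>\<omega>. - F (Y i \<omega>) \<partial>M)"
        using \<open>0 < e\<close> Fn by (rule lower) (rule Bn)
      ultimately show ?thesis by eventually_elim (auto simp: dist_real_def)
    qed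
  qed
qed

text \<open>The tents are the weights of linear interpolation between the values \<open>v k\<close>
  at times k T / 2^n. The restriction to \<open>{0..T}\<close> makes the result extensional, as
  points of \<open>path_space T\<close> are.\<close>

definition interp :: "real \<Rightarrow> nat \<Rightarrow> (nat \<Rightarrow> complex) \<Rightarrow> real \<Rightarrow> complex" where
  "interp T n v = (\<lambda>t\<in>{0..T}. \<Sum>k\<le>2^n. of_real (hat (2^n * t / T - real k)) * v k)"

definition grid :: "real \<Rightarrow> nat \<Rightarrow> nat \<Rightarrow> real" where
  "grid T n k = real k * T / 2^n"

lemma grid_Suc_double: "grid T (Suc n) (2 * k) = grid T n k"
  by (simp add: grid_def)

lemma grid_mem: "0 < T \<Longrightarrow> k \<le> 2^n \<Longrightarrow> grid T n k \<in> {0..T}"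
proof -
  assume "0 < T" "k \<le> 2^n"
  then have "real k \<le> 2^n" by (metis of_nat_le_iff of_nat_numeral of_nat_power)
  then show ?thesis using \<open>0 < T\<close> by (simp add: grid_def field_simps)
qed

text \<open>Boundedness, which belongs to the carrier of \<open>cfunspace\<close>, is automatic on
  the compact interval.\<close>

lemma mspace_path_space:
  "f \<in> mspace (path_space T) \<longleftrightarrow> continuous_on {0..T} f \<and> f \<in> extensional {0..T}"
  unfolding path_space_def
  by (subst compactin_mspace_cfunspace) (auto simp: compactin_subtopology)

lemma restrict_mem_path_space:
  "(\<lambda>t\<in>{0..T}. y t) \<in> mspace (path_space T) \<longleftrightarrow> continuous_on {0..T} y"
proof -
  have "continuous_on {0..T} (\<lambda>t\<in>{0..T}. y t) = continuous_on {0..T} y"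
    by (rule continuous_on_cong) auto
  then show ?thesis by (simp only: mspace_path_space restrict_extensional simp_thms)
qed

lemma mdist_path_space_le_iff:
  assumes "0 < T" "f \<in> mspace (path_space T)" "g \<in> mspace (path_space T)"
  shows "mdist (path_space T) f g \<le> a \<longleftrightarrow> (\<forall>t\<in>{0..T}. cmod (f t - g t) \<le> a)"
  using assms unfolding path_space_def
  by (subst cfunspace_mdist_le) (auto simp: dist_norm)

lemma sum_hat_nat:
  assumes "0 < T" "t \<in> {0..T}"
  shows "(\<Sum>k\<le>2^n. hat (2^n * t / T - real k)) = 1"
proof -
  let ?x = "2^n * t / T"
  have x: "0 \<le> ?x" "?x \<le> real (2^n)" using assms by (auto simp: field_simps)
  have "(\<Sum>k\<le>2^n. hat (?x - real k)) = (\<Sum>k\<in>int ` {..2^n}. hat (?x - of_int k))"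
    by (subst sum.reindex) auto
  also have "\<dots> = 1"
  proof (rule sum_hat_eq_1)
    have *: "z \<in> int ` {..2^n}" if "0 \<le> z" "z \<le> int (2^n)" for z
      using that by (intro image_eqI[of _ _ "nat z"]) auto
    show "\<lfloor>?x\<rfloor> \<in> int ` {..2^n}" using x by (intro *) linarith+
    show "\<lceil>?x\<rceil> \<in> int ` {..2^n}" using x by (intro *) linarith+
  qed auto
  finally show ?thesis .
qed

text \<open>An interpolated value is a convex combination of the values at grid points less than one
  mesh away. Every estimate for interpolations is drawn from this.\<close>

lemma norm_interp_diff_le:
  assumes "0 < T" "t \<in> {0..T}"
    and near: "\<And>k. k \<le> 2^n \<Longrightarrow> \<bar>2^n * t / T - real k\<bar> < 1 \<Longrightarrow> cmod (v k - z) \<le> D"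
  shows "cmod (interp T n v t - z) \<le> D"
proof -
  let ?h = "\<lambda>k. hat (2^n * t / T - real k)"
  have "interp T n v t - z = (\<Sum>k\<le>2^n. of_real (?h k) * v k) - (\<Sum>k\<le>2^n. of_real (?h k)) * z"
    using assms sum_hat_nat[of T t n] by (simp add: interp_def of_real_sum[symmetric] del: of_real_sum)
  also have "\<dots> = (\<Sum>k\<le>2^n. of_real (?h k) * (v k - z))"
    by (simp add: right_diff_distrib sum_subtractf sum_distrib_right)
  also have "cmod \<dots> \<le> (\<Sum>k\<le>2^n. ?h k * D)"
  proof (rule sum_norm_le)
    fix k :: nat assume k: "k \<in> {..2^n}"
    show "cmod (of_real (?h k) * (v k - z)) \<le> ?h k * D"
    proof (cases "\<bar>2^n * t / T - real k\<bar> < 1")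
      case True
      then show ?thesis using near[OF _ True] k hat_nonneg[of "2^n * t / T - real k"]
        by (auto simp: norm_mult intro: mult_left_mono)
    next
      case False
      then show ?thesis by (simp add: hat_eq_0)
    qed
  qed
  also have "\<dots> = D" using sum_hat_nat[OF assms(1,2), of n] by (simp add: sum_distrib_right[symmetric])
  finally show ?thesis .
qed

lemma interp_mem: "interp T n v \<in> mspace (path_space T)"
  unfolding interp_def restrict_mem_path_space divide_inverse by (intro continuous_intros)

lemma mdist_interp_le:
  assumes "0 < T"
  shows "mdist (path_space T) (interp T n v) (interp T n w) \<le> (\<Sum>k\<le>2^n. cmod (v k - w k))"
  unfolding mdist_path_space_le_iff[OF assms interp_mem interp_mem]
proof
  fix t assume "t \<in> {0..T}"
  have "interp T n v t - interp T n w t = (\<Sum>k\<le>2^n. of_real (hat (2^n * t / T - real k)) * (v k - w k))"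
    using \<open>t \<in> {0..T}\<close> by (simp add: interp_def right_diff_distrib sum_subtractf)
  also have "cmod \<dots> \<le> (\<Sum>k\<le>2^n. cmod (v k - w k))"
    by (rule sum_norm_le) (auto simp: norm_mult hat_nonneg intro!: mult_left_le_one_le hat_le_1)
  finally show "cmod (interp T n v t - interp T n w t) \<le> (\<Sum>k\<le>2^n. cmod (v k - w k))" .
qed

lemma norm_diff_le_steps:
  fixes v :: "nat \<Rightarrow> 'b::real_normed_vector"
  assumes "\<And>k. k < N \<Longrightarrow> norm (v (Suc k) - v k) \<le> D" "i + d \<le> N"
  shows "norm (v (i + d) - v i) \<le> real d * D"
  using assms(2)
proof (induction d)
  case (Suc d)
  have "norm (v (i + Suc d) - v i) \<le> norm (v (Suc (i + d)) - v (i + d)) + norm (v (i + d) - v i)"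
    using norm_triangle_ineq[of "v (Suc (i + d)) - v (i + d)" "v (i + d) - v i"] by simp
  also have "\<dots> \<le> D + real d * D" using Suc assms(1)[of "i + d"] by (intro add_mono) auto
  finally show ?case by (simp add: algebra_simps)
qed simp

text \<open>Both interpolated values are convex combinations of grid values near \<open>t\<close>,
  and any two of the grid points involved are at most two steps of the finer grid apart; hence the
  factor 2.\<close>

lemma norm_interp_step:
  assumes "0 < T" "t \<in> {0..T}" "\<And>k. k \<le> 2^n \<Longrightarrow> w (2 * k) = v k"
    and D: "\<And>k. k < 2^Suc n \<Longrightarrow> cmod (w (Suc k) - w k) \<le> D"
  shows "cmod (interp T n v t - interp T (Suc n) w t) \<le> 2 * D"
proof (rule norm_interp_diff_le[OF assms(1,2)])
  fix k :: nat assume k: "k \<le> 2^n" "\<bar>2^n * t / T - real k\<bar> < 1"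
  have D0: "0 \<le> D" using order_trans[OF norm_ge_zero D[of 0]] by simp
  have "cmod (interp T (Suc n) w t - v k) \<le> 2 * D"
  proof (rule norm_interp_diff_le[OF assms(1,2)])
    fix j :: nat assume j: "j \<le> 2^Suc n" "\<bar>2^Suc n * t / T - real j\<bar> < 1"
    have "2^Suc n * t / T = 2 * (2^n * t / T)" by simp
    \<comment> \<open>Twice the coarse distance plus the fine distance is less than 3; for integers
      this leaves a gap of at most 2.\<close>
    then have "\<bar>real j - 2 * real k\<bar> < 3" using k(2) j(2) by linarith
    then have jk: "j < 2 * k + 3" "2 * k < j + 3" by linarith+
    have k2: "2 * k \<le> 2^Suc n" using k(1) by simp
    show "cmod (w j - v k) \<le> 2 * D"
    proof (cases "2 * k \<le> j")
      case True
      then obtain d where d: "j = 2 * k + d" using le_Suc_ex by blast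
      have "cmod (w (2 * k + d) - w (2 * k)) \<le> real d * D"
        using j(1) d by (intro norm_diff_le_steps[where N="2^Suc n" and v=w] D) auto
      also have "\<dots> \<le> 2 * D" using jk d D0 by (intro mult_right_mono) auto
      finally show ?thesis using assms(3)[OF k(1)] d by simp
    next
      case False
      then obtain d where d: "2 * k = j + d" using le_Suc_ex nat_le_linear by blast
      have "cmod (w (j + d) - w j) \<le> real d * D"
        using k2 d by (intro norm_diff_le_steps[where N="2^Suc n" and v=w] D) auto
      also have "\<dots> \<le> 2 * D" using jk d D0 by (intro mult_right_mono) auto
      finally show ?thesis using assms(3)[OF k(1)] d by (simp add: norm_minus_commute)
    qed
  qed
  then show "cmod (v k - interp T (Suc n) w t) \<le> 2 * D" by (simp add: norm_minus_commute)
qed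

lemma interp_uniform_approx:
  assumes "0 < T" "continuous_on {0..T} y" "0 < e"
  shows "\<exists>n0. \<forall>n\<ge>n0. \<forall>t\<in>{0..T}. cmod (interp T n (\<lambda>k. y (grid T n k)) t - y t) \<le> e"
proof -
  have "uniformly_continuous_on {0..T} y"
    using assms(2) by (intro compact_uniformly_continuous) auto
  then obtain d where d: "0 < d" "\<And>s t. s \<in> {0..T} \<Longrightarrow> t \<in> {0..T} \<Longrightarrow> dist s t < d \<Longrightarrow> dist (y s) (y t) < e"
    using \<open>0 < e\<close> unfolding uniformly_continuous_on_def by metis
  obtain n0 :: nat where n0: "T / d < 2^n0" using real_arch_pow[of 2 "T/d"] by auto
  show ?thesis
  proof (intro exI[of _ n0] allI impI ballI norm_interp_diff_le[OF \<open>0 < T\<close>])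
    fix n k :: nat and t assume n: "n0 \<le> n" and t: "t \<in> {0..T}" and k: "k \<le> 2^n" "\<bar>2^n * t / T - real k\<bar> < 1"
    have "T / d < 2^n" using n0 power_increasing[OF n, of "2::real"] by linarith
    then have "T < d * 2^n" using d by (simp add: field_simps)
    moreover have "\<bar>grid T n k - t\<bar> = T / 2^n * \<bar>2^n * t / T - real k\<bar>"
    proof -
      have "t - grid T n k = T / 2^n * (2^n * t / T - real k)"
        using \<open>0 < T\<close> by (simp add: grid_def field_simps)
      then show ?thesis using \<open>0 < T\<close> by (simp add: abs_mult abs_minus_commute)
    qed
    moreover have "T / 2^n * \<bar>2^n * t / T - real k\<bar> \<le> T / 2^n * 1" using k(2) \<open>0 < T\<close> by (intro mult_left_mono) auto
    moreover have "T / 2^n < d" using calculation(1) by (simp add: field_simps)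
    ultimately have "dist (grid T n k) t < d" unfolding dist_real_def by linarith
    then show "cmod (y (grid T n k) - y t) \<le> e"
      using d(2)[OF grid_mem[OF \<open>0 < T\<close> k(1)] t] by (simp add: dist_norm)
  qed
qed

text \<open>The Lipschitz bound makes \<open>f\<close> continuous for the product topology and blind
  to coordinates outside \<open>I\<close>. With countably many coordinates, measurability into the
  product can be checked coordinatewise.\<close>

lemma measurable_lipschitz_coordinates:
  fixes f :: "('i::countable \<Rightarrow> 'b::{real_normed_vector, second_countable_topology}) \<Rightarrow> real"
  assumes I: "finite I" and V: "\<And>i. i \<in> I \<Longrightarrow> V i \<in> borel_measurable M"
    and L: "\<And>v w. \<bar>f v - f w\<bar> \<le> L * (\<Sum>i\<in>I. norm (v i - w i))"
  shows "(\<lambda>\<omega>. f (\<lambda>i. V i \<omega>)) \<in> borel_measurable M"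
proof -
  have "(f \<longlongrightarrow> f v) (at v)" for v
  proof (rule LIM_zero_cancel, rule Lim_null_comparison[where g="\<lambda>w. L * (\<Sum>i\<in>I. norm (w i - v i))"])
    show "\<forall>\<^sub>F w in at v. norm (f w - f v) \<le> L * (\<Sum>i\<in>I. norm (w i - v i))"
      using L by (intro always_eventually) auto
    have "continuous_on UNIV (\<lambda>w. L * (\<Sum>i\<in>I. norm (w i - v i)))"
      by (intro continuous_intros continuous_on_product_coordinates)
    then have "((\<lambda>w. L * (\<Sum>i\<in>I. norm (w i - v i))) \<longlongrightarrow> L * (\<Sum>i\<in>I. norm (v i - v i))) (at v)"
      unfolding continuous_on_def by blast
    then show "((\<lambda>w. L * (\<Sum>i\<in>I. norm (w i - v i))) \<longlongrightarrow> 0) (at v)" by simp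
  qed
  then have "continuous_on UNIV f" by (simp add: continuous_on_def)
  then have fm: "f \<in> borel_measurable borel" by (rule borel_measurable_continuous_onI)
  \<comment> \<open>Coordinates outside \<open>I\<close> are filled with 0, which \<open>f\<close>
    does not notice.\<close>
  have "(\<lambda>\<omega> i. if i \<in> I then V i \<omega> else 0) \<in> borel_measurable M"
  proof (rule measurable_coordinatewise_then_product)
    show "(\<lambda>\<omega>. if i \<in> I then V i \<omega> else 0) \<in> borel_measurable M" for i
      using V by (cases "i \<in> I") auto
  qed
  from measurable_compose[OF this fm]
  have "(\<lambda>\<omega>. f (\<lambda>i. if i \<in> I then V i \<omega> else 0)) \<in> borel_measurable M" .
  moreover have "f (\<lambda>i. if i \<in> I then V i \<omega> else 0) = f (\<lambda>i. V i \<omega>)" for \<omega>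
    using L[of "\<lambda>i. if i \<in> I then V i \<omega> else 0" "\<lambda>i. V i \<omega>"] by simp
  ultimately show ?thesis by simp
qed

lemma lipschitz_interp:
  assumes "0 < T" and F: "\<And>x y. x \<in> mspace (path_space T) \<Longrightarrow> y \<in> mspace (path_space T) \<Longrightarrow> \<bar>F x - F y\<bar> \<le> L * mdist (path_space T) x y"
    and "0 \<le> L"
  shows "\<bar>F (interp T n v) - F (interp T n w)\<bar> \<le> L * (\<Sum>k\<le>2^n. cmod (v k - w k))"
  using F[OF interp_mem interp_mem, of n v n w] mult_left_mono[OF mdist_interp_le[OF assms(1), of n v w] \<open>0 \<le> L\<close>] by linarith

lemma measurable_interp:
  assumes "0 < T" and F: "\<And>x y. x \<in> mspace (path_space T) \<Longrightarrow> y \<in> mspace (path_space T) \<Longrightarrow> \<bar>F x - F y\<bar> \<le> L * mdist (path_space T) x y"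
    and "0 \<le> L" and "\<And>k. k \<le> 2^n \<Longrightarrow> V k \<in> borel_measurable M"
  shows "(\<lambda>\<omega>. F (interp T n (\<lambda>k. V k \<omega>))) \<in> borel_measurable M"
  by (rule measurable_lipschitz_coordinates[where I="{..2^n}" and f="\<lambda>v. F (interp T n v)", OF _ _ lipschitz_interp[OF assms(1) F assms(3)]])
     (use assms(4) in auto)

lemma tendsto_lipschitz_interp:
  assumes "0 < T" and F: "\<And>x y. x \<in> mspace (path_space T) \<Longrightarrow> y \<in> mspace (path_space T) \<Longrightarrow> \<bar>F x - F y\<bar> \<le> L * mdist (path_space T) x y"
    and "0 \<le> L" and y: "continuous_on {0..T} y"
  shows "(\<lambda>n. F (interp T n (\<lambda>k. y (grid T n k)))) \<longlonglongrightarrow> F (\<lambda>t\<in>{0..T}. y t)"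
proof (rule LIMSEQ_I)
  fix e :: real assume "0 < e"
  have ym: "(\<lambda>t\<in>{0..T}. y t) \<in> mspace (path_space T)"
    using y by (simp add: restrict_mem_path_space)
  have e': "0 < e / (2 * (L + 1))" using \<open>0 < e\<close> \<open>0 \<le> L\<close> by simp
  from interp_uniform_approx[OF \<open>0 < T\<close> y this] obtain n0 where n0: "\<And>n t. n0 \<le> n \<Longrightarrow> t \<in> {0..T} \<Longrightarrow>
    cmod (interp T n (\<lambda>k. y (grid T n k)) t - y t) \<le> e / (2 * (L + 1))" by blast
  show "\<exists>n0. \<forall>n\<ge>n0. norm (F (interp T n (\<lambda>k. y (grid T n k))) - F (\<lambda>t\<in>{0..T}. y t)) < e"
  proof (intro exI[of _ n0] allI impI)
    fix n assume n: "n0 \<le> n"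
    have "mdist (path_space T) (interp T n (\<lambda>k. y (grid T n k))) (\<lambda>t\<in>{0..T}. y t) \<le> e / (2 * (L + 1))"
      using n0[OF n] by (subst mdist_path_space_le_iff[OF \<open>0 < T\<close> interp_mem ym]) auto
    then have "L * mdist (path_space T) (interp T n (\<lambda>k. y (grid T n k))) (\<lambda>t\<in>{0..T}. y t) \<le> L * (e / (2 * (L + 1)))"
      using \<open>0 \<le> L\<close> by (rule mult_left_mono)
    also have "\<dots> < e" using \<open>0 < e\<close> \<open>0 \<le> L\<close> by (simp add: field_simps) (smt (verit) mult_nonneg_nonneg)
    finally show "norm (F (interp T n (\<lambda>k. y (grid T n k))) - F (\<lambda>t\<in>{0..T}. y t)) < e"
      using F[OF interp_mem ym, of n "\<lambda>k. y (grid T n k)"] by simp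
  qed
qed

text \<open>An open set is where the distance to its complement is positive. This distance is a
  Lipschitz functional, so along a continuous path it is the limit of its values at dyadic
  interpolations, each of which depends on finitely many times.\<close>

lemma measurable_path:
  assumes "0 < T" and Y: "\<And>t. t \<in> {0..T} \<Longrightarrow> Y t \<in> borel_measurable M"
    and cont: "\<And>\<omega>. \<omega> \<in> space M \<Longrightarrow> continuous_on {0..T} (\<lambda>t. Y t \<omega>)"
  shows "(\<lambda>\<omega>. \<lambda>t\<in>{0..T}. Y t \<omega>) \<in> measurable M (borel_of_metric (path_space T))"
  unfolding borel_of_metric_def
proof (rule measurable_measure_of)
  let ?m = "path_space T" and ?Y = "\<lambda>\<omega>. \<lambda>t\<in>{0..T}. Y t \<omega>"
  show "{U. openin (mtopology_of ?m) U} \<subseteq> Pow (mspace ?m)"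
    using openin_subset[of "mtopology_of ?m"] by auto
  show *: "?Y \<in> space M \<rightarrow> mspace ?m"
    using cont restrict_mem_path_space by blast
  fix U assume U: "U \<in> {U. openin (mtopology_of ?m) U}"
  show "?Y -` U \<inter> space M \<in> sets M"
  proof (cases "mspace ?m - U = {}")
    case True
    then have "?Y -` U \<inter> space M = space M" using * by auto
    then show ?thesis by simp
  next
    case False
    \<comment> \<open>The distance to the complement of \<open>U\<close>; the case of an empty
      complement has been separated, since the infimum would range over nothing.\<close>
    define d where "d = inf_convolution ?m (mspace ?m - U) (\<lambda>_. 0) 1"
    have sub: "mspace ?m - U \<subseteq> mspace ?m" by auto
    have dl: "\<bar>d x - d y\<bar> \<le> 1 * mdist ?m x y" if "x \<in> mspace ?m" "y \<in> mspace ?m" for x y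
      unfolding d_def by (rule inf_convolution_lipschitz[OF sub False, of 0]) (use that in auto)
    have pos: "0 < d x \<longleftrightarrow> x \<in> U" if x: "x \<in> mspace ?m" for x
    proof
      assume "x \<in> U"
      then have "\<exists>r>0. mball_of ?m x r \<subseteq> U"
        using U by (simp add: mtopology_of_def mball_of_def Metric_space.openin_mtopology[OF Metric_space_mspace_mdist])
      then obtain r where r: "0 < r" "mball_of ?m x r \<subseteq> U" by blast
      have "r \<le> d x" unfolding d_def
      proof (rule inf_convolution_ge[OF sub False, of 0])
        fix y assume "y \<in> mspace ?m - U"
        then have "y \<notin> mball_of ?m x r" "y \<in> mspace ?m" using r(2) by auto
        then show "r \<le> 0 + 1 * mdist ?m x y" using x by (simp add: not_less)
      qed auto
      with r show "0 < d x" by simp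
    next
      assume "0 < d x"
      show "x \<in> U"
      proof (rule ccontr)
        assume "x \<notin> U"
        then have "d x \<le> 0 + 1 * mdist ?m x x"
          unfolding d_def by (intro inf_convolution_le[OF sub False, of 0]) (use x in auto)
        with \<open>0 < d x\<close> x show False by (simp add: mdist_self)
      qed
    qed
    have "(\<lambda>\<omega>. d (?Y \<omega>)) \<in> borel_measurable M"
    proof (rule borel_measurable_LIMSEQ_real)
      show "(\<lambda>n. d (interp T n (\<lambda>k. Y (grid T n k) \<omega>))) \<longlonglongrightarrow> d (?Y \<omega>)" if "\<omega> \<in> space M" for \<omega>
        by (rule tendsto_lipschitz_interp[OF \<open>0 < T\<close> dl _ cont[OF that]]) auto
      show "(\<lambda>\<omega>. d (interp T n (\<lambda>k. Y (grid T n k) \<omega>))) \<in> borel_measurable M" for n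
        by (rule measurable_interp[OF \<open>0 < T\<close> dl]) (use Y grid_mem[OF \<open>0 < T\<close>] in auto)
    qed
    then have "{\<omega> \<in> space M. 0 < d (?Y \<omega>)} \<in> sets M" by measurable
    moreover have "?Y -` U \<inter> space M = {\<omega> \<in> space M. 0 < d (?Y \<omega>)}"
      using pos * by (auto simp: Pi_iff)
    ultimately show ?thesis by simp
  qed
qed


section \<open>Chaining along dyadic grids\<close>

lemma interp_grid:
  assumes "0 < T" "k \<le> 2^n"
  shows "interp T n v (grid T n k) = v k"
proof -
  have "cmod (interp T n v (grid T n k) - v k) \<le> 0"
  proof (rule norm_interp_diff_le[OF assms(1) grid_mem[OF assms]])
    fix j :: nat assume "\<bar>2 ^ n * grid T n k / T - real j\<bar> < 1"
    then have "j = k" using assms(1) by (simp add: grid_def)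
    then show "cmod (v j - v k) \<le> 0" by simp
  qed
  then show ?thesis by simp
qed

text \<open>The number 2^(-1/4). The 2^n fourth moments of level n add up to at most C / 2^n = C
  q^(4n) for this ratio q, and dividing by q^(3n) leaves C q^n, a summable series.\<close>

definition chain_ratio :: real where
  "chain_ratio = root 4 (1/2)"

lemma chain_ratio: "0 < chain_ratio" "chain_ratio < 1" "chain_ratio ^ 4 = 1/2"
  unfolding chain_ratio_def by (auto intro: real_root_pow_pos2)

text \<open>Kolmogorov's moment condition in dyadic form: \<open>V n k\<close> is the value at the
  k-th point of level \<open>n\<close>, and C / 4^n is of the order of the squared mesh. The scaled
  processes and the Levy construction are both instances, so one chaining argument serves
  both.\<close>

locale dyadic_process = prob_space M for M :: "'a measure" +
  fixes V :: "nat \<Rightarrow> nat \<Rightarrow> 'a \<Rightarrow> complex" and C T :: real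
  assumes T_pos: "0 < T"
    and refine: "\<And>n k \<omega>. k \<le> 2^n \<Longrightarrow> V (Suc n) (2 * k) \<omega> = V n k \<omega>"
    and measurable_V: "\<And>n k. k \<le> 2^n \<Longrightarrow> V n k \<in> borel_measurable M"
    and integrable_fourth: "\<And>n k. k < 2^n \<Longrightarrow> integrable M (\<lambda>\<omega>. cmod (V n (Suc k) \<omega> - V n k \<omega>) ^ 4)"
    and fourth_moment: "\<And>n k. k < 2^n \<Longrightarrow> (\<integral>\<omega>. cmod (V n (Suc k) \<omega> - V n k \<omega>) ^ 4 \<partial>M) \<le> C / 4^n"
begin

text \<open>For \<open>x, \<delta> > 0\<close> one has \<open>x \<le> \<delta> + x\<^sup>4 / \<delta>\<^sup>3\<close>, so \<open>osc n\<close> dominates every increment of level \<open>n\<close>.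
  The choice \<open>\<delta> = chain_ratio ^ n\<close> balances the two terms.\<close>

definition osc :: "nat \<Rightarrow> 'a \<Rightarrow> real" where
  "osc n \<omega> = chain_ratio ^ n + (\<Sum>k<2^n. cmod (V n (Suc k) \<omega> - V n k \<omega>) ^ 4) / (chain_ratio ^ n) ^ 3"

lemma osc_nonneg: "0 \<le> osc n \<omega>"
  using chain_ratio(1) unfolding osc_def by (intro add_nonneg_nonneg divide_nonneg_nonneg sum_nonneg) auto

lemma increment_le_osc:
  assumes "k < 2^n"
  shows "cmod (V n (Suc k) \<omega> - V n k \<omega>) \<le> osc n \<omega>"
proof -
  let ?x = "cmod (V n (Suc k) \<omega> - V n k \<omega>)" and ?d = "chain_ratio ^ n"
  have d: "0 < ?d" using chain_ratio(1) by simp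
  have "?x \<le> ?d + ?x ^ 4 / ?d ^ 3"
  proof (cases "?x \<le> ?d")
    case True
    then show ?thesis using d by (simp add: add_increasing2)
  next
    case False
    then have "?d ^ 3 * ?x \<le> ?x ^ 3 * ?x" using d by (intro mult_right_mono power_mono) auto
    then have "?x \<le> ?x ^ 4 / ?d ^ 3" using d by (simp add: field_simps eval_nat_numeral)
    then show ?thesis using d by simp
  qed
  also have "?x ^ 4 \<le> (\<Sum>k<2^n. cmod (V n (Suc k) \<omega> - V n k \<omega>) ^ 4)"
    using assms by (intro member_le_sum[of k "{..<2^n}" "\<lambda>k. cmod (V n (Suc k) \<omega> - V n k \<omega>) ^ 4"]) auto
  finally show ?thesis using d unfolding osc_def by (simp add: divide_right_mono)
qed

lemma integrable_osc: "integrable M (osc n)"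
  unfolding osc_def[abs_def] using integrable_fourth
  by (intro Bochner_Integration.integrable_add integrable_divide Bochner_Integration.integrable_sum) auto

lemma C_nonneg: "0 \<le> C"
proof -
  have "0 \<le> (\<integral>\<omega>. cmod (V 0 (Suc 0) \<omega> - V 0 0 \<omega>) ^ 4 \<partial>M)" by (rule Bochner_Integration.integral_nonneg) simp
  also have "\<dots> \<le> C" using fourth_moment[of 0 0] by simp
  finally show ?thesis .
qed

lemma expectation_osc_le: "expectation (osc n) \<le> (1 + C) * chain_ratio ^ n"
proof -
  let ?d = "chain_ratio ^ n"
  have d: "0 < ?d" using chain_ratio(1) by simp
  have d4: "?d ^ 4 = 1 / 2^n"
  proof -
    have "?d ^ 4 = (chain_ratio ^ 4) ^ n" by (simp only: power_mult[symmetric] mult.commute)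
    also have "\<dots> = 1 / 2^n" by (simp only: chain_ratio(3) power_one_over)
    finally show ?thesis .
  qed
  have "expectation (osc n) = ?d + (\<Sum>k<2^n. \<integral>\<omega>. cmod (V n (Suc k) \<omega> - V n k \<omega>) ^ 4 \<partial>M) / ?d ^ 3"
    unfolding osc_def using integrable_fourth prob_space
    by (subst Bochner_Integration.integral_add)
       (auto simp: Bochner_Integration.integral_sum intro!: Bochner_Integration.integrable_sum)
  also have "\<dots> \<le> ?d + (\<Sum>k<(2::nat)^n. C / 4^n) / ?d ^ 3"
    using d fourth_moment by (intro add_left_mono divide_right_mono sum_mono) auto
  also have "(\<Sum>k<(2::nat)^n. C / 4^n) = C * ?d ^ 4"
    by (simp add: d4 power_mult_distrib[symmetric] field_simps)
  also have "C * ?d ^ 4 / ?d ^ 3 = C * ?d" using d by (simp add: eval_nat_numeral)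
  finally show ?thesis by (simp add: algebra_simps)
qed

lemma norm_interp_Suc_le:
  assumes "t \<in> {0..T}"
  shows "cmod (interp T n (\<lambda>k. V n k \<omega>) t - interp T (Suc n) (\<lambda>k. V (Suc n) k \<omega>) t) \<le> 2 * osc (Suc n) \<omega>"
  by (rule norm_interp_step[OF T_pos assms]) (use refine increment_le_osc in auto)

context
  fixes F :: "(real \<Rightarrow> complex) \<Rightarrow> real" and L B :: real
  assumes F: "\<And>x y. x \<in> mspace (path_space T) \<Longrightarrow> y \<in> mspace (path_space T) \<Longrightarrow> \<bar>F x - F y\<bar> \<le> L * mdist (path_space T) x y"
    and L: "0 \<le> L" and B: "\<And>x. x \<in> mspace (path_space T) \<Longrightarrow> \<bar>F x\<bar> \<le> B"
begin

lemma integrable_F_interp: "integrable M (\<lambda>\<omega>. F (interp T n (\<lambda>k. V n k \<omega>)))"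
  using measurable_interp[OF T_pos F L measurable_V] B[OF interp_mem]
  by (intro integrable_const_bound[where B=B]) auto

text \<open>The bound is a difference of powers so that successive steps telescope: q^(n+d) equals
  (q^(n+d) - q^(n+d+1)) / (1 - q). Each step is controlled by the expected oscillation of the finer
  level.\<close>

lemma expectation_interp_chain:
  "\<bar>(\<integral>\<omega>. F (interp T (n + d) (\<lambda>k. V (n + d) k \<omega>)) \<partial>M) - (\<integral>\<omega>. F (interp T n (\<lambda>k. V n k \<omega>)) \<partial>M)\<bar>
    \<le> 2 * L * (1 + C) / (1 - chain_ratio) * (chain_ratio ^ n - chain_ratio ^ (n + d))"
proof (induction d)
  case (Suc d)
  let ?E = "\<lambda>n. \<integral>\<omega>. F (interp T n (\<lambda>k. V n k \<omega>)) \<partial>M" and ?q = chain_ratio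
  have "\<bar>?E (Suc (n + d)) - ?E (n + d)\<bar>
      = \<bar>\<integral>\<omega>. F (interp T (Suc (n + d)) (\<lambda>k. V (Suc (n + d)) k \<omega>)) - F (interp T (n + d) (\<lambda>k. V (n + d) k \<omega>)) \<partial>M\<bar>"
    using integrable_F_interp by simp
  also have "\<dots> \<le> (\<integral>\<omega>. L * (2 * osc (Suc (n + d)) \<omega>) \<partial>M)"
    unfolding real_norm_def[symmetric]
  proof (rule norm_integral_le_integral)
    fix \<omega>
    have "mdist (path_space T) (interp T (Suc (n + d)) (\<lambda>k. V (Suc (n + d)) k \<omega>)) (interp T (n + d) (\<lambda>k. V (n + d) k \<omega>)) \<le> 2 * osc (Suc (n + d)) \<omega>"
      using norm_interp_Suc_le[of _ "n + d" \<omega>]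
      by (subst mdist_path_space_le_iff[OF T_pos interp_mem interp_mem]) (auto simp: norm_minus_commute)
    then show "norm (F (interp T (Suc (n + d)) (\<lambda>k. V (Suc (n + d)) k \<omega>)) - F (interp T (n + d) (\<lambda>k. V (n + d) k \<omega>)))
       \<le> L * (2 * osc (Suc (n + d)) \<omega>)"
      using F[OF interp_mem interp_mem] mult_left_mono[OF _ L] by (metis order_trans real_norm_def)
  qed (use integrable_osc in auto)
  also have "\<dots> \<le> L * (2 * ((1 + C) * ?q ^ Suc (n + d)))"
    using expectation_osc_le[of "Suc (n + d)"] L by (simp add: mult_left_mono)
  also have "\<dots> \<le> L * (2 * ((1 + C) * ?q ^ (n + d)))"
    using L C_nonneg chain_ratio by (intro mult_left_mono) (auto simp: mult_left_le_one_le)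
  also have "\<dots> = 2 * L * (1 + C) / (1 - ?q) * (?q ^ (n + d) - ?q ^ (n + Suc d))"
    using chain_ratio(2) by (simp add: field_simps)
  finally have "\<bar>?E (n + Suc d) - ?E (n + d)\<bar> \<le> 2 * L * (1 + C) / (1 - ?q) * (?q ^ (n + d) - ?q ^ (n + Suc d))" by simp
  with Suc.IH have "\<bar>?E (n + Suc d) - ?E n\<bar> \<le> 2 * L * (1 + C) / (1 - ?q) * (?q ^ (n + d) - ?q ^ (n + Suc d))
     + 2 * L * (1 + C) / (1 - ?q) * (?q ^ n - ?q ^ (n + d))" by linarith
  then show ?case by (simp only: distrib_left[symmetric]) simp
qed simp

text \<open>Let \<open>d\<close> tend to infinity in the chain: interpolations of a continuous path
  converge to it. The bound depends on \<open>L\<close>, \<open>C\<close> and \<open>n\<close> only,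
  hence is uniform over a family of processes sharing \<open>C\<close>. Agreement on the grid is
  almost sure, which is all a limit of interpolations provides.\<close>

lemma expectation_path_interp:
  assumes Y: "\<And>t. t \<in> {0..T} \<Longrightarrow> Y t \<in> borel_measurable M"
    and cont: "\<And>\<omega>. \<omega> \<in> space M \<Longrightarrow> continuous_on {0..T} (\<lambda>t. Y t \<omega>)"
    and V: "AE \<omega> in M. \<forall>n. \<forall>k\<le>2^n. V n k \<omega> = Y (grid T n k) \<omega>"
  shows "\<bar>(\<integral>\<omega>. F (\<lambda>t\<in>{0..T}. Y t \<omega>) \<partial>M) - (\<integral>\<omega>. F (interp T n (\<lambda>k. V n k \<omega>)) \<partial>M)\<bar>
    \<le> 2 * L * (1 + C) / (1 - chain_ratio) * chain_ratio ^ n"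
proof -
  let ?K = "2 * L * (1 + C) / (1 - chain_ratio)"
  have K: "0 \<le> ?K" using L C_nonneg chain_ratio by simp
  have icong: "interp T n v = interp T n w" if "\<And>k. k \<le> 2^n \<Longrightarrow> v k = w k" for n v w
    unfolding interp_def using that by (intro restrict_ext sum.cong) auto
  have Fm: "(\<lambda>\<omega>. F (\<lambda>t\<in>{0..T}. Y t \<omega>)) \<in> borel_measurable M"
    by (rule measurable_compose[OF measurable_path[OF T_pos Y cont]
          continuous_map_imp_borel_measurable[OF lipschitz_imp_continuous_map_mtopology_of[OF F L]]])
  have "(\<lambda>m. \<integral>\<omega>. F (interp T m (\<lambda>k. V m k \<omega>)) \<partial>M) \<longlonglongrightarrow> (\<integral>\<omega>. F (\<lambda>t\<in>{0..T}. Y t \<omega>) \<partial>M)"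
  proof (rule integral_dominated_convergence[where w="\<lambda>_. B"])
    show "AE \<omega> in M. (\<lambda>m. F (interp T m (\<lambda>k. V m k \<omega>))) \<longlonglongrightarrow> F (\<lambda>t\<in>{0..T}. Y t \<omega>)"
      using V AE_space
    proof eventually_elim
      case (elim \<omega>)
      have "interp T m (\<lambda>k. V m k \<omega>) = interp T m (\<lambda>k. Y (grid T m k) \<omega>)" for m
        using elim(1) by (intro icong) auto
      then show ?case using tendsto_lipschitz_interp[OF T_pos F L cont[OF elim(2)]] by simp
    qed
  qed (use Fm integrable_F_interp B[OF interp_mem] in auto)
  then have "(\<lambda>d. \<bar>(\<integral>\<omega>. F (interp T (d + n) (\<lambda>k. V (d + n) k \<omega>)) \<partial>M) - (\<integral>\<omega>. F (interp T n (\<lambda>k. V n k \<omega>)) \<partial>M)\<bar>)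
     \<longlonglongrightarrow> \<bar>(\<integral>\<omega>. F (\<lambda>t\<in>{0..T}. Y t \<omega>) \<partial>M) - (\<integral>\<omega>. F (interp T n (\<lambda>k. V n k \<omega>)) \<partial>M)\<bar>"
    by (intro tendsto_intros LIMSEQ_ignore_initial_segment)
  then show ?thesis
  proof (rule LIMSEQ_le_const2, intro exI[of _ 0] allI impI)
    fix d
    have "?K * (chain_ratio ^ n - chain_ratio ^ (n + d)) \<le> ?K * chain_ratio ^ n"
      using K chain_ratio(1) by (intro mult_left_mono) auto
    with expectation_interp_chain[of n d]
    show "\<bar>(\<integral>\<omega>. F (interp T (d + n) (\<lambda>k. V (d + n) k \<omega>)) \<partial>M) - (\<integral>\<omega>. F (interp T n (\<lambda>k. V n k \<omega>)) \<partial>M)\<bar> \<le> ?K * chain_ratio ^ n"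
      by (simp add: add.commute)
  qed
qed

end

text \<open>The value 0 on the exceptional set makes every path continuous, as the definition of
  Brownian motion in use requires, and not merely almost every path.\<close>

definition chain_limit :: "real \<Rightarrow> 'a \<Rightarrow> complex" where
  "chain_limit t \<omega> = (if summable (\<lambda>n. osc n \<omega>) then lim (\<lambda>n. interp T n (\<lambda>k. V n k \<omega>) t) else 0)"

text \<open>The expected oscillations are dominated by a geometric series, so the sum of the
  oscillations has finite expectation.\<close>

lemma AE_summable_osc: "AE \<omega> in M. summable (\<lambda>n. osc n \<omega>)"
proof -
  have [measurable]: "osc n \<in> borel_measurable M" for n using integrable_osc by auto
  have "(\<integral>\<^sup>+\<omega>. (\<Sum>n. ennreal (osc n \<omega>)) \<partial>M) = (\<Sum>n. \<integral>\<^sup>+\<omega>. ennreal (osc n \<omega>) \<partial>M)"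
    by (rule nn_integral_suminf) simp
  also have "\<dots> \<le> (\<Sum>n. ennreal ((1 + C) * chain_ratio ^ n))"
    using integrable_osc osc_nonneg expectation_osc_le
    by (intro suminf_le) (auto simp: nn_integral_eq_integral intro: ennreal_leI)
  also have "\<dots> = ennreal (\<Sum>n. (1 + C) * chain_ratio ^ n)"
    using C_nonneg chain_ratio by (intro suminf_ennreal2 summable_mult summable_geometric) auto
  also have "\<dots> < \<infinity>" by simp
  finally have "(\<integral>\<^sup>+\<omega>. (\<Sum>n. ennreal (osc n \<omega>)) \<partial>M) \<noteq> \<infinity>" by simp
  then have "AE \<omega> in M. (\<Sum>n. ennreal (osc n \<omega>)) \<noteq> \<infinity>"
    by (intro nn_integral_PInf_AE) auto
  then show ?thesis
    by eventually_elim (auto intro!: summable_suminf_not_top osc_nonneg)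
qed

text \<open>Weierstrass' test for the telescoping series of successive interpolations, with twice
  the oscillations as majorant.\<close>

lemma interp_uniform_limit:
  assumes "summable (\<lambda>n. osc n \<omega>)"
  shows "uniform_limit {0..T} (\<lambda>n. interp T n (\<lambda>k. V n k \<omega>)) (\<lambda>t. chain_limit t \<omega>) sequentially"
proof -
  let ?A = "\<lambda>n. interp T n (\<lambda>k. V n k \<omega>)"
  have sm: "summable (\<lambda>n. 2 * osc (Suc n) \<omega>)"
    using assms by (intro summable_mult) (simp add: summable_Suc_iff[of "\<lambda>n. osc n \<omega>"])
  have "uniform_limit {0..T} (\<lambda>n t. \<Sum>i<n. ?A (Suc i) t - ?A i t) (\<lambda>t. \<Sum>i. ?A (Suc i) t - ?A i t) sequentially"
    using norm_interp_Suc_le by (intro Weierstrass_m_test[OF _ sm]) (simp add: norm_minus_commute)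
  then have "uniform_limit {0..T} (\<lambda>n t. ?A n t - ?A 0 t) (\<lambda>t. \<Sum>i. ?A (Suc i) t - ?A i t) sequentially"
    by (simp only: sum_lessThan_telescope[of "\<lambda>i. ?A i t" for t])
  moreover have "uniform_limit {0..T} (\<lambda>_. ?A 0) (?A 0) sequentially" by (rule uniform_limit_const)
  ultimately have "uniform_limit {0..T} (\<lambda>n t. ?A n t - ?A 0 t + ?A 0 t) (\<lambda>t. (\<Sum>i. ?A (Suc i) t - ?A i t) + ?A 0 t) sequentially"
    by (rule uniform_limit_add)
  then
  have u: "uniform_limit {0..T} ?A (\<lambda>t. (\<Sum>i. ?A (Suc i) t - ?A i t) + ?A 0 t) sequentially" by simp
  have "(\<Sum>i. ?A (Suc i) t - ?A i t) + ?A 0 t = chain_limit t \<omega>" if "t \<in> {0..T}" for t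
    using tendsto_uniform_limitI[OF u that] assms by (simp add: chain_limit_def limI)
  then have "uniform_limit {0..T} ?A (\<lambda>t. (\<Sum>i. ?A (Suc i) t - ?A i t) + ?A 0 t) sequentially
      \<longleftrightarrow> uniform_limit {0..T} ?A (\<lambda>t. chain_limit t \<omega>) sequentially"
    by (intro uniform_limit_cong') auto
  with u show ?thesis by blast
qed

lemma continuous_on_chain_limit: "continuous_on {0..T} (\<lambda>t. chain_limit t \<omega>)"
proof (cases "summable (\<lambda>n. osc n \<omega>)")
  case True
  show ?thesis
    by (rule uniform_limit_theorem[OF _ interp_uniform_limit[OF True]]) (use interp_mem mspace_path_space in auto)
next
  case False
  then show ?thesis by (simp add: chain_limit_def)
qed

lemma V_refine: "k \<le> 2^n \<Longrightarrow> V (n + d) (k * 2^d) \<omega> = V n k \<omega>"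
proof (induction d)
  case (Suc d)
  have "k * 2^d \<le> 2^(n + d)" using Suc.prems by (simp add: power_add)
  from refine[OF this] Suc show ?case by (simp add: mult.left_commute)
qed simp

text \<open>From level \<open>n\<close> on, every interpolation takes the value \<open>V n k\<close>
  at this grid point, by consistency of the levels; the defining sequence is eventually
  constant.\<close>

lemma chain_limit_grid:
  assumes "summable (\<lambda>n. osc n \<omega>)" "k \<le> 2^n"
  shows "chain_limit (grid T n k) \<omega> = V n k \<omega>"
proof -
  have "(\<lambda>m. interp T m (\<lambda>k. V m k \<omega>) (grid T n k)) \<longlonglongrightarrow> chain_limit (grid T n k) \<omega>"
    by (rule tendsto_uniform_limitI[OF interp_uniform_limit[OF assms(1)] grid_mem[OF T_pos assms(2)]])
  then have "(\<lambda>d. interp T (d + n) (\<lambda>k. V (d + n) k \<omega>) (grid T n k)) \<longlonglongrightarrow> chain_limit (grid T n k) \<omega>"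
    by (rule LIMSEQ_ignore_initial_segment)
  moreover have "interp T (d + n) (\<lambda>k. V (d + n) k \<omega>) (grid T n k) = V n k \<omega>" for d
  proof -
    have "grid T n k = grid T (d + n) (k * 2^d)" by (simp add: grid_def power_add)
    moreover have "k * 2^d \<le> 2^(d + n)" using assms(2) by (simp add: power_add)
    ultimately show ?thesis using V_refine[OF assms(2), of d \<omega>] by (simp add: interp_grid[OF T_pos] add.commute)
  qed
  ultimately show ?thesis by (simp add: LIMSEQ_const_iff)
qed

lemma measurable_chain_limit:
  assumes "t \<in> {0..T}"
  shows "chain_limit t \<in> borel_measurable M"
proof -
  have [measurable]: "osc n \<in> borel_measurable M" for n using integrable_osc by auto
  have "(\<lambda>\<omega>. interp T n (\<lambda>k. V n k \<omega>) t) \<in> borel_measurable M" for n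
    unfolding interp_def using assms measurable_V by (auto intro!: borel_measurable_sum borel_measurable_times)
  then have lim: "(\<lambda>\<omega>. lim (\<lambda>n. interp T n (\<lambda>k. V n k \<omega>) t)) \<in> borel_measurable M"
    by (rule borel_measurable_lim_metric)
  \<comment> \<open>Summability is restated as finiteness of a sum in the extended nonnegative
    reals, which is a measurable condition.\<close>
  have "summable (\<lambda>n. osc n \<omega>) \<longleftrightarrow> (\<Sum>n. ennreal (osc n \<omega>)) \<noteq> top" for \<omega>
  proof
    assume "summable (\<lambda>n. osc n \<omega>)"
    from suminf_ennreal2[OF osc_nonneg this] show "(\<Sum>n. ennreal (osc n \<omega>)) \<noteq> top" by simp
  qed (intro summable_suminf_not_top osc_nonneg)
  moreover have "{\<omega> \<in> space M. (\<Sum>n. ennreal (osc n \<omega>)) \<noteq> top} \<in> sets M" by measurable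
  ultimately have "{\<omega> \<in> space M. summable (\<lambda>n. osc n \<omega>)} \<in> sets M" by simp
  then show ?thesis unfolding chain_limit_def[abs_def] by (intro measurable_If lim) auto
qed

end


section \<open>The Levy construction of complex Brownian motion\<close>

text \<open>Both coordinates have variance 1, so the expected square of the modulus is 2, in
  accordance with 2 (t - s) in condition (B).\<close>

definition complex_gauss :: "complex measure" where
  "complex_gauss = distr (std_normal_distribution \<Otimes>\<^sub>M std_normal_distribution) borel (\<lambda>(x, y). Complex x y)"

lemma measurable_Complex [measurable]:
  "(\<lambda>(x, y). Complex x y) \<in> borel_measurable (std_normal_distribution \<Otimes>\<^sub>M std_normal_distribution)"
  unfolding Complex_eq by measurable

lemma sets_complex_gauss [measurable_cong, simp]: "sets complex_gauss = sets borel"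
  and space_complex_gauss [simp]: "space complex_gauss = UNIV"
  by (simp_all add: complex_gauss_def)

lemma prob_space_complex_gauss: "prob_space complex_gauss"
proof -
  interpret G: prob_space std_normal_distribution by (rule prob_space_std_normal)
  interpret P: pair_prob_space std_normal_distribution std_normal_distribution ..
  show ?thesis unfolding complex_gauss_def by (rule P.prob_space_distr) measurable
qed

text \<open>\<open>Re (cnj u * z)\<close> is the Euclidean inner product of \<open>u\<close> and
  \<open>z\<close> in the plane, so complex frequencies index all characters. Characters of complex
  variables are written this way from here on.\<close>

lemma char_complex_gauss:
  "(CLINT z | complex_gauss. iexp (Re (cnj u * z))) = of_real (exp (- (cmod u)\<^sup>2 / 2))"
proof -
  let ?G = std_normal_distribution
  interpret G: prob_space ?G by (rule prob_space_std_normal)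
  interpret P: pair_prob_space ?G ?G ..
  have [measurable]: "(\<lambda>p. Re u * fst p + Im u * snd p) \<in> borel_measurable (?G \<Otimes>\<^sub>M ?G)" by measurable
  have "(CLINT z | complex_gauss. iexp (Re (cnj u * z))) = (CLINT p | ?G \<Otimes>\<^sub>M ?G. iexp (Re u * fst p + Im u * snd p))"
    unfolding complex_gauss_def by (subst integral_distr) (auto simp: case_prod_beta intro!: Bochner_Integration.integral_cong)
  also have "\<dots> = (CLINT x | ?G. CLINT y | ?G. iexp (Re u * x + Im u * y))"
    by (subst P.integral_fst'[symmetric]) (auto intro!: P.P.integrable_const_bound[where B=1])
  also have "\<dots> = (CLINT x | ?G. CLINT y | ?G. iexp (Re u * x) * iexp (Im u * y))"
    by (simp add: exp_add[symmetric] algebra_simps)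
  also have "\<dots> = char ?G (Re u) * char ?G (Im u)"
    by (simp add: char_def)
  also have "\<dots> = of_real (exp (- (cmod u)\<^sup>2 / 2))"
    by (simp add: char_std_normal_distribution cmod_power2 exp_add[symmetric] of_real_mult[symmetric] add_divide_distrib del: of_real_mult)
  finally show ?thesis .
qed

lemma measurable_iexp_Re: "(\<lambda>z. iexp (Re (cnj u * z))) \<in> borel_measurable complex_gauss"
  by measurable

text \<open>The index set is all of the reals so that the sample type is the one prescribed by
  \<open>complex_brownian_law\<close>; the construction reads the coordinates at natural
  numbers.\<close>

definition noise :: "(real \<Rightarrow> complex) measure" where
  "noise = (\<Pi>\<^sub>M x\<in>(UNIV::real set). complex_gauss)"

lemma measurable_noise: "(\<lambda>\<omega>. \<omega> x) \<in> borel_measurable noise"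
proof -
  have "(\<lambda>\<omega>. \<omega> x) \<in> measurable (\<Pi>\<^sub>M x\<in>(UNIV::real set). complex_gauss) complex_gauss" by measurable
  then show ?thesis by (simp add: noise_def cong: measurable_cong_sets)
qed

lemma prob_space_noise: "prob_space noise"
  unfolding noise_def by (intro prob_space_PiM prob_space_complex_gauss)

lemma iexp_sum: "finite A \<Longrightarrow> iexp (\<Sum>x\<in>A. f x) = (\<Prod>x\<in>A. iexp (f x))"
  by (simp add: exp_sum sum_distrib_left)

lemma char_noise:
  "(CLINT \<omega> | noise. iexp (\<Sum>j<m. Re (cnj (a j) * \<omega> (real j)))) = of_real (exp (- (\<Sum>j<m. (cmod (a j))\<^sup>2) / 2))"
proof -
  interpret product_prob_space "\<lambda>_::real. complex_gauss" UNIV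
    by (simp add: product_prob_space_def product_prob_space_axioms_def product_sigma_finite_def
        prob_space_complex_gauss prob_space_imp_sigma_finite)
  let ?J = "real ` {..<m}"
  \<comment> \<open>Transports the coefficients from natural to real indices; the floor undoes the
    embedding.\<close>
  define b where "b x = a (nat \<lfloor>x\<rfloor>)" for x :: real
  have re: "(\<Sum>x\<in>?J. f x) = (\<Sum>j<m. f (real j))" "(\<Prod>x\<in>?J. g x) = (\<Prod>j<m. g (real j))" for f g :: "real \<Rightarrow> complex"
    by (auto simp: sum.reindex prod.reindex inj_on_def)
  have "(CLINT \<omega> | noise. iexp (\<Sum>j<m. Re (cnj (a j) * \<omega> (real j)))) = (CLINT \<omega> | noise. (\<Prod>x\<in>?J. iexp (Re (cnj (b x) * restrict \<omega> ?J x))))"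
    unfolding re iexp_sum[OF finite_lessThan] by (simp add: b_def)
  also have "\<dots> = (CLINT \<omega> | distr noise (PiM ?J (\<lambda>_. complex_gauss)) (\<lambda>\<omega>. restrict \<omega> ?J). (\<Prod>x\<in>?J. iexp (Re (cnj (b x) * \<omega> x))))"
    unfolding noise_def
  proof (subst integral_distr)
    show "(\<lambda>\<omega>. restrict \<omega> ?J) \<in> measurable (\<Pi>\<^sub>M x\<in>UNIV. complex_gauss) (PiM ?J (\<lambda>_. complex_gauss))"
      by (rule measurable_restrict_subset) simp
    show "(\<lambda>\<omega>. \<Prod>x\<in>?J. iexp (Re (cnj (b x) * \<omega> x))) \<in> borel_measurable (PiM ?J (\<lambda>_. complex_gauss))"
    proof (rule borel_measurable_prod)
      fix x assume "x \<in> ?J"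
      then have "(\<lambda>\<omega>. \<omega> x) \<in> measurable (PiM ?J (\<lambda>_. complex_gauss)) complex_gauss"
        by (rule measurable_component_singleton)
      from measurable_compose[OF this measurable_iexp_Re]
      show "(\<lambda>\<omega>. iexp (Re (cnj (b x) * \<omega> x))) \<in> borel_measurable (PiM ?J (\<lambda>_. complex_gauss))" .
    qed
  qed (rule refl)
  also have "\<dots> = (CLINT \<omega> | PiM ?J (\<lambda>_. complex_gauss). (\<Prod>x\<in>?J. iexp (Re (cnj (b x) * \<omega> x))))"
    unfolding noise_def by (subst distr_PiM_restrict_finite) auto
  also have "\<dots> = (\<Prod>x\<in>?J. CLINT z | complex_gauss. iexp (Re (cnj (b x) * z)))"
    by (intro product_integral_prod M.integrable_const_bound[where B=1] measurable_iexp_Re) auto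
  also have "\<dots> = of_real (exp (- (\<Sum>j<m. (cmod (a j))\<^sup>2) / 2))"
    unfolding re char_complex_gauss
    by (simp only: of_real_prod[symmetric] exp_sum[OF finite_lessThan, symmetric] b_def floor_of_nat nat_int sum_negf[symmetric] sum_divide_distrib)
  finally show ?thesis .
qed

lemma sum_lessThan_double: "(\<Sum>k<2 * N. f k) = (\<Sum>k<(N::nat). f (2 * k) + f (2 * k + 1))" for f :: "nat \<Rightarrow> 'a::comm_monoid_add"
  by (induction N) (auto simp: add.assoc)

lemma sum_lessThan_add: "(\<Sum>j<N + K. f j) = (\<Sum>j<N. f j) + (\<Sum>k<K. f (N + k))" for f :: "nat \<Rightarrow> 'a::comm_monoid_add"
  by (induction K) (auto simp: add.assoc)

text \<open>Levy's midpoint refinement: an increment \<open>\<Delta>\<close> over a dyadic interval of length \<open>h\<close> splits into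
  \<open>\<Delta>/2 + \<xi>\<close> and \<open>\<Delta>/2 - \<xi>\<close> with a fresh Gaussian \<open>\<xi>\<close> of variance \<open>h/4\<close> per real coordinate.\<close>

primrec levy_inc :: "real \<Rightarrow> nat \<Rightarrow> nat \<Rightarrow> (real \<Rightarrow> complex) \<Rightarrow> complex" where
  "levy_inc T 0 k \<omega> = of_real (sqrt T) * \<omega> 0"
| "levy_inc T (Suc n) k \<omega> = levy_inc T n (k div 2) \<omega> / 2 +
     (if even k then 1 else - 1) * of_real (sqrt (T / 2^n) / 2) * \<omega> (real (2^n + k div 2))"

definition levy_val :: "real \<Rightarrow> nat \<Rightarrow> nat \<Rightarrow> (real \<Rightarrow> complex) \<Rightarrow> complex" where
  "levy_val T n k \<omega> = (\<Sum>j<k. levy_inc T n j \<omega>)"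

lemma levy_val_refine: "levy_val T (Suc n) (2 * k) \<omega> = levy_val T n k \<omega>"
  unfolding levy_val_def sum_lessThan_double by simp

lemma measurable_levy_inc [measurable]: "levy_inc T n k \<in> borel_measurable noise"
proof (induction n arbitrary: k)
  case 0
  show ?case unfolding levy_inc.simps[abs_def] by (intro borel_measurable_times measurable_noise) simp
next
  case (Suc n)
  show ?case unfolding levy_inc.simps[abs_def]
    by (intro borel_measurable_add borel_measurable_times borel_measurable_divide Suc.IH measurable_noise) auto
qed

text \<open>The map from noise to increments is sqrt (T / 2^n) times an orthogonal one. Level n + 1
  consumes the fresh coordinates from 2^n to 2^(n+1) - 1, so level n uses exactly the first 2^n, and
  the induction rests on the parallelogram law.\<close>

lemma levy_inc_linear:
  assumes "0 < T"
  shows "\<exists>a. (\<forall>\<omega>. (\<Sum>k<2^n. Re (cnj (u k) * levy_inc T n k \<omega>)) = (\<Sum>j<2^n. Re (cnj (a j) * \<omega> (real j))))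
     \<and> (\<Sum>j<2^n. (cmod (a j))\<^sup>2) = T / 2^n * (\<Sum>k<2^n. (cmod (u k))\<^sup>2)"
proof (induction n arbitrary: u)
  case 0
  show ?case using assms
    by (intro exI[of _ "\<lambda>_. of_real (sqrt T) * u 0"]) (auto simp: norm_mult power_mult_distrib algebra_simps)
next
  case (Suc n)
  define \<sigma> where "\<sigma> = sqrt (T / 2^n) / 2"
  have \<sigma>2: "\<sigma>\<^sup>2 = T / 2^n / 4" using assms by (simp add: \<sigma>_def power_divide)
  \<comment> \<open>The parent increment sees the mean of the two child frequencies; the fresh
    coordinate sees their difference, scaled by its standard deviation.\<close>
  define u' where "u' k = (u (2 * k) + u (2 * k + 1)) / 2" for k
  define d where "d k = of_real \<sigma> * (u (2 * k) - u (2 * k + 1))" for k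
  obtain a' where a': "\<And>\<omega>. (\<Sum>k<2^n. Re (cnj (u' k) * levy_inc T n k \<omega>)) = (\<Sum>j<2^n. Re (cnj (a' j) * \<omega> (real j)))"
    "(\<Sum>j<2^n. (cmod (a' j))\<^sup>2) = T / 2^n * (\<Sum>k<2^n. (cmod (u' k))\<^sup>2)"
    using Suc.IH[of u'] by blast
  define a where "a j = (if j < 2^n then a' j else d (j - 2^n))" for j
  have split: "(\<Sum>j<2^Suc n. f j) = (\<Sum>j<2^n. f j) + (\<Sum>k<2^n. f (2^n + k))" for f :: "nat \<Rightarrow> real"
    using sum_lessThan_add[of f "2^n" "2^n"] by (simp add: mult_2)
  show ?case
  proof (intro exI[of _ a] conjI allI)
    fix \<omega>
    have "(\<Sum>k<2^Suc n. Re (cnj (u k) * levy_inc T (Suc n) k \<omega>))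
       = (\<Sum>k<2^n. Re (cnj (u' k) * levy_inc T n k \<omega>) + Re (cnj (d k) * \<omega> (real (2^n + k))))"
      unfolding power_Suc sum_lessThan_double
      by (intro sum.cong refl) (simp add: u'_def d_def \<sigma>_def[symmetric] algebra_simps add_divide_distrib)
    also have "\<dots> = (\<Sum>j<2^Suc n. Re (cnj (a j) * \<omega> (real j)))"
      unfolding split sum.distrib a'(1) by (simp add: a_def)
    finally show "(\<Sum>k<2^Suc n. Re (cnj (u k) * levy_inc T (Suc n) k \<omega>)) = (\<Sum>j<2^Suc n. Re (cnj (a j) * \<omega> (real j)))" .
  next
    have "(\<Sum>j<2^Suc n. (cmod (a j))\<^sup>2) = T / 2^n * (\<Sum>k<2^n. (cmod (u' k))\<^sup>2) + (\<Sum>k<2^n. (cmod (d k))\<^sup>2)"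
      unfolding split a'(2)[symmetric] by (simp add: a_def)
    also have "\<dots> = (\<Sum>k<2^n. T / 2^n * (cmod (u' k))\<^sup>2 + (cmod (d k))\<^sup>2)"
      by (simp add: sum.distrib sum_distrib_left)
    also have "\<dots> = (\<Sum>k<2^n. T / 2^Suc n * ((cmod (u (2 * k)))\<^sup>2 + (cmod (u (2 * k + 1)))\<^sup>2))"
    proof (intro sum.cong refl)
      fix k
      \<comment> \<open>The parallelogram law: the mean and half the difference of the two
        frequencies carry half of their total energy.\<close>
      have "(cmod ((x + y) / 2))\<^sup>2 + (cmod (x - y))\<^sup>2 / 4 = ((cmod x)\<^sup>2 + (cmod y)\<^sup>2) / 2" for x y :: complex
        unfolding cmod_power2 by (simp add: power2_eq_square field_simps)
      note e = this[of "u (2 * k)" "u (2 * k + 1)"]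
      have "(cmod (d k))\<^sup>2 = T / 2^n * ((cmod (u (2 * k) - u (2 * k + 1)))\<^sup>2 / 4)"
        unfolding d_def norm_mult power_mult_distrib norm_of_real power2_abs \<sigma>2 by simp
      then have "T / 2^n * (cmod (u' k))\<^sup>2 + (cmod (d k))\<^sup>2 = T / 2^n * (((cmod (u (2 * k)))\<^sup>2 + (cmod (u (2 * k + 1)))\<^sup>2) / 2)"
        unfolding u'_def by (simp only: distrib_left[symmetric] e)
      then show "T / 2^n * (cmod (u' k))\<^sup>2 + (cmod (d k))\<^sup>2 = T / 2^Suc n * ((cmod (u (2 * k)))\<^sup>2 + (cmod (u (2 * k + 1)))\<^sup>2)"
        by simp
    qed
    also have "\<dots> = T / 2^Suc n * (\<Sum>k<2^Suc n. (cmod (u k))\<^sup>2)"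
      unfolding power_Suc sum_lessThan_double by (simp add: sum_distrib_left)
    finally show "(\<Sum>j<2^Suc n. (cmod (a j))\<^sup>2) = T / 2^Suc n * (\<Sum>k<2^Suc n. (cmod (u k))\<^sup>2)" .
  qed
qed

lemma char_levy_inc:
  assumes "0 < T"
  shows "(CLINT \<omega> | noise. iexp (\<Sum>k<2^n. Re (cnj (u k) * levy_inc T n k \<omega>))) = of_real (exp (- (T / 2^n * (\<Sum>k<2^n. (cmod (u k))\<^sup>2)) / 2))"
proof -
  obtain a where a: "\<And>\<omega>. (\<Sum>k<2^n. Re (cnj (u k) * levy_inc T n k \<omega>)) = (\<Sum>j<2^n. Re (cnj (a j) * \<omega> (real j)))"
    "(\<Sum>j<2^n. (cmod (a j))\<^sup>2) = T / 2^n * (\<Sum>k<2^n. (cmod (u k))\<^sup>2)"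
    using levy_inc_linear[OF assms, where n=n and u=u] by blast
  show ?thesis unfolding a(1) char_noise a(2) ..
qed

lemma (in prob_space) distributed_normal_of_char:
  assumes [measurable]: "X \<in> borel_measurable M" and "0 < h"
    and char: "\<And>s. (CLINT \<omega> | M. iexp (s * X \<omega>)) = of_real (exp (- (s\<^sup>2 * h) / 2))"
  shows "distributed M lborel X (normal_density 0 (sqrt h))"
proof -
  let ?Y = "\<lambda>\<omega>. (X \<omega> - 0) / sqrt h"
  have "distr M borel ?Y = std_normal_distribution"
  proof (rule Levy_uniqueness)
    show "char (distr M borel ?Y) = char std_normal_distribution"
    proof
      fix s
      have "char (distr M borel ?Y) s = (CLINT \<omega> | M. iexp (s / sqrt h * X \<omega>))"
        unfolding char_def by (subst integral_distr) auto
      also have "\<dots> = char std_normal_distribution s"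
        using \<open>0 < h\<close> unfolding char by (simp add: char_std_normal_distribution power_divide)
      finally show "char (distr M borel ?Y) s = char std_normal_distribution s" .
    qed
  qed (use real_dist_normal_dist in auto)
  then have "distributed M lborel ?Y std_normal_density"
    by (auto simp: distributed_def cong: distr_cong)
  then show ?thesis
    using normal_standard_normal_convert[of "sqrt h" X 0] \<open>0 < h\<close> by simp
qed

lemma (in prob_space) fourth_moment_of_char:
  assumes [measurable]: "X \<in> borel_measurable M" and "0 < h"
    and char: "\<And>s. (CLINT \<omega> | M. iexp (s * X \<omega>)) = of_real (exp (- (s\<^sup>2 * h) / 2))"
  shows "integrable M (\<lambda>\<omega>. X \<omega> ^ 4)" "(\<integral>\<omega>. X \<omega> ^ 4 \<partial>M) = 3 * h\<^sup>2"
proof -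
  note d = distributed_normal_of_char[OF assms]
  have s: "0 < sqrt h" using \<open>0 < h\<close> by simp
  have hb: "has_bochner_integral lborel (\<lambda>x. normal_density 0 (sqrt h) x * x ^ 4) (3 * h\<^sup>2)"
    using normal_moment_even[OF s, of 0 2] \<open>0 < h\<close> by (simp add: fact_numeral power_one_over field_simps power_mult[of "sqrt h" 2 2, simplified] eval_nat_numeral)
  show "integrable M (\<lambda>\<omega>. X \<omega> ^ 4)"
    using distributed_integrable[OF d, of "\<lambda>x. x ^ 4"] hb by (auto simp: normal_density_nonneg intro: integrable.intros)
  show "(\<integral>\<omega>. X \<omega> ^ 4 \<partial>M) = 3 * h\<^sup>2"
    using distributed_integral[OF d, of "\<lambda>x. x ^ 4"] hb by (auto simp: normal_density_nonneg has_bochner_integral_integral_eq)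
qed

lemma norm_complex_fourth_le: "cmod z ^ 4 \<le> 2 * (Re z ^ 4 + Im z ^ 4)"
proof -
  have "cmod z ^ 4 = ((Re z)\<^sup>2 + (Im z)\<^sup>2)\<^sup>2"
    using cmod_power2[of z] by (metis power_mult[of "cmod z" 2 2] mult_2 numeral_Bit0)
  also have "\<dots> \<le> 2 * (((Re z)\<^sup>2)\<^sup>2 + ((Im z)\<^sup>2)\<^sup>2)"
    using zero_le_power2[of "(Re z)\<^sup>2 - (Im z)\<^sup>2"] by (simp add: power2_eq_square algebra_simps)
  finally show ?thesis by (simp add: power_mult[symmetric])
qed

text \<open>Each real coordinate is centred normal with variance h = T / 2^n and fourth moment 3
  h^2; splitting the modulus into its two coordinates costs a factor 2, so the total is 12
  h^2.\<close>

lemma levy_fourth_moment: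
  assumes "0 < T" "k < 2^n"
  shows "integrable noise (\<lambda>\<omega>. cmod (levy_inc T n k \<omega>) ^ 4)" "(\<integral>\<omega>. cmod (levy_inc T n k \<omega>) ^ 4 \<partial>noise) \<le> 12 * T\<^sup>2 / 4^n"
proof -
  interpret prob_space noise by (rule prob_space_noise)
  have h: "0 < T / 2^n" using assms by simp
  \<comment> \<open>Here \<open>w\<close> = 1 selects the real part and \<open>w\<close> = \<i> the
    imaginary part.\<close>
  have ch: "(CLINT \<omega> | noise. iexp (s * Re (cnj w * levy_inc T n k \<omega>))) = of_real (exp (- (s\<^sup>2 * (T / 2^n)) / 2))"
    if "cmod w = 1" for s w
  proof -
    let ?u = "\<lambda>j. if j = k then of_real s * w else 0"
    have "(\<Sum>j<2^n. Re (cnj (?u j) * levy_inc T n j \<omega>)) = (\<Sum>j<2^n. if j = k then s * Re (cnj w * levy_inc T n k \<omega>) else 0)" for \<omega>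
      by (intro sum.cong) (auto simp: algebra_simps)
    then have e: "(\<Sum>j<2^n. Re (cnj (?u j) * levy_inc T n j \<omega>)) = s * Re (cnj w * levy_inc T n k \<omega>)" for \<omega>
      using assms(2) by simp
    have "(\<Sum>j<2^n. (cmod (?u j))\<^sup>2) = (\<Sum>j<2^n. if j = k then s\<^sup>2 else 0)"
      using that by (intro sum.cong) (auto simp: norm_mult)
    then have "(\<Sum>j<2^n. (cmod (?u j))\<^sup>2) = s\<^sup>2" using assms(2) by simp
    with char_levy_inc[OF assms(1), where n=n and u="?u"] show ?thesis unfolding e by (simp only: mult.commute)
  qed
  have R: "integrable noise (\<lambda>\<omega>. Re (levy_inc T n k \<omega>) ^ 4)" "(\<integral>\<omega>. Re (levy_inc T n k \<omega>) ^ 4 \<partial>noise) = 3 * (T / 2^n)\<^sup>2"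
    using fourth_moment_of_char[OF _ h, of "\<lambda>\<omega>. Re (levy_inc T n k \<omega>)"] ch[of 1] by auto
  have I: "integrable noise (\<lambda>\<omega>. Im (levy_inc T n k \<omega>) ^ 4)" "(\<integral>\<omega>. Im (levy_inc T n k \<omega>) ^ 4 \<partial>noise) = 3 * (T / 2^n)\<^sup>2"
    using fourth_moment_of_char[OF _ h, of "\<lambda>\<omega>. Im (levy_inc T n k \<omega>)"] ch[of \<i>] by auto
  show i4: "integrable noise (\<lambda>\<omega>. cmod (levy_inc T n k \<omega>) ^ 4)"
  proof (rule Bochner_Integration.integrable_bound)
    show "integrable noise (\<lambda>\<omega>. 2 * (Re (levy_inc T n k \<omega>) ^ 4 + Im (levy_inc T n k \<omega>) ^ 4))" using R I by simp
    show "AE \<omega> in noise. norm (cmod (levy_inc T n k \<omega>) ^ 4) \<le> norm (2 * (Re (levy_inc T n k \<omega>) ^ 4 + Im (levy_inc T n k \<omega>) ^ 4))"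
      using norm_complex_fourth_le by (intro AE_I2) (auto intro: order_trans[OF _ abs_ge_self])
  qed measurable
  have "(\<integral>\<omega>. cmod (levy_inc T n k \<omega>) ^ 4 \<partial>noise) \<le> (\<integral>\<omega>. 2 * (Re (levy_inc T n k \<omega>) ^ 4 + Im (levy_inc T n k \<omega>) ^ 4) \<partial>noise)"
    using i4 R I norm_complex_fourth_le by (intro integral_mono) auto
  also have "\<dots> = 12 * T\<^sup>2 / 4^n"
  proof -
    have "((2::real)^n)\<^sup>2 = 4^n" by (simp add: power2_eq_square power_mult_distrib[symmetric])
    then have "(T / 2^n)\<^sup>2 = T\<^sup>2 / 4^n" by (simp add: power_divide)
    then show ?thesis using R I by simp
  qed
  finally show "(\<integral>\<omega>. cmod (levy_inc T n k \<omega>) ^ 4 \<partial>noise) \<le> 12 * T\<^sup>2 / 4^n" .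
qed


section \<open>Finite-dimensional laws of the limit process and its Brownian property\<close>

lemma iexp_add: "iexp (a + b) = iexp a * iexp b"
  by (simp add: distrib_left exp_add)

lemma Re_double_sum:
  "Re (cnj (\<Sum>i\<in>I. z i) * (\<Sum>i\<in>I. z i)) = (\<Sum>i\<in>I. \<Sum>j\<in>I. Re (cnj (z i) * z j))"
  by (simp only: cnj_sum sum_product Re_sum)

lemma cmod_sum_power2: "(cmod (\<Sum>i\<in>I. z i))\<^sup>2 = (\<Sum>i\<in>I. \<Sum>j\<in>I. Re (cnj (z i) * z j))"
proof -
  have "(cmod w)\<^sup>2 = Re (cnj w * w)" for w
    by (simp add: cmod_power2) (simp add: power2_eq_square)
  then show ?thesis by (simp only: Re_double_sum)
qed

text \<open>Summation by parts: increment \<open>l\<close> occurs in the value at \<open>k i\<close>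
  exactly when l < k i. Expanding the squared coefficients counts the common increments of two
  values, which produces the covariance \<open>min\<close>.\<close>

lemma levy_val_linear:
  fixes k :: "'i \<Rightarrow> nat" and a :: "'i \<Rightarrow> complex"
  assumes "finite I" "\<And>i. i \<in> I \<Longrightarrow> k i \<le> N"
  shows "(\<Sum>i\<in>I. Re (cnj (a i) * levy_val T n (k i) \<omega>)) = (\<Sum>l<N. Re (cnj (\<Sum>i\<in>I. if l < k i then a i else 0) * levy_inc T n l \<omega>))"
    and "(\<Sum>l<N. (cmod (\<Sum>i\<in>I. if l < k i then a i else 0))\<^sup>2) = (\<Sum>i\<in>I. \<Sum>j\<in>I. Re (cnj (a i) * a j) * real (min (k i) (k j)))"
proof -
  have r: "(\<Sum>l<K. f l) = (\<Sum>l<N. if l < K then f l else 0)" if "K \<le> N" for K and f :: "nat \<Rightarrow> 'b::comm_monoid_add"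
    using that by (intro sum.mono_neutral_cong_left) auto
  have "(\<Sum>i\<in>I. Re (cnj (a i) * levy_val T n (k i) \<omega>)) = (\<Sum>i\<in>I. \<Sum>l<N. if l < k i then Re (cnj (a i) * levy_inc T n l \<omega>) else 0)"
  proof (intro sum.cong refl)
    fix i assume "i \<in> I"
    have "Re (cnj (a i) * levy_val T n (k i) \<omega>) = (\<Sum>l<k i. Re (cnj (a i) * levy_inc T n l \<omega>))"
      unfolding levy_val_def sum_distrib_left Re_sum ..
    then show "Re (cnj (a i) * levy_val T n (k i) \<omega>) = (\<Sum>l<N. if l < k i then Re (cnj (a i) * levy_inc T n l \<omega>) else 0)"
      using r[OF assms(2)[OF \<open>i \<in> I\<close>], of "\<lambda>l. Re (cnj (a i) * levy_inc T n l \<omega>)"] by simp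
  qed
  also have "\<dots> = (\<Sum>l<N. \<Sum>i\<in>I. Re (cnj (if l < k i then a i else 0) * levy_inc T n l \<omega>))"
    by (subst sum.swap) (intro sum.cong refl, simp)
  also have "\<dots> = (\<Sum>l<N. Re (cnj (\<Sum>i\<in>I. if l < k i then a i else 0) * levy_inc T n l \<omega>))"
    by (simp only: cnj_sum sum_distrib_right Re_sum)
  finally show "(\<Sum>i\<in>I. Re (cnj (a i) * levy_val T n (k i) \<omega>)) = (\<Sum>l<N. Re (cnj (\<Sum>i\<in>I. if l < k i then a i else 0) * levy_inc T n l \<omega>))" .
  have "(\<Sum>l<N. (cmod (\<Sum>i\<in>I. if l < k i then a i else 0))\<^sup>2)
      = (\<Sum>l<N. \<Sum>i\<in>I. \<Sum>j\<in>I. if l < min (k i) (k j) then Re (cnj (a i) * a j) else 0)"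
    unfolding cmod_sum_power2 by (intro sum.cong refl) auto
  also have "\<dots> = (\<Sum>i\<in>I. \<Sum>j\<in>I. \<Sum>l<N. if l < min (k i) (k j) then Re (cnj (a i) * a j) else 0)"
    by (subst sum.swap) (intro sum.cong refl sum.swap)
  also have "\<dots> = (\<Sum>i\<in>I. \<Sum>j\<in>I. Re (cnj (a i) * a j) * real (min (k i) (k j)))"
  proof (intro sum.cong refl)
    fix i j assume "i \<in> I" "j \<in> I"
    then have "min (k i) (k j) \<le> N" using assms(2)[of i] by linarith
    from r[OF this, of "\<lambda>_. Re (cnj (a i) * a j)"]
    show "(\<Sum>l<N. if l < min (k i) (k j) then Re (cnj (a i) * a j) else 0) = Re (cnj (a i) * a j) * real (min (k i) (k j))"
      by (simp add: mult.commute)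
  qed
  finally show "(\<Sum>l<N. (cmod (\<Sum>i\<in>I. if l < k i then a i else 0))\<^sup>2) = (\<Sum>i\<in>I. \<Sum>j\<in>I. Re (cnj (a i) * a j) * real (min (k i) (k j)))" .
qed

lemma char_levy_val:
  fixes k :: "'i \<Rightarrow> nat" and a :: "'i \<Rightarrow> complex"
  assumes "0 < T" "finite I" "\<And>i. i \<in> I \<Longrightarrow> k i \<le> 2^n"
  shows "(CLINT \<omega> | noise. iexp (\<Sum>i\<in>I. Re (cnj (a i) * levy_val T n (k i) \<omega>)))
    = of_real (exp (- (\<Sum>i\<in>I. \<Sum>j\<in>I. Re (cnj (a i) * a j) * min (grid T n (k i)) (grid T n (k j))) / 2))"
proof -
  have m: "min (grid T n x) (grid T n y) = T / 2^n * real (min x y)" for x y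
    using assms(1) by (auto simp: grid_def min_def field_simps)
  have e1: "(\<Sum>i\<in>I. Re (cnj (a i) * levy_val T n (k i) \<omega>)) = (\<Sum>l<2^n. Re (cnj (\<Sum>i\<in>I. if l < k i then a i else 0) * levy_inc T n l \<omega>))" for \<omega>
    by (rule levy_val_linear(1)[OF assms(2,3)])
  have e2: "(\<Sum>l<2^n. (cmod (\<Sum>i\<in>I. if l < k i then a i else 0))\<^sup>2) = (\<Sum>i\<in>I. \<Sum>j\<in>I. Re (cnj (a i) * a j) * real (min (k i) (k j)))"
    by (rule levy_val_linear(2)[OF assms(2,3)])
  have "T / 2^n * (\<Sum>i\<in>I. \<Sum>j\<in>I. Re (cnj (a i) * a j) * real (min (k i) (k j)))
     = (\<Sum>i\<in>I. \<Sum>j\<in>I. Re (cnj (a i) * a j) * min (grid T n (k i)) (grid T n (k j)))"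
    unfolding m sum_distrib_left by (simp only: mult.left_commute)
  then show ?thesis
    unfolding e1 char_levy_inc[OF assms(1)] e2 by (simp only:)
qed

lemma dyadic_process_levy: "0 < T \<Longrightarrow> dyadic_process noise (levy_val T) (12 * T\<^sup>2) T"
  unfolding dyadic_process_def dyadic_process_axioms_def
  using levy_fourth_moment levy_val_refine
  by (auto simp: prob_space_noise levy_val_def[abs_def] intro!: borel_measurable_sum measurable_levy_inc)

definition levy_bm :: "real \<Rightarrow> real \<Rightarrow> (real \<Rightarrow> complex) \<Rightarrow> complex" where
  "levy_bm T = dyadic_process.chain_limit (levy_val T) T"

context
  fixes T :: real assumes T: "0 < T"
begin

interpretation L: dyadic_process noise "levy_val T" "12 * T\<^sup>2" T
  by (rule dyadic_process_levy[OF T])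

lemma continuous_levy_bm: "continuous_on {0..T} (\<lambda>t. levy_bm T t \<omega>)"
  unfolding levy_bm_def by (rule L.continuous_on_chain_limit)

lemma measurable_levy_bm: "t \<in> {0..T} \<Longrightarrow> levy_bm T t \<in> borel_measurable noise"
  unfolding levy_bm_def by (rule L.measurable_chain_limit)

lemma AE_levy_bm_grid: "AE \<omega> in noise. \<forall>n. \<forall>k\<le>2^n. levy_val T n k \<omega> = levy_bm T (grid T n k) \<omega>"
  using L.AE_summable_osc unfolding levy_bm_def by eventually_elim (simp add: L.chain_limit_grid)

lemma levy_bm_0: "AE \<omega> in noise. levy_bm T 0 \<omega> = 0"
  using AE_levy_bm_grid
proof eventually_elim
  case (elim \<omega>)
  then have "levy_val T 0 0 \<omega> = levy_bm T (grid T 0 0) \<omega>" by blast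
  then show ?case by (simp add: levy_val_def grid_def)
qed

text \<open>Arbitrary times are approximated by grid points, where the law is explicit; path
  continuity and dominated convergence carry the formula over.\<close>

lemma char_levy_bm:
  fixes \<tau> :: "'i \<Rightarrow> real" and a :: "'i \<Rightarrow> complex"
  assumes I: "finite I" and \<tau>: "\<And>i. i \<in> I \<Longrightarrow> \<tau> i \<in> {0..T}"
  shows "(CLINT \<omega> | noise. iexp (\<Sum>i\<in>I. Re (cnj (a i) * levy_bm T (\<tau> i) \<omega>)))
    = of_real (exp (- (\<Sum>i\<in>I. \<Sum>j\<in>I. Re (cnj (a i) * a j) * min (\<tau> i) (\<tau> j)) / 2))"
proof -
  \<comment> \<open>The last grid index not after the given time; the error is at most one mesh, and
    the index stays within the grid.\<close>
  define k where "k n i = nat \<lfloor>2^n * \<tau> i / T\<rfloor>" for n i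
  have k_le: "k n i \<le> 2^n" if "i \<in> I" for n i
  proof -
    have "2^n * \<tau> i / T \<le> 2^n" using \<tau>[OF that] T by (simp add: field_simps)
    then have "\<lfloor>2^n * \<tau> i / T\<rfloor> \<le> 2^n" by (metis floor_mono floor_of_int of_int_numeral of_int_power)
    then show ?thesis by (simp add: k_def nat_le_iff)
  qed
  have lim: "(\<lambda>n. grid T n (k n i)) \<longlonglongrightarrow> \<tau> i" if "i \<in> I" for i
  proof (rule Lim_null[THEN iffD2], rule Lim_null_comparison)
    show "\<forall>\<^sub>F n in sequentially. norm (grid T n (k n i) - \<tau> i) \<le> T * (1/2)^n"
    proof (intro always_eventually allI)
      fix n
      have nn: "0 \<le> 2^n * \<tau> i / T" using \<tau>[OF that] T by simp
      have "grid T n (k n i) - \<tau> i = T / 2^n * (real (k n i) - 2^n * \<tau> i / T)"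
        using T by (simp add: grid_def field_simps)
      moreover have "\<bar>real (k n i) - 2^n * \<tau> i / T\<bar> \<le> 1" using nn unfolding k_def by linarith
      ultimately have "norm (grid T n (k n i) - \<tau> i) \<le> T / 2^n * 1"
        using T by (simp only: real_norm_def abs_mult) (intro mult_mono, auto)
      then show "norm (grid T n (k n i) - \<tau> i) \<le> T * (1/2)^n" by (simp add: power_one_over)
    qed
    show "(\<lambda>n. T * (1/2)^n) \<longlonglongrightarrow> 0" by (intro tendsto_mult_right_zero LIMSEQ_power_zero) simp
  qed
  have 1: "(\<lambda>n. CLINT \<omega> | noise. iexp (\<Sum>i\<in>I. Re (cnj (a i) * levy_val T n (k n i) \<omega>)))
     \<longlonglongrightarrow> (CLINT \<omega> | noise. iexp (\<Sum>i\<in>I. Re (cnj (a i) * levy_bm T (\<tau> i) \<omega>)))"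
  proof (rule integral_dominated_convergence[where w="\<lambda>_. 1"])
    show "AE \<omega> in noise. (\<lambda>n. iexp (\<Sum>i\<in>I. Re (cnj (a i) * levy_val T n (k n i) \<omega>))) \<longlonglongrightarrow> iexp (\<Sum>i\<in>I. Re (cnj (a i) * levy_bm T (\<tau> i) \<omega>))"
      using AE_levy_bm_grid
    proof eventually_elim
      case (elim \<omega>)
      have "(\<lambda>n. levy_bm T (grid T n (k n i)) \<omega>) \<longlonglongrightarrow> levy_bm T (\<tau> i) \<omega>" if "i \<in> I" for i
        using continuous_on_tendsto_compose[OF continuous_levy_bm lim[OF that] \<tau>[OF that]] grid_mem[OF T k_le[OF that]] by simp
      then have "(\<lambda>n. levy_val T n (k n i) \<omega>) \<longlonglongrightarrow> levy_bm T (\<tau> i) \<omega>" if "i \<in> I" for i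
        using elim k_le that by simp
      then show ?case by (intro tendsto_intros)
    qed
    have [measurable]: "(\<lambda>\<omega>. Re (cnj z * Y \<omega>)) \<in> borel_measurable noise" if [measurable]: "Y \<in> borel_measurable noise" for z Y
      by measurable
    show "(\<lambda>\<omega>. iexp (\<Sum>i\<in>I. Re (cnj (a i) * levy_bm T (\<tau> i) \<omega>))) \<in> borel_measurable noise"
    proof -
      have "(\<lambda>\<omega>. \<Sum>i\<in>I. Re (cnj (a i) * levy_bm T (\<tau> i) \<omega>)) \<in> borel_measurable noise"
        using measurable_levy_bm \<tau> by (intro borel_measurable_sum) simp
      then show ?thesis by measurable
    qed
    show "(\<lambda>\<omega>. iexp (\<Sum>i\<in>I. Re (cnj (a i) * levy_val T n (k n i) \<omega>))) \<in> borel_measurable noise" for n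
    proof -
      have "(\<lambda>\<omega>. \<Sum>i\<in>I. Re (cnj (a i) * levy_val T n (k n i) \<omega>)) \<in> borel_measurable noise"
        using L.measurable_V k_le by (intro borel_measurable_sum) simp
      then show ?thesis by measurable
    qed
  qed auto
  have 2: "(\<lambda>n. CLINT \<omega> | noise. iexp (\<Sum>i\<in>I. Re (cnj (a i) * levy_val T n (k n i) \<omega>)))
     \<longlonglongrightarrow> of_real (exp (- (\<Sum>i\<in>I. \<Sum>j\<in>I. Re (cnj (a i) * a j) * min (\<tau> i) (\<tau> j)) / 2))"
  proof -
    have "(\<lambda>n. complex_of_real (exp (- (\<Sum>i\<in>I. \<Sum>j\<in>I. Re (cnj (a i) * a j) * min (grid T n (k n i)) (grid T n (k n j))) / 2)))
       \<longlonglongrightarrow> of_real (exp (- (\<Sum>i\<in>I. \<Sum>j\<in>I. Re (cnj (a i) * a j) * min (\<tau> i) (\<tau> j)) / 2))"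
      using lim by (intro tendsto_intros tendsto_min) auto
    moreover have "(CLINT \<omega> | noise. iexp (\<Sum>i\<in>I. Re (cnj (a i) * levy_val T n (k n i) \<omega>)))
       = of_real (exp (- (\<Sum>i\<in>I. \<Sum>j\<in>I. Re (cnj (a i) * a j) * min (grid T n (k n i)) (grid T n (k n j))) / 2))" for n
      by (rule char_levy_val[OF T I k_le])
    ultimately show ?thesis by simp
  qed
  show ?thesis by (rule LIMSEQ_unique[OF 1 2])
qed

text \<open>Rotating by \<open>w\<close> treats the real part (\<open>w = 1\<close>) and the imaginary part (\<open>w = \<i>\<close>) at once.\<close>

lemma char_rotated_levy_bm:
  fixes \<tau> :: "'i \<Rightarrow> real"
  assumes "finite I" "\<And>i. i \<in> I \<Longrightarrow> \<tau> i \<in> {0..T}" and w: "cmod w = 1"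
  shows "(CLINT \<omega> | noise. iexp (\<Sum>i\<in>I. r i * Re (cnj w * levy_bm T (\<tau> i) \<omega>)))
    = of_real (exp (- (\<Sum>i\<in>I. \<Sum>j\<in>I. r i * r j * min (\<tau> i) (\<tau> j)) / 2))"
proof -
  have "(Re w)\<^sup>2 + (Im w)\<^sup>2 = 1" using w by (metis cmod_power2 power_one)
  then have "Re (cnj (of_real x * w) * (of_real y * w)) = x * y" for x y
    by (simp add: power2_eq_square) (metis distrib_left mult.left_commute mult.right_neutral mult.commute)
  moreover have "r i * Re (cnj w * z) = Re (cnj (of_real (r i) * w) * z)" for i z
    by (simp add: algebra_simps)
  ultimately show ?thesis
    using char_levy_bm[OF assms(1,2), where a="\<lambda>i. of_real (r i) * w"] by simp
qed

text \<open>The two-point index set \<open>bool\<close> carries weight \<open>x\<close> at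
  \<open>t\<close> and \<open>- x\<close> at \<open>s\<close>.\<close>

lemma char_levy_increment:
  assumes "cmod w = 1" "0 \<le> s" "s < t" "t \<le> T"
  shows "(CLINT \<omega> | noise. iexp (x * (Re (cnj w * levy_bm T t \<omega>) - Re (cnj w * levy_bm T s \<omega>)))) = of_real (exp (- (x\<^sup>2 * (t - s)) / 2))"
  using char_rotated_levy_bm[of "UNIV :: bool set" "\<lambda>b. if b then t else s" w "\<lambda>b. if b then x else - x"] assms
  by (simp add: UNIV_bool power2_eq_square algebra_simps)

lemma standard_brownian_motion_levy_bm:
  assumes w: "cmod w = 1"
  shows "standard_brownian_motion T noise (\<lambda>t \<omega>. Re (cnj w * levy_bm T t \<omega>))"
  unfolding standard_brownian_motion_def
proof (intro conjI ballI allI impI)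
  let ?W = "\<lambda>t \<omega>. Re (cnj w * levy_bm T t \<omega>)"
  have m: "?W t \<in> borel_measurable noise" if "t \<in> {0..T}" for t
    using measurable_levy_bm[OF that] by measurable
  show "prob_space noise" by (rule prob_space_noise)
  show "?W t \<in> borel_measurable noise" if "t \<in> {0..T}" for t using m[OF that] .
  show "AE \<omega> in noise. ?W 0 \<omega> = 0" using levy_bm_0 by eventually_elim simp
  show "continuous_on {0..T} (\<lambda>t. ?W t \<omega>)" for \<omega> by (intro continuous_intros continuous_levy_bm)
  show "distributed noise lborel (\<lambda>\<omega>. ?W t \<omega> - ?W s \<omega>) (normal_density 0 (sqrt (t - s)))"
    if "0 \<le> s \<and> s < t \<and> t \<le> T" for s t
    using that m[of s] m[of t] char_levy_increment[OF w] by (intro L.distributed_normal_of_char borel_measurable_diff) auto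
  show "indep_increments noise {0..T} ?W"
    unfolding indep_increments_def
  proof (intro ballI impI)
    fix s t assume st: "s \<in> {0..T}" "t \<in> {0..T}" "s < t"
    let ?D = "\<lambda>\<omega>. ?W t \<omega> - ?W s \<omega>" and ?K = "{0..T} \<inter> {..s}"
    \<comment> \<open>The increment is dressed as a family over a one-point set to fit the criterion
      for families; the generated sigma-algebras are compared at the end.\<close>
    have ind: "L.indep_set
      (sets (vimage_algebra (space noise) (\<lambda>\<omega>. \<lambda>i\<in>{()}. ?D \<omega>) (Pi\<^sub>M {()} (\<lambda>_. borel))))
      (sets (vimage_algebra (space noise) (\<lambda>\<omega>. \<lambda>u\<in>?K. ?W u \<omega>) (Pi\<^sub>M ?K (\<lambda>_. borel))))"
    proof (rule prob_space_indep_set_vimage_PiM_of_char[OF prob_space_noise])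
      fix I' K' and u :: "unit \<Rightarrow> real" and v :: "real \<Rightarrow> real"
      assume K': "finite K'" "K' \<subseteq> ?K"
      define x where "x = (\<Sum>i\<in>I'. u i)"
      \<comment> \<open>The joint character is one linear functional of the process: past times with
        weights \<open>v\<close>, together with the endpoints \<open>t\<close> and \<open>s\<close>
        with weights \<open>x\<close> and \<open>- x\<close>.\<close>
      define \<tau> where "\<tau> = case_sum (\<lambda>r. r) (\<lambda>b. if b then t else s)"
      define r where "r = case_sum v (\<lambda>b. if b then x else - x)"
      let ?q = "\<Sum>i\<in>K'. \<Sum>j\<in>K'. v i * v j * min i j"
      have \<tau>: "\<tau> i \<in> {0..T}" if "i \<in> K' <+> UNIV" for i using that K' st by (auto simp: \<tau>_def)
      have "(CLINT \<omega> | noise. iexp (\<Sum>i\<in>I'. u i * ?D \<omega>) * iexp (\<Sum>j\<in>K'. v j * ?W j \<omega>))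
        = (CLINT \<omega> | noise. iexp (\<Sum>i\<in>K' <+> UNIV. r i * ?W (\<tau> i) \<omega>))"
      proof (intro Bochner_Integration.integral_cong refl)
        fix \<omega>
        have "(\<Sum>i\<in>K' <+> UNIV. r i * W (\<tau> i)) = x * (W t - W s) + (\<Sum>j\<in>K'. v j * W j)" for W
          using K'(1) by (simp add: sum.Plus r_def \<tau>_def UNIV_bool algebra_simps)
        from this[of "\<lambda>t. ?W t \<omega>"]
        have "iexp (\<Sum>i\<in>K' <+> UNIV. r i * ?W (\<tau> i) \<omega>) = iexp (x * ?D \<omega>) * iexp (\<Sum>j\<in>K'. v j * ?W j \<omega>)"
          by (simp only: iexp_add)
        then show "iexp (\<Sum>i\<in>I'. u i * ?D \<omega>) * iexp (\<Sum>j\<in>K'. v j * ?W j \<omega>) = iexp (\<Sum>i\<in>K' <+> UNIV. r i * ?W (\<tau> i) \<omega>)"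
          by (simp only: x_def sum_distrib_right)
      qed
      also have "\<dots> = of_real (exp (- (\<Sum>i\<in>K' <+> UNIV. \<Sum>j\<in>K' <+> UNIV. r i * r j * min (\<tau> i) (\<tau> j)) / 2))"
        by (rule char_rotated_levy_bm[OF _ \<tau> w]) (use K' in auto)
      also have "(\<Sum>i\<in>K' <+> UNIV. \<Sum>j\<in>K' <+> UNIV. r i * r j * min (\<tau> i) (\<tau> j)) = ?q + x\<^sup>2 * (t - s)"
      proof -
        have cross: "(\<Sum>j\<in>K'. r (Inl j) * r (Inr b) * min (\<tau> (Inl j)) (\<tau> (Inr b))) = (\<Sum>j\<in>K'. v j * r (Inr b) * j)" for b
          using K' st by (intro sum.cong) (auto simp: r_def \<tau>_def min_def)
        have cross': "(\<Sum>j\<in>K'. r (Inr b) * r (Inl j) * min (\<tau> (Inr b)) (\<tau> (Inl j))) = (\<Sum>j\<in>K'. v j * r (Inr b) * j)" for b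
          using K' st by (intro sum.cong) (auto simp: r_def \<tau>_def min_def)
        have "(\<Sum>i\<in>K' <+> UNIV. \<Sum>j\<in>K' <+> UNIV. r i * r j * min (\<tau> i) (\<tau> j))
          = ?q + (\<Sum>b\<in>UNIV. \<Sum>j\<in>K'. v j * r (Inr b) * j) + ((\<Sum>b\<in>UNIV. \<Sum>j\<in>K'. v j * r (Inr b) * j) + x\<^sup>2 * (t - s))"
        proof -
          have "(\<Sum>i\<in>K'. \<Sum>b\<in>(UNIV::bool set). r (Inl i) * r (Inr b) * min (\<tau> (Inl i)) (\<tau> (Inr b))) = (\<Sum>b\<in>UNIV. \<Sum>j\<in>K'. v j * r (Inr b) * j)"
            by (subst sum.swap) (simp only: cross)
          moreover have "(\<Sum>b\<in>(UNIV::bool set). \<Sum>b'\<in>(UNIV::bool set). r (Inr b) * r (Inr b') * min (\<tau> (Inr b)) (\<tau> (Inr b'))) = x\<^sup>2 * (t - s)"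
            using st by (simp add: UNIV_bool r_def \<tau>_def power2_eq_square algebra_simps)
          moreover have "(\<Sum>i\<in>K'. \<Sum>j\<in>K'. r (Inl i) * r (Inl j) * min (\<tau> (Inl i)) (\<tau> (Inl j))) = ?q"
            by (simp add: r_def \<tau>_def)
          ultimately show ?thesis
            using K'(1) by (simp only: sum.Plus finite_code o_def sum.distrib cross')
        qed
        \<comment> \<open>A past time \<open>j\<close> satisfies min j t = min j s = j, so its
          covariances with the two endpoints cancel under the weights \<open>x\<close> and
          \<open>- x\<close>.\<close>
        also have "(\<Sum>b\<in>UNIV. \<Sum>j\<in>K'. v j * r (Inr b) * j) = 0"
          by (simp add: UNIV_bool r_def sum.distrib[symmetric])
        finally show ?thesis by simp
      qed
      also have "complex_of_real (exp (- (?q + x\<^sup>2 * (t - s)) / 2)) = of_real (exp (- (x\<^sup>2 * (t - s)) / 2)) * of_real (exp (- ?q / 2))"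
        by (simp add: of_real_mult[symmetric] exp_add[symmetric] add_divide_distrib del: of_real_mult)
      also have "of_real (exp (- (x\<^sup>2 * (t - s)) / 2)) = (CLINT \<omega> | noise. iexp (\<Sum>i\<in>I'. u i * ?D \<omega>))"
        using char_levy_increment[OF w, of s t x] st by (simp only: x_def sum_distrib_right[symmetric]) auto
      also have "of_real (exp (- ?q / 2)) = (CLINT \<omega> | noise. iexp (\<Sum>j\<in>K'. v j * ?W j \<omega>))"
        by (rule char_rotated_levy_bm[symmetric]) (use K' w in auto)
      finally show "(CLINT \<omega> | noise. iexp (\<Sum>i\<in>I'. u i * ?D \<omega>) * iexp (\<Sum>j\<in>K'. v j * ?W j \<omega>))
        = (CLINT \<omega> | noise. iexp (\<Sum>i\<in>I'. u i * ?D \<omega>)) * (CLINT \<omega> | noise. iexp (\<Sum>j\<in>K'. v j * ?W j \<omega>))" .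
    next
      show "?D \<in> borel_measurable noise" using m st by (intro borel_measurable_diff) auto
    qed (use m in auto)
    have sub: "sets (vimage_algebra (space noise) ?D borel) \<subseteq> sets (vimage_algebra (space noise) (\<lambda>\<omega>. \<lambda>i\<in>{()}. ?D \<omega>) (Pi\<^sub>M {()} (\<lambda>_. borel)))"
      (is "_ \<subseteq> sets ?V")
    proof -
      have "(\<lambda>\<omega>. \<lambda>i\<in>{()}. ?D \<omega>) \<in> measurable ?V (Pi\<^sub>M {()} (\<lambda>_. borel))"
        by (rule measurable_vimage_algebra1) (auto simp: space_PiM)
      from measurable_compose[OF this measurable_component_singleton[of "()"]]
      have "?D \<in> borel_measurable ?V" by simp
      from measurable_sets[OF this] show ?thesis
        by (auto simp: sets_vimage_algebra2)
    qed
    show "L.indep_set (sets (vimage_algebra (space noise) ?D borel))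
       (sets (vimage_algebra (space noise) (\<lambda>\<omega>. \<lambda>u\<in>?K. ?W u \<omega>) (Pi\<^sub>M ?K (\<lambda>_. borel))))"
      using ind sub unfolding L.indep_sets2_eq by blast
  qed
qed

lemma complex_brownian_motion_levy_bm: "complex_brownian_motion T noise (levy_bm T)"
  unfolding complex_brownian_motion_def
proof (intro conjI)
  show "standard_brownian_motion T noise (\<lambda>t \<omega>. Re (levy_bm T t \<omega>))"
    using standard_brownian_motion_levy_bm[of 1] by simp
  show "standard_brownian_motion T noise (\<lambda>t \<omega>. Im (levy_bm T t \<omega>))"
    using standard_brownian_motion_levy_bm[of \<i>] by simp
  let ?R = "\<lambda>t \<omega>. Re (levy_bm T t \<omega>)" and ?J = "\<lambda>t \<omega>. Im (levy_bm T t \<omega>)"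
  have mR: "?R t \<in> borel_measurable noise" and mJ: "?J t \<in> borel_measurable noise" if "t \<in> {0..T}" for t
    using measurable_levy_bm[OF that] by measurable
  have "L.indep_set
      (sets (vimage_algebra (space noise) (\<lambda>\<omega>. \<lambda>t\<in>{0..T}. ?R t \<omega>) (Pi\<^sub>M {0..T} (\<lambda>_. borel))))
      (sets (vimage_algebra (space noise) (\<lambda>\<omega>. \<lambda>t\<in>{0..T}. ?J t \<omega>) (Pi\<^sub>M {0..T} (\<lambda>_. borel))))"
  proof (rule prob_space_indep_set_vimage_PiM_of_char[OF prob_space_noise])
    fix I' K' and u v :: "real \<Rightarrow> real"
    assume I': "finite I'" "I' \<subseteq> {0..T}" and K': "finite K'" "K' \<subseteq> {0..T}"
    define \<tau> where "\<tau> = case_sum (\<lambda>r::real. r) (\<lambda>r. r)"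
    \<comment> \<open>Real frequencies read the real part, purely imaginary ones the imaginary part.
      The two kinds are orthogonal in the plane, so no cross terms survive in the exponent.\<close>
    define a where "a = case_sum (\<lambda>r. complex_of_real (u r)) (\<lambda>r. of_real (v r) * \<i>)"
    let ?p = "\<Sum>i\<in>I'. \<Sum>j\<in>I'. u i * u j * min i j"
    let ?q = "\<Sum>i\<in>K'. \<Sum>j\<in>K'. v i * v j * min i j"
    have "(CLINT \<omega> | noise. iexp (\<Sum>i\<in>I'. u i * ?R i \<omega>) * iexp (\<Sum>j\<in>K'. v j * ?J j \<omega>))
      = (CLINT \<omega> | noise. iexp (\<Sum>i\<in>I' <+> K'. Re (cnj (a i) * levy_bm T (\<tau> i) \<omega>)))"
      using I' K' by (intro Bochner_Integration.integral_cong refl)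
        (simp add: sum.Plus a_def \<tau>_def exp_add[symmetric] algebra_simps)
    also have "\<dots> = of_real (exp (- (\<Sum>i\<in>I' <+> K'. \<Sum>j\<in>I' <+> K'. Re (cnj (a i) * a j) * min (\<tau> i) (\<tau> j)) / 2))"
      by (rule char_levy_bm) (use I' K' in \<open>auto simp: \<tau>_def\<close>)
    also have "(\<Sum>i\<in>I' <+> K'. \<Sum>j\<in>I' <+> K'. Re (cnj (a i) * a j) * min (\<tau> i) (\<tau> j)) = ?p + ?q"
      using I' K' by (simp add: sum.Plus a_def \<tau>_def)
    also have "complex_of_real (exp (- (?p + ?q) / 2)) = of_real (exp (- ?p / 2)) * of_real (exp (- ?q / 2))"
      by (simp add: of_real_mult[symmetric] exp_add[symmetric] add_divide_distrib del: of_real_mult)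
    also have "of_real (exp (- ?p / 2)) = (CLINT \<omega> | noise. iexp (\<Sum>i\<in>I'. u i * ?R i \<omega>))"
      using char_rotated_levy_bm[of I' "\<lambda>x. x" 1 u] I' by (auto simp: subset_eq)
    also have "of_real (exp (- ?q / 2)) = (CLINT \<omega> | noise. iexp (\<Sum>i\<in>K'. v i * ?J i \<omega>))"
      using char_rotated_levy_bm[of K' "\<lambda>x. x" \<i> v] K' by (auto simp: subset_eq)
    finally show "(CLINT \<omega> | noise. iexp (\<Sum>i\<in>I'. u i * ?R i \<omega>) * iexp (\<Sum>j\<in>K'. v j * ?J j \<omega>))
      = (CLINT \<omega> | noise. iexp (\<Sum>i\<in>I'. u i * ?R i \<omega>)) * (CLINT \<omega> | noise. iexp (\<Sum>j\<in>K'. v j * ?J j \<omega>))" .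
  qed (use mR mJ in auto)
  then show "L.indep_var (Pi\<^sub>M {0..T} (\<lambda>_. borel)) (\<lambda>\<omega>. \<lambda>t\<in>{0..T}. ?R t \<omega>) (Pi\<^sub>M {0..T} (\<lambda>_. borel)) (\<lambda>\<omega>. \<lambda>t\<in>{0..T}. ?J t \<omega>)"
    unfolding L.indep_var_eq sets_vimage_algebra using mR mJ by (auto intro!: measurable_restrict)
qed

end


section \<open>Time integrals\<close>

lemma set_integrable_Icc_bounded:
  fixes f :: "real \<Rightarrow> 'b::{banach, second_countable_topology}"
  assumes [measurable]: "f \<in> borel_measurable borel" and "\<And>s. s \<in> {a..b} \<Longrightarrow> norm (f s) \<le> C"
  shows "set_integrable lborel {a..b} f"
  unfolding set_integrable_def
  by (rule integrableI_bounded_set[where A="{a..b}" and B=C])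
     (use assms(2) in \<open>auto simp: emeasure_lborel_Icc_eq\<close>)

lemma norm_set_integral_le:
  fixes f :: "'a \<Rightarrow> 'b::{banach, second_countable_topology}"
  assumes "set_integrable M A g" "\<And>s. s \<in> A \<Longrightarrow> norm (f s) \<le> g s"
  shows "norm (LINT s:A|M. f s) \<le> (LINT s:A|M. g s)"
  using assms unfolding set_integrable_def set_lebesgue_integral_def
  by (intro norm_integral_le_integral) (auto simp: indicator_def)

lemma norm_set_integral_Icc_le:
  fixes f :: "real \<Rightarrow> 'b::{banach, second_countable_topology}"
  assumes "\<And>s. s \<in> {a..b} \<Longrightarrow> norm (f s) \<le> C" "a \<le> b"
  shows "norm (LBINT s:{a..b}. f s) \<le> C * (b - a)"
proof -
  have "norm (LBINT s:{a..b}. f s) \<le> (LBINT s:{a..b}. C)"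
    using assms(1) by (intro norm_set_integral_le set_integrable_Icc_bounded[where C="norm C"]) auto
  also have "\<dots> = C * (b - a)" using assms(2) by (simp add: set_lebesgue_integral_def mult.commute)
  finally show ?thesis .
qed

lemma measurable_set_integral_Icc:
  fixes g :: "'a \<Rightarrow> real \<Rightarrow> 'b::{banach, second_countable_topology}"
  assumes [measurable]: "(\<lambda>(x, s). g x s) \<in> borel_measurable (N \<Otimes>\<^sub>M borel)" "l \<in> borel_measurable N" "u \<in> borel_measurable N"
  shows "(\<lambda>x. LBINT s:{l x..u x}. g x s) \<in> borel_measurable N"
proof -
  have "(\<lambda>x. \<integral>s. (if l x \<le> s \<and> s \<le> u x then g x s else 0) \<partial>lborel) \<in> borel_measurable N"
    by measurable
  moreover have "(LBINT s:{l x..u x}. g x s) = (\<integral>s. (if l x \<le> s \<and> s \<le> u x then g x s else 0) \<partial>lborel)" for x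
    unfolding set_lebesgue_integral_def by (intro Bochner_Integration.integral_cong) (auto simp: indicator_def)
  ultimately show ?thesis by simp
qed

lemma (in finite_measure) Fubini_set_integral_Icc:
  fixes f :: "real \<Rightarrow> 'a \<Rightarrow> 'b::{banach, second_countable_topology}"
  assumes f[measurable]: "(\<lambda>(s, \<omega>). f s \<omega>) \<in> borel_measurable (borel \<Otimes>\<^sub>M M)"
    and C: "\<And>s \<omega>. s \<in> {a..b} \<Longrightarrow> norm (f s \<omega>) \<le> C"
  shows "(\<integral>\<omega>. (LBINT s:{a..b}. f s \<omega>) \<partial>M) = (LBINT s:{a..b}. \<integral>\<omega>. f s \<omega> \<partial>M)"
proof -
  interpret P: pair_sigma_finite lborel M ..
  have "integrable (lborel \<Otimes>\<^sub>M M) (\<lambda>(s, \<omega>). indicator {a..b} s *\<^sub>R f s \<omega>)"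
  proof (rule integrableI_bounded_set[where A="{a..b} \<times> space M" and B=C])
    show "emeasure (lborel \<Otimes>\<^sub>M M) ({a..b} \<times> space M) < \<infinity>"
      by (subst emeasure_pair_measure_Times) (auto simp: emeasure_lborel_Icc_eq ennreal_mult_eq_top_iff less_top[symmetric] emeasure_eq_measure)
  qed (use C in \<open>auto simp: space_pair_measure indicator_def\<close>)
  from P.Fubini_integral[OF this] show ?thesis
    by (simp add: set_lebesgue_integral_def)
qed

text \<open>Integration by parts for absolutely continuous functions with merely measurable
  densities: the square is split along its diagonal and the order of integration is exchanged on one
  triangle.\<close>

lemma set_integral_product_rule:
  fixes u v :: "real \<Rightarrow> complex"
  assumes [measurable]: "u \<in> borel_measurable borel" "v \<in> borel_measurable borel"
    and u: "\<And>s. s \<in> {a..t} \<Longrightarrow> cmod (u s) \<le> C" and v: "\<And>s. s \<in> {a..t} \<Longrightarrow> cmod (v s) \<le> D"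
  shows "(CLBINT s:{a..t}. u s) * (CLBINT s:{a..t}. v s)
    = (CLBINT s:{a..t}. u s * (CLBINT r:{a..s}. v r) + v s * (CLBINT r:{a..s}. u r))"
proof (cases "a \<le> t")
  case False
  then show ?thesis by (simp add: set_lebesgue_integral_def)
next
  case True
  have C0: "0 \<le> C" using True by (intro order_trans[OF norm_ge_zero u[of t]]) auto
  have D0: "0 \<le> D" using True by (intro order_trans[OF norm_ge_zero v[of t]]) auto
  have iu: "set_integrable lborel {a..s} u" and iv: "set_integrable lborel {a..s} v" if "s \<le> t" for s
    using u v that by (auto intro: set_integrable_Icc_bounded[where C=C] set_integrable_Icc_bounded[where C=D])
  have mu: "(\<lambda>s. CLBINT r:{a..s}. u r) \<in> borel_measurable borel" and mv: "(\<lambda>s. CLBINT r:{a..s}. v r) \<in> borel_measurable borel"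
    by (rule measurable_set_integral_Icc; measurable)+
  have bu: "cmod (CLBINT r:{a..s}. u r) \<le> C * (t - a)" and bv: "cmod (CLBINT r:{a..s}. v r) \<le> D * (t - a)" if "s \<in> {a..t}" for s
  proof -
    have "cmod (CLBINT r:{a..s}. u r) \<le> C * (s - a)" using u that by (intro norm_set_integral_Icc_le) auto
    also have "\<dots> \<le> C * (t - a)" using that C0 by (intro mult_left_mono) auto
    finally show "cmod (CLBINT r:{a..s}. u r) \<le> C * (t - a)" .
    have "cmod (CLBINT r:{a..s}. v r) \<le> D * (s - a)" using v that by (intro norm_set_integral_Icc_le) auto
    also have "\<dots> \<le> D * (t - a)" using that D0 by (intro mult_left_mono) auto
    finally show "cmod (CLBINT r:{a..s}. v r) \<le> D * (t - a)" .
  qed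
  define U V where "U s = indicator {a..t} s *\<^sub>R u s" and "V s = indicator {a..t} s *\<^sub>R v s" for s
  have [measurable]: "U \<in> borel_measurable borel" "V \<in> borel_measurable borel" unfolding U_def[abs_def] V_def[abs_def] by auto
  have UV: "cmod (U s * V r) \<le> C * D" for s r
    using u[of s] v[of r] C0 D0 by (auto simp: U_def V_def norm_mult indicator_def intro: mult_mono)
  \<comment> \<open>The upper triangle, read first with the earlier and then with the later variable
    outside.\<close>
  have upper: "(\<integral>s. U s * (CLBINT r:{s<..t}. v r) \<partial>lborel) = (\<integral>r. V r * (CLBINT s:{a..r}. u s) \<partial>lborel)"
  proof -
    have UVp: "cmod (case p of (s, r) \<Rightarrow> if s < r then U s * V r else 0) \<le> C * D" for p
      using UV C0 D0 by (cases p) auto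
    have "integrable (lborel \<Otimes>\<^sub>M lborel) (\<lambda>(s, r). if s < r then U s * V r else 0)"
    proof (rule integrableI_bounded_set[where A="{a..t} \<times> {a..t}" and B="C * D"])
      show "emeasure (lborel \<Otimes>\<^sub>M lborel) ({a..t} \<times> {a..t}) < \<infinity>"
        by (subst lborel.emeasure_pair_measure_Times) (auto simp: emeasure_lborel_Icc_eq ennreal_mult_eq_top_iff less_top[symmetric])
      show "AE p\<in>{a..t} \<times> {a..t} in lborel \<Otimes>\<^sub>M lborel. cmod (case p of (s, r) \<Rightarrow> if s < r then U s * V r else 0) \<le> C * D"
        using UVp by simp
    qed (auto simp: U_def V_def indicator_def split: if_splits)
    from lborel_pair.Fubini_integral[OF this]
    have "(\<integral>s. \<integral>r. (if s < r then U s * V r else 0) \<partial>lborel \<partial>lborel) = (\<integral>r. \<integral>s. (if s < r then U s * V r else 0) \<partial>lborel \<partial>lborel)"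
      by simp
    moreover have "(\<integral>r. (if s < r then U s * V r else 0) \<partial>lborel) = U s * (CLBINT r:{s<..t}. v r)" for s
    proof (cases "s \<in> {a..t}")
      case True
      have "(\<integral>r. (if s < r then U s * V r else 0) \<partial>lborel) = (\<integral>r. U s * (indicator {s<..t} r *\<^sub>R v r) \<partial>lborel)"
        using True by (intro Bochner_Integration.integral_cong) (auto simp: V_def indicator_def)
      then show ?thesis by (simp only: set_lebesgue_integral_def integral_mult_right_zero)
    next
      case False
      then have "U s = 0" by (simp add: U_def)
      then show ?thesis by (simp cong: if_cong)
    qed
    moreover have "(\<integral>s. (if s < r then U s * V r else 0) \<partial>lborel) = V r * (CLBINT s:{a..r}. u s)" for r
    proof (cases "r \<in> {a..t}")
      case True
      have "(\<integral>s. (if s < r then U s * V r else 0) \<partial>lborel) = (\<integral>s. V r * (indicator {a..r} s *\<^sub>R u s) \<partial>lborel)"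
      proof (rule integral_cong_AE)
        \<comment> \<open>The closed interval differs from the strict inequality by the diagonal
          point, a null set.\<close>
        show "AE s in lborel. (if s < r then U s * V r else 0) = V r * (indicator {a..r} s *\<^sub>R u s)"
          using AE_lborel_singleton[of r] by eventually_elim (use True in \<open>auto simp: U_def indicator_def\<close>)
      qed auto
      then show ?thesis by (simp only: set_lebesgue_integral_def integral_mult_right_zero)
    next
      case False
      then have "V r = 0" by (simp add: V_def)
      then show ?thesis by (simp cong: if_cong)
    qed
    ultimately show ?thesis by simp
  qed
  have split: "(CLBINT r:{a..t}. v r) = (CLBINT r:{a..s}. v r) + (CLBINT r:{s<..t}. v r)" if "s \<in> {a..t}" for s
  proof -
    have "{a..t} = {a..s} \<union> {s<..t}" using that by auto
    moreover have "set_integrable lborel {s<..t} v"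
      by (rule set_integrable_subset[OF iv[of t]]) (use that in auto)
    moreover have "set_integrable lborel {a..s} v" using that by (intro iv) auto
    ultimately show ?thesis by (auto intro!: set_integral_Un)
  qed
  have muv: "(\<lambda>s. CLBINT r:{s<..t}. v r) \<in> borel_measurable borel"
  proof -
    have "(\<lambda>s. \<integral>r. (if s < r \<and> r \<le> t then v r else 0) \<partial>lborel) \<in> borel_measurable borel" by measurable
    moreover have "(CLBINT r:{s<..t}. v r) = (\<integral>r. (if s < r \<and> r \<le> t then v r else 0) \<partial>lborel)" for s
      unfolding set_lebesgue_integral_def by (intro Bochner_Integration.integral_cong) (auto simp: indicator_def)
    ultimately show ?thesis by simp
  qed
  have i1: "integrable lborel (\<lambda>s. U s * (CLBINT r:{a..s}. v r))" and i2: "integrable lborel (\<lambda>s. V s * (CLBINT r:{a..s}. u r))"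
  proof -
    have "set_integrable lborel {a..t} (\<lambda>s. u s * (CLBINT r:{a..s}. v r))"
      by (rule set_integrable_Icc_bounded[where C="C * (D * (t - a))"])
         (use mv u bv C0 in \<open>auto simp: norm_mult intro!: mult_mono\<close>)
    then show "integrable lborel (\<lambda>s. U s * (CLBINT r:{a..s}. v r))" by (simp add: set_integrable_def U_def)
    have "set_integrable lborel {a..t} (\<lambda>s. v s * (CLBINT r:{a..s}. u r))"
      by (rule set_integrable_Icc_bounded[where C="D * (C * (t - a))"])
         (use mu v bu D0 in \<open>auto simp: norm_mult intro!: mult_mono\<close>)
    then show "integrable lborel (\<lambda>s. V s * (CLBINT r:{a..s}. u r))" by (simp add: set_integrable_def V_def)
  qed
  have i3: "integrable lborel (\<lambda>s. U s * (CLBINT r:{s<..t}. v r))"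
  proof -
    have b2: "cmod ((CLBINT r:{a..t}. v r) - (CLBINT r:{a..s}. v r)) \<le> D * (t - a) + D * (t - a)" if "s \<in> {a..t}" for s
      using bv[of t] bv[OF that] True by (intro order_trans[OF norm_triangle_ineq4] add_mono) auto
    have "set_integrable lborel {a..t} (\<lambda>s. u s * ((CLBINT r:{a..t}. v r) - (CLBINT r:{a..s}. v r)))"
      by (rule set_integrable_Icc_bounded[where C="C * (D * (t - a) + D * (t - a))"])
         (use mv u b2 C0 True in \<open>auto simp: norm_mult intro!: mult_mono simp del: mult_2[symmetric]\<close>)
    moreover have "indicator {a..t} s *\<^sub>R (u s * ((CLBINT r:{a..t}. v r) - (CLBINT r:{a..s}. v r))) = U s * (CLBINT r:{s<..t}. v r)" for s
      using split[of s] by (auto simp: U_def indicator_def)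
    ultimately show ?thesis by (simp add: set_integrable_def)
  qed
  have "(CLBINT s:{a..t}. u s) * (CLBINT s:{a..t}. v s) = (\<integral>s. U s * (CLBINT r:{a..t}. v r) \<partial>lborel)"
    by (simp only: U_def set_lebesgue_integral_def integral_mult_left_zero)
  also have "\<dots> = (\<integral>s. U s * (CLBINT r:{a..s}. v r) + U s * (CLBINT r:{s<..t}. v r) \<partial>lborel)"
  proof (rule Bochner_Integration.integral_cong[OF refl])
    fix s
    show "U s * (CLBINT r:{a..t}. v r) = U s * (CLBINT r:{a..s}. v r) + U s * (CLBINT r:{s<..t}. v r)"
      using split[of s] by (cases "s \<in> {a..t}") (auto simp: U_def distrib_left)
  qed
  also have "\<dots> = (\<integral>s. U s * (CLBINT r:{a..s}. v r) + V s * (CLBINT r:{a..s}. u r) \<partial>lborel)"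
    using i1 i2 i3 upper by simp
  also have "\<dots> = (CLBINT s:{a..t}. u s * (CLBINT r:{a..s}. v r) + v s * (CLBINT r:{a..s}. u r))"
    unfolding set_lebesgue_integral_def
    by (rule Bochner_Integration.integral_cong[OF refl]) (simp add: U_def V_def scaleR_add_right set_lebesgue_integral_def)
  finally show ?thesis .
qed


section \<open>Processes with independent increments\<close>

lemma measurable_coarser:
  assumes f: "f \<in> measurable A N" and "space A = space B" "sets A \<subseteq> sets B"
  shows "f \<in> measurable B N"
proof (rule measurableI)
  show "f x \<in> space N" if "x \<in> space B" for x using measurable_space[OF f] that assms(2) by simp
  show "f -` S \<inter> space B \<in> sets B" if "S \<in> sets N" for S using measurable_sets[OF f that] assms(2,3) by auto
qed

locale increment_process = prob_space M for M :: "'a measure" +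
  fixes X :: "real \<Rightarrow> 'a \<Rightarrow> real"
  assumes jointly: "jointly_measurable M X" and indep: "indep_increments M {0..} X"
begin

abbreviation (input) gen :: "real \<Rightarrow> 'a measure" where
  "gen a \<equiv> vimage_algebra (space M) (\<lambda>\<omega>. \<lambda>u\<in>{0..} \<inter> {..a}. X u \<omega>) (Pi\<^sub>M ({0..} \<inter> {..a}) (\<lambda>_. borel))"

text \<open>The history up to time \<open>a\<close> is completed by null sets: the process is only jointly measurable,
  not progressively measurable, so time integrals are measurable for the history only up to null sets.\<close>

definition past_sets :: "real \<Rightarrow> 'a set set" where
  "past_sets a = {A \<in> sets M. \<exists>B\<in>sets (gen a). AE \<omega> in M. \<omega> \<in> A \<longleftrightarrow> \<omega> \<in> B}"

definition past :: "real \<Rightarrow> 'a measure" where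
  "past a = sigma (space M) (past_sets a)"

lemma sigma_algebra_past_sets: "sigma_algebra (space M) (past_sets a)"
  unfolding sigma_algebra_iff2
proof (intro conjI ballI allI impI)
  show "past_sets a \<subseteq> Pow (space M)" using sets.sets_into_space by (auto simp: past_sets_def)
  show "{} \<in> past_sets a" by (auto simp: past_sets_def intro!: bexI[of _ "{}"])
  fix A assume "A \<in> past_sets a"
  then obtain B where B: "A \<in> sets M" "B \<in> sets (gen a)" "AE \<omega> in M. \<omega> \<in> A \<longleftrightarrow> \<omega> \<in> B" by (auto simp: past_sets_def)
  have "space M - B \<in> sets (gen a)" using sets.compl_sets[OF B(2)] by simp
  moreover have "AE \<omega> in M. \<omega> \<in> space M - A \<longleftrightarrow> \<omega> \<in> space M - B" using B(3) by eventually_elim auto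
  moreover have "space M - A \<in> sets M" using B(1) by auto
  ultimately show "space M - A \<in> past_sets a"
    unfolding past_sets_def by (intro CollectI conjI bexI[of _ "space M - B"])
next
  fix A :: "nat \<Rightarrow> 'a set" assume "range A \<subseteq> past_sets a"
  then have A: "A i \<in> past_sets a" for i by auto
  then have "\<forall>i. \<exists>B. B \<in> sets (gen a) \<and> (AE \<omega> in M. \<omega> \<in> A i \<longleftrightarrow> \<omega> \<in> B)" unfolding past_sets_def by blast
  from choice[OF this] obtain B where B: "\<And>i. A i \<in> sets M" "\<And>i. B i \<in> sets (gen a)" "\<And>i. AE \<omega> in M. \<omega> \<in> A i \<longleftrightarrow> \<omega> \<in> B i"
    using A unfolding past_sets_def by blast
  have "(\<Union>i. B i) \<in> sets (gen a)" by (rule sets.countable_nat_UN) (rule image_subsetI, rule B(2))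
  moreover have "AE \<omega> in M. \<forall>i. \<omega> \<in> A i \<longleftrightarrow> \<omega> \<in> B i" using B(3) by (simp add: AE_all_countable)
  then have "AE \<omega> in M. \<omega> \<in> (\<Union>i. A i) \<longleftrightarrow> \<omega> \<in> (\<Union>i. B i)" by eventually_elim auto
  moreover have "(\<Union>i. A i) \<in> sets M" by (rule sets.countable_nat_UN) (rule image_subsetI, rule B(1))
  ultimately show "(\<Union>i. A i) \<in> past_sets a"
    unfolding past_sets_def by (intro CollectI conjI bexI[of _ "\<Union>i. B i"])
qed

lemma space_past [simp]: "space (past a) = space M"
  using sigma_algebra.space_measure_of_eq[OF sigma_algebra_past_sets] by (simp add: past_def)

lemma sets_past: "sets (past a) = past_sets a"
  unfolding past_def by (rule sigma_algebra.sets_measure_of_eq[OF sigma_algebra_past_sets])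

lemma subalgebra_past: "subalgebra M (past a)"
  by (auto simp: subalgebra_def sets_past past_sets_def)

lemma measurable_past_imp: "f \<in> measurable (past a) N \<Longrightarrow> f \<in> measurable M N"
  by (rule measurable_from_subalg[OF subalgebra_past])

text \<open>Clamping negative times to 0 extends the process to the whole line, so that ordinary
  Borel measurability in time is available everywhere below.\<close>

lemma measurable_X_time: "(\<lambda>(s, \<omega>). X (max 0 s) \<omega>) \<in> borel_measurable (borel \<Otimes>\<^sub>M M)"
proof -
  have "(\<lambda>p. max 0 (fst p)) \<in> measurable (borel \<Otimes>\<^sub>M M) (restrict_space borel {0::real..})"
    by (rule measurable_restrict_space2) auto
  then have "(\<lambda>p. (max 0 (fst p), snd p)) \<in> measurable (borel \<Otimes>\<^sub>M M) (restrict_space borel {0::real..} \<Otimes>\<^sub>M M)"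
    by (intro measurable_Pair) auto
  from measurable_compose[OF this jointly[unfolded jointly_measurable_def]] show ?thesis
    by (simp add: case_prod_beta)
qed

lemma measurable_X: "0 \<le> t \<Longrightarrow> X t \<in> borel_measurable M"
  using measurable_compose[OF measurable_Pair1' measurable_X_time, of t] by (simp add: max_def)

lemma gen_subset: assumes "A \<in> sets (gen a)" shows "A \<in> sets M"
proof -
  have "(\<lambda>\<omega>. \<lambda>u\<in>{0..} \<inter> {..a}. X u \<omega>) \<in> measurable M (Pi\<^sub>M ({0..} \<inter> {..a}) (\<lambda>_. borel))"
    using measurable_X by (intro measurable_restrict) auto
  from measurable_sets[OF this] show ?thesis
    using assms by (subst (asm) sets_vimage_algebra2) (auto simp: space_PiM)
qed

lemma gen_past: "A \<in> sets (gen a) \<Longrightarrow> A \<in> sets (past a)"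
  using gen_subset by (auto simp: sets_past past_sets_def)

lemma measurable_X_past:
  assumes "0 \<le> u" "u \<le> a"
  shows "X u \<in> borel_measurable (past a)"
proof -
  have "(\<lambda>\<omega>. \<lambda>u\<in>{0..} \<inter> {..a}. X u \<omega>) \<in> measurable (gen a) (Pi\<^sub>M ({0..} \<inter> {..a}) (\<lambda>_. borel))"
    by (rule measurable_vimage_algebra1) (auto simp: space_PiM)
  from measurable_compose[OF this measurable_component_singleton[of u]] assms
  have "X u \<in> borel_measurable (gen a)" by simp
  then show ?thesis by (rule measurable_coarser) (use gen_past in auto)
qed

lemma past_mono:
  assumes "0 \<le> a" "a \<le> b" "f \<in> measurable (past a) N"
  shows "f \<in> measurable (past b) N"
proof -
  let ?r = "\<lambda>a \<omega>. \<lambda>u\<in>{0..} \<inter> {..a}. X u \<omega>"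
  have "sets (gen a) \<subseteq> sets (gen b)"
  proof
    fix A assume "A \<in> sets (gen a)"
    then obtain B where B: "B \<in> sets (Pi\<^sub>M ({0..} \<inter> {..a}) (\<lambda>_. borel))" "A = ?r a -` B \<inter> space M"
      by (subst (asm) sets_vimage_algebra2) (auto simp: space_PiM)
    have "?r b \<in> measurable (gen b) (Pi\<^sub>M ({0..} \<inter> {..b}) (\<lambda>_. borel))"
      by (rule measurable_vimage_algebra1) (auto simp: space_PiM)
    moreover have sub: "{0..} \<inter> {..a} \<subseteq> {0..} \<inter> {..b}" using assms(2) by auto
    ultimately have "(\<lambda>\<omega>. restrict (?r b \<omega>) ({0..} \<inter> {..a})) \<in> measurable (gen b) (Pi\<^sub>M ({0..} \<inter> {..a}) (\<lambda>_. borel))"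
      by (rule measurable_compose[OF _ measurable_restrict_subset])
    moreover have "restrict (?r b \<omega>) ({0..} \<inter> {..a}) = ?r a \<omega>" for \<omega>
      using sub by (auto simp: restrict_def fun_eq_iff)
    ultimately have "?r a \<in> measurable (gen b) (Pi\<^sub>M ({0..} \<inter> {..a}) (\<lambda>_. borel))" by simp
    from measurable_sets[OF this B(1)] show "A \<in> sets (gen b)" by (simp add: B(2))
  qed
  then have "sets (past a) \<subseteq> sets (past b)" by (auto simp: sets_past past_sets_def)
  then show ?thesis by (intro measurable_coarser[OF assms(3)]) auto
qed

text \<open>This is what the completion provides: the preimages under \<open>f\<close> and
  \<open>g\<close> differ by null sets, and the completed history absorbs them.\<close>

lemma measurable_past_cong_AE:
  assumes f: "f \<in> borel_measurable M" and g: "g \<in> borel_measurable (past a)" and eq: "AE \<omega> in M. f \<omega> = g \<omega>"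
  shows "f \<in> borel_measurable (past a)"
proof (rule measurableI)
  fix A :: "'b set" assume A: "A \<in> sets borel"
  have "g -` A \<inter> space M \<in> sets (past a)" using measurable_sets[OF g A] by simp
  then obtain B where B: "B \<in> sets (gen a)" "AE \<omega> in M. \<omega> \<in> g -` A \<inter> space M \<longleftrightarrow> \<omega> \<in> B"
    by (auto simp: sets_past past_sets_def)
  have "AE \<omega> in M. \<omega> \<in> f -` A \<inter> space M \<longleftrightarrow> \<omega> \<in> B" using B(2) eq by eventually_elim auto
  then show "f -` A \<inter> space (past a) \<in> sets (past a)"
    using B(1) measurable_sets[OF f A] by (auto simp: sets_past past_sets_def)
qed simp

text \<open>The characteristic function of the increment from the second argument to the third, with
  clamped times so that it is jointly measurable on the whole plane.\<close>

definition \<phi> :: "real \<Rightarrow> real \<Rightarrow> real \<Rightarrow> complex" where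
  "\<phi> \<kappa> s t = (CLINT \<omega> | M. iexp (\<kappa> * (X (max 0 t) \<omega> - X (max 0 s) \<omega>)))"

lemma \<phi>_eq: "0 \<le> s \<Longrightarrow> 0 \<le> t \<Longrightarrow> \<phi> \<kappa> s t = (CLINT \<omega> | M. iexp (\<kappa> * (X t \<omega> - X s \<omega>)))"
  by (simp add: \<phi>_def max_def)

lemma char_fun_eq: "0 \<le> s \<Longrightarrow> 0 \<le> t \<Longrightarrow> char_fun M (\<lambda>\<omega>. X t \<omega> - X s \<omega>) \<kappa> = \<phi> \<kappa> s t"
  unfolding char_fun_def char_def
  by (simp only: \<phi>_eq, subst integral_distr) (auto intro!: borel_measurable_diff measurable_X)

lemma \<phi>_le_1: "cmod (\<phi> \<kappa> s t) \<le> 1"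
  unfolding \<phi>_def by (intro norm_integral_le_const) simp

lemma \<phi>_minus: "\<phi> (- \<kappa>) s t = cnj (\<phi> \<kappa> s t)"
proof -
  have c: "iexp (- \<kappa> * z) = cnj (iexp (\<kappa> * z))" for z by (simp add: exp_cnj)
  show ?thesis unfolding \<phi>_def c by (rule Bochner_Integration.integral_cnj)
qed

text \<open>Independence from the raw history extends to the completed one, since null sets do not
  affect probabilities. The case s = t is separate because independence is given for s < t.\<close>

lemma expectation_times_increment:
  fixes Q :: "'a \<Rightarrow> complex"
  assumes Q: "Q \<in> borel_measurable (past s)" "\<And>\<omega>. cmod (Q \<omega>) \<le> C" and st: "0 \<le> s" "s \<le> t"
  shows "(CLINT \<omega> | M. Q \<omega> * iexp (\<kappa> * (X t \<omega> - X s \<omega>))) = (CLINT \<omega> | M. Q \<omega>) * \<phi> \<kappa> s t"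
proof (cases "s = t")
  case True
  then show ?thesis by (simp add: \<phi>_def prob_space)
next
  case False
  let ?D = "\<lambda>\<omega>. X t \<omega> - X s \<omega>"
  have D: "?D \<in> borel_measurable M" using st by (intro borel_measurable_diff measurable_X) auto
  have QM: "Q \<in> borel_measurable M" by (rule measurable_past_imp[OF Q(1)])
  have ind: "indep_set (sets (vimage_algebra (space M) ?D borel)) (sets (gen s))"
    using indep st False unfolding indep_increments_def by (auto elim!: ballE[of _ _ s] ballE[of _ _ t])
  \<comment> \<open>A completed event \<open>A\<close> is replaced by its raw version
    \<open>B\<close>; the probabilities involved are the same.\<close>
  have i: "indep_set (sets (past s)) (sets (vimage_algebra (space M) ?D borel))"
  proof (rule indep_setI)
    show "sets (vimage_algebra (space M) ?D borel) \<subseteq> events" by (rule indep_setD_ev1[OF ind])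
    show "sets (past s) \<subseteq> events" by (auto simp: sets_past past_sets_def)
    fix A E assume "A \<in> sets (past s)" and E: "E \<in> sets (vimage_algebra (space M) ?D borel)"
    then obtain B where A: "A \<in> sets M" and B: "B \<in> sets (gen s)" "AE \<omega> in M. \<omega> \<in> A \<longleftrightarrow> \<omega> \<in> B" by (auto simp: sets_past past_sets_def)
    have EM: "E \<in> sets M" using indep_setD_ev1[OF ind] E by auto
    have "prob (A \<inter> E) = prob (B \<inter> E)"
      using B A EM gen_subset[OF B(1)] by (intro finite_measure_eq_AE) auto
    moreover have "prob A = prob B"
      using B A gen_subset[OF B(1)] by (intro finite_measure_eq_AE) auto
    moreover have "prob (E \<inter> B) = prob E * prob B" by (rule indep_setD[OF ind E B(1)])
    ultimately show "prob (A \<inter> E) = prob A * prob E" by (simp add: Int_commute)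
  qed
  have s1: "sigma_sets (space M) {Q -` A \<inter> space M | A. A \<in> sets borel} \<subseteq> sets (past s)"
    using measurable_sets[OF Q(1)] sets.sigma_sets_subset[of "{Q -` A \<inter> space M | A. A \<in> sets borel}" "past s"] by auto
  let ?R = "\<lambda>\<omega>. iexp (\<kappa> * ?D \<omega>)"
  have "?D \<in> borel_measurable (vimage_algebra (space M) ?D borel)" by (rule measurable_vimage_algebra1) auto
  then have R: "?R \<in> borel_measurable (vimage_algebra (space M) ?D borel)" by measurable
  have s2: "sigma_sets (space M) {?R -` A \<inter> space M | A. A \<in> sets borel} \<subseteq> sets (vimage_algebra (space M) ?D borel)"
    using measurable_sets[OF R] sets.sigma_sets_subset[of "{?R -` A \<inter> space M | A. A \<in> sets borel}" "vimage_algebra (space M) ?D borel"] by auto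
  have "?R \<in> borel_measurable M" using D by measurable
  moreover have "indep_set (sigma_sets (space M) {Q -` A \<inter> space M | A. A \<in> sets borel}) (sigma_sets (space M) {?R -` A \<inter> space M | A. A \<in> sets borel})"
    using i s1 s2 unfolding indep_sets2_eq by (meson subset_iff)
  ultimately have "indep_var borel Q borel ?R"
    unfolding indep_var_eq using QM by blast
  moreover have "integrable M Q" using QM Q(2) by (intro integrable_const_bound[where B=C]) auto
  moreover have "integrable M (\<lambda>\<omega>. iexp (\<kappa> * ?D \<omega>))"
  proof (rule integrable_const_bound[where B=1])
    note [measurable] = D
    show "(\<lambda>\<omega>. iexp (\<kappa> * ?D \<omega>)) \<in> borel_measurable M" by measurable
  qed auto
  ultimately show ?thesis unfolding \<phi>_eq[OF st(1) order_trans[OF st]] by (rule indep_var_lebesgue_integral)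
qed

text \<open>The increments over adjacent intervals are independent: the character of the first one
  is a weight measurable at time \<open>s\<close>.\<close>

lemma \<phi>_mult:
  assumes "0 \<le> r" "r \<le> s" "s \<le> t"
  shows "\<phi> \<kappa> r t = \<phi> \<kappa> r s * \<phi> \<kappa> s t"
proof -
  note [measurable] = measurable_X_past[of s s] measurable_X_past[of r s]
  have "(CLINT \<omega> | M. iexp (\<kappa> * (X s \<omega> - X r \<omega>)) * iexp (\<kappa> * (X t \<omega> - X s \<omega>))) = \<phi> \<kappa> r s * \<phi> \<kappa> s t"
    unfolding \<phi>_eq[OF assms(1) order_trans[OF assms(1,2)]] using assms by (intro expectation_times_increment[where C=1]) auto
  moreover have "iexp (\<kappa> * (X s \<omega> - X r \<omega>)) * iexp (\<kappa> * (X t \<omega> - X s \<omega>)) = iexp (\<kappa> * (X t \<omega> - X r \<omega>))" for \<omega>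
    by (simp add: iexp_add[symmetric] algebra_simps exp_add[symmetric])
  ultimately show ?thesis using assms by (simp add: \<phi>_eq)
qed

definition e :: "real \<Rightarrow> real \<Rightarrow> 'a \<Rightarrow> complex" where
  "e \<kappa> s \<omega> = iexp (\<kappa> * X (max 0 s) \<omega>)"

lemma cmod_e [simp]: "cmod (e \<kappa> s \<omega>) = 1"
  by (simp add: e_def)

lemma e_mult: "e \<kappa> s \<omega> * e \<mu> s \<omega> = e (\<kappa> + \<mu>) s \<omega>"
  by (simp only: e_def distrib_right iexp_add)

lemma e_0 [simp]: "e 0 s \<omega> = 1"
  by (simp add: e_def)

lemma cnj_e: "cnj (e \<kappa> s \<omega>) = e (- \<kappa>) s \<omega>"
  by (simp add: e_def exp_cnj)

lemma measurable_e: "(\<lambda>(s, \<omega>). e \<kappa> s \<omega>) \<in> borel_measurable (borel \<Otimes>\<^sub>M M)"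
proof -
  note [measurable] = measurable_X_time
  have [measurable]: "(\<lambda>p. X (max 0 (fst p)) (snd p)) \<in> borel_measurable (borel \<Otimes>\<^sub>M M)"
    using measurable_X_time by (simp add: case_prod_beta)
  show ?thesis unfolding e_def case_prod_beta by measurable
qed

lemma measurable_e_past: "0 \<le> s \<Longrightarrow> e \<kappa> s \<in> borel_measurable (past s)"
proof -
  assume "0 \<le> s"
  then have [measurable]: "X (max 0 s) \<in> borel_measurable (past s)" by (intro measurable_X_past) auto
  show ?thesis unfolding e_def[abs_def] by measurable
qed

text \<open>The basic reduction: an exponential at \<open>t\<close> may be pulled back to any
  earlier \<open>s\<close> to which the weight belongs, at the price of the factor
  \<open>\<phi> \<kappa> s t\<close>.\<close>

lemma expectation_times_e:
  assumes Q: "Q \<in> borel_measurable (past s)" "\<And>\<omega>. cmod (Q \<omega>) \<le> C" and st: "0 \<le> s" "s \<le> t"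
  shows "(CLINT \<omega> | M. Q \<omega> * e \<kappa> t \<omega>) = (CLINT \<omega> | M. Q \<omega> * e \<kappa> s \<omega>) * \<phi> \<kappa> s t"
proof -
  have "e \<kappa> t \<omega> = e \<kappa> s \<omega> * iexp (\<kappa> * (X t \<omega> - X s \<omega>))" for \<omega>
    using st by (simp add: e_def max_def algebra_simps exp_add[symmetric])
  then have "(CLINT \<omega> | M. Q \<omega> * e \<kappa> t \<omega>) = (CLINT \<omega> | M. (Q \<omega> * e \<kappa> s \<omega>) * iexp (\<kappa> * (X t \<omega> - X s \<omega>)))"
    by (simp add: mult.assoc)
  also have "\<dots> = (CLINT \<omega> | M. Q \<omega> * e \<kappa> s \<omega>) * \<phi> \<kappa> s t"
  proof (rule expectation_times_increment[where C=C])
    note [measurable] = Q(1) measurable_e_past[OF st(1)]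
    show "(\<lambda>\<omega>. Q \<omega> * e \<kappa> s \<omega>) \<in> borel_measurable (past s)" by measurable
  qed (use Q st in \<open>auto simp: norm_mult\<close>)
  finally show ?thesis .
qed

text \<open>Let Y be the integral minus its conditional expectation given the past. Every
  \<open>f s\<close> is orthogonal to Y, hence by Fubini so is the integral; the conditional
  expectation is orthogonal as well. Thus Y has zero second moment, and the integral equals a
  past-measurable function almost surely.\<close>

lemma real_set_integral_past:
  fixes f :: "real \<Rightarrow> 'a \<Rightarrow> real"
  assumes f[measurable]: "(\<lambda>(s, \<omega>). f s \<omega>) \<in> borel_measurable (borel \<Otimes>\<^sub>M M)"
    and past: "\<And>s. s \<in> {a..b} \<Longrightarrow> f s \<in> borel_measurable (past b)"
    and C: "\<And>s \<omega>. s \<in> {a..b} \<Longrightarrow> \<bar>f s \<omega>\<bar> \<le> C" and ab: "a \<le> b"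
  shows "(\<lambda>\<omega>. LBINT s:{a..b}. f s \<omega>) \<in> borel_measurable (past b)"
proof -
  interpret S: finite_measure_subalgebra M "past b"
    by unfold_locales (rule subalgebra_past)
  define I where "I \<omega> = (LBINT s:{a..b}. f s \<omega>)" for \<omega>
  define g where "g = real_cond_exp M (past b) I"
  have C0: "0 \<le> C" using C[of a undefined] ab by auto
  have "(\<lambda>(\<omega>, s). f s \<omega>) \<in> borel_measurable (M \<Otimes>\<^sub>M borel)"
    using measurable_pair_swap[OF f] by simp
  then have [measurable]: "I \<in> borel_measurable M"
    unfolding I_def by (rule measurable_set_integral_Icc) auto
  define K where "K = C * (b - a)"
  have K0: "0 \<le> K" using C0 ab by (simp add: K_def)
  have Ib: "\<bar>I \<omega>\<bar> \<le> K" for \<omega> unfolding K_def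
    unfolding I_def using norm_set_integral_Icc_le[of a b "\<lambda>s. f s \<omega>" C] C ab by simp
  have Ii: "integrable M I" using Ib by (intro integrable_const_bound[where B="K"]) auto
  have gm[measurable]: "g \<in> borel_measurable (past b)" "g \<in> borel_measurable M" unfolding g_def by auto
  have gi: "integrable M g" unfolding g_def by (rule S.real_cond_exp_int(1)[OF Ii])
  define Y where "Y \<omega> = I \<omega> - g \<omega>" for \<omega>
  have Yi: "integrable M Y" unfolding Y_def using Ii gi by simp
  then have [measurable]: "Y \<in> borel_measurable M" by auto
  have orth: "(\<integral>\<omega>. h \<omega> * Y \<omega> \<partial>M) = 0" "integrable M (\<lambda>\<omega>. h \<omega> * Y \<omega>)"
    if h: "h \<in> borel_measurable (past b)" and hI: "integrable M (\<lambda>\<omega>. h \<omega> * I \<omega>)" for h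
  proof -
    have "integrable M (\<lambda>\<omega>. h \<omega> * g \<omega>)" "(\<integral>\<omega>. h \<omega> * g \<omega> \<partial>M) = (\<integral>\<omega>. h \<omega> * I \<omega> \<partial>M)"
      unfolding g_def using S.real_cond_exp_intg[OF hI h] by auto
    then show "(\<integral>\<omega>. h \<omega> * Y \<omega> \<partial>M) = 0" "integrable M (\<lambda>\<omega>. h \<omega> * Y \<omega>)"
      using hI by (auto simp: Y_def right_diff_distrib)
  qed
  \<comment> \<open>The conditional expectation \<open>g\<close> enters as an integrable function;
    the product is integrable because \<open>I\<close> is bounded.\<close>
  have gI: "integrable M (\<lambda>\<omega>. g \<omega> * I \<omega>)"
  proof (rule Bochner_Integration.integrable_bound)
    show "integrable M (\<lambda>\<omega>. K * g \<omega>)" using gi by simp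
    show "AE \<omega> in M. norm (g \<omega> * I \<omega>) \<le> norm (K * g \<omega>)"
      using Ib K0 by (intro AE_I2) (simp add: abs_mult mult.commute[of "\<bar>g _\<bar>"] mult_right_mono)
  qed measurable
  have fY: "(\<integral>\<omega>. f s \<omega> * Y \<omega> \<partial>M) = 0" "integrable M (\<lambda>\<omega>. f s \<omega> * Y \<omega>)" if "s \<in> {a..b}" for s
  proof -
    have [measurable]: "f s \<in> borel_measurable M" by (rule measurable_past_imp[OF past[OF that]])
    have "integrable M (\<lambda>\<omega>. f s \<omega> * I \<omega>)"
      using C[OF that] Ib C0 by (intro integrable_const_bound[where B="C * (K)"]) (auto simp: abs_mult intro!: mult_mono)
    from orth[OF past[OF that] this] show "(\<integral>\<omega>. f s \<omega> * Y \<omega> \<partial>M) = 0" "integrable M (\<lambda>\<omega>. f s \<omega> * Y \<omega>)" .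
  qed
  interpret P: pair_sigma_finite lborel M ..
  have "integrable (lborel \<Otimes>\<^sub>M M) (\<lambda>p. indicator {a..b} (fst p) * f (fst p) (snd p) * Y (snd p))"
  proof (rule P.Fubini_integrable)
    have [measurable]: "(\<lambda>p. f (fst p) (snd p)) \<in> borel_measurable (borel \<Otimes>\<^sub>M M)" using f by (simp add: case_prod_beta)
    show [measurable]: "(\<lambda>p. indicator {a..b} (fst p) * f (fst p) (snd p) * Y (snd p)) \<in> borel_measurable (lborel \<Otimes>\<^sub>M M)"
      by measurable
    have "(\<lambda>s. \<integral>\<omega>. norm (indicator {a..b} s * f s \<omega> * Y \<omega>) \<partial>M) \<in> borel_measurable lborel" by measurable
    moreover have "(\<integral>\<omega>. norm (indicator {a..b} s * f s \<omega> * Y \<omega>) \<partial>M) \<le> (\<integral>\<omega>. C * \<bar>Y \<omega>\<bar> \<partial>M)" if "s \<in> {a..b}" for s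
    proof (rule integral_mono)
      show "integrable M (\<lambda>\<omega>. norm (indicator {a..b} s * f s \<omega> * Y \<omega>))"
        using integrable_norm[OF fY(2)[OF that]] that by simp
    qed (use C[OF that] Yi that in \<open>auto simp: abs_mult intro!: mult_right_mono\<close>)
    ultimately show "integrable lborel (\<lambda>s. \<integral>\<omega>. norm (indicator {a..b} (fst (s, \<omega>)) * f (fst (s, \<omega>)) (snd (s, \<omega>)) * Y (snd (s, \<omega>))) \<partial>M)"
      by (intro integrableI_bounded_set[where A="{a..b}" and B="\<integral>\<omega>. C * \<bar>Y \<omega>\<bar> \<partial>M"])
         (auto simp: emeasure_lborel_Icc_eq)
    show "AE s in lborel. integrable M (\<lambda>\<omega>. indicator {a..b} (fst (s, \<omega>)) * f (fst (s, \<omega>)) (snd (s, \<omega>)) * Y (snd (s, \<omega>)))"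
      using fY(2) by (intro AE_I2) (auto simp: indicator_def)
  qed
  then have "integrable (lborel \<Otimes>\<^sub>M M) (\<lambda>(s, \<omega>). indicator {a..b} s * f s \<omega> * Y \<omega>)" by (simp only: case_prod_unfold)
  from P.Fubini_integral[OF this]
  have F1: "(\<integral>\<omega>. (\<integral>s. indicator {a..b} s * f s \<omega> * Y \<omega> \<partial>lborel) \<partial>M) = (\<integral>s. (\<integral>\<omega>. indicator {a..b} s * f s \<omega> * Y \<omega> \<partial>M) \<partial>lborel)" .
  have F2: "(\<integral>s. indicator {a..b} s * f s \<omega> * Y \<omega> \<partial>lborel) = I \<omega> * Y \<omega>" for \<omega>
    by (simp only: I_def set_lebesgue_integral_def integral_mult_left_zero real_scaleR_def)
  have F3: "(\<integral>\<omega>. indicator {a..b} s * f s \<omega> * Y \<omega> \<partial>M) = 0" for s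
    using fY(1)[of s] by (cases "s \<in> {a..b}") (auto simp: mult.assoc)
  \<comment> \<open>Fubini integrates the orthogonality of the single \<open>f s\<close> over
    time.\<close>
  have IY: "(\<integral>\<omega>. I \<omega> * Y \<omega> \<partial>M) = 0" using F1 unfolding F2 F3 by simp
  have IYi: "integrable M (\<lambda>\<omega>. I \<omega> * Y \<omega>)"
  proof (rule Bochner_Integration.integrable_bound)
    show "integrable M (\<lambda>\<omega>. K * Y \<omega>)" using Yi by simp
    show "AE \<omega> in M. norm (I \<omega> * Y \<omega>) \<le> norm (K * Y \<omega>)"
      using Ib K0 by (intro AE_I2) (simp add: abs_mult mult_right_mono)
  qed measurable
  have "(\<integral>\<omega>. (Y \<omega>)\<^sup>2 \<partial>M) = (\<integral>\<omega>. I \<omega> * Y \<omega> - g \<omega> * Y \<omega> \<partial>M)"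
    by (simp add: Y_def power2_eq_square algebra_simps)
  also have "\<dots> = 0" using IY IYi orth[OF gm(1) gI] by simp
  finally have "(\<integral>\<omega>. (Y \<omega>)\<^sup>2 \<partial>M) = 0" .
  moreover have "integrable M (\<lambda>\<omega>. (Y \<omega>)\<^sup>2)"
  proof -
    have "integrable M (\<lambda>\<omega>. I \<omega> * Y \<omega> - g \<omega> * Y \<omega>)" using IYi orth[OF gm(1) gI] by simp
    then show ?thesis by (simp add: Y_def power2_eq_square algebra_simps)
  qed
  ultimately have "AE \<omega> in M. (Y \<omega>)\<^sup>2 = 0" by (subst (asm) integral_nonneg_eq_0_iff_AE) auto
  then have "AE \<omega> in M. I \<omega> = g \<omega>" by eventually_elim (simp add: Y_def)
  then have "I \<in> borel_measurable (past b)" by (intro measurable_past_cong_AE[OF _ gm(1)]) auto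
  then show ?thesis unfolding I_def[abs_def] .
qed

end


section \<open>Moments of oscillatory integrals\<close>

lemma set_integral_Icc_inverse_square:
  fixes a b :: real
  assumes "a \<le> b"
  shows "(LBINT s:{a..b}. 1 / (1 + (s - a))\<^sup>2) \<le> 1" "set_integrable lborel {a..b} (\<lambda>s. 1 / (1 + (s - a))\<^sup>2)"
proof -
  have "(\<integral>s. 1 / (1 + (s - a))\<^sup>2 * indicator {a..b} s \<partial>lborel) = - (1 / (1 + (b - a))) - (- (1 / (1 + (a - a))))"
  proof (rule integral_FTC_Icc_real[OF assms])
    show "((\<lambda>s. - (1 / (1 + (s - a)))) has_real_derivative 1 / (1 + (s - a))\<^sup>2) (at s)" if "a \<le> s" "s \<le> b" for s
      using that by (auto intro!: derivative_eq_intros simp: power2_eq_square)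
    show "isCont (\<lambda>s. 1 / (1 + (s - a))\<^sup>2) s" if "a \<le> s" "s \<le> b" for s
      using that by (intro continuous_intros) auto
  qed
  also have "\<dots> \<le> 1" using assms by simp
  finally show "(LBINT s:{a..b}. 1 / (1 + (s - a))\<^sup>2) \<le> 1" by (simp add: set_lebesgue_integral_def mult.commute)
  show "set_integrable lborel {a..b} (\<lambda>s. 1 / (1 + (s - a))\<^sup>2)"
    by (rule set_integrable_Icc_bounded[where C=1]) (auto simp: divide_le_eq)
qed

section \<open>Adapted integrands: product rule, Fubini and pulling exponentials back in
  time\<close>

context increment_process
begin

text \<open>Joint measurability serves Fubini, measurability for the past serves independence, and
  boundedness on bounded intervals serves integrability. The class is closed under products, sums
  and running integrals, so the product rule can be iterated.\<close>

definition adapted :: "real \<Rightarrow> (real \<Rightarrow> 'a \<Rightarrow> complex) \<Rightarrow> bool" where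
  "adapted a f \<longleftrightarrow> (\<lambda>(s, \<omega>). f s \<omega>) \<in> borel_measurable (borel \<Otimes>\<^sub>M M) \<and>
     (\<forall>s\<ge>a. f s \<in> borel_measurable (past s)) \<and> (\<forall>b. \<exists>C. \<forall>s\<in>{a..b}. \<forall>\<omega>. cmod (f s \<omega>) \<le> C)"

lemma adapted_jm: "adapted a f \<Longrightarrow> (\<lambda>(s, \<omega>). f s \<omega>) \<in> borel_measurable (borel \<Otimes>\<^sub>M M)"
  and adapted_past: "adapted a f \<Longrightarrow> a \<le> s \<Longrightarrow> f s \<in> borel_measurable (past s)"
  by (auto simp: adapted_def)

lemma adapted_bdd:
  assumes "adapted a f" obtains C where "0 \<le> C" "\<And>s \<omega>. s \<in> {a..b} \<Longrightarrow> cmod (f s \<omega>) \<le> C"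
proof -
  from assms obtain C where C: "\<forall>s\<in>{a..b}. \<forall>\<omega>. cmod (f s \<omega>) \<le> C" unfolding adapted_def by blast
  have "cmod (f s \<omega>) \<le> max 0 C" if "s \<in> {a..b}" for s \<omega> using C that by (simp add: le_max_iff_disj)
  then show ?thesis by (intro that[of "max 0 C"]) auto
qed

lemma adapted_section:
  assumes "adapted a f" "\<omega> \<in> space M" shows "(\<lambda>s. f s \<omega>) \<in> borel_measurable borel"
  using measurable_compose[OF measurable_Pair2'[OF assms(2)] adapted_jm[OF assms(1)]] by simp

lemma adapted_random:
  assumes "adapted a f" shows "f s \<in> borel_measurable M"
  using measurable_compose[OF measurable_Pair1'[of s borel M] adapted_jm[OF assms]] by simp

lemma adapted_e: "0 \<le> a \<Longrightarrow> adapted a (e \<kappa>)"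
  unfolding adapted_def using measurable_e measurable_e_past by (auto intro!: exI[of _ 1])

lemma adapted_const:
  assumes "P \<in> borel_measurable (past a)" "\<And>\<omega>. cmod (P \<omega>) \<le> C" "0 \<le> a"
  shows "adapted a (\<lambda>_. P)"
proof -
  have [measurable]: "P \<in> borel_measurable M" by (rule measurable_past_imp[OF assms(1)])
  show ?thesis unfolding adapted_def using assms past_mono by auto
qed

lemma adapted_mult:
  assumes f: "adapted a f" and g: "adapted a g"
  shows "adapted a (\<lambda>s \<omega>. f s \<omega> * g s \<omega>)"
  unfolding adapted_def
proof (intro conjI allI impI)
  have [measurable]: "(\<lambda>p. f (fst p) (snd p)) \<in> borel_measurable (borel \<Otimes>\<^sub>M M)"
    "(\<lambda>p. g (fst p) (snd p)) \<in> borel_measurable (borel \<Otimes>\<^sub>M M)"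
    using adapted_jm[OF f] adapted_jm[OF g] by (simp_all add: case_prod_beta)
  show "(\<lambda>(s, \<omega>). f s \<omega> * g s \<omega>) \<in> borel_measurable (borel \<Otimes>\<^sub>M M)"
    unfolding case_prod_beta by measurable
  show "(\<lambda>\<omega>. f s \<omega> * g s \<omega>) \<in> borel_measurable (past s)" if "a \<le> s" for s
    using adapted_past[OF f that] adapted_past[OF g that] by (rule borel_measurable_times)
  fix b
  obtain C D where "0 \<le> C" "\<And>s \<omega>. s \<in> {a..b} \<Longrightarrow> cmod (f s \<omega>) \<le> C" "0 \<le> D" "\<And>s \<omega>. s \<in> {a..b} \<Longrightarrow> cmod (g s \<omega>) \<le> D"
    using adapted_bdd[OF f] adapted_bdd[OF g] by metis
  then show "\<exists>C. \<forall>s\<in>{a..b}. \<forall>\<omega>. cmod (f s \<omega> * g s \<omega>) \<le> C"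
    by (intro exI[of _ "C * D"]) (auto simp: norm_mult intro!: mult_mono)
qed

lemma adapted_add:
  assumes f: "adapted a f" and g: "adapted a g"
  shows "adapted a (\<lambda>s \<omega>. f s \<omega> + g s \<omega>)"
  unfolding adapted_def
proof (intro conjI allI impI)
  have [measurable]: "(\<lambda>p. f (fst p) (snd p)) \<in> borel_measurable (borel \<Otimes>\<^sub>M M)"
    "(\<lambda>p. g (fst p) (snd p)) \<in> borel_measurable (borel \<Otimes>\<^sub>M M)"
    using adapted_jm[OF f] adapted_jm[OF g] by (simp_all add: case_prod_beta)
  show "(\<lambda>(s, \<omega>). f s \<omega> + g s \<omega>) \<in> borel_measurable (borel \<Otimes>\<^sub>M M)"
    unfolding case_prod_beta by measurable
  show "(\<lambda>\<omega>. f s \<omega> + g s \<omega>) \<in> borel_measurable (past s)" if "a \<le> s" for s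
    using adapted_past[OF f that] adapted_past[OF g that] by (rule borel_measurable_add)
  fix b
  obtain C D where CD: "\<And>s \<omega>. s \<in> {a..b} \<Longrightarrow> cmod (f s \<omega>) \<le> C" "\<And>s \<omega>. s \<in> {a..b} \<Longrightarrow> cmod (g s \<omega>) \<le> D"
    using adapted_bdd[OF f] adapted_bdd[OF g] by metis
  have "cmod (f s \<omega> + g s \<omega>) \<le> C + D" if "s \<in> {a..b}" for s \<omega>
    using CD[OF that, of \<omega>] norm_triangle_ineq[of "f s \<omega>" "g s \<omega>"] by linarith
  then show "\<exists>C. \<forall>s\<in>{a..b}. \<forall>\<omega>. cmod (f s \<omega> + g s \<omega>) \<le> C" by blast
qed

lemma set_integral_past:
  fixes f :: "real \<Rightarrow> 'a \<Rightarrow> complex"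
  assumes f[measurable]: "(\<lambda>(s, \<omega>). f s \<omega>) \<in> borel_measurable (borel \<Otimes>\<^sub>M M)"
    and past: "\<And>s. s \<in> {a..b} \<Longrightarrow> f s \<in> borel_measurable (past b)"
    and C: "\<And>s \<omega>. s \<in> {a..b} \<Longrightarrow> cmod (f s \<omega>) \<le> C" and ab: "a \<le> b"
  shows "(\<lambda>\<omega>. CLBINT s:{a..b}. f s \<omega>) \<in> borel_measurable (past b)"
proof -
  have [measurable]: "(\<lambda>p. f (fst p) (snd p)) \<in> borel_measurable (borel \<Otimes>\<^sub>M M)"
    using f by (simp add: case_prod_beta)
  have sec: "set_integrable lborel {a..b} (\<lambda>s. f s \<omega>)" if "\<omega> \<in> space M" for \<omega>
    using measurable_compose[OF measurable_Pair2'[OF that] f] C by (intro set_integrable_Icc_bounded[where C=C]) auto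
  have Re: "Re (CLBINT s:{a..b}. f s \<omega>) = (LBINT s:{a..b}. Re (f s \<omega>))"
    and Im: "Im (CLBINT s:{a..b}. f s \<omega>) = (LBINT s:{a..b}. Im (f s \<omega>))" if "\<omega> \<in> space M" for \<omega>
    using sec[OF that] unfolding set_lebesgue_integral_def set_integrable_def by (auto simp flip: Bochner_Integration.integral_Re Bochner_Integration.integral_Im)
  have "(\<lambda>\<omega>. LBINT s:{a..b}. Re (f s \<omega>)) \<in> borel_measurable (past b)"
  proof (rule real_set_integral_past[OF _ _ _ ab])
    show "(\<lambda>(s, \<omega>). Re (f s \<omega>)) \<in> borel_measurable (borel \<Otimes>\<^sub>M M)" unfolding case_prod_beta by measurable
    show "(\<lambda>\<omega>. Re (f s \<omega>)) \<in> borel_measurable (past b)" if "s \<in> {a..b}" for s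
      using past[OF that] by measurable
    show "\<bar>Re (f s \<omega>)\<bar> \<le> C" if "s \<in> {a..b}" for s \<omega> using abs_Re_le_cmod C[OF that] by (rule order_trans)
  qed
  moreover have "(\<lambda>\<omega>. LBINT s:{a..b}. Im (f s \<omega>)) \<in> borel_measurable (past b)"
  proof (rule real_set_integral_past[OF _ _ _ ab])
    show "(\<lambda>(s, \<omega>). Im (f s \<omega>)) \<in> borel_measurable (borel \<Otimes>\<^sub>M M)" unfolding case_prod_beta by measurable
    show "(\<lambda>\<omega>. Im (f s \<omega>)) \<in> borel_measurable (past b)" if "s \<in> {a..b}" for s
      using past[OF that] by measurable
    show "\<bar>Im (f s \<omega>)\<bar> \<le> C" if "s \<in> {a..b}" for s \<omega> using abs_Im_le_cmod C[OF that] by (rule order_trans)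
  qed
  moreover have "(\<lambda>\<omega>. Re (CLBINT s:{a..b}. f s \<omega>)) \<in> borel_measurable (past b) \<longleftrightarrow> (\<lambda>\<omega>. LBINT s:{a..b}. Re (f s \<omega>)) \<in> borel_measurable (past b)"
    by (rule measurable_cong) (simp add: Re)
  moreover have "(\<lambda>\<omega>. Im (CLBINT s:{a..b}. f s \<omega>)) \<in> borel_measurable (past b) \<longleftrightarrow> (\<lambda>\<omega>. LBINT s:{a..b}. Im (f s \<omega>)) \<in> borel_measurable (past b)"
    by (rule measurable_cong) (simp add: Im)
  ultimately show ?thesis unfolding borel_measurable_complex_iff by blast
qed

text \<open>Measurability of the running integral for the past is where the completed history
  enters; joint measurability in the upper limit is Fubini.\<close>

lemma adapted_integral:
  assumes f: "adapted a f" and "0 \<le> a"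
  shows "adapted a (\<lambda>t \<omega>. CLBINT s:{a..t}. f s \<omega>)"
  unfolding adapted_def
proof (intro conjI allI impI)
  have [measurable]: "(\<lambda>p. f (fst p) (snd p)) \<in> borel_measurable (borel \<Otimes>\<^sub>M M)"
    using adapted_jm[OF f] by (simp add: case_prod_beta)
  show "(\<lambda>(t, \<omega>). CLBINT s:{a..t}. f s \<omega>) \<in> borel_measurable (borel \<Otimes>\<^sub>M M)"
    unfolding case_prod_beta
  proof (rule measurable_set_integral_Icc)
    have "(\<lambda>q. f (fst (snd q, snd (fst q))) (snd (snd q, snd (fst q)))) \<in> borel_measurable ((borel \<Otimes>\<^sub>M M) \<Otimes>\<^sub>M borel)"
      by (rule measurable_compose[where g="\<lambda>p. f (fst p) (snd p)" and N="borel \<Otimes>\<^sub>M M"]) measurable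
    then show "(\<lambda>(p, s). f s (snd p)) \<in> borel_measurable ((borel \<Otimes>\<^sub>M M) \<Otimes>\<^sub>M borel)"
      by (simp only: case_prod_unfold fst_conv snd_conv)
  qed measurable
  show "(\<lambda>\<omega>. CLBINT s:{a..t}. f s \<omega>) \<in> borel_measurable (past t)" if t: "a \<le> t" for t
  proof -
    obtain C where C: "0 \<le> C" "\<And>s \<omega>. s \<in> {a..t} \<Longrightarrow> cmod (f s \<omega>) \<le> C" using adapted_bdd[OF f] by metis
    show ?thesis
      by (rule set_integral_past[OF adapted_jm[OF f] _ C(2) t])
         (use \<open>0 \<le> a\<close> in \<open>auto intro: past_mono[OF _ _ adapted_past[OF f]]\<close>)
  qed
  fix b
  obtain C where C: "0 \<le> C" "\<And>s \<omega>. s \<in> {a..b} \<Longrightarrow> cmod (f s \<omega>) \<le> C" using adapted_bdd[OF f] by metis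
  have "cmod (CLBINT s:{a..t}. f s \<omega>) \<le> C * (b - a)" if "t \<in> {a..b}" for t \<omega>
  proof -
    have "cmod (CLBINT s:{a..t}. f s \<omega>) \<le> C * (t - a)" using C that by (intro norm_set_integral_Icc_le) auto
    also have "\<dots> \<le> C * (b - a)" using C that by (intro mult_left_mono) auto
    finally show ?thesis .
  qed
  then show "\<exists>C. \<forall>t\<in>{a..b}. \<forall>\<omega>. cmod (CLBINT s:{a..t}. f s \<omega>) \<le> C" by blast
qed

lemma Fubini_adapted:
  assumes "adapted a f"
  shows "(CLINT \<omega> | M. CLBINT s:{a..b}. f s \<omega>) = (CLBINT s:{a..b}. (CLINT \<omega> | M. f s \<omega>))"
proof -
  obtain C where C: "0 \<le> C" "\<And>s \<omega>. s \<in> {a..b} \<Longrightarrow> cmod (f s \<omega>) \<le> C" using adapted_bdd[OF assms] by metis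
  show ?thesis by (rule Fubini_set_integral_Icc[OF adapted_jm[OF assms] C(2)])
qed

lemma product_rule_adapted:
  assumes "adapted a f" "adapted a g" "\<omega> \<in> space M"
  shows "(CLBINT s:{a..t}. f s \<omega>) * (CLBINT s:{a..t}. g s \<omega>)
    = (CLBINT s:{a..t}. f s \<omega> * (CLBINT r:{a..s}. g r \<omega>) + g s \<omega> * (CLBINT r:{a..s}. f r \<omega>))"
proof -
  obtain C D where "\<And>s \<omega>. s \<in> {a..t} \<Longrightarrow> cmod (f s \<omega>) \<le> C" "\<And>s \<omega>. s \<in> {a..t} \<Longrightarrow> cmod (g s \<omega>) \<le> D"
    using adapted_bdd[OF assms(1)] adapted_bdd[OF assms(2)] by metis
  then show ?thesis using adapted_section[OF assms(1,3)] adapted_section[OF assms(2,3)]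
    by (intro set_integral_product_rule) auto
qed

text \<open>Fubini brings the expectation inside, and the exponential at the final time
  \<open>t\<close> is pulled back to the time \<open>s\<close> of the integrand.\<close>

lemma expectation_integral_times_e:
  assumes f: "adapted a f" and a: "0 \<le> a" "a \<le> t"
  shows "(CLINT \<omega> | M. (CLBINT s:{a..t}. f s \<omega>) * e \<kappa> t \<omega>) = (CLBINT s:{a..t}. (CLINT \<omega> | M. f s \<omega> * e \<kappa> s \<omega>) * \<phi> \<kappa> s t)"
proof -
  obtain C where C: "0 \<le> C" "\<And>s \<omega>. s \<in> {a..t} \<Longrightarrow> cmod (f s \<omega>) \<le> C" using adapted_bdd[OF f] by metis
  have [measurable]: "(\<lambda>p. f (fst p) (snd p)) \<in> borel_measurable (borel \<Otimes>\<^sub>M M)" "e \<kappa> t \<in> borel_measurable M"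
    using adapted_jm[OF f] adapted_random[OF adapted_e[of 0]] by (simp_all add: case_prod_beta)
  have "(CLINT \<omega> | M. (CLBINT s:{a..t}. f s \<omega>) * e \<kappa> t \<omega>) = (CLINT \<omega> | M. CLBINT s:{a..t}. f s \<omega> * e \<kappa> t \<omega>)" by simp
  also have "\<dots> = (CLBINT s:{a..t}. (CLINT \<omega> | M. f s \<omega> * e \<kappa> t \<omega>))"
  proof (rule Fubini_set_integral_Icc)
    show "(\<lambda>(s, \<omega>). f s \<omega> * e \<kappa> t \<omega>) \<in> borel_measurable (borel \<Otimes>\<^sub>M M)" unfolding case_prod_beta by measurable
  qed (use C in \<open>auto simp: norm_mult\<close>)
  also have "\<dots> = (CLBINT s:{a..t}. (CLINT \<omega> | M. f s \<omega> * e \<kappa> s \<omega>) * \<phi> \<kappa> s t)"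
    using C a by (intro set_lebesgue_integral_cong) (auto intro!: expectation_times_e[OF adapted_past[OF f]])
  finally show ?thesis .
qed

lemma measurable_\<phi>: "(\<lambda>(s, t). \<phi> \<kappa> s t) \<in> borel_measurable (borel \<Otimes>\<^sub>M borel)"
proof -
  have [measurable]: "(\<lambda>p. X (max 0 (fst p)) (snd p)) \<in> borel_measurable (borel \<Otimes>\<^sub>M M)"
    using measurable_X_time by (simp add: case_prod_beta)
  have "(\<lambda>q. X (max 0 (fst (fst (fst q), snd q))) (snd (fst (fst q), snd q))) \<in> borel_measurable ((borel \<Otimes>\<^sub>M borel) \<Otimes>\<^sub>M M)"
    by (rule measurable_compose[where g="\<lambda>p. X (max 0 (fst p)) (snd p)" and N="borel \<Otimes>\<^sub>M M"]) measurable
  then have [measurable]: "(\<lambda>q. X (max 0 (fst (fst q))) (snd q)) \<in> borel_measurable ((borel \<Otimes>\<^sub>M borel) \<Otimes>\<^sub>M M)" by simp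
  have "(\<lambda>q. X (max 0 (fst (snd (fst q), snd q))) (snd (snd (fst q), snd q))) \<in> borel_measurable ((borel \<Otimes>\<^sub>M borel) \<Otimes>\<^sub>M M)"
    by (rule measurable_compose[where g="\<lambda>p. X (max 0 (fst p)) (snd p)" and N="borel \<Otimes>\<^sub>M M"]) measurable
  then have [measurable]: "(\<lambda>q. X (max 0 (snd (fst q))) (snd q)) \<in> borel_measurable ((borel \<Otimes>\<^sub>M borel) \<Otimes>\<^sub>M M)" by simp
  show ?thesis
    unfolding \<phi>_def case_prod_beta by (rule borel_measurable_lebesgue_integral) measurable
qed

lemma measurable_\<phi>_compose [measurable]:
  "f \<in> borel_measurable N \<Longrightarrow> g \<in> borel_measurable N \<Longrightarrow> (\<lambda>x. \<phi> \<kappa> (f x) (g x)) \<in> borel_measurable N"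
  using measurable_compose[OF measurable_Pair measurable_\<phi>, of f N g] by simp

text \<open>The double integral of condition (A) in unscaled time.\<close>

definition J :: "real \<Rightarrow> real \<Rightarrow> real \<Rightarrow> real" where
  "J \<kappa> a b = (LBINT t:{a..b}. LBINT s:{a..t}. cmod (\<phi> \<kappa> s t))"

lemma set_integrable_\<phi>: "set_integrable lborel {a..b} (\<lambda>s. cmod (\<phi> \<kappa> s t))"
  by (rule set_integrable_Icc_bounded[where C=1]) (auto simp: \<phi>_le_1)

lemma double_integrable:
  fixes g :: "real \<Rightarrow> real \<Rightarrow> 'b::{banach, second_countable_topology}"
  assumes [measurable]: "(\<lambda>(t, s). g t s) \<in> borel_measurable (borel \<Otimes>\<^sub>M borel)" and g: "\<And>t s. norm (g t s) \<le> C"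
  shows "set_integrable lborel {a..b} (\<lambda>t. LBINT s:{a..t}. g t s)"
proof (cases "a \<le> b")
  case True
  have C0: "0 \<le> C" using g norm_ge_zero order_trans by blast
  show ?thesis
  proof (rule set_integrable_Icc_bounded[where C="C * (b - a)"])
    show "(\<lambda>t. LBINT s:{a..t}. g t s) \<in> borel_measurable borel" by (rule measurable_set_integral_Icc) auto
    fix t assume t: "t \<in> {a..b}"
    have "norm (LBINT s:{a..t}. g t s) \<le> C * (t - a)" using g t by (intro norm_set_integral_Icc_le) auto
    also have "\<dots> \<le> C * (b - a)" using t C0 by (intro mult_left_mono) auto
    finally show "norm (LBINT s:{a..t}. g t s) \<le> C * (b - a)" .
  qed
qed (simp add: set_integrable_def)

lemma norm_double_integral_le:
  fixes g :: "real \<Rightarrow> real \<Rightarrow> complex" and h :: "real \<Rightarrow> real \<Rightarrow> real"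
  assumes [measurable]: "(\<lambda>(t, s). h t s) \<in> borel_measurable (borel \<Otimes>\<^sub>M borel)" and C: "\<And>t s. \<bar>h t s\<bar> \<le> C"
    and le: "\<And>t s. t \<in> {a..b} \<Longrightarrow> s \<in> {a..t} \<Longrightarrow> cmod (g t s) \<le> h t s"
  shows "cmod (CLBINT t:{a..b}. (CLBINT s:{a..t}. g t s)) \<le> (LBINT t:{a..b}. LBINT s:{a..t}. h t s)"
proof (rule norm_set_integral_le[OF double_integrable])
  fix t assume t: "t \<in> {a..b}"
  show "cmod (CLBINT s:{a..t}. g t s) \<le> (LBINT s:{a..t}. h t s)"
  proof (rule norm_set_integral_le)
    have "(\<lambda>s. h t s) \<in> borel_measurable borel"
      using measurable_compose[OF measurable_Pair1' assms(1), of t] by simp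
    then show "set_integrable lborel {a..t} (\<lambda>s. h t s)" by (rule set_integrable_Icc_bounded[where C=C]) (use C in auto)
  qed (use le t in auto)
qed (use C in auto)

section \<open>Conditional first and second moments of the oscillatory integral\<close>

definition Z :: "real \<Rightarrow> real \<Rightarrow> real \<Rightarrow> 'a \<Rightarrow> complex" where
  "Z \<kappa> a t \<omega> = (CLBINT s:{a..t}. e \<kappa> s \<omega>)"

lemma adapted_Z: "0 \<le> a \<Longrightarrow> adapted a (Z \<kappa> a)"
  unfolding Z_def[abs_def] by (intro adapted_integral adapted_e)

lemma cmod_Z_le: "a \<le> t \<Longrightarrow> cmod (Z \<kappa> a t \<omega>) \<le> t - a"
  unfolding Z_def using norm_set_integral_Icc_le[of a t "\<lambda>s. e \<kappa> s \<omega>" 1] by simp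

lemma cnj_Z: "cnj (Z \<kappa> a t \<omega>) = Z (- \<kappa>) a t \<omega>"
  unfolding Z_def set_lebesgue_integral_def
  by (subst Bochner_Integration.integral_cnj[symmetric]) (simp add: cnj_e[symmetric])

lemma norm_Z_power2: "of_real ((cmod (Z \<kappa> a t \<omega>))\<^sup>2) = Z \<kappa> a t \<omega> * Z (- \<kappa>) a t \<omega>"
  unfolding cnj_Z[symmetric] by (rule complex_norm_square)

lemma adapted_Z_section: "0 \<le> a \<Longrightarrow> Z \<kappa> a t \<in> borel_measurable M"
  by (rule adapted_random[OF adapted_Z])

lemma norm_expectation_P_e_le:
  assumes "\<And>\<omega>. cmod (P \<omega>) \<le> 1" shows "cmod (CLINT \<omega> | M. P \<omega> * e \<kappa> s \<omega>) \<le> 1"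
  using assms by (intro norm_integral_le_const) (auto simp: norm_mult)

context
  fixes a :: real and P :: "'a \<Rightarrow> complex"
  assumes a: "0 \<le> a" and P: "P \<in> borel_measurable (past a)" "\<And>\<omega>. cmod (P \<omega>) \<le> 1"
begin

lemma adapted_P: "adapted a (\<lambda>_. P)"
  using adapted_const[OF P(1) _ a, of 1] P(2) by auto

text \<open>Testing against an arbitrary past-measurable \<open>P\<close> of modulus at most 1
  stands for conditioning on the past of \<open>a\<close>. Each exponential is pulled back to
  \<open>a\<close>, leaving a factor of modulus at most 1.\<close>

lemma first_moment: "cmod (CLINT \<omega> | M. P \<omega> * Z \<kappa> a b \<omega>) \<le> (LBINT s:{a..b}. cmod (\<phi> \<kappa> a s))"
proof -
  have "(CLINT \<omega> | M. P \<omega> * Z \<kappa> a b \<omega>) = (CLINT \<omega> | M. CLBINT s:{a..b}. P \<omega> * e \<kappa> s \<omega>)"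
    by (simp add: Z_def)
  also have "\<dots> = (CLBINT s:{a..b}. (CLINT \<omega> | M. P \<omega> * e \<kappa> s \<omega>))"
    by (rule Fubini_adapted[OF adapted_mult[OF adapted_P adapted_e[OF a]]])
  also have "cmod \<dots> \<le> (LBINT s:{a..b}. cmod (\<phi> \<kappa> a s))"
  proof (rule norm_set_integral_le)
    show "set_integrable lborel {a..b} (\<lambda>s. cmod (\<phi> \<kappa> a s))"
      by (rule set_integrable_Icc_bounded[where C=1]) (auto simp: \<phi>_le_1)
    show "cmod (CLINT \<omega> | M. P \<omega> * e \<kappa> s \<omega>) \<le> cmod (\<phi> \<kappa> a s)" if "s \<in> {a..b}" for s
      using expectation_times_e[OF P a, of s \<kappa>] that norm_expectation_P_e_le[where P=P and \<kappa>=\<kappa> and s=a, OF P(2)]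
      by (simp add: norm_mult mult_left_le_one_le)
  qed
  finally show ?thesis .
qed

text \<open>The product rule singles out the later time \<open>t\<close>, whose exponential is
  pulled back to \<open>s\<close>. There the two exponentials merge into one with frequency \<kappa>
  + \<mu>, which is pulled back to \<open>a\<close>.\<close>

lemma second_moment:
  "(CLINT \<omega> | M. P \<omega> * (Z \<kappa> a b \<omega> * Z \<mu> a b \<omega>))
    = (CLBINT t:{a..b}. (CLBINT s:{a..t}. (CLINT \<omega> | M. P \<omega> * e (\<kappa> + \<mu>) a \<omega>) * \<phi> (\<kappa> + \<mu>) a s * (\<phi> \<kappa> s t + \<phi> \<mu> s t)))"
proof -
  have half: "(CLINT \<omega> | M. P \<omega> * Z \<mu> a t \<omega> * e \<kappa> t \<omega>)
      = (CLBINT s:{a..t}. (CLINT \<omega> | M. P \<omega> * e (\<kappa> + \<mu>) a \<omega>) * \<phi> (\<kappa> + \<mu>) a s * \<phi> \<kappa> s t)" if "a \<le> t" for t \<kappa> \<mu>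
  proof -
    have "(CLINT \<omega> | M. P \<omega> * Z \<mu> a t \<omega> * e \<kappa> t \<omega>) = (CLINT \<omega> | M. (CLBINT s:{a..t}. P \<omega> * e \<mu> s \<omega>) * e \<kappa> t \<omega>)"
      by (simp add: Z_def)
    also have "\<dots> = (CLBINT s:{a..t}. (CLINT \<omega> | M. P \<omega> * e \<mu> s \<omega> * e \<kappa> s \<omega>) * \<phi> \<kappa> s t)"
      by (rule expectation_integral_times_e[OF adapted_mult[OF adapted_P adapted_e[OF a]] a that])
    also have "\<dots> = (CLBINT s:{a..t}. (CLINT \<omega> | M. P \<omega> * e (\<kappa> + \<mu>) a \<omega>) * \<phi> (\<kappa> + \<mu>) a s * \<phi> \<kappa> s t)"
    proof (intro set_lebesgue_integral_cong allI impI)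
      fix s assume s: "s \<in> {a..t}"
      have "(CLINT \<omega> | M. P \<omega> * e \<mu> s \<omega> * e \<kappa> s \<omega>) = (CLINT \<omega> | M. P \<omega> * e (\<kappa> + \<mu>) s \<omega>)"
        by (simp only: mult.assoc e_mult add.commute[of \<mu> \<kappa>])
      also have "\<dots> = (CLINT \<omega> | M. P \<omega> * e (\<kappa> + \<mu>) a \<omega>) * \<phi> (\<kappa> + \<mu>) a s"
        by (rule expectation_times_e[OF P a]) (use s in auto)
      finally show "(CLINT \<omega> | M. P \<omega> * e \<mu> s \<omega> * e \<kappa> s \<omega>) * \<phi> \<kappa> s t = (CLINT \<omega> | M. P \<omega> * e (\<kappa> + \<mu>) a \<omega>) * \<phi> (\<kappa> + \<mu>) a s * \<phi> \<kappa> s t"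
        by (simp only:)
    qed simp
    finally show ?thesis .
  qed
  have "(CLINT \<omega> | M. P \<omega> * (Z \<kappa> a b \<omega> * Z \<mu> a b \<omega>))
    = (CLINT \<omega> | M. CLBINT t:{a..b}. P \<omega> * Z \<mu> a t \<omega> * e \<kappa> t \<omega> + P \<omega> * Z \<kappa> a t \<omega> * e \<mu> t \<omega>)"
  proof (rule Bochner_Integration.integral_cong[OF refl])
    fix \<omega> assume "\<omega> \<in> space M"
    then have "Z \<kappa> a b \<omega> * Z \<mu> a b \<omega> = (CLBINT t:{a..b}. e \<kappa> t \<omega> * Z \<mu> a t \<omega> + e \<mu> t \<omega> * Z \<kappa> a t \<omega>)"
      unfolding Z_def by (rule product_rule_adapted[OF adapted_e[OF a] adapted_e[OF a]])
    then show "P \<omega> * (Z \<kappa> a b \<omega> * Z \<mu> a b \<omega>) = (CLBINT t:{a..b}. P \<omega> * Z \<mu> a t \<omega> * e \<kappa> t \<omega> + P \<omega> * Z \<kappa> a t \<omega> * e \<mu> t \<omega>)"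
      by (simp add: set_integral_mult_right[symmetric] algebra_simps del: set_integral_mult_right)
  qed
  also have "\<dots> = (CLBINT t:{a..b}. (CLINT \<omega> | M. P \<omega> * Z \<mu> a t \<omega> * e \<kappa> t \<omega> + P \<omega> * Z \<kappa> a t \<omega> * e \<mu> t \<omega>))"
    by (intro Fubini_adapted adapted_add adapted_mult adapted_P adapted_Z adapted_e a)
  also have "\<dots> = (CLBINT t:{a..b}. (CLBINT s:{a..t}. (CLINT \<omega> | M. P \<omega> * e (\<kappa> + \<mu>) a \<omega>) * \<phi> (\<kappa> + \<mu>) a s * (\<phi> \<kappa> s t + \<phi> \<mu> s t)))"
  proof (intro set_lebesgue_integral_cong allI impI)
    fix t assume t: "t \<in> {a..b}"
    have int: "integrable M (\<lambda>\<omega>. P \<omega> * Z \<mu> a t \<omega> * e \<kappa> t \<omega>)" for \<kappa> \<mu>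
    proof (rule integrable_const_bound[where B="t - a"])
      show "AE \<omega> in M. norm (P \<omega> * Z \<mu> a t \<omega> * e \<kappa> t \<omega>) \<le> t - a"
        using cmod_Z_le[of a t \<mu>] t mult_mono[OF P(2) cmod_Z_le[of a t \<mu>]] by (intro AE_I2) (auto simp: norm_mult)
      show "(\<lambda>\<omega>. P \<omega> * Z \<mu> a t \<omega> * e \<kappa> t \<omega>) \<in> borel_measurable M"
        by (rule adapted_random[OF adapted_mult[OF adapted_mult[OF adapted_P adapted_Z[OF a]] adapted_e[OF a]]])
    qed
    have si: "set_integrable lborel {a..t} (\<lambda>s. (CLINT \<omega> | M. P \<omega> * e (\<kappa> + \<mu>) a \<omega>) * \<phi> (\<kappa> + \<mu>) a s * \<phi> \<nu> s t)" for \<nu>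
      by (rule set_integrable_Icc_bounded[where C=1])
         (auto simp: norm_mult intro!: mult_le_one mult_nonneg_nonneg \<phi>_le_1 norm_expectation_P_e_le[where P=P, OF P(2)])
    show "(CLINT \<omega> | M. P \<omega> * Z \<mu> a t \<omega> * e \<kappa> t \<omega> + P \<omega> * Z \<kappa> a t \<omega> * e \<mu> t \<omega>)
      = (CLBINT s:{a..t}. (CLINT \<omega> | M. P \<omega> * e (\<kappa> + \<mu>) a \<omega>) * \<phi> (\<kappa> + \<mu>) a s * (\<phi> \<kappa> s t + \<phi> \<mu> s t))"
      using t si[of \<kappa>] si[of \<mu>] by (simp add: int half add.commute[of \<mu> \<kappa>] distrib_left set_integral_add)
  qed auto
  finally show ?thesis .
qed

text \<open>For equal frequencies the merged frequency is 2 \<kappa>, and the integrand becomes that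
  of condition (C).\<close>

lemma second_moment_same: "cmod (CLINT \<omega> | M. P \<omega> * (Z \<kappa> a b \<omega> * Z \<kappa> a b \<omega>))
    \<le> 2 * (LBINT t:{a..b}. LBINT s:{a..t}. cmod (\<phi> \<kappa> s t) * cmod (\<phi> (2 * \<kappa>) a s))"
proof -
  have "cmod (CLINT \<omega> | M. P \<omega> * (Z \<kappa> a b \<omega> * Z \<kappa> a b \<omega>)) \<le> (LBINT t:{a..b}. LBINT s:{a..t}. 2 * (cmod (\<phi> \<kappa> s t) * cmod (\<phi> (2 * \<kappa>) a s)))"
    unfolding second_moment
  proof (rule norm_double_integral_le[where C=2])
    show "(\<lambda>(t, s). 2 * (cmod (\<phi> \<kappa> s t) * cmod (\<phi> (2 * \<kappa>) a s))) \<in> borel_measurable (borel \<Otimes>\<^sub>M borel)"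
      unfolding case_prod_beta by measurable
    show "\<bar>2 * (cmod (\<phi> \<kappa> s t) * cmod (\<phi> (2 * \<kappa>) a s))\<bar> \<le> 2" for t s
      by (simp add: abs_mult mult_le_one \<phi>_le_1)
    show "cmod ((CLINT \<omega> | M. P \<omega> * e (\<kappa> + \<kappa>) a \<omega>) * \<phi> (\<kappa> + \<kappa>) a s * (\<phi> \<kappa> s t + \<phi> \<kappa> s t)) \<le> 2 * (cmod (\<phi> \<kappa> s t) * cmod (\<phi> (2 * \<kappa>) a s))" for t s
      using norm_expectation_P_e_le[where P=P and \<kappa>="2 * \<kappa>" and s=a, OF P(2)]
      by (simp add: norm_mult mult_2[symmetric] mult.assoc mult.left_commute[of _ 2] mult_left_le_one_le mult.commute[of "cmod (\<phi> (2 * \<kappa>) a s)"])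
  qed
  then show ?thesis by simp
qed

text \<open>For opposite frequencies the merged exponential is constant, so the dependence on
  \<open>P\<close> factors out and the deterministic double integral of condition (B) is
  left.\<close>

lemma second_moment_abs: "(CLINT \<omega> | M. P \<omega> * of_real ((cmod (Z \<kappa> a b \<omega>))\<^sup>2))
    = (CLINT \<omega> | M. P \<omega>) * (CLBINT t:{a..b}. (CLBINT s:{a..t}. \<phi> \<kappa> s t + \<phi> (- \<kappa>) s t))"
proof -
  have "\<phi> 0 a s = 1" for s by (simp add: \<phi>_def prob_space)
  then show ?thesis unfolding norm_Z_power2 second_moment by (simp add: mult.assoc)
qed

end

text \<open>With \<open>P\<close> = 1, the integrand is the sum of two complex conjugate numbers;
  this is the factor 2.\<close>

lemma expectation_Z_power2_le:
  assumes "0 \<le> a"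
  shows "(\<integral>\<omega>. (cmod (Z \<kappa> a b \<omega>))\<^sup>2 \<partial>M) \<le> 2 * J \<kappa> a b"
proof -
  have "complex_of_real (\<integral>\<omega>. (cmod (Z \<kappa> a b \<omega>))\<^sup>2 \<partial>M) = (CLINT \<omega> | M. 1 * of_real ((cmod (Z \<kappa> a b \<omega>))\<^sup>2))"
    by (subst integral_complex_of_real[symmetric]) simp
  also have "\<dots> = (CLBINT t:{a..b}. (CLBINT s:{a..t}. \<phi> \<kappa> s t + \<phi> (- \<kappa>) s t))"
    by (subst second_moment_abs[OF assms, of "\<lambda>_. 1"]) (auto simp: prob_space)
  finally have "(\<integral>\<omega>. (cmod (Z \<kappa> a b \<omega>))\<^sup>2 \<partial>M) \<le> cmod (CLBINT t:{a..b}. (CLBINT s:{a..t}. \<phi> \<kappa> s t + \<phi> (- \<kappa>) s t))"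
    by (metis norm_of_real abs_ge_self)
  also have "\<dots> \<le> (LBINT t:{a..b}. LBINT s:{a..t}. 2 * cmod (\<phi> \<kappa> s t))"
  proof (rule norm_double_integral_le[where C=2])
    show "(\<lambda>(t, s). 2 * cmod (\<phi> \<kappa> s t)) \<in> borel_measurable (borel \<Otimes>\<^sub>M borel)"
      unfolding case_prod_beta by measurable
    show "cmod (\<phi> \<kappa> s t + \<phi> (- \<kappa>) s t) \<le> 2 * cmod (\<phi> \<kappa> s t)" for t s
      using norm_triangle_ineq[of "\<phi> \<kappa> s t" "\<phi> (- \<kappa>) s t"] by (simp add: \<phi>_minus)
  qed (simp add: \<phi>_le_1)
  also have "\<dots> = 2 * J \<kappa> a b" by (simp add: J_def)
  finally show ?thesis .
qed

end


lemma set_integral_Icc_linear: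
  fixes a b :: real
  assumes "a \<le> b"
  shows "(LBINT t:{a..b}. c * (t - a)) = c * (b - a)\<^sup>2 / 2" "set_integrable lborel {a..b} (\<lambda>t. c * (t - a))"
proof -
  have "(\<integral>t. c * (t - a) * indicator {a..b} t \<partial>lborel) = c * (b - a)\<^sup>2 / 2 - c * (a - a)\<^sup>2 / 2"
    by (rule integral_FTC_Icc_real[OF assms]) (auto intro!: derivative_eq_intros continuous_intros)
  moreover have "(LBINT t:{a..b}. c * (t - a)) = (\<integral>t. c * (t - a) * indicator {a..b} t \<partial>lborel)"
    unfolding set_lebesgue_integral_def by (simp only: real_scaleR_def mult.commute[of "indicator _ _"])
  ultimately show "(LBINT t:{a..b}. c * (t - a)) = c * (b - a)\<^sup>2 / 2"
    by (simp only: diff_self zero_power2 mult_zero_right div_0 diff_0_right)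
  show "set_integrable lborel {a..b} (\<lambda>t. c * (t - a))"
    by (rule set_integrable_Icc_bounded[where C="\<bar>c\<bar> * (b - a)"]) (auto simp: abs_mult intro!: mult_left_mono)
qed

section \<open>Fourth moments and decay of the characteristic functions of increments\<close>

context increment_process
begin

lemma integrable_adapted:
  assumes f: "adapted a f" and "a \<le> t"
  shows "integrable M (f t)"
proof -
  obtain C where C: "0 \<le> C" "\<And>s \<omega>. s \<in> {a..t} \<Longrightarrow> cmod (f s \<omega>) \<le> C" using adapted_bdd[OF f] by metis
  show ?thesis using C assms(2) by (intro integrable_const_bound[where B=C] adapted_random[OF f]) auto
qed

lemma cmod_Z_minus: "cmod (Z (- \<kappa>) a t \<omega>) = cmod (Z \<kappa> a t \<omega>)"
  unfolding cnj_Z[symmetric] by simp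

lemma integrable_Z_power2: "0 \<le> a \<Longrightarrow> a \<le> t \<Longrightarrow> integrable M (\<lambda>\<omega>. (cmod (Z \<kappa> a t \<omega>))\<^sup>2)"
  using adapted_Z_section[of a \<kappa> t] cmod_Z_le[of a t \<kappa>]
  by (intro integrable_const_bound[where B="(t - a)\<^sup>2"]) (auto intro!: power_mono)

text \<open>\<open>\<bar>Z\<bar>\<^sup>4\<close> is differentiated twice in time by the product rule, isolating in each term the last
  two of the four time points; the remaining two are controlled by the second moment.\<close>

lemma third_power_times_e:
  assumes a: "0 \<le> a" "a \<le> t" and S: "\<And>s. s \<in> {a..t} \<Longrightarrow> (\<integral>\<omega>. (cmod (Z \<sigma> a s \<omega>))\<^sup>2 \<partial>M) \<le> S"
  shows "cmod (CLINT \<omega> | M. Z \<sigma> a t \<omega> * (Z (- \<sigma>) a t \<omega> * Z (- \<sigma>) a t \<omega>) * e \<sigma> t \<omega>) \<le> 3 * S * (LBINT s:{a..t}. cmod (\<phi> \<sigma> s t))"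
proof -
  \<comment> \<open>\<open>\<beta>\<close> is the time derivative of the square of
    \<open>Z (- \<sigma>) a\<close>, and \<open>\<alpha>\<close> that of this square times
    \<open>Z \<sigma> a\<close>.\<close>
  define \<beta> where "\<beta> s \<omega> = e (- \<sigma>) s \<omega> * Z (- \<sigma>) a s \<omega> + e (- \<sigma>) s \<omega> * Z (- \<sigma>) a s \<omega>" for s \<omega>
  define \<alpha> where "\<alpha> s \<omega> = e \<sigma> s \<omega> * (Z (- \<sigma>) a s \<omega> * Z (- \<sigma>) a s \<omega>) + \<beta> s \<omega> * Z \<sigma> a s \<omega>" for s \<omega>
  have \<beta>: "adapted a \<beta>" unfolding \<beta>_def[abs_def] by (intro adapted_add adapted_mult adapted_e adapted_Z a)
  have \<alpha>: "adapted a \<alpha>" unfolding \<alpha>_def[abs_def] by (intro adapted_add adapted_mult adapted_e adapted_Z a \<beta>)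
  have W: "Z (- \<sigma>) a s \<omega> * Z (- \<sigma>) a s \<omega> = (CLBINT r:{a..s}. \<beta> r \<omega>)" if "\<omega> \<in> space M" for s \<omega>
    unfolding Z_def \<beta>_def by (rule product_rule_adapted[OF adapted_e[OF a(1)] adapted_e[OF a(1)] that])
  have A: "Z \<sigma> a t \<omega> * (Z (- \<sigma>) a t \<omega> * Z (- \<sigma>) a t \<omega>) = (CLBINT s:{a..t}. \<alpha> s \<omega>)" if "\<omega> \<in> space M" for \<omega>
  proof -
    have "(CLBINT s:{a..t}. e \<sigma> s \<omega>) * (CLBINT s:{a..t}. \<beta> s \<omega>)
       = (CLBINT s:{a..t}. e \<sigma> s \<omega> * (CLBINT r:{a..s}. \<beta> r \<omega>) + \<beta> s \<omega> * (CLBINT r:{a..s}. e \<sigma> r \<omega>))"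
      by (rule product_rule_adapted[OF adapted_e[OF a(1)] \<beta> that])
    then show ?thesis unfolding W[OF that, symmetric] \<alpha>_def Z_def[of \<sigma>, symmetric] .
  qed
  have "(CLINT \<omega> | M. Z \<sigma> a t \<omega> * (Z (- \<sigma>) a t \<omega> * Z (- \<sigma>) a t \<omega>) * e \<sigma> t \<omega>) = (CLINT \<omega> | M. (CLBINT s:{a..t}. \<alpha> s \<omega>) * e \<sigma> t \<omega>)"
    by (intro Bochner_Integration.integral_cong refl) (simp add: A)
  also have "\<dots> = (CLBINT s:{a..t}. (CLINT \<omega> | M. \<alpha> s \<omega> * e \<sigma> s \<omega>) * \<phi> \<sigma> s t)"
    by (rule expectation_integral_times_e[OF \<alpha> a])
  also have "cmod \<dots> \<le> (LBINT s:{a..t}. 3 * S * cmod (\<phi> \<sigma> s t))"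
  proof (rule norm_set_integral_le)
    show "set_integrable lborel {a..t} (\<lambda>s. 3 * S * cmod (\<phi> \<sigma> s t))"
      by (intro set_integrable_mult_right set_integrable_\<phi>)
    fix s assume s: "s \<in> {a..t}"
    \<comment> \<open>Each of the three terms of \<open>\<alpha>\<close> is a unimodular factor
      times two integrals of equal modulus.\<close>
    have "cmod (\<alpha> s \<omega> * e \<sigma> s \<omega>) \<le> 3 * (cmod (Z \<sigma> a s \<omega>))\<^sup>2" for \<omega>
    proof -
      have "cmod (\<alpha> s \<omega>) \<le> cmod (Z \<sigma> a s \<omega>) * cmod (Z \<sigma> a s \<omega>) + 2 * cmod (Z \<sigma> a s \<omega>) * cmod (Z \<sigma> a s \<omega>)"
        unfolding \<alpha>_def \<beta>_def mult_2[symmetric]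
        by (intro order_trans[OF norm_triangle_ineq]) (simp add: norm_mult cmod_Z_minus)
      then show ?thesis by (simp add: norm_mult power2_eq_square)
    qed
    then have "cmod (CLINT \<omega> | M. \<alpha> s \<omega> * e \<sigma> s \<omega>) \<le> (\<integral>\<omega>. 3 * (cmod (Z \<sigma> a s \<omega>))\<^sup>2 \<partial>M)"
      using integrable_Z_power2[of a s \<sigma>] a s by (intro norm_integral_le_integral) auto
    also have "\<dots> \<le> 3 * S" using S[OF s] by simp
    finally show "cmod ((CLINT \<omega> | M. \<alpha> s \<omega> * e \<sigma> s \<omega>) * \<phi> \<sigma> s t) \<le> 3 * S * cmod (\<phi> \<sigma> s t)"
      by (simp add: norm_mult mult_right_mono)
  qed
  finally show ?thesis by simp
qed

text \<open>The fourth power is the square of Z times its conjugate. Its derivative has the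
  prefactor 2 and two conjugate terms, each bounded by 3 S times an inner integral of |\<phi>|,
  which gives 12.\<close>

lemma expectation_Z_power4_le:
  assumes a: "0 \<le> a" "a \<le> b" and S: "\<And>s. s \<in> {a..b} \<Longrightarrow> (\<integral>\<omega>. (cmod (Z \<kappa> a s \<omega>))\<^sup>2 \<partial>M) \<le> S"
  shows "(\<integral>\<omega>. cmod (Z \<kappa> a b \<omega>) ^ 4 \<partial>M) \<le> 12 * S * J \<kappa> a b"
proof -
  define A where "A \<sigma> t \<omega> = Z \<sigma> a t \<omega> * (Z (- \<sigma>) a t \<omega> * Z (- \<sigma>) a t \<omega>)" for \<sigma> t \<omega>
  \<comment> \<open>The time derivative of \<open>Z \<kappa> a\<close> times its conjugate.\<close>
  define q where "q t \<omega> = e \<kappa> t \<omega> * Z (- \<kappa>) a t \<omega> + e (- \<kappa>) t \<omega> * Z \<kappa> a t \<omega>" for t \<omega>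
  have q: "adapted a q" unfolding q_def[abs_def] by (intro adapted_add adapted_mult adapted_e adapted_Z a)
  have A: "adapted a (\<lambda>t \<omega>. A \<sigma> t \<omega> * e \<sigma> t \<omega>)" for \<sigma>
    unfolding A_def[abs_def] by (intro adapted_mult adapted_e adapted_Z a)
  have ZZ: "Z \<kappa> a t \<omega> * Z (- \<kappa>) a t \<omega> = (CLBINT s:{a..t}. q s \<omega>)" if "\<omega> \<in> space M" for t \<omega>
    unfolding Z_def q_def by (rule product_rule_adapted[OF adapted_e[OF a(1)] adapted_e[OF a(1)] that])
  have pt: "of_real (cmod (Z \<kappa> a b \<omega>) ^ 4) = (CLBINT t:{a..b}. 2 * (A \<kappa> t \<omega> * e \<kappa> t \<omega> + A (- \<kappa>) t \<omega> * e (- \<kappa>) t \<omega>))" if "\<omega> \<in> space M" for \<omega>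
  proof -
    have "complex_of_real (cmod (Z \<kappa> a b \<omega>) ^ 4) = of_real ((cmod (Z \<kappa> a b \<omega>))\<^sup>2) * of_real ((cmod (Z \<kappa> a b \<omega>))\<^sup>2)"
      by (simp add: power2_eq_square eval_nat_numeral)
    also have "\<dots> = (CLBINT s:{a..b}. q s \<omega>) * (CLBINT s:{a..b}. q s \<omega>)"
      unfolding norm_Z_power2 ZZ[OF that] ..
    also have "\<dots> = (CLBINT t:{a..b}. q t \<omega> * (CLBINT s:{a..t}. q s \<omega>) + q t \<omega> * (CLBINT s:{a..t}. q s \<omega>))"
      by (rule product_rule_adapted[OF q q that])
    also have "\<dots> = (CLBINT t:{a..b}. 2 * (A \<kappa> t \<omega> * e \<kappa> t \<omega> + A (- \<kappa>) t \<omega> * e (- \<kappa>) t \<omega>))"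
      unfolding ZZ[OF that, symmetric] by (intro set_lebesgue_integral_cong) (auto simp: A_def q_def algebra_simps)
    finally show ?thesis .
  qed
  have "complex_of_real (\<integral>\<omega>. cmod (Z \<kappa> a b \<omega>) ^ 4 \<partial>M) = (CLINT \<omega> | M. of_real (cmod (Z \<kappa> a b \<omega>) ^ 4))"
    by (rule integral_complex_of_real[symmetric])
  also have "\<dots> = (CLINT \<omega> | M. CLBINT t:{a..b}. 2 * (A \<kappa> t \<omega> * e \<kappa> t \<omega> + A (- \<kappa>) t \<omega> * e (- \<kappa>) t \<omega>))"
    by (intro Bochner_Integration.integral_cong refl pt)
  also have "\<dots> = (CLBINT t:{a..b}. (CLINT \<omega> | M. 2 * (A \<kappa> t \<omega> * e \<kappa> t \<omega> + A (- \<kappa>) t \<omega> * e (- \<kappa>) t \<omega>)))"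
    by (intro Fubini_adapted adapted_mult[OF adapted_const[of _ _ 2]] adapted_add A a) auto
  finally have eq: "complex_of_real (\<integral>\<omega>. cmod (Z \<kappa> a b \<omega>) ^ 4 \<partial>M) = (CLBINT t:{a..b}. (CLINT \<omega> | M. 2 * (A \<kappa> t \<omega> * e \<kappa> t \<omega> + A (- \<kappa>) t \<omega> * e (- \<kappa>) t \<omega>)))" .
  have "(\<integral>\<omega>. cmod (Z \<kappa> a b \<omega>) ^ 4 \<partial>M) \<le> cmod (complex_of_real (\<integral>\<omega>. cmod (Z \<kappa> a b \<omega>) ^ 4 \<partial>M))"
    by (simp only: norm_of_real abs_ge_self)
  also have "\<dots> \<le> (LBINT t:{a..b}. 12 * S * (LBINT s:{a..t}. cmod (\<phi> \<kappa> s t)))"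
    unfolding eq
  proof (rule norm_set_integral_le)
    have "(\<lambda>(t, s). cmod (\<phi> \<kappa> s t)) \<in> borel_measurable (borel \<Otimes>\<^sub>M borel)" unfolding case_prod_beta by measurable
    then show "set_integrable lborel {a..b} (\<lambda>t. 12 * S * (LBINT s:{a..t}. cmod (\<phi> \<kappa> s t)))"
      by (intro set_integrable_mult_right double_integrable[where C=1]) (auto simp: \<phi>_le_1)
    fix t assume t: "t \<in> {a..b}"
    have 3: "cmod (CLINT \<omega> | M. A \<kappa> t \<omega> * e \<kappa> t \<omega>) \<le> 3 * S * (LBINT s:{a..t}. cmod (\<phi> \<kappa> s t))"
      unfolding A_def using t a S by (intro third_power_times_e) auto
    have "cmod (CLINT \<omega> | M. A (- \<kappa>) t \<omega> * e (- \<kappa>) t \<omega>) \<le> 3 * S * (LBINT s:{a..t}. cmod (\<phi> (- \<kappa>) s t))"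
      unfolding A_def using t a S by (intro third_power_times_e) (auto simp: cmod_Z_minus)
    then have 4: "cmod (CLINT \<omega> | M. A (- \<kappa>) t \<omega> * e (- \<kappa>) t \<omega>) \<le> 3 * S * (LBINT s:{a..t}. cmod (\<phi> \<kappa> s t))"
      by (simp add: \<phi>_minus)
    have "(CLINT \<omega> | M. 2 * (A \<kappa> t \<omega> * e \<kappa> t \<omega> + A (- \<kappa>) t \<omega> * e (- \<kappa>) t \<omega>))
       = 2 * ((CLINT \<omega> | M. A \<kappa> t \<omega> * e \<kappa> t \<omega>) + (CLINT \<omega> | M. A (- \<kappa>) t \<omega> * e (- \<kappa>) t \<omega>))"
      using integrable_adapted[OF A, of t] t by simp
    then have "cmod (CLINT \<omega> | M. 2 * (A \<kappa> t \<omega> * e \<kappa> t \<omega> + A (- \<kappa>) t \<omega> * e (- \<kappa>) t \<omega>))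
       = 2 * cmod ((CLINT \<omega> | M. A \<kappa> t \<omega> * e \<kappa> t \<omega>) + (CLINT \<omega> | M. A (- \<kappa>) t \<omega> * e (- \<kappa>) t \<omega>))"
      by (simp only: norm_mult norm_numeral)
    then show "cmod (CLINT \<omega> | M. 2 * (A \<kappa> t \<omega> * e \<kappa> t \<omega> + A (- \<kappa>) t \<omega> * e (- \<kappa>) t \<omega>)) \<le> 12 * S * (LBINT s:{a..t}. cmod (\<phi> \<kappa> s t))"
      using 3 4 norm_triangle_ineq[of "CLINT \<omega> | M. A \<kappa> t \<omega> * e \<kappa> t \<omega>" "CLINT \<omega> | M. A (- \<kappa>) t \<omega> * e (- \<kappa>) t \<omega>"]
      by linarith
  qed
  also have "\<dots> = 12 * S * J \<kappa> a b" by (simp add: J_def)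
  finally show ?thesis .
qed

text \<open>The value over the large interval is the value over the small one times two factors of
  modulus at most 1.\<close>

lemma \<phi>_antimono:
  assumes "0 \<le> a" "a \<le> s" "s \<le> t" "t \<le> b"
  shows "cmod (\<phi> \<kappa> a b) \<le> cmod (\<phi> \<kappa> s t)"
proof -
  have "\<phi> \<kappa> a b = \<phi> \<kappa> a s * (\<phi> \<kappa> s t * \<phi> \<kappa> t b)"
    using assms \<phi>_mult[of a s b \<kappa>] \<phi>_mult[of s t b \<kappa>] by simp
  then have "cmod (\<phi> \<kappa> a b) = cmod (\<phi> \<kappa> a s) * (cmod (\<phi> \<kappa> s t) * cmod (\<phi> \<kappa> t b))" by (simp only: norm_mult)
  also have "\<dots> \<le> 1 * (cmod (\<phi> \<kappa> s t) * 1)"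
    by (intro mult_mono mult_left_mono \<phi>_le_1 mult_nonneg_nonneg norm_ge_zero zero_le_one)
  finally show ?thesis by simp
qed

context
  fixes \<kappa> K :: real
  assumes K0: "0 \<le> K" and K: "\<And>a b. 0 \<le> a \<Longrightarrow> a \<le> b \<Longrightarrow> J \<kappa> a b \<le> K * (b - a)"
begin

text \<open>On the triangle a \<le> s \<le> t \<le> b the integrand of \<open>J\<close> is at least
  its value at the corner (a, b), and the triangle has area (b - a)^2 / 2.\<close>

lemma \<phi>_decay:
  assumes "0 \<le> a" "a \<le> b"
  shows "cmod (\<phi> \<kappa> a b) * (b - a) \<le> 2 * K"
proof (cases "a = b")
  case False
  let ?c = "cmod (\<phi> \<kappa> a b)"
  have "?c * (b - a)\<^sup>2 / 2 = (LBINT t:{a..b}. ?c * (t - a))" by (rule set_integral_Icc_linear(1)[OF assms(2), symmetric])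
  also have "\<dots> \<le> J \<kappa> a b"
    unfolding J_def
  proof (rule set_integral_mono)
    show "set_integrable lborel {a..b} (\<lambda>t. ?c * (t - a))" by (rule set_integral_Icc_linear(2)[OF assms(2)])
    have "(\<lambda>(t, s). cmod (\<phi> \<kappa> s t)) \<in> borel_measurable (borel \<Otimes>\<^sub>M borel)" unfolding case_prod_beta by measurable
    then show "set_integrable lborel {a..b} (\<lambda>t. LBINT s:{a..t}. cmod (\<phi> \<kappa> s t))"
      by (intro double_integrable[where C=1]) (auto simp: \<phi>_le_1)
    fix t assume t: "t \<in> {a..b}"
    have "?c * (t - a) = (LBINT s:{a..t}. ?c)" using t by (simp add: set_lebesgue_integral_def mult.commute)
    also have "\<dots> \<le> (LBINT s:{a..t}. cmod (\<phi> \<kappa> s t))"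
      using t assms by (intro set_integral_mono set_integrable_\<phi> set_integrable_Icc_bounded[where C="?c"] \<phi>_antimono) auto
    finally show "?c * (t - a) \<le> (LBINT s:{a..t}. cmod (\<phi> \<kappa> s t))" .
  qed
  also have "\<dots> \<le> K * (b - a)" by (rule K[OF assms])
  finally have "(?c * (b - a)) * (b - a) \<le> (2 * K) * (b - a)" by (simp add: power2_eq_square)
  then show ?thesis using False assms by simp
qed (use K0 in simp)

text \<open>Linear decay on each half of the interval multiplies to quadratic decay with constant (4
  K)^2. Adding 1 to the length keeps the estimate meaningful at short range, where |\<phi>| \<le> 1
  is used.\<close>

lemma \<phi>_decay_square:
  assumes "0 \<le> a" "a \<le> s"
  shows "cmod (\<phi> \<kappa> a s) * (1 + (s - a))\<^sup>2 \<le> 2 + 32 * K\<^sup>2"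
proof -
  define v where "v = s - a"
  define m where "m = a + v / 2"
  have m: "0 \<le> a" "a \<le> m" "m \<le> s" "m - a = v / 2" "s - m = v / 2" "0 \<le> v" using assms by (auto simp: m_def v_def field_simps)
  have 1: "cmod (\<phi> \<kappa> a m) * v \<le> 4 * K" using \<phi>_decay[of a m] m by simp
  have 2: "cmod (\<phi> \<kappa> m s) * v \<le> 4 * K" using \<phi>_decay[of m s] m by simp
  have "cmod (\<phi> \<kappa> a s) * v\<^sup>2 = (cmod (\<phi> \<kappa> a m) * v) * (cmod (\<phi> \<kappa> m s) * v)"
    using \<phi>_mult[of a m s \<kappa>] m by (simp add: norm_mult power2_eq_square)
  also have "\<dots> \<le> (4 * K) * (4 * K)" using K0 m(6) by (intro mult_mono 1 2 mult_nonneg_nonneg) auto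
  finally have 3: "cmod (\<phi> \<kappa> a s) * v\<^sup>2 \<le> 16 * K\<^sup>2" by (simp add: power2_eq_square)
  have "(1 + v)\<^sup>2 \<le> 2 + 2 * v\<^sup>2" using zero_le_power2[of "1 - v"] by (simp add: power2_eq_square algebra_simps)
  then have "cmod (\<phi> \<kappa> a s) * (1 + v)\<^sup>2 \<le> cmod (\<phi> \<kappa> a s) * (2 + 2 * v\<^sup>2)" by (rule mult_left_mono) simp
  also have "\<dots> \<le> 2 + 32 * K\<^sup>2" using 3 \<phi>_le_1[of \<kappa> a s] by (simp add: algebra_simps)
  finally show ?thesis by (simp add: v_def)
qed

text \<open>The inverse square majorant has integral at most 1, whatever the length of the interval.
  After scaling, this makes the first moments of the increments of order \<epsilon>.\<close>

lemma integral_\<phi>_le: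
  assumes "0 \<le> a" "a \<le> b"
  shows "(LBINT s:{a..b}. cmod (\<phi> \<kappa> a s)) \<le> 2 + 32 * K\<^sup>2"
proof -
  have "(LBINT s:{a..b}. cmod (\<phi> \<kappa> a s)) \<le> (LBINT s:{a..b}. (2 + 32 * K\<^sup>2) * (1 / (1 + (s - a))\<^sup>2))"
  proof (rule set_integral_mono)
    show "set_integrable lborel {a..b} (\<lambda>s. cmod (\<phi> \<kappa> a s))"
      by (rule set_integrable_Icc_bounded[where C=1]) (auto simp: \<phi>_le_1)
    show "set_integrable lborel {a..b} (\<lambda>s. (2 + 32 * K\<^sup>2) * (1 / (1 + (s - a))\<^sup>2))"
      by (intro set_integrable_mult_right set_integral_Icc_inverse_square assms)
    fix s assume s: "s \<in> {a..b}"
    then have "0 < (1 + (s - a))\<^sup>2" by simp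
    then show "cmod (\<phi> \<kappa> a s) \<le> (2 + 32 * K\<^sup>2) * (1 / (1 + (s - a))\<^sup>2)"
      using \<phi>_decay_square[of a s] s assms by (simp add: field_simps)
  qed
  also have "\<dots> \<le> (2 + 32 * K\<^sup>2) * 1"
    unfolding set_integral_mult_right using set_integral_Icc_inverse_square(1)[OF assms(2)] by (intro mult_left_mono) auto
  finally show ?thesis by simp
qed

lemma Z_second_moment_le: "0 \<le> a \<Longrightarrow> a \<le> b \<Longrightarrow> (\<integral>\<omega>. (cmod (Z \<kappa> a b \<omega>))\<^sup>2 \<partial>M) \<le> 2 * K * (b - a)"
  using expectation_Z_power2_le[of a \<kappa> b] K[of a b] by simp

lemma Z_fourth_moment_le:
  assumes "0 \<le> a" "a \<le> b"
  shows "(\<integral>\<omega>. cmod (Z \<kappa> a b \<omega>) ^ 4 \<partial>M) \<le> 24 * K\<^sup>2 * (b - a)\<^sup>2"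
proof -
  have "(\<integral>\<omega>. cmod (Z \<kappa> a b \<omega>) ^ 4 \<partial>M) \<le> 12 * (2 * K * (b - a)) * J \<kappa> a b"
  proof (rule expectation_Z_power4_le[OF assms])
    fix s assume s: "s \<in> {a..b}"
    have "(\<integral>\<omega>. (cmod (Z \<kappa> a s \<omega>))\<^sup>2 \<partial>M) \<le> 2 * K * (s - a)" using s assms by (intro Z_second_moment_le) auto
    also have "\<dots> \<le> 2 * K * (b - a)" using s K0 by (intro mult_left_mono) auto
    finally show "(\<integral>\<omega>. (cmod (Z \<kappa> a s \<omega>))\<^sup>2 \<partial>M) \<le> 2 * K * (b - a)" .
  qed
  also have "\<dots> \<le> 12 * (2 * K * (b - a)) * (K * (b - a))"
    using K[OF assms] K0 assms by (intro mult_left_mono) auto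
  finally show ?thesis by (simp add: power2_eq_square mult_ac)
qed

end

end

section \<open>Second-order expansion of a character over one time step\<close>

lemma exp_minus_quadratic: "0 \<le> (x::real) \<Longrightarrow> \<bar>exp (- x) - (1 - x)\<bar> \<le> x\<^sup>2 / 2"
proof -
  assume x: "0 \<le> x"
  have l: "1 - x \<le> exp (- x)" using exp_ge_add_one_self[of "- x"] by simp
  have pos: "0 < 1 + x + x\<^sup>2 / 2" using x by (simp add: add_pos_nonneg)
  have "exp (- x) \<le> 1 / (1 + x + x\<^sup>2 / 2)"
    using exp_lower_Taylor_quadratic[OF x] pos by (simp add: exp_minus inverse_eq_divide frac_le)
  also have "\<dots> \<le> 1 - x + x\<^sup>2 / 2"
  proof -
    \<comment> \<open>Turns the lower Taylor bound for exp x into an upper bound for exp (- x): the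
      two quadratics multiply to 1 + x^4 / 4, which is at least 1.\<close>
    have "(1 - x + x\<^sup>2 / 2) * (1 + x + x\<^sup>2 / 2) = 1 + x ^ 4 / 4" by (simp add: power2_eq_square eval_nat_numeral field_simps)
    then have "1 \<le> (1 - x + x\<^sup>2 / 2) * (1 + x + x\<^sup>2 / 2)" by simp
    then show ?thesis using pos by (simp add: pos_divide_le_eq)
  qed
  finally show ?thesis using l by simp
qed

text \<open>Taylor expansion of the character, tested against \<open>P\<close>. The linear terms and
  the two squares cost \<open>m1\<close> and \<open>m2\<close>; the squared modulus has coefficient
  -|u|^2 / 4 and approximate mean 2 h, matching the linear term of the Gaussian factor. The terms in
  \<open>h\<close> come from the third-order remainder and from the quadratic error of the
  exponential.\<close>

lemma (in prob_space) characteristic_step: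
  fixes P \<Delta> :: "'a \<Rightarrow> complex"
  assumes [measurable]: "P \<in> borel_measurable M" "\<Delta> \<in> borel_measurable M"
    and P: "\<And>\<omega>. cmod (P \<omega>) \<le> 1" and bdd: "\<And>\<omega>. cmod (\<Delta> \<omega>) \<le> B"
    and m1: "cmod (CLINT \<omega> | M. P \<omega> * \<Delta> \<omega>) \<le> m1" "cmod (CLINT \<omega> | M. P \<omega> * cnj (\<Delta> \<omega>)) \<le> m1"
    and m2: "cmod (CLINT \<omega> | M. P \<omega> * (\<Delta> \<omega> * \<Delta> \<omega>)) \<le> m2" "cmod (CLINT \<omega> | M. P \<omega> * (cnj (\<Delta> \<omega>) * cnj (\<Delta> \<omega>))) \<le> m2"
    and m3: "cmod ((CLINT \<omega> | M. P \<omega> * of_real ((cmod (\<Delta> \<omega>))\<^sup>2)) - (CLINT \<omega> | M. P \<omega>) * of_real (2 * h)) \<le> m3"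
    and C2: "(\<integral>\<omega>. (cmod (\<Delta> \<omega>))\<^sup>2 \<partial>M) \<le> C2 * h" and C4: "(\<integral>\<omega>. cmod (\<Delta> \<omega>) ^ 4 \<partial>M) \<le> C4 * h\<^sup>2"
    and h: "0 < h" and u: "cmod u \<le> U"
  shows "cmod ((CLINT \<omega> | M. P \<omega> * iexp (Re (cnj u * \<Delta> \<omega>))) - (CLINT \<omega> | M. P \<omega>) * of_real (exp (- (h * (cmod u)\<^sup>2) / 2)))
    \<le> U * m1 + U\<^sup>2 * (m2 + m3) + U ^ 3 * (C2 + C4) * (h * sqrt h) + U ^ 4 * h\<^sup>2"
proof -
  have U0: "0 \<le> U" by (rule order_trans[OF norm_ge_zero u])
  have B0: "0 \<le> B" by (rule order_trans[OF norm_ge_zero bdd])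
  have m0: "0 \<le> m1" "0 \<le> m2" "0 \<le> m3" by (rule order_trans[OF norm_ge_zero m1(1)], rule order_trans[OF norm_ge_zero m2(1)], rule order_trans[OF norm_ge_zero m3])
  define x where "x \<omega> = Re (cnj u * \<Delta> \<omega>)" for \<omega>
  have [measurable]: "x \<in> borel_measurable M" unfolding x_def[abs_def] by measurable
  have x1: "complex_of_real (x \<omega>) = (cnj u * \<Delta> \<omega> + u * cnj (\<Delta> \<omega>)) / 2" for \<omega>
    using complex_add_cnj[of "cnj u * \<Delta> \<omega>"] by (simp add: x_def)
  have x2: "complex_of_real ((x \<omega>)\<^sup>2) = ((cnj u)\<^sup>2 * (\<Delta> \<omega> * \<Delta> \<omega>) + u\<^sup>2 * (cnj (\<Delta> \<omega>) * cnj (\<Delta> \<omega>))) / 4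
      + of_real ((cmod u)\<^sup>2) * of_real ((cmod (\<Delta> \<omega>))\<^sup>2) / 2" for \<omega>
  proof -
    have "complex_of_real ((cmod u)\<^sup>2) = u * cnj u" "complex_of_real ((cmod (\<Delta> \<omega>))\<^sup>2) = \<Delta> \<omega> * cnj (\<Delta> \<omega>)"
      by (rule complex_norm_square)+
    moreover have "complex_of_real ((x \<omega>)\<^sup>2) = ((cnj u * \<Delta> \<omega> + u * cnj (\<Delta> \<omega>)) / 2)\<^sup>2"
      unfolding x1[symmetric] by (rule of_real_power)
    ultimately show ?thesis by (simp only:) (simp add: power2_eq_square field_simps)
  qed
  have xb: "\<bar>x \<omega>\<bar> \<le> U * cmod (\<Delta> \<omega>)" for \<omega>
  proof -
    have "\<bar>x \<omega>\<bar> \<le> cmod u * cmod (\<Delta> \<omega>)" unfolding x_def using abs_Re_le_cmod[of "cnj u * \<Delta> \<omega>"] by (simp add: norm_mult)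
    also have "\<dots> \<le> U * cmod (\<Delta> \<omega>)" using u by (rule mult_right_mono) simp
    finally show ?thesis .
  qed
  define R where "R \<omega> = iexp (x \<omega>) - (1 + \<i> * x \<omega> - of_real ((x \<omega>)\<^sup>2) / 2)" for \<omega>
  have [measurable]: "R \<in> borel_measurable M" unfolding R_def[abs_def] by measurable
  have Rb: "cmod (R \<omega>) \<le> U ^ 3 / 6 * (sqrt h * (cmod (\<Delta> \<omega>))\<^sup>2 + cmod (\<Delta> \<omega>) ^ 4 / sqrt h)" for \<omega>
  proof -
    have "cmod (R \<omega>) \<le> \<bar>x \<omega>\<bar> ^ 3 / 6"
      using iexp_approx1[of "x \<omega>" 2] unfolding R_def
      by (simp add: eval_nat_numeral fact_numeral atMost_Suc algebra_simps)
    also have "\<bar>x \<omega>\<bar> ^ 3 \<le> (U * cmod (\<Delta> \<omega>)) ^ 3" using xb by (intro power_mono) auto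
    also have "(U * cmod (\<Delta> \<omega>)) ^ 3 = U ^ 3 * cmod (\<Delta> \<omega>) ^ 3" by (rule power_mult_distrib)
    \<comment> \<open>The cube is split at the natural size sqrt h of the increment, below it
      against the square and above it against the fourth power. Both parts then have expectation of
      order h^(3/2).\<close>
    also have "cmod (\<Delta> \<omega>) ^ 3 \<le> sqrt h * (cmod (\<Delta> \<omega>))\<^sup>2 + cmod (\<Delta> \<omega>) ^ 4 / sqrt h"
    proof (cases "cmod (\<Delta> \<omega>) \<le> sqrt h")
      case True
      then have "cmod (\<Delta> \<omega>) * (cmod (\<Delta> \<omega>))\<^sup>2 \<le> sqrt h * (cmod (\<Delta> \<omega>))\<^sup>2" by (rule mult_right_mono) simp
      moreover have "0 \<le> cmod (\<Delta> \<omega>) ^ 4 / sqrt h" using h by simp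
      ultimately show ?thesis by (simp add: power3_eq_cube power2_eq_square)
    next
      case False
      then have "cmod (\<Delta> \<omega>) ^ 3 * sqrt h \<le> cmod (\<Delta> \<omega>) ^ 3 * cmod (\<Delta> \<omega>)" by (intro mult_left_mono) auto
      then have "cmod (\<Delta> \<omega>) ^ 3 \<le> cmod (\<Delta> \<omega>) ^ 4 / sqrt h" using h by (simp add: pos_le_divide_eq eval_nat_numeral mult_ac)
      moreover have "0 \<le> sqrt h * (cmod (\<Delta> \<omega>))\<^sup>2" using h by simp
      ultimately show ?thesis by linarith
    qed
    finally show ?thesis using U0 by (simp add: mult_left_mono divide_right_mono)
  qed
  have bounded_integrable: "integrable M f" if "f \<in> borel_measurable M" "\<And>\<omega>. cmod (f \<omega>) \<le> D" for f :: "'a \<Rightarrow> complex" and D :: real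
    using that by (intro integrable_const_bound[of _ D]) auto
  have intr: "integrable M (\<lambda>\<omega>. cmod (\<Delta> \<omega>) ^ n)" for n
    using bdd by (intro integrable_const_bound[where B="B ^ n"]) (auto intro!: power_mono)
  have [measurable]: "(\<lambda>\<omega>. cnj (\<Delta> \<omega>)) \<in> borel_measurable M"
    by (rule measurable_compose[OF assms(2) borel_measurable_continuous_onI]) (intro continuous_intros)
  have iP: "integrable M P" using P by (intro bounded_integrable) auto
  have i1: "integrable M (\<lambda>\<omega>. P \<omega> * \<Delta> \<omega>)" "integrable M (\<lambda>\<omega>. P \<omega> * cnj (\<Delta> \<omega>))"
    using mult_mono[OF P bdd] by (auto intro!: bounded_integrable[of _ "1 * B"] simp: norm_mult)
  have DD: "cmod (\<Delta> \<omega>) * cmod (\<Delta> \<omega>) \<le> B * B" for \<omega> using bdd B0 by (intro mult_mono) auto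
  have i2: "integrable M (\<lambda>\<omega>. P \<omega> * (\<Delta> \<omega> * \<Delta> \<omega>))" "integrable M (\<lambda>\<omega>. P \<omega> * (cnj (\<Delta> \<omega>) * cnj (\<Delta> \<omega>)))"
    "integrable M (\<lambda>\<omega>. P \<omega> * of_real ((cmod (\<Delta> \<omega>))\<^sup>2))"
    using mult_mono[OF P DD] by (auto intro!: bounded_integrable[of _ "1 * (B * B)"] simp: norm_mult power2_eq_square)
  have Rc: "cmod (R \<omega>) \<le> U ^ 3 / 6 * (sqrt h * B\<^sup>2 + B ^ 4 / sqrt h)" for \<omega>
    using U0 h bdd[of \<omega>] by (intro order_trans[OF Rb] mult_left_mono add_mono divide_right_mono power_mono) auto
  have iR: "integrable M (\<lambda>\<omega>. P \<omega> * R \<omega>)"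
    using mult_mono[OF P Rc] by (intro bounded_integrable[of _ "1 * (U ^ 3 / 6 * (sqrt h * B\<^sup>2 + B ^ 4 / sqrt h))"]) (auto simp: norm_mult)
  define E1 where "E1 = (CLINT \<omega> | M. P \<omega> * \<Delta> \<omega>)"
  define E1' where "E1' = (CLINT \<omega> | M. P \<omega> * cnj (\<Delta> \<omega>))"
  define E2 where "E2 = (CLINT \<omega> | M. P \<omega> * (\<Delta> \<omega> * \<Delta> \<omega>))"
  define E2' where "E2' = (CLINT \<omega> | M. P \<omega> * (cnj (\<Delta> \<omega>) * cnj (\<Delta> \<omega>)))"
  define E3 where "E3 = (CLINT \<omega> | M. P \<omega> * of_real ((cmod (\<Delta> \<omega>))\<^sup>2))"
  define ER where "ER = (CLINT \<omega> | M. P \<omega> * R \<omega>)"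
  define EP where "EP = (CLINT \<omega> | M. P \<omega>)"
  have pt: "P \<omega> * iexp (x \<omega>) = P \<omega> + (\<i> / 2 * cnj u) * (P \<omega> * \<Delta> \<omega>) + (\<i> / 2 * u) * (P \<omega> * cnj (\<Delta> \<omega>))
     + (- ((cnj u)\<^sup>2) / 8) * (P \<omega> * (\<Delta> \<omega> * \<Delta> \<omega>)) + (- (u\<^sup>2) / 8) * (P \<omega> * (cnj (\<Delta> \<omega>) * cnj (\<Delta> \<omega>)))
     + (- of_real ((cmod u)\<^sup>2) / 4) * (P \<omega> * of_real ((cmod (\<Delta> \<omega>))\<^sup>2)) + P \<omega> * R \<omega>" for \<omega>
  proof -
    have "iexp (x \<omega>) = 1 + \<i> * x \<omega> - of_real ((x \<omega>)\<^sup>2) / 2 + R \<omega>" by (simp add: R_def)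
    then have "P \<omega> * iexp (x \<omega>) = P \<omega> * (1 + \<i> * x \<omega> - of_real ((x \<omega>)\<^sup>2) / 2 + R \<omega>)" by (simp only:)
    also have "\<dots> = P \<omega> + (\<i> / 2 * cnj u) * (P \<omega> * \<Delta> \<omega>) + (\<i> / 2 * u) * (P \<omega> * cnj (\<Delta> \<omega>))
     + (- ((cnj u)\<^sup>2) / 8) * (P \<omega> * (\<Delta> \<omega> * \<Delta> \<omega>)) + (- (u\<^sup>2) / 8) * (P \<omega> * (cnj (\<Delta> \<omega>) * cnj (\<Delta> \<omega>)))
     + (- of_real ((cmod u)\<^sup>2) / 4) * (P \<omega> * of_real ((cmod (\<Delta> \<omega>))\<^sup>2)) + P \<omega> * R \<omega>"
      unfolding x2 unfolding x1 by (simp add: algebra_simps add_divide_distrib)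
    finally show ?thesis .
  qed
  have main: "(CLINT \<omega> | M. P \<omega> * iexp (x \<omega>)) = EP + (\<i> / 2 * cnj u) * E1 + (\<i> / 2 * u) * E1'
     + (- ((cnj u)\<^sup>2) / 8) * E2 + (- (u\<^sup>2) / 8) * E2' + (- of_real ((cmod u)\<^sup>2) / 4) * E3 + ER"
    unfolding pt E1_def E1'_def E2_def E2'_def E3_def ER_def EP_def
    by (simp only: Bochner_Integration.integral_add Bochner_Integration.integrable_add integrable_mult_right iP i1 i2 iR integral_mult_right_zero)
  define g where "g = exp (- (h * (cmod u)\<^sup>2) / 2)"
  \<comment> \<open>Adding and subtracting 2 h in the squared-modulus term leaves 1 - h |u|^2 / 2,
    which is compared with the exponential \<open>g\<close>.\<close>
  have diff: "(CLINT \<omega> | M. P \<omega> * iexp (x \<omega>)) - EP * of_real g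
    = (\<i> / 2 * cnj u) * E1 + (\<i> / 2 * u) * E1' + (- ((cnj u)\<^sup>2) / 8) * E2 + (- (u\<^sup>2) / 8) * E2'
      + (- of_real ((cmod u)\<^sup>2) / 4) * (E3 - EP * of_real (2 * h)) + ER - EP * of_real (g - (1 - h * (cmod u)\<^sup>2 / 2))"
    unfolding main by (simp add: field_simps)
  have EPb: "cmod EP \<le> 1" unfolding EP_def using P by (rule norm_integral_le_const)
  have u2: "(cmod u)\<^sup>2 \<le> U\<^sup>2" using u by (intro power_mono) auto
  have b1: "cmod ((\<i> / 2 * cnj u) * E1) \<le> U / 2 * m1" "cmod ((\<i> / 2 * u) * E1') \<le> U / 2 * m1"
    using u U0 m1 by (auto simp: norm_mult norm_divide E1_def E1'_def intro!: mult_mono)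
  have b2: "cmod ((- ((cnj u)\<^sup>2) / 8) * E2) \<le> U\<^sup>2 / 8 * m2" "cmod ((- (u\<^sup>2) / 8) * E2') \<le> U\<^sup>2 / 8 * m2"
    using u2 m2 by (auto simp: norm_mult norm_divide norm_power E2_def E2'_def intro!: mult_mono)
  have b3: "cmod ((- of_real ((cmod u)\<^sup>2) / 4) * (E3 - EP * of_real (2 * h))) \<le> U\<^sup>2 / 4 * m3"
    using u2 m3 by (auto simp: norm_mult norm_divide norm_power E3_def EP_def simp del: of_real_mult intro!: mult_mono)
  have bR: "cmod ER \<le> U ^ 3 / 6 * (sqrt h * (C2 * h) + C4 * h\<^sup>2 / sqrt h)"
  proof -
    have "cmod ER \<le> (\<integral>\<omega>. U ^ 3 / 6 * (sqrt h * (cmod (\<Delta> \<omega>))\<^sup>2 + cmod (\<Delta> \<omega>) ^ 4 / sqrt h) \<partial>M)"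
      unfolding ER_def
    proof (rule norm_integral_le_integral)
      show "integrable M (\<lambda>\<omega>. U ^ 3 / 6 * (sqrt h * (cmod (\<Delta> \<omega>))\<^sup>2 + cmod (\<Delta> \<omega>) ^ 4 / sqrt h))"
        using intr[of 2] intr[of 4] by auto
      show "cmod (P \<omega> * R \<omega>) \<le> U ^ 3 / 6 * (sqrt h * (cmod (\<Delta> \<omega>))\<^sup>2 + cmod (\<Delta> \<omega>) ^ 4 / sqrt h)" for \<omega>
        using mult_mono[OF P Rb, of \<omega> \<omega>] by (simp add: norm_mult)
    qed
    also have "\<dots> = U ^ 3 / 6 * (sqrt h * (\<integral>\<omega>. (cmod (\<Delta> \<omega>))\<^sup>2 \<partial>M) + (\<integral>\<omega>. cmod (\<Delta> \<omega>) ^ 4 \<partial>M) / sqrt h)"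
      using intr[of 2] intr[of 4] by simp
    also have "\<dots> \<le> U ^ 3 / 6 * (sqrt h * (C2 * h) + C4 * h\<^sup>2 / sqrt h)"
      using C2 C4 U0 h by (intro mult_left_mono add_mono divide_right_mono) auto
    finally show ?thesis .
  qed
  have "C4 * h\<^sup>2 / sqrt h = C4 * (h * sqrt h)" using h by (simp add: power2_eq_square field_simps)
  then have bR': "cmod ER \<le> U ^ 3 / 6 * ((C2 + C4) * (h * sqrt h))" using bR by (simp add: algebra_simps)
  have bg: "cmod (EP * of_real (g - (1 - h * (cmod u)\<^sup>2 / 2))) \<le> U ^ 4 * h\<^sup>2 / 8"
  proof -
    have "\<bar>g - (1 - h * (cmod u)\<^sup>2 / 2)\<bar> \<le> (h * (cmod u)\<^sup>2 / 2)\<^sup>2 / 2"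
      unfolding g_def using exp_minus_quadratic[of "h * (cmod u)\<^sup>2 / 2"] h by simp
    also have "\<dots> \<le> (h * U\<^sup>2 / 2)\<^sup>2 / 2"
      using u h by (intro divide_right_mono power_mono mult_left_mono) auto
    also have "\<dots> = U ^ 4 * h\<^sup>2 / 8" by (simp add: power2_eq_square eval_nat_numeral)
    finally have "cmod EP * \<bar>g - (1 - h * (cmod u)\<^sup>2 / 2)\<bar> \<le> 1 * (U ^ 4 * h\<^sup>2 / 8)"
      by (intro mult_mono EPb) auto
    then show ?thesis by (simp only: norm_mult norm_of_real mult_1_left)
  qed
  have "0 \<le> C2 * h" by (rule order_trans[OF Bochner_Integration.integral_nonneg C2]) simp
  moreover have "0 \<le> C4 * h\<^sup>2" by (rule order_trans[OF Bochner_Integration.integral_nonneg C4]) simp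
  ultimately have C0: "0 \<le> C2" "0 \<le> C4" using h by (simp_all add: zero_le_mult_iff)
  have "cmod ((CLINT \<omega> | M. P \<omega> * iexp (x \<omega>)) - EP * of_real g)
     \<le> U / 2 * m1 + U / 2 * m1 + U\<^sup>2 / 8 * m2 + U\<^sup>2 / 8 * m2 + U\<^sup>2 / 4 * m3 + U ^ 3 / 6 * ((C2 + C4) * (h * sqrt h)) + U ^ 4 * h\<^sup>2 / 8"
    unfolding diff
    by (intro order_trans[OF norm_triangle_ineq4] order_trans[OF norm_triangle_ineq] add_mono b1 b2 b3 bR' bg)
  also have "\<dots> \<le> U * m1 + U\<^sup>2 * (m2 + m3) + U ^ 3 * (C2 + C4) * (h * sqrt h) + U ^ 4 * h\<^sup>2"
  proof -
    have nn: "0 \<le> U\<^sup>2 * m2" "0 \<le> U\<^sup>2 * m3" "0 \<le> U ^ 3 * (C2 + C4) * (h * sqrt h)" "0 \<le> U ^ 4 * h\<^sup>2"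
      using U0 m0 C0 h by auto
    have "p / 8 + p / 8 + q / 4 + r / 6 + w / 8 \<le> p + q + r + w" if "0 \<le> p" "0 \<le> q" "0 \<le> r" "0 \<le> w" for p q r w :: real
      using that by linarith
    note add_left_mono[OF this[OF nn], of "U * m1"]
    moreover have "U / 2 * m1 + U / 2 * m1 + U\<^sup>2 / 8 * m2 + U\<^sup>2 / 8 * m2 + U\<^sup>2 / 4 * m3 + U ^ 3 / 6 * ((C2 + C4) * (h * sqrt h)) + U ^ 4 * h\<^sup>2 / 8
      = U * m1 + (U\<^sup>2 * m2 / 8 + U\<^sup>2 * m2 / 8 + U\<^sup>2 * m3 / 4 + U ^ 3 * (C2 + C4) * (h * sqrt h) / 6 + U ^ 4 * h\<^sup>2 / 8)"
      by simp
    moreover have "U * m1 + U\<^sup>2 * (m2 + m3) + U ^ 3 * (C2 + C4) * (h * sqrt h) + U ^ 4 * h\<^sup>2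
      = U * m1 + (U\<^sup>2 * m2 + U\<^sup>2 * m3 + U ^ 3 * (C2 + C4) * (h * sqrt h) + U ^ 4 * h\<^sup>2)"
      by (simp only: distrib_left add.assoc)
    ultimately show ?thesis by (simp only:)
  qed
  finally show ?thesis by (simp add: x_def EP_def g_def)
qed

text \<open>Since the factors have modulus at most 1, later steps do not amplify earlier errors, and
  the errors add.\<close>

lemma telescoping_product_bound:
  fixes f g :: "nat \<Rightarrow> complex"
  assumes "\<And>k. k < n \<Longrightarrow> cmod (f (Suc k) - f k * g k) \<le> \<epsilon>" "\<And>k. k < n \<Longrightarrow> cmod (g k) \<le> 1"
  shows "cmod (f n - f 0 * (\<Prod>k<n. g k)) \<le> real n * \<epsilon>"
  using assms
proof (induction n)
  case (Suc n)
  have "f (Suc n) - f 0 * (\<Prod>k<Suc n. g k) = (f (Suc n) - f n * g n) + (f n - f 0 * (\<Prod>k<n. g k)) * g n"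
    by (simp add: algebra_simps)
  also have "cmod \<dots> \<le> \<epsilon> + real n * \<epsilon> * 1"
  proof (intro order_trans[OF norm_triangle_ineq] add_mono)
    have IH: "cmod (f n - f 0 * (\<Prod>k<n. g k)) \<le> real n * \<epsilon>" by (rule Suc.IH) (simp_all add: Suc.prems)
    show "cmod (f (Suc n) - f n * g n) \<le> \<epsilon>" by (rule Suc.prems) simp
    show "cmod ((f n - f 0 * (\<Prod>k<n. g k)) * g n) \<le> real n * \<epsilon> * 1"
      unfolding norm_mult by (intro mult_mono IH Suc.prems order_trans[OF norm_ge_zero IH]) auto
  qed
  finally show ?case by (simp add: algebra_simps)
qed simp


section \<open>Convergence of the finite-dimensional characteristic functions\<close>

lemma nested_set_integral_cong:
  fixes f g :: "real \<Rightarrow> real \<Rightarrow> 'b::{banach, second_countable_topology}"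
  assumes "\<And>y x. a \<le> x \<Longrightarrow> x \<le> y \<Longrightarrow> y \<le> b \<Longrightarrow> f y x = g y x"
  shows "(LBINT y:{a..b}. LBINT x:{a..y}. f y x) = (LBINT y:{a..b}. LBINT x:{a..y}. g y x)"
  using assms by (intro set_lebesgue_integral_cong allI impI) auto

locale scaled_process = increment_process M X for M :: "'a measure" and X +
  fixes T \<theta> c :: real
  assumes T: "0 < T" and A: "cond_A M X T \<theta>" and B: "cond_B M X T \<theta> c" and C: "cond_C M X T \<theta>"
begin

text \<open>Condition (A) is confined to [0, T] but free in \<epsilon>. Choosing the scale so that
  \<open>T\<close> corresponds to \<open>b\<close> reaches every interval, with half the constant
  since time is scaled by 2 / \<epsilon>^2.\<close>

lemma J_linear_bound: "\<exists>K\<ge>0. \<forall>a b. 0 \<le> a \<longrightarrow> a \<le> b \<longrightarrow> J \<theta> a b \<le> K * (b - a)"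
proof -
  from A obtain K where K: "\<And>s t \<epsilon>. 0 \<le> s \<Longrightarrow> s < t \<Longrightarrow> t \<le> T \<Longrightarrow> 0 < \<epsilon> \<Longrightarrow>
      \<epsilon>\<^sup>2 * (LBINT y:{2 * s / \<epsilon>\<^sup>2..2 * t / \<epsilon>\<^sup>2}. LBINT x:{2 * s / \<epsilon>\<^sup>2..y}. cmod (char_fun M (\<lambda>\<omega>. X y \<omega> - X x \<omega>) \<theta>)) \<le> K * (t - s)"
    unfolding cond_A_def by blast
  have "J \<theta> a b \<le> max 0 (K / 2) * (b - a)" if ab: "0 \<le> a" "a \<le> b" for a b
  proof (cases "a = b")
    case True
    have "norm (J \<theta> a a) \<le> norm (LBINT s:{a..a}. cmod (\<phi> \<theta> s a)) * (a - a)"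
      unfolding J_def by (rule norm_set_integral_Icc_le) auto
    then show ?thesis using True by simp
  next
    case False
    then have b: "0 < b" "a < b" using ab by auto
    \<comment> \<open>With this scale the times a T / b and T become \<open>a\<close> and
      \<open>b\<close>.\<close>
    define \<epsilon> where "\<epsilon> = sqrt (2 * T / b)"
    have e: "0 < \<epsilon>" "\<epsilon>\<^sup>2 = 2 * T / b" using T b by (auto simp: \<epsilon>_def)
    have "2 * (a * T / b) / \<epsilon>\<^sup>2 = a" "2 * T / \<epsilon>\<^sup>2 = b" unfolding e(2) using T b by simp_all
    moreover have "(LBINT y:{a..b}. LBINT x:{a..y}. cmod (char_fun M (\<lambda>\<omega>. X y \<omega> - X x \<omega>) \<theta>)) = J \<theta> a b"
      unfolding J_def using ab by (intro nested_set_integral_cong) (simp add: char_fun_eq)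
    moreover have "a * T / b < T" using T b by (simp add: field_simps)
    ultimately have "2 * T / b * J \<theta> a b \<le> K * (T - a * T / b)"
      using K[of "a * T / b" T \<epsilon>] e ab T b by simp
    also have "\<dots> = 2 * T / b * (K / 2 * (b - a))" using b by (simp add: field_simps)
    finally have "J \<theta> a b \<le> K / 2 * (b - a)" using T b by (subst (asm) mult_le_cancel_left_pos) auto
    also have "\<dots> \<le> max 0 (K / 2) * (b - a)" using ab by (intro mult_right_mono) auto
    finally show ?thesis .
  qed
  then show ?thesis by (intro exI[of _ "max 0 (K / 2)"]) auto
qed

lemma x_process_eq: "x_process X \<theta> c \<epsilon> t \<omega> = of_real (\<epsilon> * c) * Z \<theta> 0 (2 * t / \<epsilon>\<^sup>2) \<omega>"
  unfolding x_process_def Z_def e_def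
  by (intro arg_cong[where f="\<lambda>z. _ * z"] set_lebesgue_integral_cong) (auto simp: max_def)

lemma Z_split:
  assumes "a \<le> b" "b \<le> d" "\<omega> \<in> space M"
  shows "Z \<kappa> a d \<omega> = Z \<kappa> a b \<omega> + Z \<kappa> b d \<omega>"
proof -
  have i: "set_integrable lborel {p..q} (\<lambda>s. e \<kappa> s \<omega>)" for p q
    using adapted_section[OF adapted_e[of 0] assms(3)] by (intro set_integrable_Icc_bounded[where C=1]) auto
  have u: "{a..d} = {a..b} \<union> {b..d}" using assms by auto
  have "AE s in lborel. \<not> (s \<in> {a..b} \<and> s \<in> {b..d})" using AE_lborel_singleton[of b] by eventually_elim auto
  then show ?thesis unfolding Z_def u by (rule set_integral_Un_AE) (auto intro: i)
qed

text \<open>The increment as an integral over its own time interval instead of a difference of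
  values: the moment formulas for \<open>Z\<close> and measurability for the past then apply
  directly.\<close>

definition incr :: "real \<Rightarrow> real \<Rightarrow> real \<Rightarrow> 'a \<Rightarrow> complex" where
  "incr \<epsilon> s t \<omega> = of_real (\<epsilon> * c) * Z \<theta> (2 * s / \<epsilon>\<^sup>2) (2 * t / \<epsilon>\<^sup>2) \<omega>"

lemma scale_mono: "0 \<le> s \<Longrightarrow> s \<le> t \<Longrightarrow> 2 * s / \<epsilon>\<^sup>2 \<le> 2 * t / \<epsilon>\<^sup>2" for s t \<epsilon> :: real
  by (intro divide_right_mono) auto

lemma incr_split:
  "0 \<le> s \<Longrightarrow> s \<le> t \<Longrightarrow> t \<le> v \<Longrightarrow> \<omega> \<in> space M \<Longrightarrow> incr \<epsilon> s v \<omega> = incr \<epsilon> s t \<omega> + incr \<epsilon> t v \<omega>"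
  unfolding incr_def using scale_mono[of s t \<epsilon>] scale_mono[of t v \<epsilon>]
  by (subst Z_split[of "2 * s / \<epsilon>\<^sup>2" "2 * t / \<epsilon>\<^sup>2" "2 * v / \<epsilon>\<^sup>2" \<omega> \<theta>]) (auto simp: distrib_left)

lemma x_process_diff:
  "0 \<le> s \<Longrightarrow> s \<le> t \<Longrightarrow> \<omega> \<in> space M \<Longrightarrow> x_process X \<theta> c \<epsilon> t \<omega> - x_process X \<theta> c \<epsilon> s \<omega> = incr \<epsilon> s t \<omega>"
  using incr_split[of 0 s t \<omega> \<epsilon>] by (simp add: x_process_eq incr_def)

lemma measurable_incr: "0 \<le> s \<Longrightarrow> incr \<epsilon> s t \<in> borel_measurable M"
  unfolding incr_def[abs_def] by (intro borel_measurable_times borel_measurable_const adapted_Z_section) simp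

lemma measurable_incr_past:
  assumes "0 \<le> s" "s \<le> t" "t \<le> v" shows "incr \<epsilon> s t \<in> borel_measurable (past (2 * v / \<epsilon>\<^sup>2))"
proof (rule past_mono)
  show "0 \<le> 2 * t / \<epsilon>\<^sup>2" "2 * t / \<epsilon>\<^sup>2 \<le> 2 * v / \<epsilon>\<^sup>2" using assms scale_mono[of t v \<epsilon>] by auto
  show "incr \<epsilon> s t \<in> borel_measurable (past (2 * t / \<epsilon>\<^sup>2))"
    unfolding incr_def[abs_def] using assms scale_mono[of s t \<epsilon>]
    by (intro borel_measurable_times borel_measurable_const adapted_past[OF adapted_Z]) auto
qed

lemma cmod_incr_le:
  assumes "0 < \<epsilon>" "0 \<le> s" "s \<le> t" shows "cmod (incr \<epsilon> s t \<omega>) \<le> 2 * \<bar>c\<bar> / \<epsilon> * (t - s)"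
proof -
  have "cmod (incr \<epsilon> s t \<omega>) = \<epsilon> * \<bar>c\<bar> * cmod (Z \<theta> (2 * s / \<epsilon>\<^sup>2) (2 * t / \<epsilon>\<^sup>2) \<omega>)"
    using assms(1) by (simp add: incr_def norm_mult abs_mult)
  also have "\<dots> \<le> \<epsilon> * \<bar>c\<bar> * (2 * t / \<epsilon>\<^sup>2 - 2 * s / \<epsilon>\<^sup>2)"
    using assms scale_mono[of s t \<epsilon>] by (intro mult_left_mono cmod_Z_le) auto
  also have "\<dots> = 2 * \<bar>c\<bar> / \<epsilon> * (t - s)" using assms(1) by (simp add: power2_eq_square field_simps)
  finally show ?thesis .
qed

definition QB :: "real \<Rightarrow> real \<Rightarrow> real \<Rightarrow> complex" where
  "QB s t \<epsilon> = (LBINT x:{2 * s / \<epsilon>\<^sup>2..2 * t / \<epsilon>\<^sup>2}. LBINT y:{2 * s / \<epsilon>\<^sup>2..x}.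
               char_fun M (\<lambda>\<omega>. X x \<omega> - X y \<omega>) \<theta> + char_fun M (\<lambda>\<omega>. X x \<omega> - X y \<omega>) (- \<theta>))"

definition QC :: "real \<Rightarrow> real \<Rightarrow> real \<Rightarrow> real" where
  "QC s t \<epsilon> = (LBINT y:{2 * s / \<epsilon>\<^sup>2..2 * t / \<epsilon>\<^sup>2}. LBINT x:{2 * s / \<epsilon>\<^sup>2..y}.
               cmod (char_fun M (\<lambda>\<omega>. X y \<omega> - X x \<omega>) \<theta>) *
               cmod (char_fun M (\<lambda>\<omega>. X x \<omega> - X (2 * s / \<epsilon>\<^sup>2) \<omega>) (2 * \<theta>)))"

text \<open>The part of the one-step error that vanishes with \<epsilon> for fixed times: the first
  moment, the square controlled by (C), and the deviation in (B).\<close>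

definition rest :: "real \<Rightarrow> real \<Rightarrow> real \<Rightarrow> real \<Rightarrow> real \<Rightarrow> real" where
  "rest K U s t \<epsilon> = U * (\<epsilon> * \<bar>c\<bar> * (2 + 32 * K\<^sup>2))
     + U\<^sup>2 * (2 * c\<^sup>2 * (\<epsilon>\<^sup>2 * QC s t \<epsilon>) + cmod (of_real (\<epsilon>\<^sup>2 * c\<^sup>2) * QB s t \<epsilon> - of_real (2 * (t - s))))"

lemma rest_nonneg: "0 \<le> U \<Longrightarrow> 0 < \<epsilon> \<Longrightarrow> 0 \<le> rest K U s t \<epsilon>"
proof -
  have "0 \<le> QC s t \<epsilon>" unfolding QC_def set_lebesgue_integral_def
    by (intro Bochner_Integration.integral_nonneg) (auto intro!: mult_nonneg_nonneg Bochner_Integration.integral_nonneg)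
  moreover assume "0 \<le> U" "0 < \<epsilon>"
  ultimately show ?thesis unfolding rest_def by (intro add_nonneg_nonneg mult_nonneg_nonneg) auto
qed

lemma tendsto_rest: "0 \<le> s \<Longrightarrow> s < t \<Longrightarrow> t \<le> T \<Longrightarrow> (rest K U s t \<longlongrightarrow> 0) (at_right 0)"
proof -
  assume st: "0 \<le> s" "s < t" "t \<le> T"
  have "((\<lambda>\<epsilon>. of_real (\<epsilon>\<^sup>2 * c\<^sup>2) * QB s t \<epsilon>) \<longlongrightarrow> complex_of_real (2 * (t - s))) (at_right 0)"
    using B st unfolding cond_B_def QB_def by blast
  then have "((\<lambda>\<epsilon>. of_real (\<epsilon>\<^sup>2 * c\<^sup>2) * QB s t \<epsilon> - of_real (2 * (t - s))) \<longlongrightarrow> 0) (at_right 0)"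
    by (subst LIM_zero_iff)
  then have b: "((\<lambda>\<epsilon>. cmod (of_real (\<epsilon>\<^sup>2 * c\<^sup>2) * QB s t \<epsilon> - of_real (2 * (t - s)))) \<longlongrightarrow> 0) (at_right 0)"
    by (rule tendsto_norm_zero)
  have "((\<lambda>\<epsilon>. \<epsilon>\<^sup>2 * QC s t \<epsilon>) \<longlongrightarrow> 0) (at_right 0)"
    using C st unfolding cond_C_def QC_def by blast
  then have q: "((\<lambda>\<epsilon>. 2 * c\<^sup>2 * (\<epsilon>\<^sup>2 * QC s t \<epsilon>)) \<longlongrightarrow> 0) (at_right 0)" by (rule tendsto_mult_right_zero)
  have "((\<lambda>\<epsilon>. \<epsilon> * \<bar>c\<bar> * (2 + 32 * K\<^sup>2)) \<longlongrightarrow> 0) (at_right 0)"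
    by (intro tendsto_mult_left_zero tendsto_ident_at)
  then have "((\<lambda>\<epsilon>. U * (\<epsilon> * \<bar>c\<bar> * (2 + 32 * K\<^sup>2)) + U\<^sup>2 * (2 * c\<^sup>2 * (\<epsilon>\<^sup>2 * QC s t \<epsilon>)
     + cmod (of_real (\<epsilon>\<^sup>2 * c\<^sup>2) * QB s t \<epsilon> - of_real (2 * (t - s))))) \<longlongrightarrow> 0) (at_right 0)"
    by (intro tendsto_add_zero tendsto_mult_right_zero b q)
  then show ?thesis unfolding rest_def[abs_def] .
qed

lemma cmod_integral_scaled: "cmod (CLINT \<omega> | M. P \<omega> * (of_real r * f \<omega>)) = \<bar>r\<bar> * cmod (CLINT \<omega> | M. P \<omega> * f \<omega>)"
proof -
  have "(\<lambda>\<omega>. P \<omega> * (of_real r * f \<omega>)) = (\<lambda>\<omega>. of_real r * (P \<omega> * f \<omega>))" by (rule ext) (rule mult.left_commute)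
  then show ?thesis by (simp only: integral_mult_right_zero norm_mult norm_of_real)
qed

context
  fixes K :: real
  assumes K0: "0 \<le> K" and K: "\<And>a b. 0 \<le> a \<Longrightarrow> a \<le> b \<Longrightarrow> J \<theta> a b \<le> K * (b - a)"
begin

lemma incr_second_moment:
  assumes "0 < \<epsilon>" "0 \<le> s" "s \<le> t"
  shows "(\<integral>\<omega>. (cmod (incr \<epsilon> s t \<omega>))\<^sup>2 \<partial>M) \<le> 4 * c\<^sup>2 * K * (t - s)"
proof -
  have "(\<integral>\<omega>. (cmod (incr \<epsilon> s t \<omega>))\<^sup>2 \<partial>M) = (\<epsilon> * c)\<^sup>2 * (\<integral>\<omega>. (cmod (Z \<theta> (2 * s / \<epsilon>\<^sup>2) (2 * t / \<epsilon>\<^sup>2) \<omega>))\<^sup>2 \<partial>M)"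
    by (simp only: incr_def norm_mult norm_of_real power_mult_distrib power2_abs integral_mult_right_zero)
  also have "\<dots> \<le> (\<epsilon> * c)\<^sup>2 * (2 * K * (2 * t / \<epsilon>\<^sup>2 - 2 * s / \<epsilon>\<^sup>2))"
    using assms scale_mono[of s t \<epsilon>] by (intro mult_left_mono Z_second_moment_le[OF K0 K]) auto
  also have "\<dots> = 4 * c\<^sup>2 * K * (t - s)" using assms(1) by (simp add: power2_eq_square field_simps)
  finally show ?thesis .
qed

lemma incr_fourth_moment:
  assumes "0 < \<epsilon>" "0 \<le> s" "s \<le> t"
  shows "(\<integral>\<omega>. cmod (incr \<epsilon> s t \<omega>) ^ 4 \<partial>M) \<le> 96 * c ^ 4 * K\<^sup>2 * (t - s)\<^sup>2"
proof -
  have "(\<integral>\<omega>. cmod (incr \<epsilon> s t \<omega>) ^ 4 \<partial>M) = \<bar>\<epsilon> * c\<bar> ^ 4 * (\<integral>\<omega>. cmod (Z \<theta> (2 * s / \<epsilon>\<^sup>2) (2 * t / \<epsilon>\<^sup>2) \<omega>) ^ 4 \<partial>M)"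
    by (simp only: incr_def norm_mult norm_of_real power_mult_distrib integral_mult_right_zero)
  also have "\<dots> \<le> \<bar>\<epsilon> * c\<bar> ^ 4 * (24 * K\<^sup>2 * (2 * t / \<epsilon>\<^sup>2 - 2 * s / \<epsilon>\<^sup>2)\<^sup>2)"
    using assms scale_mono[of s t \<epsilon>] by (intro mult_left_mono Z_fourth_moment_le[OF K0 K]) auto
  also have "\<bar>\<epsilon> * c\<bar> ^ 4 = \<epsilon> ^ 4 * c ^ 4" by (simp add: power_mult_distrib)
  also have "2 * t / \<epsilon>\<^sup>2 - 2 * s / \<epsilon>\<^sup>2 = 2 * (t - s) / \<epsilon>\<^sup>2" by (simp only: diff_divide_distrib right_diff_distrib)
  also have "\<epsilon> ^ 4 * c ^ 4 * (24 * K\<^sup>2 * (2 * w / \<epsilon>\<^sup>2)\<^sup>2) = 96 * c ^ 4 * K\<^sup>2 * w\<^sup>2" for w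
    using assms(1) by (simp add: power_divide power_mult_distrib power_mult[symmetric])
  finally show ?thesis .
qed

text \<open>Over one step of length t - s the conditional character given the past is replaced by
  the Gaussian one. All moment bounds are those of \<open>Z\<close> after scaling by \<epsilon>
  c.\<close>

lemma incr_characteristic_step:
  assumes e: "0 < \<epsilon>" and st: "0 \<le> s" "s < t" and P: "P \<in> borel_measurable (past (2 * s / \<epsilon>\<^sup>2))" "\<And>\<omega>. cmod (P \<omega>) \<le> 1" and u: "cmod u \<le> U"
  shows "cmod ((CLINT \<omega> | M. P \<omega> * iexp (Re (cnj u * incr \<epsilon> s t \<omega>))) - (CLINT \<omega> | M. P \<omega>) * of_real (exp (- ((t - s) * (cmod u)\<^sup>2) / 2)))
    \<le> rest K U s t \<epsilon> + U ^ 3 * (4 * c\<^sup>2 * K + 96 * c ^ 4 * K\<^sup>2) * ((t - s) * sqrt (t - s)) + U ^ 4 * (t - s)\<^sup>2"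
proof -
  define a where "a = 2 * s / \<epsilon>\<^sup>2"
  define b where "b = 2 * t / \<epsilon>\<^sup>2"
  define r where "r = \<epsilon> * c"
  have a: "0 \<le> a" "a \<le> b" using st scale_mono[of s t \<epsilon>] by (auto simp: a_def b_def)
  have P': "P \<in> borel_measurable (past a)" using P(1) by (simp add: a_def)
  have D: "incr \<epsilon> s t \<omega> = of_real r * Z \<theta> a b \<omega>" for \<omega> by (simp add: incr_def a_def b_def r_def)
  \<comment> \<open>Conjugation turns the frequency \<theta> into its negative without changing the
    modulus of \<open>\<phi>\<close>, so the same bounds serve the conjugate increment.\<close>
  have D': "cnj (incr \<epsilon> s t \<omega>) = of_real r * Z (- \<theta>) a b \<omega>" for \<omega> by (simp only: D complex_cnj_mult complex_cnj_complex_of_real cnj_Z)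
  have D2: "(of_real r * z) * (of_real r * z) = of_real (r\<^sup>2) * (z * z)" for z :: complex by (simp add: power2_eq_square mult_ac)
  have D3: "complex_of_real ((cmod (of_real r * z))\<^sup>2) = of_real (r\<^sup>2) * of_real ((cmod z)\<^sup>2)" for z
    by (simp only: norm_mult norm_of_real power_mult_distrib power2_abs of_real_mult)
  have neg: "cmod (\<phi> (- \<kappa>) s t) = cmod (\<phi> \<kappa> s t)" for \<kappa> s t by (simp add: \<phi>_minus)
  have r: "\<bar>r\<bar> = \<epsilon> * \<bar>c\<bar>" "\<bar>r\<^sup>2\<bar> = \<epsilon>\<^sup>2 * c\<^sup>2" "r\<^sup>2 = \<epsilon>\<^sup>2 * c\<^sup>2" using e by (simp_all add: r_def abs_mult power_mult_distrib)
  have QC: "QC s t \<epsilon> = (LBINT y:{a..b}. LBINT x:{a..y}. cmod (\<phi> \<theta> x y) * cmod (\<phi> (2 * \<theta>) a x))"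
    unfolding QC_def a_def[symmetric] b_def[symmetric] using a by (intro nested_set_integral_cong) (simp add: char_fun_eq)
  have QB: "QB s t \<epsilon> = (LBINT x:{a..b}. LBINT y:{a..x}. \<phi> \<theta> y x + \<phi> (- \<theta>) y x)"
    unfolding QB_def a_def[symmetric] b_def[symmetric] using a by (intro nested_set_integral_cong) (simp add: char_fun_eq)
  have I: "(LBINT s:{a..b}. cmod (\<phi> \<theta> a s)) \<le> 2 + 32 * K\<^sup>2" by (rule integral_\<phi>_le[OF K0 K a])
  have EP: "cmod (CLINT \<omega> | M. P \<omega>) \<le> 1" using P(2) by (rule norm_integral_le_const)
  have "cmod ((CLINT \<omega> | M. P \<omega> * iexp (Re (cnj u * incr \<epsilon> s t \<omega>))) - (CLINT \<omega> | M. P \<omega>) * of_real (exp (- ((t - s) * (cmod u)\<^sup>2) / 2)))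
    \<le> U * (\<epsilon> * \<bar>c\<bar> * (2 + 32 * K\<^sup>2))
     + U\<^sup>2 * (2 * c\<^sup>2 * (\<epsilon>\<^sup>2 * QC s t \<epsilon>) + cmod (of_real (\<epsilon>\<^sup>2 * c\<^sup>2) * QB s t \<epsilon> - of_real (2 * (t - s))))
     + U ^ 3 * (4 * c\<^sup>2 * K + 96 * c ^ 4 * K\<^sup>2) * ((t - s) * sqrt (t - s)) + U ^ 4 * (t - s)\<^sup>2"
  proof (rule characteristic_step)
    show "P \<in> borel_measurable M" by (rule measurable_past_imp[OF P(1)])
    show "incr \<epsilon> s t \<in> borel_measurable M" by (rule measurable_incr[OF st(1)])
    show "cmod (P \<omega>) \<le> 1" for \<omega> by (rule P(2))
    show "cmod (incr \<epsilon> s t \<omega>) \<le> 2 * \<bar>c\<bar> / \<epsilon> * (t - s)" for \<omega> using st by (intro cmod_incr_le e) auto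
    show "cmod (CLINT \<omega> | M. P \<omega> * incr \<epsilon> s t \<omega>) \<le> \<epsilon> * \<bar>c\<bar> * (2 + 32 * K\<^sup>2)"
      unfolding D cmod_integral_scaled r(1) using e
      by (intro mult_left_mono order_trans[OF first_moment[OF a(1) P' P(2)] I]) auto
    show "cmod (CLINT \<omega> | M. P \<omega> * cnj (incr \<epsilon> s t \<omega>)) \<le> \<epsilon> * \<bar>c\<bar> * (2 + 32 * K\<^sup>2)"
      unfolding D' cmod_integral_scaled r(1) using e I
      by (intro mult_left_mono order_trans[OF first_moment[OF a(1) P' P(2)]]) (auto simp: neg)
    have "\<epsilon>\<^sup>2 * c\<^sup>2 * (2 * QC s t \<epsilon>) = 2 * c\<^sup>2 * (\<epsilon>\<^sup>2 * QC s t \<epsilon>)" by simp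
    note QC' = this
    show "cmod (CLINT \<omega> | M. P \<omega> * (incr \<epsilon> s t \<omega> * incr \<epsilon> s t \<omega>)) \<le> 2 * c\<^sup>2 * (\<epsilon>\<^sup>2 * QC s t \<epsilon>)"
      unfolding D D2 cmod_integral_scaled r(2) QC'[symmetric] unfolding QC
      by (intro mult_left_mono second_moment_same[OF a(1) P' P(2)]) auto
    have "cmod (CLINT \<omega> | M. P \<omega> * (Z (- \<theta>) a b \<omega> * Z (- \<theta>) a b \<omega>)) \<le> 2 * QC s t \<epsilon>"
      using second_moment_same[OF a(1) P' P(2), of "- \<theta>" b] unfolding QC by (simp add: neg)
    then show "cmod (CLINT \<omega> | M. P \<omega> * (cnj (incr \<epsilon> s t \<omega>) * cnj (incr \<epsilon> s t \<omega>))) \<le> 2 * c\<^sup>2 * (\<epsilon>\<^sup>2 * QC s t \<epsilon>)"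
      unfolding D' D2 cmod_integral_scaled r(2) QC'[symmetric] by (rule mult_left_mono) auto
    have "(CLINT \<omega> | M. P \<omega> * of_real ((cmod (incr \<epsilon> s t \<omega>))\<^sup>2)) = of_real (r\<^sup>2) * (CLINT \<omega> | M. P \<omega> * of_real ((cmod (Z \<theta> a b \<omega>))\<^sup>2))"
      unfolding D D3 by (simp only: mult.left_commute[of "P _" "of_real (r\<^sup>2)"] integral_mult_right_zero)
    also have "\<dots> = of_real (r\<^sup>2) * ((CLINT \<omega> | M. P \<omega>) * QB s t \<epsilon>)"
      unfolding second_moment_abs[OF a(1) P' P(2)] QB ..
    finally have "(CLINT \<omega> | M. P \<omega> * of_real ((cmod (incr \<epsilon> s t \<omega>))\<^sup>2)) - (CLINT \<omega> | M. P \<omega>) * of_real (2 * (t - s))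
       = (CLINT \<omega> | M. P \<omega>) * (of_real (r\<^sup>2) * QB s t \<epsilon> - of_real (2 * (t - s)))"
      by (simp only: right_diff_distrib mult.left_commute)
    then have "cmod ((CLINT \<omega> | M. P \<omega> * of_real ((cmod (incr \<epsilon> s t \<omega>))\<^sup>2)) - (CLINT \<omega> | M. P \<omega>) * of_real (2 * (t - s)))
       = cmod (CLINT \<omega> | M. P \<omega>) * cmod (of_real (r\<^sup>2) * QB s t \<epsilon> - of_real (2 * (t - s)))"
      by (simp only: norm_mult)
    also have "\<dots> \<le> 1 * cmod (of_real (r\<^sup>2) * QB s t \<epsilon> - of_real (2 * (t - s)))"
      by (intro mult_right_mono EP) auto
    finally show "cmod ((CLINT \<omega> | M. P \<omega> * of_real ((cmod (incr \<epsilon> s t \<omega>))\<^sup>2)) - (CLINT \<omega> | M. P \<omega>) * of_real (2 * (t - s)))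
      \<le> cmod (of_real (\<epsilon>\<^sup>2 * c\<^sup>2) * QB s t \<epsilon> - of_real (2 * (t - s)))"
      unfolding r(3) mult_1_left .
    show "(\<integral>\<omega>. (cmod (incr \<epsilon> s t \<omega>))\<^sup>2 \<partial>M) \<le> 4 * c\<^sup>2 * K * (t - s)" using st by (intro incr_second_moment e) auto
    show "(\<integral>\<omega>. cmod (incr \<epsilon> s t \<omega>) ^ 4 \<partial>M) \<le> 96 * c ^ 4 * K\<^sup>2 * (t - s)\<^sup>2" using st by (intro incr_fourth_moment e) auto
  qed (use st u in auto)
  then show ?thesis unfolding rest_def .
qed

end

section \<open>Characteristic functions of the dyadic increments\<close>

definition \<Delta> :: "nat \<Rightarrow> nat \<Rightarrow> real \<Rightarrow> 'a \<Rightarrow> complex" where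
  "\<Delta> n k \<epsilon> \<omega> = incr \<epsilon> (grid T n k) (grid T n (Suc k)) \<omega>"

definition chr :: "nat \<Rightarrow> (nat \<Rightarrow> complex) \<Rightarrow> real \<Rightarrow> complex" where
  "chr n u \<epsilon> = (CLINT \<omega> | M. iexp (\<Sum>k<2^n. Re (cnj (u k) * \<Delta> n k \<epsilon> \<omega>)))"

text \<open>The joint characteristic function of independent planar Gaussian increments over cells
  of length T / 2^n, in the form obtained for the Levy construction.\<close>

definition gau :: "nat \<Rightarrow> (nat \<Rightarrow> complex) \<Rightarrow> complex" where
  "gau n u = of_real (exp (- (T / 2^n * (\<Sum>k<2^n. (cmod (u k))\<^sup>2)) / 2))"

lemma grid_nonneg: "0 \<le> grid T n k" and grid_mono: "j \<le> k \<Longrightarrow> grid T n j \<le> grid T n k"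
  and grid_step: "grid T n (Suc k) - grid T n k = T / 2^n"
  using T by (auto simp: grid_def divide_right_mono mult_right_mono add_divide_distrib distrib_right)

text \<open>The increments are peeled off from the last to the first: the product of the earlier
  characters is a past-measurable weight of modulus 1, and the one-step errors add.\<close>

lemma chr_level_bound:
  assumes K0: "0 \<le> K" and K: "\<And>a b. 0 \<le> a \<Longrightarrow> a \<le> b \<Longrightarrow> J \<theta> a b \<le> K * (b - a)"
    and e: "0 < \<epsilon>" and U: "0 \<le> U" "\<And>k. k < 2^n \<Longrightarrow> cmod (u k) \<le> U"
  shows "cmod (chr n u \<epsilon> - gau n u) \<le> 2^n * ((\<Sum>k<2^n. rest K U (grid T n k) (grid T n (Suc k)) \<epsilon>)
     + U ^ 3 * (4 * c\<^sup>2 * K + 96 * c ^ 4 * K\<^sup>2) * (T / 2^n * sqrt (T / 2^n)) + U ^ 4 * (T / 2^n)\<^sup>2)"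
proof -
  define P where "P k \<omega> = iexp (\<Sum>j<k. Re (cnj (u j) * \<Delta> n j \<epsilon> \<omega>))" for k \<omega>
  define f where "f k = (CLINT \<omega> | M. P k \<omega>)" for k
  define g where "g k = complex_of_real (exp (- (T / 2^n * (cmod (u k))\<^sup>2) / 2))" for k
  let ?R = "(\<Sum>k<2^n. rest K U (grid T n k) (grid T n (Suc k)) \<epsilon>)
     + U ^ 3 * (4 * c\<^sup>2 * K + 96 * c ^ 4 * K\<^sup>2) * (T / 2^n * sqrt (T / 2^n)) + U ^ 4 * (T / 2^n)\<^sup>2"
  have "cmod (f (2^n) - f 0 * (\<Prod>k<2^n. g k)) \<le> real (2^n) * ?R"
  proof (rule telescoping_product_bound)
    fix k :: nat assume k: "k < 2^n"
    have [measurable]: "\<Delta> n j \<epsilon> \<in> borel_measurable (past (2 * grid T n k / \<epsilon>\<^sup>2))" if "j < k" for j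
      unfolding \<Delta>_def[abs_def] using that by (intro measurable_incr_past grid_nonneg grid_mono) auto
    have "(\<lambda>\<omega>. Re (cnj (u j) * \<Delta> n j \<epsilon> \<omega>)) \<in> borel_measurable (past (2 * grid T n k / \<epsilon>\<^sup>2))" if "j < k" for j
      using that by measurable
    then have "(\<lambda>\<omega>. \<Sum>j<k. Re (cnj (u j) * \<Delta> n j \<epsilon> \<omega>)) \<in> borel_measurable (past (2 * grid T n k / \<epsilon>\<^sup>2))"
      by (intro borel_measurable_sum) auto
    then have Pm: "P k \<in> borel_measurable (past (2 * grid T n k / \<epsilon>\<^sup>2))"
      unfolding P_def[abs_def] by measurable
    have lt: "grid T n k < grid T n (Suc k)" using grid_step[of n k] T by (smt (verit) divide_pos_pos zero_less_power)
    have PS: "P (Suc k) \<omega> = P k \<omega> * iexp (Re (cnj (u k) * incr \<epsilon> (grid T n k) (grid T n (Suc k)) \<omega>))" for \<omega>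
      by (simp only: P_def \<Delta>_def[symmetric] sum.lessThan_Suc iexp_add)
    have P1: "cmod (P k \<omega>) \<le> 1" for \<omega> by (simp add: P_def)
    have "cmod (f (Suc k) - f k * g k) \<le> rest K U (grid T n k) (grid T n (Suc k)) \<epsilon>
       + U ^ 3 * (4 * c\<^sup>2 * K + 96 * c ^ 4 * K\<^sup>2) * (T / 2^n * sqrt (T / 2^n)) + U ^ 4 * (T / 2^n)\<^sup>2"
      using incr_characteristic_step[OF K0 K e grid_nonneg lt Pm P1 U(2)[OF k]]
      unfolding f_def g_def grid_step PS .
    \<comment> \<open>A single remainder is enlarged to the sum over all cells, so that one error
      bound serves every step. For fixed \<open>n\<close> this sum still vanishes with
      \<epsilon>.\<close>
    also have "rest K U (grid T n k) (grid T n (Suc k)) \<epsilon> \<le> (\<Sum>k<2^n. rest K U (grid T n k) (grid T n (Suc k)) \<epsilon>)"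
      using k by (intro member_le_sum rest_nonneg U e) auto
    finally show "cmod (f (Suc k) - f k * g k) \<le> ?R" by simp
    show "cmod (g k) \<le> 1" unfolding g_def norm_of_real using T by simp
  qed
  moreover have "f (2^n) = chr n u \<epsilon>" unfolding f_def P_def chr_def ..
  moreover have "f 0 = 1" by (simp add: f_def P_def prob_space)
  moreover have "(\<Prod>k<2^n. g k) = gau n u"
    unfolding g_def gau_def of_real_prod[symmetric] by (simp add: exp_sum[symmetric] sum_distrib_left sum_negf sum_divide_distrib)
  ultimately show ?thesis by (simp only: mult_1_left of_nat_power of_nat_numeral)
qed

text \<open>2^n steps with error h^(3/2), h = T / 2^n, leave T sqrt h; the remainders vanish with
  \<epsilon>. The constant \<open>D\<close> depends on the bound \<open>U\<close> of the frequencies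
  but neither on \<open>n\<close> nor on \<open>u\<close>, which allows the level to grow
  later.\<close>

lemma chr_bound:
  assumes U: "0 \<le> U"
  shows "\<exists>D\<ge>0. \<forall>n u. (\<forall>k<2^n. cmod (u k) \<le> U) \<longrightarrow>
    (\<forall>e>0. \<forall>\<^sub>F \<epsilon> in at_right 0. cmod (chr n u \<epsilon> - gau n u) \<le> D * (T * sqrt (T / 2^n)) + e)"
proof -
  obtain K where K: "0 \<le> K" "\<And>a b. 0 \<le> a \<Longrightarrow> a \<le> b \<Longrightarrow> J \<theta> a b \<le> K * (b - a)" using J_linear_bound by blast
  define C where "C = U ^ 3 * (4 * c\<^sup>2 * K + 96 * c ^ 4 * K\<^sup>2)"
  have C0: "0 \<le> C" using U K(1) by (simp add: C_def)
  have "\<forall>\<^sub>F \<epsilon> in at_right 0. cmod (chr n u \<epsilon> - gau n u) \<le> (C + U ^ 4 * sqrt T) * (T * sqrt (T / 2^n)) + \<delta>"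
    if u: "\<And>k. k < 2^n \<Longrightarrow> cmod (u k) \<le> U" and \<delta>: "0 < \<delta>" for n u \<delta>
  proof -
    define S where "S \<epsilon> = (\<Sum>k<2^n. rest K U (grid T n k) (grid T n (Suc k)) \<epsilon>)" for \<epsilon>
    have "(S \<longlongrightarrow> (\<Sum>k<(2::nat)^n. 0)) (at_right 0)"
      unfolding S_def[abs_def]
    proof (intro tendsto_sum tendsto_rest grid_nonneg)
      fix k :: nat assume "k \<in> {..<2^n}"
      then show "grid T n (Suc k) \<le> T" using grid_mem[OF T, of "Suc k" n] by simp
      show "grid T n k < grid T n (Suc k)" using grid_step[of n k] T by (smt (verit) divide_pos_pos zero_less_power)
    qed
    then have "((\<lambda>\<epsilon>. 2^n * S \<epsilon>) \<longlongrightarrow> 0) (at_right 0)" by (intro tendsto_mult_right_zero) simp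
    then have ev: "\<forall>\<^sub>F \<epsilon> in at_right 0. 2^n * S \<epsilon> < \<delta>" using \<delta> by (rule order_tendstoD)
    have pos: "\<forall>\<^sub>F \<epsilon>::real in at_right 0. 0 < \<epsilon>" by (rule eventually_at_right_less)
    define h where "h = T / 2^n"
    have h: "0 \<le> h" "h \<le> T" "2^n * h = T" using T by (auto simp: h_def divide_le_eq)
    \<comment> \<open>The term of order h^2 is absorbed into the order h^(3/2), using h \<le>
      T.\<close>
    have "h\<^sup>2 = h * (sqrt h * sqrt h)" using h by (simp add: power2_eq_square)
    also have "\<dots> \<le> h * (sqrt T * sqrt h)" using h by (intro mult_left_mono mult_right_mono) auto
    finally have h2: "h\<^sup>2 \<le> sqrt T * (h * sqrt h)" by (simp add: mult_ac)
    have "2^n * (C * (h * sqrt h) + U ^ 4 * h\<^sup>2) \<le> 2^n * (C * (h * sqrt h) + U ^ 4 * (sqrt T * (h * sqrt h)))"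
      using h2 U by (intro mult_left_mono add_left_mono) auto
    also have "\<dots> = (C + U ^ 4 * sqrt T) * ((2^n * h) * sqrt h)" by (simp add: algebra_simps)
    also have "\<dots> = (C + U ^ 4 * sqrt T) * (T * sqrt h)" unfolding h(3) ..
    finally have le: "2^n * (C * (h * sqrt h) + U ^ 4 * h\<^sup>2) \<le> (C + U ^ 4 * sqrt T) * (T * sqrt h)" .
    show ?thesis using ev pos
    proof eventually_elim
      case (elim \<epsilon>)
      have "cmod (chr n u \<epsilon> - gau n u) \<le> 2^n * (S \<epsilon> + C * (h * sqrt h) + U ^ 4 * h\<^sup>2)"
        unfolding S_def C_def h_def by (rule chr_level_bound[OF K elim(2) U u])
      also have "\<dots> = 2^n * S \<epsilon> + 2^n * (C * (h * sqrt h) + U ^ 4 * h\<^sup>2)" by (simp only: distrib_left add.assoc)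
      also have "\<dots> \<le> \<delta> + (C + U ^ 4 * sqrt T) * (T * sqrt h)" using elim(1) le by simp
      finally show ?case by (simp add: h_def)
    qed
  qed
  moreover have "0 \<le> C + U ^ 4 * sqrt T" using C0 U T by simp
  ultimately show ?thesis by (intro exI[of _ "C + U ^ 4 * sqrt T"] conjI allI impI) auto
qed

lemma \<Delta>_refine:
  assumes "\<omega> \<in> space M"
  shows "\<Delta> n k \<epsilon> \<omega> = \<Delta> (Suc n) (2 * k) \<epsilon> \<omega> + \<Delta> (Suc n) (2 * k + 1) \<epsilon> \<omega>"
proof -
  have g: "grid T n k = grid T (Suc n) (2 * k)" by (simp only: grid_Suc_double)
  have g': "grid T n (Suc k) = grid T (Suc n) (Suc (2 * k + 1))" using grid_Suc_double[of T n "Suc k"] by simp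
  have "incr \<epsilon> (grid T (Suc n) (2 * k)) (grid T (Suc n) (Suc (2 * k + 1))) \<omega>
      = incr \<epsilon> (grid T (Suc n) (2 * k)) (grid T (Suc n) (2 * k + 1)) \<omega> + incr \<epsilon> (grid T (Suc n) (2 * k + 1)) (grid T (Suc n) (Suc (2 * k + 1))) \<omega>"
    by (intro incr_split grid_nonneg grid_mono assms) auto
  then show ?thesis unfolding \<Delta>_def g g' by (simp only: Suc_eq_plus1)
qed

text \<open>A cell increment is the sum of its two halves, so giving both halves the frequency of
  the cell leaves the exponent unchanged.\<close>

lemma chr_refine: "chr n u \<epsilon> = chr (Suc n) (\<lambda>k. u (k div 2)) \<epsilon>"
proof -
  have "(\<Sum>k<2^n. Re (cnj (u k) * \<Delta> n k \<epsilon> \<omega>)) = (\<Sum>k<2^Suc n. Re (cnj (u (k div 2)) * \<Delta> (Suc n) k \<epsilon> \<omega>))" if "\<omega> \<in> space M" for \<omega>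
    unfolding power_Suc sum_lessThan_double by (intro sum.cong refl) (simp add: \<Delta>_refine[OF that, of n] distrib_left)
  then show ?thesis unfolding chr_def by (intro Bochner_Integration.integral_cong refl) (simp only:)
qed

lemma gau_refine: "gau n u = gau (Suc n) (\<lambda>k. u (k div 2))"
proof -
  have "T / 2^n * (\<Sum>k<2^n. (cmod (u k))\<^sup>2) = T / 2^Suc n * (\<Sum>k<2^Suc n. (cmod (u (k div 2)))\<^sup>2)"
    unfolding power_Suc sum_lessThan_double by (simp add: sum_distrib_left[symmetric])
  then show ?thesis unfolding gau_def by (simp only:)
qed

text \<open>Viewed at level n + d with repeated frequencies, neither characteristic function
  changes, while the error becomes \<open>D * (T * sqrt (T / 2^(n + d)))\<close> up to an
  arbitrarily small term. The frequency bound survives refinement, so \<open>D\<close> stays fixed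
  as \<open>d\<close> grows.\<close>

lemma tendsto_chr: "(chr n u \<longlongrightarrow> gau n u) (at_right 0)"
proof -
  \<comment> \<open>Any common bound for the finitely many frequencies would do; their sum is
    one.\<close>
  define U where "U = (\<Sum>k<2^n. cmod (u k))"
  have U: "0 \<le> U" unfolding U_def by (intro sum_nonneg) auto
  obtain D where D: "0 \<le> D" "\<And>n u e. \<forall>k<2^n. cmod (u k) \<le> U \<Longrightarrow> 0 < e \<Longrightarrow>
    \<forall>\<^sub>F \<epsilon> in at_right 0. cmod (chr n u \<epsilon> - gau n u) \<le> D * (T * sqrt (T / 2^n)) + e" using chr_bound[OF U] by blast
  have lev: "\<forall>\<^sub>F \<epsilon> in at_right 0. cmod (chr n u \<epsilon> - gau n u) \<le> D * (T * sqrt (T / 2^(n + d))) + e"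
    if "\<forall>k<2^n. cmod (u k) \<le> U" "0 < e" for d n u e
    using that(1)
  proof (induction d arbitrary: n u)
    case 0
    then show ?case using D(2)[of n u e] that(2) by simp
  next
    case (Suc d)
    have "\<forall>k<2 ^ Suc n. cmod (u (k div 2)) \<le> U" using Suc.prems by auto
    from Suc.IH[OF this] show ?case
      by (simp add: chr_refine[of n u] gau_refine[of n u])
  qed
  have uU: "\<forall>k<2^n. cmod (u k) \<le> U" unfolding U_def by (intro allI impI member_le_sum) auto
  show ?thesis
  proof (rule tendstoI)
    fix \<delta> :: real assume \<delta>: "0 < \<delta>"
    have "(\<lambda>d. D * (T * sqrt (T * (1 / 2)^d * (1 / 2)^n))) \<longlonglongrightarrow> D * (T * sqrt (T * 0 * (1 / 2)^n))"
      by (intro tendsto_intros LIMSEQ_power_zero) auto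
    moreover have "T * (1 / 2)^d * (1 / 2)^n = T / 2^(n + d)" for d by (simp add: power_add power_one_over mult.commute)
    ultimately have "(\<lambda>d. D * (T * sqrt (T / 2^(n + d)))) \<longlonglongrightarrow> 0" by (simp only: mult_zero_left mult_zero_right real_sqrt_zero)
    then have "\<forall>\<^sub>F d in sequentially. D * (T * sqrt (T / 2^(n + d))) < \<delta> / 2" using \<delta> by (intro order_tendstoD) auto
    then obtain d where d: "D * (T * sqrt (T / 2^(n + d))) < \<delta> / 2" unfolding eventually_sequentially by blast
    have "\<forall>\<^sub>F \<epsilon> in at_right 0. cmod (chr n u \<epsilon> - gau n u) \<le> D * (T * sqrt (T / 2^(n + d))) + \<delta> / 2"
      using \<delta> by (intro lev uU) auto
    then show "\<forall>\<^sub>F \<epsilon> in at_right 0. dist (chr n u \<epsilon>) (gau n u) < \<delta>"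
      by eventually_elim (use d in \<open>simp add: dist_norm\<close>)
  qed
qed

end


section \<open>Weak convergence\<close>

text \<open>For real y, the nonnegative square of y^2 - 1/2 shows that y^2 is at most 1 +
  y^4.\<close>

lemma (in prob_space) second_moment_of_fourth:
  fixes f :: "'a \<Rightarrow> real" and g :: "'a \<Rightarrow> complex"
  assumes [measurable]: "f \<in> borel_measurable M" and f: "\<And>\<omega>. \<bar>f \<omega>\<bar> \<le> cmod (g \<omega>)"
    and g: "integrable M (\<lambda>\<omega>. cmod (g \<omega>) ^ 4)" "(\<integral>\<omega>. cmod (g \<omega>) ^ 4 \<partial>M) \<le> D"
  shows "integrable M (\<lambda>\<omega>. (f \<omega>)\<^sup>2)" "(\<integral>\<omega>. (f \<omega>)\<^sup>2 \<partial>M) \<le> 1 + D"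
proof -
  have le: "(f \<omega>)\<^sup>2 \<le> 1 + cmod (g \<omega>) ^ 4" for \<omega>
  proof -
    have "(f \<omega>)\<^sup>2 \<le> (cmod (g \<omega>))\<^sup>2" using f[of \<omega>] by (metis abs_ge_zero power2_abs power_mono)
    also have "\<dots> \<le> 1 + cmod (g \<omega>) ^ 4"
      using zero_le_power2[of "(cmod (g \<omega>))\<^sup>2 - 1 / 2"] by (simp add: power2_eq_square eval_nat_numeral algebra_simps)
    finally show ?thesis .
  qed
  have i: "integrable M (\<lambda>\<omega>. 1 + cmod (g \<omega>) ^ 4)" using g(1) by simp
  then show i2: "integrable M (\<lambda>\<omega>. (f \<omega>)\<^sup>2)"
    by (rule Bochner_Integration.integrable_bound) (use le in auto)
  have "(\<integral>\<omega>. (f \<omega>)\<^sup>2 \<partial>M) \<le> (\<integral>\<omega>. 1 + cmod (g \<omega>) ^ 4 \<partial>M)" using i2 i le by (intro integral_mono)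
  also have "\<dots> \<le> 1 + D" using g by (simp add: prob_space)
  finally show "(\<integral>\<omega>. (f \<omega>)\<^sup>2 \<partial>M) \<le> 1 + D" .
qed

lemma sum_Times_bool: "(\<Sum>i\<in>A \<times> (UNIV :: bool set). g i) = (\<Sum>k\<in>A. g (k, True) + g (k, False))"
  for g :: "'a \<times> bool \<Rightarrow> 'b::comm_monoid_add"
proof -
  have "(\<Sum>k\<in>A. \<Sum>b\<in>UNIV. g (k, b)) = (\<Sum>i\<in>A \<times> (UNIV :: bool set). g i)"
    by (subst sum.cartesian_product) simp
  then show ?thesis by (simp add: UNIV_bool add.commute)
qed

text \<open>Presents a path functional as a function of finitely many reals: \<open>True\<close>
  indexes real parts of increments, \<open>False\<close> imaginary parts, and partial sums give the
  grid values.\<close>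

definition of_increments :: "real \<Rightarrow> nat \<Rightarrow> (nat \<times> bool \<Rightarrow> real) \<Rightarrow> real \<Rightarrow> complex" where
  "of_increments T n v = interp T n (\<lambda>k. \<Sum>j<k. Complex (v (j, True)) (v (j, False)))"

text \<open>Every partial sum moves by at most the total change of the coordinates, and the
  interpolation has 2^n + 1 grid values.\<close>

lemma lipschitz_of_increments:
  assumes T: "0 < T" and F: "\<And>x y. x \<in> mspace (path_space T) \<Longrightarrow> y \<in> mspace (path_space T) \<Longrightarrow> \<bar>F x - F y\<bar> \<le> L * mdist (path_space T) x y"
    and L: "0 \<le> L"
  shows "\<bar>F (of_increments T n v) - F (of_increments T n w)\<bar> \<le> L * (2^n + 1) * (\<Sum>i\<in>{..<2^n} \<times> UNIV. \<bar>v i - w i\<bar>)"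
proof -
  have le: "cmod ((\<Sum>j<k. Complex (v (j, True)) (v (j, False))) - (\<Sum>j<k. Complex (w (j, True)) (w (j, False))))
      \<le> (\<Sum>i\<in>{..<2^n} \<times> UNIV. \<bar>v i - w i\<bar>)" if k: "k \<le> 2^n" for k
  proof -
    have "cmod ((\<Sum>j<k. Complex (v (j, True)) (v (j, False))) - (\<Sum>j<k. Complex (w (j, True)) (w (j, False))))
       \<le> (\<Sum>j<k. cmod (Complex (v (j, True)) (v (j, False)) - Complex (w (j, True)) (w (j, False))))"
      unfolding sum_subtractf[symmetric] by (rule norm_sum)
    also have "\<dots> \<le> (\<Sum>j<k. \<bar>v (j, True) - w (j, True)\<bar> + \<bar>v (j, False) - w (j, False)\<bar>)"
      by (intro sum_mono order_trans[OF cmod_le]) simp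
    also have "\<dots> \<le> (\<Sum>j<2^n. \<bar>v (j, True) - w (j, True)\<bar> + \<bar>v (j, False) - w (j, False)\<bar>)"
      using k by (intro sum_mono2) auto
    finally show ?thesis unfolding sum_Times_bool .
  qed
  have "\<bar>F (of_increments T n v) - F (of_increments T n w)\<bar> \<le> L * (\<Sum>k\<le>2^n. cmod ((\<Sum>j<k. Complex (v (j, True)) (v (j, False))) - (\<Sum>j<k. Complex (w (j, True)) (w (j, False)))))"
    unfolding of_increments_def by (rule lipschitz_interp[OF T F L])
  also have "\<dots> \<le> L * (\<Sum>k\<le>(2::nat)^n. \<Sum>i\<in>{..<2^n} \<times> UNIV. \<bar>v i - w i\<bar>)"
    using L by (intro mult_left_mono sum_mono le) auto
  also have "\<dots> = L * (2^n + 1) * (\<Sum>i\<in>{..<2^n} \<times> UNIV. \<bar>v i - w i\<bar>)" by (simp add: add.commute)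
  finally show ?thesis .
qed

context scaled_process
begin

lemma measurable_x_process: "x_process X \<theta> c \<epsilon> t \<in> borel_measurable M"
proof -
  have "(\<lambda>\<omega>. of_real (\<epsilon> * c) * Z \<theta> 0 (2 * t / \<epsilon>\<^sup>2) \<omega>) \<in> borel_measurable M"
    by (intro borel_measurable_times borel_measurable_const adapted_Z_section) simp
  then show ?thesis by (simp only: x_process_eq[symmetric])
qed

lemma continuous_x_process:
  assumes \<epsilon>: "0 < \<epsilon>" and \<omega>: "\<omega> \<in> space M"
  shows "continuous_on {0..T} (\<lambda>t. x_process X \<theta> c \<epsilon> t \<omega>)"
proof (rule lipschitz_on_continuous_on[OF lipschitz_onI])
  have le: "dist (x_process X \<theta> c \<epsilon> t \<omega>) (x_process X \<theta> c \<epsilon> s \<omega>) \<le> 2 * \<bar>c\<bar> / \<epsilon> * (t - s)" if "0 \<le> s" "s \<le> t" for s t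
    unfolding dist_norm x_process_diff[OF that \<omega>] by (rule cmod_incr_le[OF \<epsilon> that])
  fix t s assume ts: "t \<in> {0..T}" "s \<in> {0..T}"
  show "dist (x_process X \<theta> c \<epsilon> t \<omega>) (x_process X \<theta> c \<epsilon> s \<omega>) \<le> 2 * \<bar>c\<bar> / \<epsilon> * dist t s"
  proof (cases "s \<le> t")
    case True
    then show ?thesis using le[of s t] ts by (simp add: dist_real_def)
  next
    case False
    then show ?thesis using le[of t s] ts by (simp add: dist_real_def dist_commute)
  qed
qed (use \<epsilon> in simp)

lemma sum_\<Delta>:
  assumes "\<omega> \<in> space M" shows "(\<Sum>j<k. \<Delta> n j \<epsilon> \<omega>) = x_process X \<theta> c \<epsilon> (grid T n k) \<omega>"
proof -
  have "\<Delta> n j \<epsilon> \<omega> = x_process X \<theta> c \<epsilon> (grid T n (Suc j)) \<omega> - x_process X \<theta> c \<epsilon> (grid T n j) \<omega>" for j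
    unfolding \<Delta>_def by (rule x_process_diff[symmetric]) (auto simp: grid_nonneg grid_mono assms)
  then have "(\<Sum>j<k. \<Delta> n j \<epsilon> \<omega>) = x_process X \<theta> c \<epsilon> (grid T n k) \<omega> - x_process X \<theta> c \<epsilon> (grid T n 0) \<omega>"
    using sum_lessThan_telescope[of "\<lambda>j. x_process X \<theta> c \<epsilon> (grid T n j) \<omega>" k] by (simp only:)
  moreover have "x_process X \<theta> c \<epsilon> (grid T n 0) \<omega> = 0"
    using cmod_Z_le[of 0 0 \<theta> \<omega>] by (simp add: x_process_eq grid_def)
  ultimately show ?thesis by simp
qed

text \<open>The constant is independent of \<epsilon>, which makes the chaining estimate uniform
  along the limit.\<close>

lemma fourth_moment_\<Delta>: "\<exists>C\<ge>0. \<forall>\<epsilon>>0. \<forall>n k. integrable M (\<lambda>\<omega>. cmod (\<Delta> n k \<epsilon> \<omega>) ^ 4) \<and> (\<integral>\<omega>. cmod (\<Delta> n k \<epsilon> \<omega>) ^ 4 \<partial>M) \<le> C / 4^n"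
proof -
  obtain K where K: "0 \<le> K" "\<And>a b. 0 \<le> a \<Longrightarrow> a \<le> b \<Longrightarrow> J \<theta> a b \<le> K * (b - a)" using J_linear_bound by blast
  have "integrable M (\<lambda>\<omega>. cmod (\<Delta> n k \<epsilon> \<omega>) ^ 4)" "(\<integral>\<omega>. cmod (\<Delta> n k \<epsilon> \<omega>) ^ 4 \<partial>M) \<le> 96 * c ^ 4 * K\<^sup>2 * T\<^sup>2 / 4^n" if "0 < \<epsilon>" for \<epsilon> n k
  proof -
    have "(\<integral>\<omega>. cmod (\<Delta> n k \<epsilon> \<omega>) ^ 4 \<partial>M) \<le> 96 * c ^ 4 * K\<^sup>2 * (grid T n (Suc k) - grid T n k)\<^sup>2"
      unfolding \<Delta>_def by (intro incr_fourth_moment[OF K that] grid_nonneg grid_mono) auto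
    also have "grid T n (Suc k) - grid T n k = T / 2^n" by (rule grid_step)
    also have "(T / 2^n)\<^sup>2 = T\<^sup>2 / 4^n" using power_mult_distrib[of "2::real" 2 n] by (simp add: power_divide power2_eq_square)
    finally show "(\<integral>\<omega>. cmod (\<Delta> n k \<epsilon> \<omega>) ^ 4 \<partial>M) \<le> 96 * c ^ 4 * K\<^sup>2 * T\<^sup>2 / 4^n" by simp
    have [measurable]: "\<Delta> n k \<epsilon> \<in> borel_measurable M" unfolding \<Delta>_def[abs_def] by (rule measurable_incr[OF grid_nonneg])
    have "cmod (\<Delta> n k \<epsilon> \<omega>) ^ 4 \<le> (2 * \<bar>c\<bar> / \<epsilon> * (grid T n (Suc k) - grid T n k)) ^ 4" for \<omega>
      unfolding \<Delta>_def by (intro power_mono cmod_incr_le that grid_nonneg grid_mono) auto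
    then show "integrable M (\<lambda>\<omega>. cmod (\<Delta> n k \<epsilon> \<omega>) ^ 4)"
      by (intro integrable_const_bound[where B="(2 * \<bar>c\<bar> / \<epsilon> * (grid T n (Suc k) - grid T n k)) ^ 4"]) auto
  qed
  then show ?thesis by (intro exI[of _ "96 * c ^ 4 * K\<^sup>2 * T\<^sup>2"]) auto
qed

lemma dyadic_process_x_process: "\<exists>C. \<forall>\<epsilon>>0. dyadic_process M (\<lambda>n k. x_process X \<theta> c \<epsilon> (grid T n k)) C T"
proof -
  obtain C where C: "\<And>\<epsilon> n k. 0 < \<epsilon> \<Longrightarrow> integrable M (\<lambda>\<omega>. cmod (\<Delta> n k \<epsilon> \<omega>) ^ 4)"
    "\<And>\<epsilon> n k. 0 < \<epsilon> \<Longrightarrow> (\<integral>\<omega>. cmod (\<Delta> n k \<epsilon> \<omega>) ^ 4 \<partial>M) \<le> C / 4^n" using fourth_moment_\<Delta> by blast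
  have "dyadic_process M (\<lambda>n k. x_process X \<theta> c \<epsilon> (grid T n k)) C T" if \<epsilon>: "0 < \<epsilon>" for \<epsilon>
  proof
    have d: "x_process X \<theta> c \<epsilon> (grid T n (Suc k)) \<omega> - x_process X \<theta> c \<epsilon> (grid T n k) \<omega> = \<Delta> n k \<epsilon> \<omega>" if "\<omega> \<in> space M" for n k \<omega>
      unfolding \<Delta>_def by (rule x_process_diff) (auto simp: grid_nonneg grid_mono that)
    fix n k :: nat
    show "integrable M (\<lambda>\<omega>. cmod (x_process X \<theta> c \<epsilon> (grid T n (Suc k)) \<omega> - x_process X \<theta> c \<epsilon> (grid T n k) \<omega>) ^ 4)"
      by (subst Bochner_Integration.integrable_cong[OF refl arg_cong[OF d, where f="\<lambda>z. cmod z ^ 4"]]) (auto intro: C \<epsilon>)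
    have "(\<integral>\<omega>. cmod (x_process X \<theta> c \<epsilon> (grid T n (Suc k)) \<omega> - x_process X \<theta> c \<epsilon> (grid T n k) \<omega>) ^ 4 \<partial>M) = (\<integral>\<omega>. cmod (\<Delta> n k \<epsilon> \<omega>) ^ 4 \<partial>M)"
      by (intro Bochner_Integration.integral_cong refl) (simp only: d)
    then show "(\<integral>\<omega>. cmod (x_process X \<theta> c \<epsilon> (grid T n (Suc k)) \<omega> - x_process X \<theta> c \<epsilon> (grid T n k) \<omega>) ^ 4 \<partial>M) \<le> C / 4^n"
      using C(2)[OF \<epsilon>, of n k] by (simp only:)
  qed (use T measurable_x_process in \<open>auto simp: grid_Suc_double simp del: power_Suc\<close>)
  then show ?thesis by blast
qed

context
  fixes F :: "(real \<Rightarrow> complex) \<Rightarrow> real" and L b :: real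
  assumes F: "\<And>x y. x \<in> mspace (path_space T) \<Longrightarrow> y \<in> mspace (path_space T) \<Longrightarrow> \<bar>F x - F y\<bar> \<le> L * mdist (path_space T) x y"
    and L: "0 \<le> L" and b: "\<And>x. x \<in> mspace (path_space T) \<Longrightarrow> \<bar>F x\<bar> \<le> b"
begin

text \<open>At a fixed level the interpolated path is a Lipschitz function of finitely many real
  increments, whose characteristic functions converge and whose second moments are bounded.\<close>

lemma tendsto_expectation_interp:
  "((\<lambda>\<epsilon>. \<integral>\<omega>. F (interp T n (\<lambda>k. x_process X \<theta> c \<epsilon> (grid T n k) \<omega>)) \<partial>M) \<longlongrightarrow> (\<integral>\<omega>. F (interp T n (\<lambda>k. levy_val T n k \<omega>)) \<partial>noise)) (at_right 0)"
proof -
  obtain C where C: "0 \<le> C" "\<And>\<epsilon> n k. 0 < \<epsilon> \<Longrightarrow> integrable M (\<lambda>\<omega>. cmod (\<Delta> n k \<epsilon> \<omega>) ^ 4)"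
    "\<And>\<epsilon> n k. 0 < \<epsilon> \<Longrightarrow> (\<integral>\<omega>. cmod (\<Delta> n k \<epsilon> \<omega>) ^ 4 \<partial>M) \<le> C / 4^n" using fourth_moment_\<Delta> by blast
  interpret N: prob_space noise by (rule prob_space_noise)
  define I where "I = {..<(2::nat)^n} \<times> (UNIV :: bool set)"
  define V where "V \<epsilon> i \<omega> = (if snd i then Re (\<Delta> n (fst i) \<epsilon> \<omega>) else Im (\<Delta> n (fst i) \<epsilon> \<omega>))" for \<epsilon> and i :: "nat \<times> bool" and \<omega>
  define W where "W i \<omega> = (if snd i then Re (levy_inc T n (fst i) \<omega>) else Im (levy_inc T n (fst i) \<omega>))" for i :: "nat \<times> bool" and \<omega>
  have FV: "F (of_increments T n (\<lambda>i. V \<epsilon> i \<omega>)) = F (interp T n (\<lambda>k. x_process X \<theta> c \<epsilon> (grid T n k) \<omega>))" if "\<omega> \<in> space M" for \<epsilon> \<omega>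
    by (simp add: of_increments_def V_def sum_\<Delta>[OF that])
  have FW: "F (of_increments T n (\<lambda>i. W i \<omega>)) = F (interp T n (\<lambda>k. levy_val T n k \<omega>))" for \<omega>
    by (simp add: of_increments_def W_def levy_val_def)
  have [measurable]: "\<Delta> n k \<epsilon> \<in> borel_measurable M" for k \<epsilon>
    unfolding \<Delta>_def[abs_def] by (rule measurable_incr[OF grid_nonneg])
  have mV: "V \<epsilon> i \<in> borel_measurable M" for \<epsilon> i
    unfolding V_def[abs_def] by (cases "snd i") (simp_all only: if_True if_False, measurable)
  have mW: "W i \<in> borel_measurable noise" for i
    unfolding W_def[abs_def] by (cases "snd i") (simp_all only: if_True if_False, measurable)
  have Vle: "\<bar>V \<epsilon> i \<omega>\<bar> \<le> cmod (\<Delta> n (fst i) \<epsilon> \<omega>)" for \<epsilon> i \<omega> by (simp add: V_def abs_Re_le_cmod abs_Im_le_cmod)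
  have Wle: "\<bar>W i \<omega>\<bar> \<le> cmod (levy_inc T n (fst i) \<omega>)" for i \<omega> by (simp add: W_def abs_Re_le_cmod abs_Im_le_cmod)
  have sV: "(\<Sum>i\<in>I. u i * V \<epsilon> i \<omega>) = (\<Sum>k<2^n. Re (cnj (Complex (u (k, True)) (u (k, False))) * \<Delta> n k \<epsilon> \<omega>))" for u \<epsilon> \<omega>
    unfolding I_def sum_Times_bool by (simp add: V_def)
  have sW: "(\<Sum>i\<in>I. u i * W i \<omega>) = (\<Sum>k<2^n. Re (cnj (Complex (u (k, True)) (u (k, False))) * levy_inc T n k \<omega>))" for u \<omega>
    unfolding I_def sum_Times_bool by (simp add: W_def)
  \<comment> \<open>The limit at 0 from the right is tested along positive null sequences, since the
    convergence theorem for Lipschitz functions is sequential.\<close>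
  have seq: "(\<lambda>m. \<integral>\<omega>. F (of_increments T n (\<lambda>i. V (E m) i \<omega>)) \<partial>M) \<longlonglongrightarrow> (\<integral>\<omega>. F (of_increments T n (\<lambda>i. W i \<omega>)) \<partial>noise)"
    if E: "\<And>m. 0 < E m" "E \<longlonglongrightarrow> 0" for E
  \<comment> \<open>The constant dominates the second moments of both sides: \<open>C\<close> comes
    from the scaled process and 12 T^2 from the Levy increments.\<close>
  proof (rule tendsto_integral_lipschitz[where I=I and C="1 + (C + 12 * T\<^sup>2) / 4^n" and f="\<lambda>v. F (of_increments T n v)" and B=b and L="L * (2^n + 1)"
        and M="\<lambda>_. M" and N=noise and V="\<lambda>m. V (E m)" and W=W])
    show "finite I" by (simp add: I_def)
    show "(\<lambda>m. CLINT \<omega> | M. iexp (\<Sum>i\<in>I. u i * V (E m) i \<omega>)) \<longlonglongrightarrow> (CLINT \<omega> | noise. iexp (\<Sum>i\<in>I. u i * W i \<omega>))" for u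
    proof -
      have "E m \<noteq> 0" for m using E(1)[of m] by simp
      then have "filterlim E (at_right 0) sequentially" using E by (auto simp: filterlim_at intro!: always_eventually)
      from filterlim_compose[OF tendsto_chr this]
      show ?thesis unfolding sV sW chr_def char_levy_inc[OF T] gau_def .
    qed
    fix m :: nat and i assume i: "i \<in> I"
    have k: "fst i < 2^n" using i by (auto simp: I_def)
    have le: "C / 4^n \<le> (C + 12 * T\<^sup>2) / 4^n" "12 * T\<^sup>2 / 4^n \<le> (C + 12 * T\<^sup>2) / 4^n" using C(1) by (auto intro!: divide_right_mono)
    note 2 = second_moment_of_fourth[OF mV Vle C(2)[OF E(1)] C(3)[OF E(1)]]
    show "integrable M (\<lambda>\<omega>. (V (E m) i \<omega>)\<^sup>2)" by (rule 2)
    show "(\<integral>\<omega>. (V (E m) i \<omega>)\<^sup>2 \<partial>M) \<le> 1 + (C + 12 * T\<^sup>2) / 4^n"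
      by (rule order_trans[OF 2(2) add_left_mono[OF le(1)]])
    note 2 = N.second_moment_of_fourth[OF mW Wle levy_fourth_moment[OF T k]]
    show "integrable noise (\<lambda>\<omega>. (W i \<omega>)\<^sup>2)" by (rule 2)
    show "(\<integral>\<omega>. (W i \<omega>)\<^sup>2 \<partial>noise) \<le> 1 + (C + 12 * T\<^sup>2) / 4^n"
      by (rule order_trans[OF 2(2) add_left_mono[OF le(2)]])
  next
    show "\<bar>F (of_increments T n v)\<bar> \<le> b" for v unfolding of_increments_def by (intro b interp_mem)
    show lip: "\<bar>F (of_increments T n v) - F (of_increments T n w)\<bar> \<le> L * (2^n + 1) * (\<Sum>i\<in>I. \<bar>v i - w i\<bar>)" for v w
      unfolding I_def by (rule lipschitz_of_increments[OF T F L])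
    show "(\<lambda>\<omega>. F (of_increments T n (\<lambda>i. V (E m) i \<omega>))) \<in> borel_measurable M" for m
      by (rule measurable_lipschitz_coordinates[where I=I and L="L * (2^n + 1)"]) (use lip mV in \<open>auto simp: I_def\<close>)
    show "(\<lambda>\<omega>. F (of_increments T n (\<lambda>i. W i \<omega>))) \<in> borel_measurable noise"
      by (rule measurable_lipschitz_coordinates[where I=I and L="L * (2^n + 1)"]) (use lip mW in \<open>auto simp: I_def\<close>)
  qed (use L mV mW prob_space_axioms prob_space_noise in auto)
  have eq: "(\<integral>\<omega>. F (interp T n (\<lambda>k. x_process X \<theta> c \<epsilon> (grid T n k) \<omega>)) \<partial>M) = (\<integral>\<omega>. F (of_increments T n (\<lambda>i. V \<epsilon> i \<omega>)) \<partial>M)" for \<epsilon>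
    by (intro Bochner_Integration.integral_cong refl) (simp only: FV)
  show ?thesis unfolding tendsto_at_iff_sequentially eq FW[symmetric] comp_def
    by (intro allI impI seq) auto
qed

text \<open>Three errors of \<delta>/3. The level is fixed first, small enough for both
  interpolation errors, which is possible because \<open>C\<close> is common to all \<epsilon>; then
  \<epsilon> is taken small at that level.\<close>

lemma tendsto_expectation_path:
  "((\<lambda>\<epsilon>. \<integral>\<omega>. F (\<lambda>t\<in>{0..T}. x_process X \<theta> c \<epsilon> t \<omega>) \<partial>M) \<longlongrightarrow> (\<integral>\<omega>. F (\<lambda>t\<in>{0..T}. levy_bm T t \<omega>) \<partial>noise)) (at_right 0)"
proof (rule tendstoI)
  fix \<delta> :: real assume \<delta>: "0 < \<delta>"
  obtain C where C: "\<And>\<epsilon>. 0 < \<epsilon> \<Longrightarrow> dyadic_process M (\<lambda>n k. x_process X \<theta> c \<epsilon> (grid T n k)) C T" using dyadic_process_x_process by blast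
  define r where "r D n = 2 * L * (1 + D) / (1 - chain_ratio) * chain_ratio ^ n" for D n
  have "(\<lambda>n. chain_ratio ^ n) \<longlonglongrightarrow> 0" using chain_ratio by (intro LIMSEQ_power_zero) auto
  then have "r D \<longlonglongrightarrow> 0" for D unfolding r_def[abs_def] by (rule tendsto_mult_right_zero)
  then have "\<forall>\<^sub>F n in sequentially. r D n < \<delta> / 3" for D using \<delta> by (intro order_tendstoD(2)) auto
  from eventually_happens[OF eventually_conj[OF this[of C] this[of "12 * T\<^sup>2"]]]
  obtain n where n: "r C n < \<delta> / 3" "r (12 * T\<^sup>2) n < \<delta> / 3" by auto
  have lev: "\<bar>(\<integral>\<omega>. F (\<lambda>t\<in>{0..T}. levy_bm T t \<omega>) \<partial>noise) - (\<integral>\<omega>. F (interp T n (\<lambda>k. levy_val T n k \<omega>)) \<partial>noise)\<bar> \<le> r (12 * T\<^sup>2) n"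
    unfolding r_def
    by (rule dyadic_process.expectation_path_interp[OF dyadic_process_levy[OF T] F L b measurable_levy_bm[OF T] continuous_levy_bm[OF T] AE_levy_bm_grid[OF T]])
  have "\<forall>\<^sub>F \<epsilon> in at_right 0. dist (\<integral>\<omega>. F (interp T n (\<lambda>k. x_process X \<theta> c \<epsilon> (grid T n k) \<omega>)) \<partial>M) (\<integral>\<omega>. F (interp T n (\<lambda>k. levy_val T n k \<omega>)) \<partial>noise) < \<delta> / 3"
    using \<delta> by (intro tendstoD[OF tendsto_expectation_interp]) auto
  moreover have "\<forall>\<^sub>F \<epsilon>::real in at_right 0. 0 < \<epsilon>" by (rule eventually_at_right_less)
  ultimately show "\<forall>\<^sub>F \<epsilon> in at_right 0. dist (\<integral>\<omega>. F (\<lambda>t\<in>{0..T}. x_process X \<theta> c \<epsilon> t \<omega>) \<partial>M) (\<integral>\<omega>. F (\<lambda>t\<in>{0..T}. levy_bm T t \<omega>) \<partial>noise) < \<delta>"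
  proof eventually_elim
    case (elim \<epsilon>)
    have "\<bar>(\<integral>\<omega>. F (\<lambda>t\<in>{0..T}. x_process X \<theta> c \<epsilon> t \<omega>) \<partial>M) - (\<integral>\<omega>. F (interp T n (\<lambda>k. x_process X \<theta> c \<epsilon> (grid T n k) \<omega>)) \<partial>M)\<bar> \<le> r C n"
      unfolding r_def
      by (rule dyadic_process.expectation_path_interp[OF C[OF elim(2)] F L b measurable_x_process continuous_x_process[OF elim(2)]]) auto
    then show ?case using n lev elim(1) unfolding dist_real_def by linarith
  qed
qed

end

end

theorem theorem3p1:
  fixes M :: "'a measure" and X :: "real \<Rightarrow> 'a \<Rightarrow> real" and T \<theta> c :: real
  assumes "prob_space M"
    and "0 < T"
    and "jointly_measurable M X"
    and "indep_increments M {0..} X"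
    and "\<theta> \<in> C_set M X T"
    and "cond_B M X T \<theta> c"
  shows "\<exists>Q. complex_brownian_law T Q \<and>
    weakly_converges (path_space T) (\<lambda>\<epsilon>. path_law T M (x_process X \<theta> c \<epsilon>)) Q (at_right 0)"
proof (intro exI conjI)
  interpret prob_space M by fact
  interpret scaled_process M X T \<theta> c
    using assms by unfold_locales (auto simp: C_set_def)
  \<comment> \<open>The witness is the law of the Levy construction, whose sample space
    \<open>noise\<close> has the prescribed type.\<close>
  show "complex_brownian_law T (path_law T noise (levy_bm T))"
    unfolding complex_brownian_law_def using complex_brownian_motion_levy_bm[OF T] by blast
  show "weakly_converges (path_space T) (\<lambda>\<epsilon>. path_law T M (x_process X \<theta> c \<epsilon>)) (path_law T noise (levy_bm T)) (at_right 0)"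
    unfolding weakly_converges_def
  proof (intro allI impI, elim conjE)
    fix f assume f: "continuous_map (mtopology_of (path_space T)) euclideanreal f" and "bounded (f ` mspace (path_space T))"
    then obtain b where b: "\<And>x. x \<in> mspace (path_space T) \<Longrightarrow> \<bar>f x\<bar> \<le> b" unfolding bounded_iff by auto
    have mx: "(\<lambda>\<omega>. \<lambda>t\<in>{0..T}. x_process X \<theta> c \<epsilon> t \<omega>) \<in> measurable M (borel_of_metric (path_space T))" if "0 < \<epsilon>" for \<epsilon>
      by (rule measurable_path[OF T measurable_x_process continuous_x_process[OF that]])
    have ml: "(\<lambda>\<omega>. \<lambda>t\<in>{0..T}. levy_bm T t \<omega>) \<in> measurable noise (borel_of_metric (path_space T))"
      by (rule measurable_path[OF T measurable_levy_bm[OF T] continuous_levy_bm[OF T]])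
    have pos: "\<forall>\<^sub>F \<epsilon>::real in at_right 0. 0 < \<epsilon>" by (rule eventually_at_right_less)
    have "((\<lambda>\<epsilon>. \<integral>\<omega>. f (\<lambda>t\<in>{0..T}. x_process X \<theta> c \<epsilon> t \<omega>) \<partial>M) \<longlongrightarrow> (\<integral>\<omega>. f (\<lambda>t\<in>{0..T}. levy_bm T t \<omega>) \<partial>noise)) (at_right 0)"
    proof (rule tendsto_integral_continuous_of_lipschitz[OF prob_space_axioms prob_space_noise _ ml _ f b])
      show "\<forall>\<^sub>F \<epsilon> in at_right 0. (\<lambda>\<omega>. \<lambda>t\<in>{0..T}. x_process X \<theta> c \<epsilon> t \<omega>) \<in> measurable M (borel_of_metric (path_space T))"
        using pos by eventually_elim (rule mx)
    qed (rule tendsto_expectation_path)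
    \<comment> \<open>The change of variables requires the path map to be measurable, which is
      established for positive \<epsilon>; hence an eventual equality.\<close>
    moreover have "\<forall>\<^sub>F \<epsilon> in at_right 0. (\<integral>\<omega>. f (\<lambda>t\<in>{0..T}. x_process X \<theta> c \<epsilon> t \<omega>) \<partial>M) = (\<integral>w. f w \<partial>path_law T M (x_process X \<theta> c \<epsilon>))"
      using pos unfolding path_law_def
      by eventually_elim (rule integral_distr[OF mx continuous_map_imp_borel_measurable[OF f], symmetric])
    moreover have "(\<integral>\<omega>. f (\<lambda>t\<in>{0..T}. levy_bm T t \<omega>) \<partial>noise) = (\<integral>w. f w \<partial>path_law T noise (levy_bm T))"
      unfolding path_law_def by (rule integral_distr[OF ml continuous_map_imp_borel_measurable[OF f], symmetric])
    ultimately show "((\<lambda>\<epsilon>. \<integral>w. f w \<partial>path_law T M (x_process X \<theta> c \<epsilon>)) \<longlongrightarrow> (\<integral>w. f w \<partial>path_law T noise (levy_bm T))) (at_right 0)"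
      by (auto elim: Lim_transform_eventually)
  qed
qed

end
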